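(* Let $n,m\in\mathbb{N}$ be positive integers with $m<n$, and let $\frac{n}{n-m}<q<\infty$. Let $\Omega\subset\mathbb{R}^n$ be open and bounded with $C^1$-boundary, let $D\Subset\Omega$ be an open precompact subset with $C^1$-boundary which is star-shaped with respect to a point $x_0\in D$, and let $u\in BV^m(\Omega)\cap L^q(\Omega-D)$. Then there is a sequence of smooth functions $(\varphi_k)_{k=1}^\infty\subset C^\infty(\overline{\Omega})$ such that $$\|u-\varphi_k\|_{m-1,1;\Omega}+\|u-\varphi_k\|_{q;\Omega-D}+\Bigl||\nabla^mu|(\Omega)-\int_{\Omega}|\nabla^m\varphi_k|\,dx\Bigr|+\Bigl|\sqrt{1+|\nabla^mu|^2}(\Omega)-\int_{\Omega}\sqrt{1+|\nabla^m\varphi_k|^2}\,dx\Bigr|\to 0$$ for $k\to\infty$.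
   Context: Functions are real-valued. $\Omega-D$ denotes set difference; $D\Subset\Omega$ means that $\overline D$ is compact and contained in $\Omega$; $\|\cdot\|_{q;A}$ is the $L^q(A)$-norm; $\|u\|_{k,1;\Omega}:=\sum_{\nu\in\mathbb{N}_0^n,\,|\nu|\le k}\|\partial^\nu u\|_{1;\Omega}$, with $W^{0,1}=L^1$. $C^\infty(\overline\Omega)$ is the usual space of functions smooth up to the boundary of $\Omega$. $BV^m(\Omega)$ is the space of all $u\in W^{m-1,1}(\Omega)$ with $\nabla^{m-1}u\in BV$, i.e. whose $m$-th order distributional partial derivatives are finite Radon measures. With $M:=\#\{\nu\in\mathbb{N}_0^n:|\nu|=m\}$, the $m$-th distributional gradient $\nabla^m u$ is regarded as the $\mathbb{R}^M$-valued measure $(\partial^\nu u)_{|\nu|=m}$, with total variation $$|\nabla^mu|(\Omega)=\sup\Bigl\{\int_\Omega u\Bigl(\sum_{|\nu|=m}\partial^\nu g_\nu\Bigr)dx: g\in C^m_0(\Omega,\mathbb{R}^M),\ \|g\|_\infty\le1\Bigr\},$$ where $C_0^m$ denotes compactly supported $C^m$ functions and $|\cdot|$ is the Euclidean norm on $\mathbb{R}^M$ (also for $\nabla^m\varphi$ with $\varphi$ smooth). $u\in BV^m(\Omega)\cap L^q(\Omega-D)$ means $u\in BV^m(\Omega)$ and $u|_{\Omega-D}\in L^q(\Omega-D)$. For a finite ($\mathbb{R}^M$-valued) Radon measure $\mu$ on $\Omega$ with Lebesgue decomposition $\mu=\mu^a\mathcal{L}^n+\mu^s$, where $\mu^a\in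 L^1(\Omega)$ and $\mu^s$ is singular with respect to Lebesgue measure $\mathcal{L}^n$, one sets $\sqrt{1+|\mu|^2}(B):=\int_B\sqrt{1+|\mu^a|^2}\,dx+|\mu^s|(B)$ for Borel sets $B\subset\Omega$. *)

theory Defs
  imports "HOL-Analysis.Analysis"
begin

text \<open>
  Functions on a subset of \<open>real ^ 'n\<close> are total functions whose values off that subset are
  never used.  Multi-indices are functions \<open>'n \<Rightarrow> nat\<close>.
\<close>

section \<open>Multi-indices and classical derivatives\<close>

definition order_of :: "('n::finite \<Rightarrow> nat) \<Rightarrow> nat" where
  "order_of \<nu> = (\<Sum>i\<in>UNIV. \<nu> i)"

definition midx :: "nat \<Rightarrow> ('n::finite \<Rightarrow> nat) set" where
  "midx k = {\<nu>. order_of \<nu> = k}"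

definition midx_le :: "nat \<Rightarrow> ('n::finite \<Rightarrow> nat) set" where
  "midx_le k = {\<nu>. order_of \<nu> \<le> k}"

lemma finite_midx_le: "finite (midx_le k :: ('n::finite \<Rightarrow> nat) set)"
proof (rule finite_subset)
  show "(midx_le k :: ('n \<Rightarrow> nat) set) \<subseteq> PiE UNIV (\<lambda>_. {..k})"
  proof
    fix \<nu> :: "'n \<Rightarrow> nat" assume "\<nu> \<in> midx_le k"
    hence "\<nu> i \<le> k" for i
      using member_le_sum[of i UNIV \<nu>] by (simp add: midx_le_def order_of_def)
    thus "\<nu> \<in> PiE UNIV (\<lambda>_. {..k})" by auto
  qed
  show "finite (PiE (UNIV :: 'n set) (\<lambda>_. {..k}))"
    by (rule finite_PiE) auto
qed

lemma finite_midx: "finite (midx k :: ('n::finite \<Rightarrow> nat) set)"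
  by (rule finite_subset[OF _ finite_midx_le[of k]]) (auto simp: midx_def midx_le_def)

definition partial_deriv :: "'n \<Rightarrow> (real ^ 'n::finite \<Rightarrow> real) \<Rightarrow> real ^ 'n \<Rightarrow> real" where
  "partial_deriv i f x = frechet_derivative f (at x) (axis i 1)"

text \<open>
  \<open>multi_deriv \<nu> f\<close> differentiates \<open>\<nu> i\<close> times in direction \<open>i\<close>, for every \<open>i\<close>.  The order in
  which this is done is an arbitrary choice depending on \<open>\<nu>\<close> only; it is immaterial for the
  functions of class \<open>C\<^sup>k\<close>, \<open>k \<ge> order_of \<nu>\<close>, to which the operator is applied.
\<close>

definition multi_deriv :: "('n \<Rightarrow> nat) \<Rightarrow> (real ^ 'n::finite \<Rightarrow> real) \<Rightarrow> real ^ 'n \<Rightarrow> real" where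
  "multi_deriv \<nu> f = foldr partial_deriv (SOME is. \<forall>i. count_list is i = \<nu> i) f"

lemma multi_index_list_exists:
  fixes \<nu> :: "'n::finite \<Rightarrow> nat"
  shows "\<exists>is. \<forall>i. count_list is i = \<nu> i"
proof -
  obtain xs where "mset xs = (\<Sum>j\<in>UNIV. replicate_mset (\<nu> j) j)"
    using ex_mset by blast
  moreover have "count (\<Sum>j\<in>UNIV. replicate_mset (\<nu> j) j) i = \<nu> i" for i
    by (simp add: count_sum if_distrib sum.delta cong: if_cong)
  ultimately show ?thesis by (metis count_mset)
qed

primrec C_on :: "nat \<Rightarrow> (real ^ 'n::finite) set \<Rightarrow> (real ^ 'n \<Rightarrow> real) \<Rightarrow> bool" where
  "C_on 0 S f \<longleftrightarrow> continuous_on S f"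
| "C_on (Suc k) S f \<longleftrightarrow>
     (\<forall>x\<in>S. f differentiable (at x)) \<and> (\<forall>i. C_on k S (partial_deriv i f))"

definition smooth_on :: "(real ^ 'n::finite) set \<Rightarrow> (real ^ 'n \<Rightarrow> real) \<Rightarrow> bool" where
  "smooth_on S f \<longleftrightarrow> (\<forall>k. C_on k S f)"

text \<open>\<open>C\<^sup>\<infinity>\<close> up to the boundary: all derivatives extend continuously to the closure.\<close>

definition smooth_up_to_boundary :: "(real ^ 'n::finite) set \<Rightarrow> (real ^ 'n \<Rightarrow> real) \<Rightarrow> bool" where
  "smooth_up_to_boundary \<Omega> f \<longleftrightarrow>
     smooth_on \<Omega> f \<and> continuous_on (closure \<Omega>) f \<and>
     (\<forall>\<nu>. \<exists>h. continuous_on (closure \<Omega>) h \<and> (\<forall>x\<in>\<Omega>. h x = multi_deriv \<nu> f x))"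

text \<open>Compactly supported functions on an open \<open>\<Omega>\<close>, extended by zero to the whole space.\<close>

definition compact_support_in :: "(real ^ 'n::finite) set \<Rightarrow> (real ^ 'n \<Rightarrow> real) \<Rightarrow> bool" where
  "compact_support_in \<Omega> f \<longleftrightarrow>
     compact (closure {x. f x \<noteq> 0}) \<and> closure {x. f x \<noteq> 0} \<subseteq> \<Omega>"

text \<open>
  Near each boundary point, \<open>\<Omega>\<close> is the part above the graph of a \<open>C\<^sup>1\<close> function over the
  hyperplane orthogonal to some unit vector \<open>e\<close>; \<open>\<gamma>\<close> is only evaluated on that hyperplane.
\<close>

definition C1_boundary :: "(real ^ 'n::finite) set \<Rightarrow> bool" where
  "C1_boundary \<Omega> \<longleftrightarrow>
     (\<forall>x\<in>frontier \<Omega>. \<exists>r>0. \<exists>e \<gamma>. norm e = 1 \<and> C_on 1 UNIV \<gamma> \<and>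
        \<Omega> \<inter> ball x r = {y \<in> ball x r. \<gamma> (y - (y \<bullet> e) *\<^sub>R e) < y \<bullet> e})"


section \<open>Lebesgue and Sobolev spaces\<close>

definition Lp_space :: "real \<Rightarrow> (real ^ 'n::finite) set \<Rightarrow> (real ^ 'n \<Rightarrow> real) set" where
  "Lp_space q A = {u. set_borel_measurable lebesgue A u \<and>
                      set_integrable lebesgue A (\<lambda>x. \<bar>u x\<bar> powr q)}"

definition Lp_norm :: "real \<Rightarrow> (real ^ 'n::finite) set \<Rightarrow> (real ^ 'n \<Rightarrow> real) \<Rightarrow> real" where
  "Lp_norm q A u = (LINT x:A|lebesgue. \<bar>u x\<bar> powr q) powr (1 / q)"

definition is_weak_deriv ::
  "(real ^ 'n::finite) set \<Rightarrow> ('n \<Rightarrow> nat) \<Rightarrow> (real ^ 'n \<Rightarrow> real) \<Rightarrow> (real ^ 'n \<Rightarrow> real) \<Rightarrow> bool" where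
  "is_weak_deriv \<Omega> \<nu> u v \<longleftrightarrow>
     set_integrable lebesgue \<Omega> v \<and>
     (\<forall>\<psi>. smooth_on UNIV \<psi> \<and> compact_support_in \<Omega> \<psi> \<longrightarrow>
        (LINT x:\<Omega>|lebesgue. u x * multi_deriv \<nu> \<psi> x) =
        (-1) ^ order_of \<nu> * (LINT x:\<Omega>|lebesgue. v x * \<psi> x))"

definition W_space :: "nat \<Rightarrow> (real ^ 'n::finite) set \<Rightarrow> (real ^ 'n \<Rightarrow> real) set" where
  "W_space k \<Omega> = {u. set_integrable lebesgue \<Omega> u \<and>
                     (\<forall>\<nu>\<in>midx_le k. \<exists>v. is_weak_deriv \<Omega> \<nu> u v)}"

definition weak_deriv ::
  "(real ^ 'n::finite) set \<Rightarrow> ('n \<Rightarrow> nat) \<Rightarrow> (real ^ 'n \<Rightarrow> real) \<Rightarrow> real ^ 'n \<Rightarrow> real" where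
  "weak_deriv \<Omega> \<nu> u = (SOME v. is_weak_deriv \<Omega> \<nu> u v)"

definition W_norm :: "nat \<Rightarrow> (real ^ 'n::finite) set \<Rightarrow> (real ^ 'n \<Rightarrow> real) \<Rightarrow> real" where
  "W_norm k \<Omega> u = (\<Sum>\<nu>\<in>midx_le k. LINT x:\<Omega>|lebesgue. \<bar>weak_deriv \<Omega> \<nu> u x\<bar>)"


section \<open>Finite signed and vector-valued Radon measures\<close>

text \<open>
  A finite signed Radon measure on the open set \<open>\<Omega>\<close> is a set function \<open>\<mu>\<close> which on the Borel
  subsets of \<open>\<Omega>\<close> is the difference of two finite Borel measures \<open>P\<close>, \<open>N\<close> (finite Borel
  measures on open subsets of Euclidean space are Radon); its values on other sets are never
  used.  The integral of a bounded Borel function with respect to \<open>\<mu>\<close> is then the difference of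
  the integrals with respect to \<open>P\<close> and \<open>N\<close>.
\<close>

definition signed_decomp ::
  "'a::euclidean_space set \<Rightarrow> ('a set \<Rightarrow> real) \<Rightarrow> 'a measure \<Rightarrow> 'a measure \<Rightarrow> bool" where
  "signed_decomp \<Omega> \<mu> P N \<longleftrightarrow>
     finite_measure P \<and> finite_measure N \<and>
     sets P = sets (restrict_space borel \<Omega>) \<and> sets N = sets (restrict_space borel \<Omega>) \<and>
     (\<forall>B\<in>sets (restrict_space borel \<Omega>). \<mu> B = measure P B - measure N B)"

definition finite_signed_measure :: "'a::euclidean_space set \<Rightarrow> ('a set \<Rightarrow> real) \<Rightarrow> bool" where
  "finite_signed_measure \<Omega> \<mu> \<longleftrightarrow> (\<exists>P N. signed_decomp \<Omega> \<mu> P N)"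

text \<open>
  A finite vector-valued measure is a family of signed measures \<open>\<mu> i\<close>, \<open>i \<in> I\<close>, with \<open>I\<close>
  finite; vectors indexed by \<open>I\<close> carry the Euclidean norm \<open>L2_set\<close>.  The total variation of a
  Borel set is the supremum over its countable Borel partitions.
\<close>

definition total_variation ::
  "'i set \<Rightarrow> ('i \<Rightarrow> 'a::euclidean_space set \<Rightarrow> real) \<Rightarrow> 'a set \<Rightarrow> real" where
  "total_variation I \<mu> B = enn2real
     (SUP E \<in> {E :: nat \<Rightarrow> 'a set. range E \<subseteq> sets borel \<and> disjoint_family E \<and> (\<Union>j. E j) = B}.
        \<Sum>j. ennreal (L2_set (\<lambda>i. \<mu> i (E j)) I))"

text \<open>Lebesgue decomposition into the absolutely continuous part with density \<open>a\<close> and the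
  singular part \<open>s\<close>, which is concentrated on a Lebesgue null set \<open>Z\<close>.\<close>

definition lebesgue_decomp ::
  "'i set \<Rightarrow> 'a::euclidean_space set \<Rightarrow> ('i \<Rightarrow> 'a set \<Rightarrow> real) \<Rightarrow>
   ('i \<Rightarrow> 'a \<Rightarrow> real) \<Rightarrow> ('i \<Rightarrow> 'a set \<Rightarrow> real) \<Rightarrow> bool" where
  "lebesgue_decomp I \<Omega> \<mu> a s \<longleftrightarrow>
     (\<forall>i\<in>I. set_integrable lebesgue \<Omega> (a i) \<and>
        finite_signed_measure \<Omega> (s i) \<and>
        (\<exists>Z\<in>null_sets lborel. \<forall>B\<in>sets (restrict_space borel \<Omega>). B \<inter> Z = {} \<longrightarrow> s i B = 0) \<and>
        (\<forall>B\<in>sets (restrict_space borel \<Omega>). \<mu> i B = (LINT x:B|lebesgue. a i x) + s i B))"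

text \<open>The measure \<open>\<surd>(1 + \<bar>\<mu>\<bar>\<^sup>2)\<close>; the value does not depend on the choice of \<open>a\<close> and \<open>s\<close>.\<close>

definition area_measure ::
  "'i set \<Rightarrow> 'a::euclidean_space set \<Rightarrow> ('i \<Rightarrow> 'a set \<Rightarrow> real) \<Rightarrow> 'a set \<Rightarrow> real" where
  "area_measure I \<Omega> \<mu> B = (SOME r. \<exists>a s. lebesgue_decomp I \<Omega> \<mu> a s \<and>
     r = (LINT x:B|lebesgue. sqrt (1 + (L2_set (\<lambda>i. a i x) I)\<^sup>2)) + total_variation I s B)"


section \<open>Functions of bounded variation of higher order\<close>

definition is_deriv_measure ::
  "(real ^ 'n::finite) set \<Rightarrow> ('n \<Rightarrow> nat) \<Rightarrow> (real ^ 'n \<Rightarrow> real) \<Rightarrow> ((real ^ 'n) set \<Rightarrow> real) \<Rightarrow> bool"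
  where
  "is_deriv_measure \<Omega> \<nu> u \<mu> \<longleftrightarrow>
     (\<exists>P N. signed_decomp \<Omega> \<mu> P N \<and>
        (\<forall>\<psi>. smooth_on UNIV \<psi> \<and> compact_support_in \<Omega> \<psi> \<longrightarrow>
           (LINT x:\<Omega>|lebesgue. u x * multi_deriv \<nu> \<psi> x) =
           (-1) ^ order_of \<nu> * ((LINT x|P. \<psi> x) - (LINT x|N. \<psi> x))))"

definition BV_space :: "nat \<Rightarrow> (real ^ 'n::finite) set \<Rightarrow> (real ^ 'n \<Rightarrow> real) set" where
  "BV_space m \<Omega> = {u. u \<in> W_space (m - 1) \<Omega> \<and> (\<forall>\<nu>\<in>midx m. \<exists>\<mu>. is_deriv_measure \<Omega> \<nu> u \<mu>)}"

text \<open>The components, indexed by \<open>midx m\<close>, of the \<open>m\<close>-th distributional gradient of \<open>u\<close>.\<close>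

definition grad_measure ::
  "(real ^ 'n::finite) set \<Rightarrow> (real ^ 'n \<Rightarrow> real) \<Rightarrow> ('n \<Rightarrow> nat) \<Rightarrow> (real ^ 'n) set \<Rightarrow> real" where
  "grad_measure \<Omega> u \<nu> = (SOME \<mu>. is_deriv_measure \<Omega> \<nu> u \<mu>)"

text \<open>The total variation of the \<open>m\<close>-th distributional gradient, defined by duality.\<close>

definition grad_variation :: "nat \<Rightarrow> (real ^ 'n::finite) set \<Rightarrow> (real ^ 'n \<Rightarrow> real) \<Rightarrow> real" where
  "grad_variation m \<Omega> u =
     Sup {LINT x:\<Omega>|lebesgue. u x * (\<Sum>\<nu>\<in>midx m. multi_deriv \<nu> (g \<nu>) x) | g.
            (\<forall>\<nu>\<in>midx m. C_on m UNIV (g \<nu>) \<and> compact_support_in \<Omega> (g \<nu>)) \<and>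
            (\<forall>x. L2_set (\<lambda>\<nu>. g \<nu> x) (midx m) \<le> 1)}"

definition grad_area :: "nat \<Rightarrow> (real ^ 'n::finite) set \<Rightarrow> (real ^ 'n \<Rightarrow> real) \<Rightarrow> real" where
  "grad_area m \<Omega> u = area_measure (midx m) \<Omega> (grad_measure \<Omega> u) \<Omega>"

definition grad_norm :: "nat \<Rightarrow> (real ^ 'n::finite \<Rightarrow> real) \<Rightarrow> real ^ 'n \<Rightarrow> real" where
  "grad_norm m f x = L2_set (\<lambda>\<nu>. multi_deriv \<nu> f x) (midx m)"

end

theory Submission
  imports Defs
begin

text \<open>
  The approximations are \<open>\<phi>\<^sub>k = (\<Sum>j. \<rho>\<^sub>j\<^sub>,\<^sub>k * (\<zeta>\<^sub>j u))\<close> for a finite smooth partition of unity \<open>\<zeta>\<^sub>j\<close> on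
  \<open>\<Omega>\<close> and smooth kernels \<open>\<rho>\<^sub>j\<^sub>,\<^sub>k\<close> that concentrate at the origin as \<open>k\<close> grows.  Near a boundary point the
  kernels are not centred: the \<open>C\<^sup>1\<close> regularity of the boundaries provides a cone of directions pointing into
  \<open>\<Omega>\<close> or out of \<open>D\<close>, and the kernels are shifted so as to sample points in that cone (\<open>adapted_kernels_exist\<close>).  The
  mollification at a point of \<open>\<Omega>\<close> therefore samples \<open>u\<close> only in \<open>\<Omega>\<close>, although \<open>\<phi>\<^sub>k\<close> is smooth on
  the whole space; at a point of \<open>\<Omega> - D\<close> it samples \<open>u\<close> only in \<open>\<Omega> - D\<close>, where \<open>u\<close> is in \<open>L\<^sup>q\<close>.

  By the product rule, a derivative of \<open>\<phi>\<^sub>k\<close> in \<open>\<Omega>\<close> is the sum of the mollified pieces of the corresponding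
  derivative of \<open>u\<close> and of commutators in which a cutoff is differentiated (\<open>pds_approx\<close>).  The commutators
  contain derivatives of \<open>u\<close> of order less than \<open>m\<close> only and tend to 0 in \<open>L\<^sup>1\<close>, because the derivatives of
  \<open>\<Sum>j. \<zeta>\<^sub>j = 1\<close> vanish (\<open>commutator_tendsto_0\<close>).  This yields the convergence of the lower derivatives in
  \<open>L\<^sup>1\<close>; the Sobolev norm is then identified by uniqueness of weak derivatives (\<open>W_norm_converges\<close>).  The
  convergence in \<open>L\<^sup>q\<close> on \<open>\<Omega> - D\<close> follows from Jensen's inequality and Scheffe's argument
  (\<open>convol_Lq_convergence\<close>).

  Variation and area are handled at once.  Let \<open>\<sigma>\<close> be a finite measure dominating Lebesgue measure on
  \<open>\<Omega>\<close> and all components of \<open>\<nabla>\<^sup>mu\<close>, and let \<open>f\<close> be the vector of the densities.  The norm of \<open>f\<close> without,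
  respectively with, the component of Lebesgue measure integrates to the variation (\<open>grad_variation_eq\<close>),
  respectively the area (\<open>grad_area_eq\<close>); the latter because \<open>sqrt (1 + \<bar>v\<bar>\<^sup>2)\<close> is the norm of \<open>(1, v)\<close>.
  It remains to see that the masses of the mollified vector measures converge to the mass of \<open>f \<sigma>\<close>
  (\<open>mass_converges\<close>).  They cannot be asymptotically larger, by the triangle inequality and Tonelli's theorem
  (\<open>grad_comp_mass_le\<close>), and cannot be asymptotically smaller, since the mass of \<open>f \<sigma>\<close> is almost attained by
  pairing with a single smooth test field (\<open>dual_test_field\<close>), for which the pairings converge.
\<close>

section \<open>Calculus of iterated partial derivatives\<close>

definition pds :: "'n list \<Rightarrow> (real ^ 'n::finite \<Rightarrow> real) \<Rightarrow> real ^ 'n \<Rightarrow> real" where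
  "pds is f = foldr partial_deriv is f"

lemma pds_Nil [simp]: "pds [] f = f"
  and pds_Cons [simp]: "pds (i # is) f = partial_deriv i (pds is f)"
  and pds_append: "pds (as @ bs) f = pds as (pds bs f)"
  by (simp_all add: pds_def)

lemma partial_deriv_eqI:
  "(f has_derivative f') (at x) \<Longrightarrow> partial_deriv i f x = f' (axis i 1)"
  unfolding partial_deriv_def by (metis frechet_derivative_at)

lemma has_derivative_partial_derivs:
  fixes f :: "real ^ 'n::finite \<Rightarrow> real"
  assumes "f differentiable (at x)"
  shows "(f has_derivative (\<lambda>h. \<Sum>i\<in>UNIV. h $ i * partial_deriv i f x)) (at x)"
proof -
  have D: "(f has_derivative frechet_derivative f (at x)) (at x)"
    using assms frechet_derivative_works by blast
  then have L: "linear (frechet_derivative f (at x))"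
    by (rule has_derivative_linear)
  have "frechet_derivative f (at x) h = (\<Sum>i\<in>UNIV. h $ i * partial_deriv i f x)" for h
  proof -
    have "frechet_derivative f (at x) h = frechet_derivative f (at x) (\<Sum>i\<in>UNIV. h $ i *\<^sub>R axis i 1)"
      by (simp only: basis_expansion scalar_mult_eq_scaleR[symmetric])
    then show ?thesis
      by (simp add: linear_sum[OF L] linear_cmul[OF L] partial_deriv_def)
  qed
  then show ?thesis using D by presburger
qed

lemma differentiable_line:
  fixes f :: "real ^ 'n::finite \<Rightarrow> real"
  assumes "f differentiable (at (x + t *\<^sub>R axis i 1))"
  shows "((\<lambda>t. f (x + t *\<^sub>R axis i 1)) has_real_derivative partial_deriv i f (x + t *\<^sub>R axis i 1)) (at t)"
proof -
  have D: "(f has_derivative frechet_derivative f (at (x + t *\<^sub>R axis i 1))) (at (x + t *\<^sub>R axis i 1))"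
    using assms frechet_derivative_works by blast
  have A: "((\<lambda>t. x + t *\<^sub>R axis i 1) has_derivative (\<lambda>h. h *\<^sub>R axis i 1)) (at t)"
    by (auto intro!: derivative_eq_intros)
  have "((\<lambda>t. f (x + t *\<^sub>R axis i 1)) has_derivative
      (\<lambda>h. frechet_derivative f (at (x + t *\<^sub>R axis i 1)) (h *\<^sub>R axis i 1))) (at t)"
    using has_derivative_compose[OF A] D by blast
  then show ?thesis
    unfolding has_field_derivative_def partial_deriv_def
    by (simp add: linear_cmul[OF has_derivative_linear[OF D]] mult.commute[of _ "frechet_derivative f _ _"])
qed

lemma C_on_Suc_D: "C_on (Suc k) UNIV f \<Longrightarrow> C_on k UNIV f"
proof (induction k arbitrary: f)
  case 0
  then show ?case
    by (auto intro!: continuous_at_imp_continuous_on differentiable_imp_continuous_within)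
next
  case (Suc k)
  then show ?case by (metis C_on.simps(2))
qed

lemma C_on_le: "C_on k UNIV f \<Longrightarrow> j \<le> k \<Longrightarrow> C_on j UNIV f"
  by (induction k) (auto simp: le_Suc_eq simp del: C_on.simps dest: C_on_Suc_D)

lemma C_on_imp_continuous: "C_on k UNIV f \<Longrightarrow> continuous_on UNIV f"
  using C_on_le[of k f 0] by simp

text \<open>
  Smoothness is a greatest fixed point: it suffices to find a class of differentiable functions that
  contains \<open>f\<close> and is stable under partial differentiation.  For reflected functions and for
  convolutions the class is the set of all functions of that form.
\<close>

lemma smooth_onI_coinduct:
  assumes "P f"
    and "\<And>f x. P f \<Longrightarrow> f differentiable (at x)"
    and "\<And>f i. P f \<Longrightarrow> P (partial_deriv i f)"
  shows "smooth_on UNIV f"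
proof -
  have "C_on k UNIV f" if "P f" for k f
    using that
  proof (induction k arbitrary: f)
    case 0
    then show ?case
      using assms(2)
      by (auto intro!: continuous_at_imp_continuous_on differentiable_imp_continuous_within)
  next
    case (Suc k)
    then show ?case using assms by simp
  qed
  with assms(1) show ?thesis by (simp add: smooth_on_def)
qed

lemma smooth_on_differentiable: "smooth_on UNIV f \<Longrightarrow> f differentiable (at x)"
  unfolding smooth_on_def by (metis C_on.simps(2) UNIV_I)

lemma smooth_on_partial_deriv: "smooth_on UNIV f \<Longrightarrow> smooth_on UNIV (partial_deriv i f)"
  unfolding smooth_on_def by (metis C_on.simps(2))

lemma smooth_on_pds: "smooth_on UNIV f \<Longrightarrow> smooth_on UNIV (pds is f)"
  by (induction "is") (auto intro: smooth_on_partial_deriv)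

lemma smooth_on_continuous: "smooth_on UNIV f \<Longrightarrow> continuous_on S f"
  unfolding smooth_on_def by (metis C_on.simps(1) continuous_on_subset subset_UNIV)

lemma smooth_on_borel [measurable_dest]: "smooth_on UNIV f \<Longrightarrow> f \<in> borel_measurable borel"
  by (simp add: smooth_on_continuous borel_measurable_continuous_onI)

lemma C_on_pds:
  "C_on k UNIV f \<Longrightarrow> length is + j \<le> k \<Longrightarrow> C_on j UNIV (pds is f)"
proof (induction "is" arbitrary: j)
  case Nil
  then show ?case by (simp add: C_on_le)
next
  case (Cons i "is")
  then have "C_on (Suc j) UNIV (pds is f)" by (intro Cons.IH) auto
  then show ?case by simp
qed

lemma partial_deriv_const: "partial_deriv i (\<lambda>x. c) = (\<lambda>x. 0)"
  by (rule ext, subst partial_deriv_eqI[OF has_derivative_const]) auto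

lemma partial_deriv_add:
  assumes "\<And>x. f differentiable (at x)" "\<And>x. g differentiable (at x)"
  shows "partial_deriv i (\<lambda>x. f x + g x) = (\<lambda>x. partial_deriv i f x + partial_deriv i g x)"
proof
  fix x
  show "partial_deriv i (\<lambda>x. f x + g x) x = partial_deriv i f x + partial_deriv i g x"
    using partial_deriv_eqI[OF has_derivative_add[OF assms[THEN has_derivative_partial_derivs]], of i x]
    by (simp add: axis_def if_distrib[of "\<lambda>x. x * _"] cong: if_cong)
qed

lemma partial_deriv_mult:
  assumes "\<And>x. f differentiable (at x)" "\<And>x. g differentiable (at x)"
  shows "partial_deriv i (\<lambda>x. f x * g x) = (\<lambda>x. f x * partial_deriv i g x + partial_deriv i f x * g x)"
proof
  fix x
  show "partial_deriv i (\<lambda>x. f x * g x) x = f x * partial_deriv i g x + partial_deriv i f x * g x"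
    using partial_deriv_eqI[OF has_derivative_mult[OF assms[THEN has_derivative_partial_derivs]], of i x]
    by (simp add: axis_def if_distrib[of "\<lambda>x. x * _"] cong: if_cong)
qed

lemma C_on_const: "C_on k UNIV (\<lambda>x. c)"
  by (induction k arbitrary: c) (auto simp: partial_deriv_const)

lemma C_on_add: "C_on k UNIV f \<Longrightarrow> C_on k UNIV g \<Longrightarrow> C_on k UNIV (\<lambda>x. f x + g x)"
  by (induction k arbitrary: f g)
     (auto simp: partial_deriv_add intro!: continuous_intros differentiable_add)

lemma C_on_mult: "C_on k UNIV f \<Longrightarrow> C_on k UNIV g \<Longrightarrow> C_on k UNIV (\<lambda>x. f x * g x)"
proof (induction k arbitrary: f g)
  case 0
  then show ?case by (auto intro!: continuous_intros)
next
  case (Suc k)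
  have "C_on k UNIV f" "C_on k UNIV g"
    using Suc.prems by (auto intro: C_on_Suc_D simp del: C_on.simps)
  with Suc show ?case
    by (auto simp: partial_deriv_mult intro!: C_on_add differentiable_mult)
qed

lemma smooth_on_const: "smooth_on UNIV (\<lambda>x. c)"
  and smooth_on_add: "smooth_on UNIV f \<Longrightarrow> smooth_on UNIV g \<Longrightarrow> smooth_on UNIV (\<lambda>x. f x + g x)"
  and smooth_on_mult: "smooth_on UNIV f \<Longrightarrow> smooth_on UNIV g \<Longrightarrow> smooth_on UNIV (\<lambda>x. f x * g x)"
  by (simp_all add: smooth_on_def C_on_const C_on_add C_on_mult)

lemma smooth_on_cmult: "smooth_on UNIV f \<Longrightarrow> smooth_on UNIV (\<lambda>x. c * f x)"
  by (intro smooth_on_mult smooth_on_const)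

lemma smooth_on_uminus: "smooth_on UNIV f \<Longrightarrow> smooth_on UNIV (\<lambda>x. - f x)"
  using smooth_on_cmult[of f "-1"] by simp

lemma smooth_on_diff:
  "smooth_on UNIV f \<Longrightarrow> smooth_on UNIV g \<Longrightarrow> smooth_on UNIV (\<lambda>x. f x - g x)"
  using smooth_on_add[OF _ smooth_on_uminus, of f g] by simp

lemma smooth_on_sum:
  "(\<And>j. j \<in> J \<Longrightarrow> smooth_on UNIV (f j)) \<Longrightarrow> smooth_on UNIV (\<lambda>x. \<Sum>j\<in>J. f j x)"
  by (induction J rule: infinite_finite_induct) (auto intro: smooth_on_const smooth_on_add)

lemma smooth_on_prod:
  "(\<And>j. j \<in> J \<Longrightarrow> smooth_on UNIV (f j)) \<Longrightarrow> smooth_on UNIV (\<lambda>x. \<Prod>j\<in>J. f j x)"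
  by (induction J rule: infinite_finite_induct) (auto intro: smooth_on_const smooth_on_mult)

lemma smooth_on_component: "smooth_on UNIV (\<lambda>x :: real ^ 'n::finite. x $ j)"
proof -
  have "partial_deriv i (\<lambda>x :: real ^ 'n. x $ j) = (\<lambda>x. axis i 1 $ j)" for i
    by (rule ext, rule partial_deriv_eqI)
       (auto intro!: bounded_linear_imp_has_derivative bounded_linear_vec_nth)
  moreover have "(\<lambda>x. x $ j) differentiable at x" for x :: "real ^ 'n"
    by (auto intro!: bounded_linear_imp_differentiable bounded_linear_vec_nth)
  ultimately have "C_on (Suc k) UNIV (\<lambda>x :: real ^ 'n. x $ j)" for k
    by (auto simp: C_on_const)
  then have "C_on k UNIV (\<lambda>x :: real ^ 'n. x $ j)" for k by (metis C_on_Suc_D)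
  then show ?thesis by (simp add: smooth_on_def)
qed

lemma partial_deriv_compose:
  fixes p :: "real ^ 'n::finite \<Rightarrow> real"
  assumes "\<And>x. (h has_real_derivative h' (p x)) (at (p x))" "\<And>x. p differentiable (at x)"
  shows "(\<lambda>x. h (p x)) differentiable (at x)"
    and "partial_deriv i (\<lambda>x. h (p x)) x = h' (p x) * partial_deriv i p x"
proof -
  have "((\<lambda>x. h (p x)) has_derivative (\<lambda>v. h' (p x) * frechet_derivative p (at x) v)) (at x)"
    by (rule has_derivative_compose[of p "frechet_derivative p (at x)" x UNIV h "(*) (h' (p x))"])
       (use assms in \<open>simp_all add: has_field_derivative_def frechet_derivative_works[symmetric]\<close>)
  then show "(\<lambda>x. h (p x)) differentiable (at x)"
    and "partial_deriv i (\<lambda>x. h (p x)) x = h' (p x) * partial_deriv i p x"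
    by (auto simp: differentiable_def partial_deriv_eqI) (simp add: partial_deriv_def)
qed

text \<open>
  \<open>H j\<close> is the \<open>j\<close>-th derivative of the outer function.  It has to be differentiable only at the values
  of \<open>p\<close>, so that functions smooth on a part of the line, such as \<open>1 / sqrt (1 + t)\<close> for \<open>t \<ge> 0\<close>,
  can be composed as well.
\<close>

lemma smooth_on_compose:
  fixes p :: "real ^ 'n::finite \<Rightarrow> real"
  assumes H: "\<And>j x. (H j has_real_derivative H (Suc j) (p x)) (at (p x))" and p: "smooth_on UNIV p"
  shows "smooth_on UNIV (\<lambda>x. H j (p x))"
proof -
  have d: "(\<lambda>x. H j (p x)) differentiable (at x)" for j x
    using partial_deriv_compose(1)[of "H j" "H (Suc j)" p x] H p by (simp add: smooth_on_differentiable)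
  have pd: "partial_deriv i (\<lambda>x. H j (p x)) = (\<lambda>x. H (Suc j) (p x) * partial_deriv i p x)" for i j
    using partial_deriv_compose(2)[of "H j" "H (Suc j)" p i] H p by (simp add: smooth_on_differentiable fun_eq_iff)
  have "C_on k UNIV (\<lambda>x. H j (p x))" for k j
  proof (induction k arbitrary: j)
    case 0
    show ?case
      using d by (auto intro!: continuous_at_imp_continuous_on differentiable_imp_continuous_within)
  next
    case (Suc k)
    have "C_on k UNIV (\<lambda>x. H (Suc j) (p x) * partial_deriv i p x)" for i
      using p smooth_on_partial_deriv by (intro C_on_mult Suc) (auto simp: smooth_on_def)
    then show ?case
      by (simp add: d pd)
  qed
  then show ?thesis by (simp add: smooth_on_def)
qed

lemma partial_deriv_reflect:
  fixes f :: "real ^ 'n::finite \<Rightarrow> real"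
  assumes "\<And>x. f differentiable (at x)"
  shows "(\<lambda>y. f (x - y)) differentiable (at y)"
    and "partial_deriv i (\<lambda>y. f (x - y)) = (\<lambda>y. - partial_deriv i f (x - y))"
proof -
  have "((\<lambda>y. f (x - y)) has_derivative (\<lambda>v. frechet_derivative f (at (x - y)) (- v))) (at y)" for y
    by (rule has_derivative_compose[of "\<lambda>y. x - y" "\<lambda>v. - v" y UNIV f "frechet_derivative f (at (x - y))"])
       (use assms in \<open>auto intro!: derivative_eq_intros simp: frechet_derivative_works[symmetric]\<close>)
  note D = this
  have "linear (frechet_derivative f (at (x - y)))" for y
    using assms by (simp add: linear_frechet_derivative)
  then show "partial_deriv i (\<lambda>y. f (x - y)) = (\<lambda>y. - partial_deriv i f (x - y))"
    using partial_deriv_eqI[OF D] by (simp add: partial_deriv_def[of _ f] linear_neg fun_eq_iff)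
  show "(\<lambda>y. f (x - y)) differentiable (at y)"
    using D by (auto simp: differentiable_def)
qed

lemma smooth_on_reflect:
  fixes f :: "real ^ 'n::finite \<Rightarrow> real"
  assumes "smooth_on UNIV f"
  shows "smooth_on UNIV (\<lambda>y. f (x - y))"
proof (rule smooth_onI_coinduct[where P="\<lambda>g. \<exists>f c. smooth_on UNIV f \<and> g = (\<lambda>y. f (x - y))"])
  fix g :: "real ^ 'n \<Rightarrow> real" and y i
  assume "\<exists>f c. smooth_on UNIV f \<and> g = (\<lambda>y. f (x - y))"
  then obtain f where f: "smooth_on UNIV f" "g = (\<lambda>y. f (x - y))" by auto
  show "g differentiable at y"
    unfolding f by (intro partial_deriv_reflect smooth_on_differentiable f)
  have "partial_deriv i g = (\<lambda>y. - partial_deriv i f (x - y))"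
    unfolding f by (intro partial_deriv_reflect smooth_on_differentiable f)
  then show "\<exists>f c. smooth_on UNIV f \<and> partial_deriv i g = (\<lambda>y. f (x - y))"
    using f by (intro exI[of _ "\<lambda>y. - partial_deriv i f y"]) (auto intro: smooth_on_uminus smooth_on_partial_deriv)
qed (use assms in auto)

lemma partial_deriv_cmult:
  assumes "\<And>x. f differentiable (at x)"
  shows "partial_deriv i (\<lambda>x. c * f x) = (\<lambda>x. c * partial_deriv i f x)"
  using assms by (simp add: partial_deriv_mult partial_deriv_const)

lemma pds_cmult: "smooth_on UNIV f \<Longrightarrow> pds is (\<lambda>x. c * f x) = (\<lambda>x. c * pds is f x)"
  by (induction "is") (auto simp: partial_deriv_cmult smooth_on_differentiable smooth_on_pds)

lemma pds_add: "smooth_on UNIV f \<Longrightarrow> smooth_on UNIV g \<Longrightarrow>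
    pds is (\<lambda>x. f x + g x) = (\<lambda>x. pds is f x + pds is g x)"
  by (induction "is") (auto simp: partial_deriv_add smooth_on_differentiable smooth_on_pds)

lemma pds_zero: "pds is (\<lambda>x. 0) = (\<lambda>x. 0)"
  by (induction "is") (auto simp: partial_deriv_const)

lemma pds_sum: "(\<And>j. j \<in> J \<Longrightarrow> smooth_on UNIV (f j)) \<Longrightarrow>
    pds is (\<lambda>x. \<Sum>j\<in>J. f j x) = (\<lambda>x. \<Sum>j\<in>J. pds is (f j) x)"
  by (induction J rule: infinite_finite_induct) (auto simp: pds_zero pds_add smooth_on_sum)

lemma pds_reflect:
  "smooth_on UNIV f \<Longrightarrow> pds is (\<lambda>y. f (x - y)) = (\<lambda>y. (-1) ^ length is * pds is f (x - y))"
  by (induction "is")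
     (auto simp: partial_deriv_cmult partial_deriv_reflect smooth_on_differentiable smooth_on_pds)

text \<open>
  The mean value theorem, applied first in direction \<open>i\<close> and then in direction \<open>j\<close>.  The left-hand side
  is symmetric in \<open>i\<close> and \<open>j\<close>, so letting \<open>h\<close> tend to 0 shows that mixed partial derivatives agree.
\<close>

lemma second_difference_mean_value:
  fixes f :: "real ^ 'n::finite \<Rightarrow> real"
  assumes f: "C_on 2 UNIV f" and h: "h > 0"
  shows "\<exists>s r. 0 < s \<and> s < h \<and> 0 < r \<and> r < h \<and>
    f (x + h *\<^sub>R axis i 1 + h *\<^sub>R axis j 1) - f (x + h *\<^sub>R axis i 1) - f (x + h *\<^sub>R axis j 1) + f x
      = h * h * partial_deriv j (partial_deriv i f) (x + s *\<^sub>R axis i 1 + r *\<^sub>R axis j 1)"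
proof -
  define ei ej :: "real ^ 'n" where "ei = axis i 1" and "ej = axis j 1"
  have f1: "f differentiable (at y)" and f2: "partial_deriv i f differentiable (at y)" for y
    using f by (auto simp: numeral_2_eq_2)
  have "((\<lambda>t. f ((x + h *\<^sub>R ej) + t *\<^sub>R ei) - f (x + t *\<^sub>R ei)) has_real_derivative
      partial_deriv i f ((x + h *\<^sub>R ej) + t *\<^sub>R ei) - partial_deriv i f (x + t *\<^sub>R ei)) (at t)" for t
    unfolding ei_def ej_def by (intro DERIV_diff differentiable_line f1)
  from MVT2[OF h this] obtain s where s: "0 < s" "s < h" and
    e1: "(f ((x + h *\<^sub>R ej) + h *\<^sub>R ei) - f (x + h *\<^sub>R ei)) - (f ((x + h *\<^sub>R ej) + 0 *\<^sub>R ei) - f (x + 0 *\<^sub>R ei))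
      = h * (partial_deriv i f ((x + h *\<^sub>R ej) + s *\<^sub>R ei) - partial_deriv i f (x + s *\<^sub>R ei))"
    by auto
  have "((\<lambda>t. partial_deriv i f ((x + s *\<^sub>R ei) + t *\<^sub>R ej)) has_real_derivative
      partial_deriv j (partial_deriv i f) ((x + s *\<^sub>R ei) + t *\<^sub>R ej)) (at t)" for t
    unfolding ej_def by (intro differentiable_line f2)
  from MVT2[OF h this] obtain r where r: "0 < r" "r < h" and
    e2: "partial_deriv i f ((x + s *\<^sub>R ei) + h *\<^sub>R ej) - partial_deriv i f ((x + s *\<^sub>R ei) + 0 *\<^sub>R ej)
      = h * partial_deriv j (partial_deriv i f) ((x + s *\<^sub>R ei) + r *\<^sub>R ej)"
    by auto
  show ?thesis
    using s r e1 e2 unfolding ei_def ej_def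
    by (intro exI[of _ s] exI[of _ r]) (simp add: algebra_simps)
qed

lemma partial_deriv_commute:
  fixes f :: "real ^ 'n::finite \<Rightarrow> real"
  assumes f: "C_on 2 UNIV f"
  shows "partial_deriv j (partial_deriv i f) x = partial_deriv i (partial_deriv j f) x"
proof -
  let ?A = "partial_deriv j (partial_deriv i f)" and ?B = "partial_deriv i (partial_deriv j f)"
  define h where "h n = inverse (real (Suc n))" for n
  have h: "h n > 0" "h \<longlonglongrightarrow> 0" for n
    using LIMSEQ_inverse_real_of_nat by (auto simp: h_def[abs_def])
  have "\<exists>s r s' r'. 0 < s \<and> s < h n \<and> 0 < r \<and> r < h n \<and> 0 < s' \<and> s' < h n \<and> 0 < r' \<and> r' < h n \<and>
      ?A (x + s *\<^sub>R axis i 1 + r *\<^sub>R axis j 1) = ?B (x + s' *\<^sub>R axis j 1 + r' *\<^sub>R axis i 1)" for n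
  proof -
    obtain s r where 1: "0 < s" "s < h n" "0 < r" "r < h n"
      "f (x + h n *\<^sub>R axis i 1 + h n *\<^sub>R axis j 1) - f (x + h n *\<^sub>R axis i 1) - f (x + h n *\<^sub>R axis j 1) + f x
      = h n * h n * ?A (x + s *\<^sub>R axis i 1 + r *\<^sub>R axis j 1)"
      using second_difference_mean_value[OF f h(1)[of n], where x=x and i=i and j=j] by blast
    obtain s' r' where 2: "0 < s'" "s' < h n" "0 < r'" "r' < h n"
      "f (x + h n *\<^sub>R axis j 1 + h n *\<^sub>R axis i 1) - f (x + h n *\<^sub>R axis j 1) - f (x + h n *\<^sub>R axis i 1) + f x
      = h n * h n * ?B (x + s' *\<^sub>R axis j 1 + r' *\<^sub>R axis i 1)"
      using second_difference_mean_value[OF f h(1)[of n], where x=x and i=j and j=i] by blast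
    have c: "x + h n *\<^sub>R axis j 1 + h n *\<^sub>R axis i 1 = x + h n *\<^sub>R axis i 1 + h n *\<^sub>R axis j 1"
      by (simp add: algebra_simps)
    have "h n * h n * ?A (x + s *\<^sub>R axis i 1 + r *\<^sub>R axis j 1) = h n * h n * ?B (x + s' *\<^sub>R axis j 1 + r' *\<^sub>R axis i 1)"
      using 1(5) 2(5)[unfolded c] by linarith
    then have "?A (x + s *\<^sub>R axis i 1 + r *\<^sub>R axis j 1) = ?B (x + s' *\<^sub>R axis j 1 + r' *\<^sub>R axis i 1)"
      using h(1)[of n] by simp
    with 1 2 show ?thesis by blast
  qed
  then obtain s r s' r' where b: "\<And>n. 0 < s n \<and> s n < h n \<and> 0 < r n \<and> r n < h n \<and> 0 < s' n \<and> s' n < h n \<and> 0 < r' n \<and> r' n < h n"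
    and e: "\<And>n. ?A (x + s n *\<^sub>R axis i 1 + r n *\<^sub>R axis j 1) = ?B (x + s' n *\<^sub>R axis j 1 + r' n *\<^sub>R axis i 1)"
    by metis
  have z: "s \<longlonglongrightarrow> 0" "r \<longlonglongrightarrow> 0" "s' \<longlonglongrightarrow> 0" "r' \<longlonglongrightarrow> 0"
    by (rule real_tendsto_sandwich[OF _ _ tendsto_const h(2)]; use b in \<open>auto intro!: always_eventually less_imp_le\<close>)+
  have cA: "continuous_on UNIV ?A" and cB: "continuous_on UNIV ?B"
    using f by (auto simp: numeral_2_eq_2)
  have "(\<lambda>n. x + s n *\<^sub>R axis i 1 + r n *\<^sub>R axis j 1) \<longlonglongrightarrow> x + 0 *\<^sub>R axis i 1 + 0 *\<^sub>R axis j 1"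
    by (intro tendsto_intros z)
  then have lA: "(\<lambda>n. ?A (x + s n *\<^sub>R axis i 1 + r n *\<^sub>R axis j 1)) \<longlonglongrightarrow> ?A x"
    using continuous_on_tendsto_compose[OF cA] by fastforce
  have "(\<lambda>n. x + s' n *\<^sub>R axis j 1 + r' n *\<^sub>R axis i 1) \<longlonglongrightarrow> x + 0 *\<^sub>R axis j 1 + 0 *\<^sub>R axis i 1"
    by (intro tendsto_intros z)
  then have lB: "(\<lambda>n. ?B (x + s' n *\<^sub>R axis j 1 + r' n *\<^sub>R axis i 1)) \<longlonglongrightarrow> ?B x"
    using continuous_on_tendsto_compose[OF cB] by fastforce
  show ?thesis
    using LIMSEQ_unique[OF lA] lB by (simp add: e)
qed

lemma partial_deriv_pds_commute:
  assumes "smooth_on UNIV f"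
  shows "partial_deriv i (pds is f) = pds is (partial_deriv i f)"
proof (induction "is")
  case (Cons j "is")
  have "C_on 2 UNIV (pds is f)"
    using smooth_on_pds[OF assms] by (simp add: smooth_on_def)
  then have "partial_deriv i (partial_deriv j (pds is f)) = partial_deriv j (partial_deriv i (pds is f))"
    by (intro ext partial_deriv_commute)
  with Cons show ?case by simp
qed simp

lemma pds_cong_mset:
  assumes "smooth_on UNIV f" "mset is = mset js"
  shows "pds is f = pds js f"
  using assms(2)
proof (induction "is" arbitrary: js)
  case (Cons i "is")
  then have "i \<in> set js" by (metis list.set_intros(1) set_mset_mset)
  then obtain as bs where js: "js = as @ i # bs" by (meson split_list)
  with Cons.prems have "mset is = mset (as @ bs)" by simp
  from Cons.IH[OF this] have "pds (i # is) f = partial_deriv i (pds as (pds bs f))"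
    by (simp add: pds_append)
  also have "\<dots> = pds as (partial_deriv i (pds bs f))"
    using assms(1) by (intro partial_deriv_pds_commute smooth_on_pds)
  finally show ?case by (simp add: js pds_append)
qed simp

text \<open>
  The list of directions chosen in \<open>multi_deriv\<close>, which thereby becomes an instance of \<open>pds\<close>.  Lists
  allow derivatives to be taken one at a time.
\<close>

definition midx_list :: "('n::finite \<Rightarrow> nat) \<Rightarrow> 'n list" where
  "midx_list \<nu> = (SOME is. \<forall>i. count_list is i = \<nu> i)"

lemma count_midx_list: "count_list (midx_list \<nu>) = \<nu>"
  unfolding midx_list_def using someI_ex[OF multi_index_list_exists[of \<nu>]] by auto

lemma multi_deriv_pds: "multi_deriv \<nu> f = pds (midx_list \<nu>) f"
  by (simp add: multi_deriv_def pds_def midx_list_def)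

lemma order_of_count_list: "order_of (count_list is) = length is"
proof (induction "is")
  case (Cons i "is")
  have "count_list (i # is) = (\<lambda>k. count_list is k + (if k = i then 1 else 0))"
    by auto
  with Cons show ?case
    by (simp add: order_of_def sum.distrib del: count_list.simps)
qed (simp add: order_of_def)

lemma length_midx_list: "length (midx_list \<nu>) = order_of \<nu>"
  using order_of_count_list[of "midx_list \<nu>"] by (simp add: count_midx_list)

lemma multi_deriv_count_list:
  assumes "smooth_on UNIV f"
  shows "multi_deriv (count_list is) f = pds is f"
proof -
  have "mset (midx_list (count_list is)) = mset is"
    by (metis count_midx_list count_mset multiset_eqI)
  then show ?thesis
    unfolding multi_deriv_pds using assms by (intro pds_cong_mset)
qed

text \<open>
  The terms of the product rule for \<open>pds is (f * g)\<close>, except the one in which all derivatives fall on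
  \<open>g\<close>: the pairs \<open>(A, B)\<close> of complementary sublists of \<open>is\<close> with \<open>A\<close> nonempty.  A derivative falling on
  the first factor is appended at the end of \<open>A\<close>, because the induction on \<open>is\<close> replaces that factor by
  its derivative before the remaining directions are treated.
\<close>

primrec leibniz_pairs :: "'n list \<Rightarrow> ('n list \<times> 'n list) list" where
  "leibniz_pairs [] = []"
| "leibniz_pairs (i # is) =
     map (\<lambda>(A, B). (A, i # B)) (leibniz_pairs is) @ map (\<lambda>(A, B). (A @ [i], B)) (([], is) # leibniz_pairs is)"

lemma leibniz_pairs_length:
  "(A, B) \<in> set (leibniz_pairs is) \<Longrightarrow> A \<noteq> [] \<and> length A + length B = length is"
  by (induction "is" arbitrary: A B) auto

text \<open>
  The product rule solved for the term in which \<open>\<zeta>\<close> is not differentiated.  Read with a test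
  function in place of \<open>\<psi>\<close>, it is the product rule for distributional derivatives.
\<close>

lemma leibniz_inverse:
  fixes \<psi> \<zeta> :: "real ^ 'n::finite \<Rightarrow> real"
  assumes \<psi>: "smooth_on UNIV \<psi>" and \<zeta>: "smooth_on UNIV \<zeta>"
  shows "(\<lambda>y. \<zeta> y * pds is \<psi> y) = (\<lambda>y. pds is (\<lambda>y. \<zeta> y * \<psi> y) y +
     (\<Sum>(A, B)\<leftarrow>leibniz_pairs is. (-1) ^ length A * pds B (\<lambda>y. pds A \<zeta> y * \<psi> y) y))"
  using \<zeta>
proof (induction "is" arbitrary: \<zeta>)
  case (Cons i "is")
  note [simp] = smooth_on_differentiable smooth_on_pds smooth_on_mult smooth_on_partial_deriv
  note \<zeta> = \<open>smooth_on UNIV \<zeta>\<close>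
  define T where "T \<zeta> AB y = (case AB of (A, B) \<Rightarrow> (-1) ^ length A * pds B (\<lambda>y. pds A \<zeta> y * \<psi> y) y)"
    for \<zeta> AB and y :: "real ^ 'n"
  have T: "T \<zeta> (A, B) = (\<lambda>y. (-1) ^ length A * pds B (\<lambda>y. pds A \<zeta> y * \<psi> y) y)" for \<zeta> A B
    by (simp add: T_def fun_eq_iff)
  have sm: "smooth_on UNIV (T \<zeta> AB)" for AB
    using \<zeta> \<psi> by (cases AB) (simp add: T smooth_on_cmult)
  have dsum: "partial_deriv i (\<lambda>y. \<Sum>AB\<leftarrow>L. T \<zeta> AB y) = (\<lambda>y. \<Sum>AB\<leftarrow>L. partial_deriv i (T \<zeta> AB) y)
      \<and> smooth_on UNIV (\<lambda>y. \<Sum>AB\<leftarrow>L. T \<zeta> AB y)" for L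
  proof (induction L)
    case Nil
    show ?case by (simp add: partial_deriv_const smooth_on_const)
  next
    case (Cons AB L)
    have "partial_deriv i (\<lambda>y. T \<zeta> AB y + (\<Sum>AB\<leftarrow>L. T \<zeta> AB y))
       = (\<lambda>y. partial_deriv i (T \<zeta> AB) y + partial_deriv i (\<lambda>y. \<Sum>AB\<leftarrow>L. T \<zeta> AB y) y)"
      using sm Cons by (intro partial_deriv_add smooth_on_differentiable) auto
    with Cons sm[of AB] show ?case by (simp add: smooth_on_add)
  qed
  have pT: "partial_deriv i (T \<zeta> AB) y = T \<zeta> (case AB of (A, B) \<Rightarrow> (A, i # B)) y" for AB y
    using \<zeta> \<psi> by (cases AB) (simp add: T partial_deriv_cmult)
  have qT: "- T (partial_deriv i \<zeta>) AB y = T \<zeta> (case AB of (A, B) \<Rightarrow> (A @ [i], B)) y" for AB y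
    by (cases AB) (simp add: T pds_append)
  have "\<zeta> y * pds (i # is) \<psi> y = partial_deriv i (\<lambda>y. \<zeta> y * pds is \<psi> y) y - partial_deriv i \<zeta> y * pds is \<psi> y" for y
    using \<zeta> \<psi> by (subst partial_deriv_mult) auto
  also have "\<dots> y = partial_deriv i (\<lambda>y. pds is (\<lambda>y. \<zeta> y * \<psi> y) y + (\<Sum>AB\<leftarrow>leibniz_pairs is. T \<zeta> AB y)) y
      - (pds is (\<lambda>y. partial_deriv i \<zeta> y * \<psi> y) y + (\<Sum>AB\<leftarrow>leibniz_pairs is. T (partial_deriv i \<zeta>) AB y))" for y
    using Cons.IH[OF \<zeta>] Cons.IH[OF smooth_on_partial_deriv[OF \<zeta>, of i]]
    by (simp add: fun_eq_iff T_def[symmetric])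
  also have "\<dots> y = partial_deriv i (pds is (\<lambda>y. \<zeta> y * \<psi> y)) y + (\<Sum>AB\<leftarrow>leibniz_pairs is. partial_deriv i (T \<zeta> AB) y)
      - (pds is (\<lambda>y. partial_deriv i \<zeta> y * \<psi> y) y + (\<Sum>AB\<leftarrow>leibniz_pairs is. T (partial_deriv i \<zeta>) AB y))" for y
    using dsum \<zeta> \<psi> by (subst partial_deriv_add) auto
  also have "\<dots> y = partial_deriv i (pds is (\<lambda>y. \<zeta> y * \<psi> y)) y + (\<Sum>AB\<leftarrow>leibniz_pairs is. T \<zeta> (case AB of (A, B) \<Rightarrow> (A, i # B)) y)
      + (T \<zeta> ([i], is) y + (\<Sum>AB\<leftarrow>leibniz_pairs is. T \<zeta> (case AB of (A, B) \<Rightarrow> (A @ [i], B)) y))" for y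
    unfolding pT qT[symmetric] by (simp add: uminus_sum_list_map o_def T)
  finally show ?case
    unfolding fun_eq_iff by (intro allI) (simp add: o_def split_def T_def)
qed simp

section \<open>Smooth bump functions\<close>

primrec flat_poly :: "nat \<Rightarrow> real poly" where
  "flat_poly 0 = 1"
| "flat_poly (Suc k) = [:0, 0, 1:] * (flat_poly k - pderiv (flat_poly k))"

text \<open>The \<open>k\<close>-th derivative of the function equal to \<open>exp (- 1 / t)\<close> for \<open>t > 0\<close> and zero for \<open>t \<le> 0\<close>.\<close>

definition flat_exp :: "nat \<Rightarrow> real \<Rightarrow> real" where
  "flat_exp k t = (if t \<le> 0 then 0 else poly (flat_poly k) (inverse t) * exp (- inverse t))"

lemma poly_exp_tendsto_0: "((\<lambda>s :: real. poly p s * exp (- s)) \<longlongrightarrow> 0) at_top"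
proof -
  have "((\<lambda>s :: real. \<Sum>i\<le>degree p. coeff p i * (s ^ i / exp s)) \<longlongrightarrow> (\<Sum>i\<le>degree p. coeff p i * 0)) at_top"
    by (intro tendsto_intros tendsto_power_div_exp_0)
  then show ?thesis
    by (simp add: poly_altdef exp_minus sum_distrib_right sum_divide_distrib field_simps)
qed

text \<open>
  Away from 0 this is the recursion defining \<open>flat_poly\<close>; at 0 the difference quotient is a polynomial
  in \<open>1 / t\<close> times \<open>exp (- 1 / t)\<close>.
\<close>

lemma flat_exp_has_derivative: "(flat_exp k has_real_derivative flat_exp (Suc k) t) (at t)"
proof -
  consider "t < 0" | "t = 0" | "t > 0" by linarith
  then show ?thesis
  proof cases
    case 1
    have "((\<lambda>_. 0) has_real_derivative 0) (at t)" by simp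
    then have "(flat_exp k has_real_derivative 0) (at t)"
      by (rule has_field_derivative_transform_within_open[where S="{..<0}"])
         (use 1 in \<open>auto simp: flat_exp_def\<close>)
    with 1 show ?thesis by (simp add: flat_exp_def)
  next
    case 3
    have "((\<lambda>t. poly (flat_poly k) (inverse t) * exp (- inverse t)) has_real_derivative
        (poly (pderiv (flat_poly k)) (inverse t) * (- (inverse t * inverse t))) * exp (- inverse t)
        + exp (- inverse t) * (inverse t * inverse t) * poly (flat_poly k) (inverse t)) (at t)"
      using 3 by (auto intro!: derivative_eq_intros DERIV_chain2[OF poly_DERIV] simp: power2_eq_square)
    also have "(poly (pderiv (flat_poly k)) (inverse t) * (- (inverse t * inverse t))) * exp (- inverse t)
        + exp (- inverse t) * (inverse t * inverse t) * poly (flat_poly k) (inverse t) = flat_exp (Suc k) t"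
      using 3 by (simp add: flat_exp_def algebra_simps)
    finally show ?thesis
      by (rule has_field_derivative_transform_within_open[where S="{0<..}"])
         (use 3 in \<open>auto simp: flat_exp_def\<close>)
  next
    case 2
    have "((\<lambda>h. poly ([:0, 1:] * flat_poly k) (inverse h) * exp (- inverse h)) \<longlongrightarrow> 0) (at_right (0::real))"
      by (rule filterlim_compose[OF poly_exp_tendsto_0 filterlim_inverse_at_top_right])
    moreover have "eventually (\<lambda>h. poly ([:0, 1:] * flat_poly k) (inverse h) * exp (- inverse h) = flat_exp k h / h) (at_right (0::real))"
      by (auto simp: eventually_at_filter flat_exp_def field_simps intro!: always_eventually)
    ultimately have r: "((\<lambda>h. flat_exp k h / h) \<longlongrightarrow> 0) (at_right 0)"
      by (rule Lim_transform_eventually)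
    have l: "((\<lambda>h. flat_exp k h / h) \<longlongrightarrow> 0) (at_left 0)"
      by (rule Lim_transform_eventually[OF tendsto_const])
         (auto simp: eventually_at_filter flat_exp_def intro!: always_eventually)
    show ?thesis
      using filterlim_split_at[OF l r] 2 by (simp add: DERIV_def flat_exp_def)
  qed
qed

lemma smooth_on_bump_profile:
  fixes c :: "real ^ 'n::finite"
  shows "smooth_on UNIV (\<lambda>x. flat_exp 0 (r\<^sup>2 - (norm (x - c))\<^sup>2))"
proof (rule smooth_on_compose[where H=flat_exp])
  have "(norm (x - c))\<^sup>2 = (\<Sum>i\<in>UNIV. (x $ i - c $ i) * (x $ i - c $ i))" for x
    by (simp add: power2_norm_eq_inner inner_vec_def)
  then show "smooth_on UNIV (\<lambda>x. r\<^sup>2 - (norm (x - c))\<^sup>2)"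
    by (auto intro!: smooth_on_diff smooth_on_const smooth_on_sum smooth_on_mult smooth_on_component)
qed (rule flat_exp_has_derivative)

lemma continuous_bounded_support:
  fixes f :: "'a::euclidean_space \<Rightarrow> real"
  assumes f: "continuous_on UNIV f" and R: "\<And>x. f x \<noteq> 0 \<Longrightarrow> norm x \<le> R"
  shows "integrable lborel f" and "\<exists>B\<ge>0. \<forall>x. \<bar>f x\<bar> \<le> B" and "uniformly_continuous_on UNIV f"
proof -
  have "integrable lborel (\<lambda>x. indicator (cball 0 R) x *\<^sub>R f x)"
    by (intro borel_integrable_compact continuous_on_subset[OF f]) auto
  also have "(\<lambda>x. indicator (cball 0 R) x *\<^sub>R f x) = f"
    using R by (auto simp: indicator_def fun_eq_iff)
  finally show "integrable lborel f" .
  have "compact (f ` cball 0 R)"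
    by (intro compact_continuous_image continuous_on_subset[OF f]) auto
  then obtain B where B: "\<And>x. norm x \<le> R \<Longrightarrow> \<bar>f x\<bar> \<le> B"
    using compact_imp_bounded[of "f ` cball 0 R"] unfolding bounded_iff by force
  have "\<bar>f x\<bar> \<le> max 0 B" for x
    using B[of x] R[of x] by (cases "f x = 0") auto
  then show "\<exists>B\<ge>0. \<forall>x. \<bar>f x\<bar> \<le> B" by (intro exI[of _ "max 0 B"]) auto
  have uc: "uniformly_continuous_on (cball 0 (R + 1)) f"
    by (intro compact_uniformly_continuous continuous_on_subset[OF f]) auto
  show "uniformly_continuous_on UNIV f"
    unfolding uniformly_continuous_on_def
  proof (intro allI impI)
    fix e :: real assume "e > 0"
    then obtain d where d: "d > 0" "\<And>x y. norm x \<le> R + 1 \<Longrightarrow> norm y \<le> R + 1 \<Longrightarrow> dist y x < d \<Longrightarrow> dist (f y) (f x) < e"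
      using uc unfolding uniformly_continuous_on_def by fastforce
    have "dist (f y) (f x) < e" if "dist y x < min d 1" for x y
    proof (cases "norm x \<le> R \<or> norm y \<le> R")
      case True
      have "norm x \<le> norm y + norm (y - x)" "norm y \<le> norm x + norm (y - x)"
        using norm_triangle_ineq4[of y "y - x"] norm_triangle_ineq[of x "y - x"] by auto
      with that True show ?thesis by (intro d) (auto simp: dist_norm)
    next
      case False
      with R[of x] R[of y] have "f x = 0" "f y = 0" by auto
      then show ?thesis using \<open>e > 0\<close> by simp
    qed
    then show "\<exists>d>0. \<forall>x\<in>UNIV. \<forall>x'\<in>UNIV. dist x' x < d \<longrightarrow> dist (f x') (f x) < e"
      using d(1) by (intro exI[of _ "min d 1"]) auto
  qed
qed

lemma lborel_integral_translate:
  fixes f :: "'a::euclidean_space \<Rightarrow> real"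
  assumes [measurable]: "f \<in> borel_measurable borel"
  shows "(\<integral>x. f (x + a) \<partial>lborel) = (\<integral>x. f x \<partial>lborel)"
    and "integrable lborel (\<lambda>x. f (x + a)) \<longleftrightarrow> integrable lborel f"
proof -
  have "(\<integral>x. f x \<partial>distr lborel borel ((+) a)) = (\<integral>x. f (x + a) \<partial>lborel)"
    by (subst integral_distr) (auto simp: add.commute)
  moreover have "integrable (distr lborel borel ((+) a)) f \<longleftrightarrow> integrable lborel (\<lambda>x. f (x + a))"
    by (subst integrable_distr_eq) (auto simp: add.commute)
  ultimately show "(\<integral>x. f (x + a) \<partial>lborel) = (\<integral>x. f x \<partial>lborel)"
    and "integrable lborel (\<lambda>x. f (x + a)) \<longleftrightarrow> integrable lborel f"
    by (simp_all add: lborel_distr_plus)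
qed

lemma distr_lborel_reflect:
  "distr lborel borel (\<lambda>y :: 'a::euclidean_space. x - y) = lborel"
  using lborel_affine[of "-1" x] by (simp add: density_1)

lemma lborel_integral_reflect:
  fixes f :: "'a::euclidean_space \<Rightarrow> real"
  assumes [measurable]: "f \<in> borel_measurable borel"
  shows "(\<integral>y. f (x - y) \<partial>lborel) = (\<integral>y. f y \<partial>lborel)"
    and "integrable lborel (\<lambda>y. f (x - y)) \<longleftrightarrow> integrable lborel f"
proof -
  have "(\<integral>y. f y \<partial>distr lborel borel (\<lambda>y. x - y)) = (\<integral>y. f (x - y) \<partial>lborel)"
    by (subst integral_distr) auto
  moreover have "integrable (distr lborel borel (\<lambda>y. x - y)) f \<longleftrightarrow> integrable lborel (\<lambda>y. f (x - y))"
    by (subst integrable_distr_eq) auto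
  ultimately show "(\<integral>y. f (x - y) \<partial>lborel) = (\<integral>y. f y \<partial>lborel)"
    and "integrable lborel (\<lambda>y. f (x - y)) \<longleftrightarrow> integrable lborel f"
    by (simp_all add: distr_lborel_reflect)
qed

text \<open>
  The support may be centred at a point \<open>c\<close> other than the origin: convolution with \<open>\<rho>\<close> then
  evaluates a function at \<open>x\<close> through its values near \<open>x - c\<close>.
\<close>

definition mollifier :: "real ^ 'n::finite \<Rightarrow> real \<Rightarrow> (real ^ 'n \<Rightarrow> real) \<Rightarrow> bool" where
  "mollifier c r \<rho> \<longleftrightarrow> smooth_on UNIV \<rho> \<and> (\<forall>x. 0 \<le> \<rho> x) \<and> (\<forall>x. \<rho> x \<noteq> 0 \<longrightarrow> x \<in> cball c r) \<and>
     (\<integral>x. \<rho> x \<partial>lborel) = 1"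

lemma cball_norm_bound: "x \<in> cball c r \<Longrightarrow> norm x \<le> norm c + r"
  using norm_triangle_ineq4[of c "c - x"] by (simp add: dist_norm)

lemma mollifierD:
  assumes "mollifier c r \<rho>"
  shows "smooth_on UNIV \<rho>" "0 \<le> \<rho> x" "\<rho> x \<noteq> 0 \<Longrightarrow> x \<in> cball c r" "\<rho> x \<noteq> 0 \<Longrightarrow> norm x \<le> norm c + r"
    "(\<integral>x. \<rho> x \<partial>lborel) = 1" "integrable lborel \<rho>" "\<rho> \<in> borel_measurable borel"
    "\<And>x. (\<integral>y. \<rho> (x - y) \<partial>lborel) = 1" "\<And>x. integrable lborel (\<lambda>y. \<rho> (x - y))"
    "\<And>y. (\<integral>x. \<rho> (x - y) \<partial>lborel) = 1" "\<And>y. integrable lborel (\<lambda>x. \<rho> (x - y))"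
proof -
  note a = assms[unfolded mollifier_def]
  show 1: "smooth_on UNIV \<rho>" "0 \<le> \<rho> x" "\<rho> x \<noteq> 0 \<Longrightarrow> x \<in> cball c r" "(\<integral>x. \<rho> x \<partial>lborel) = 1" using a by auto
  show n: "\<rho> x \<noteq> 0 \<Longrightarrow> norm x \<le> norm c + r" for x
    using a cball_norm_bound by blast
  show 2: "integrable lborel \<rho>"
    using continuous_bounded_support(1)[OF smooth_on_continuous[OF 1(1)] n] by auto
  show 3: "\<rho> \<in> borel_measurable borel" using 1 by measurable
  show "(\<integral>y. \<rho> (x - y) \<partial>lborel) = 1" "integrable lborel (\<lambda>y. \<rho> (x - y))" for x
    using lborel_integral_reflect[OF 3] 1 2 by simp_all
  show "(\<integral>x. \<rho> (x - y) \<partial>lborel) = 1" "integrable lborel (\<lambda>x. \<rho> (x - y))" for y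
    using lborel_integral_translate[OF 3, of "- y"] 1 2 by simp_all
qed

lemma mollifier_exists:
  fixes c :: "real ^ 'n::finite"
  assumes "r > 0"
  shows "\<exists>\<rho>. mollifier c r \<rho>"
proof -
  define f where "f x = flat_exp 0 (r\<^sup>2 - (norm (x - c))\<^sup>2)" for x :: "real ^ 'n"
  have f0: "f x \<ge> 0" for x by (simp add: f_def flat_exp_def)
  have sm: "smooth_on UNIV f" unfolding f_def by (rule smooth_on_bump_profile)
  have "r\<^sup>2 \<le> (norm (x - c))\<^sup>2 \<longleftrightarrow> r \<le> norm (x - c)" for x
    using assms abs_le_square_iff[of r "norm (x - c)"] by simp
  then have pos: "f x \<noteq> 0 \<longleftrightarrow> x \<in> ball c r" for x
    by (auto simp: f_def flat_exp_def dist_norm norm_minus_commute[of c] not_le)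
  have n: "f x \<noteq> 0 \<Longrightarrow> norm x \<le> norm c + r" for x
    using pos[of x] cball_norm_bound[of x c r] by auto
  have int: "integrable lborel f"
    using continuous_bounded_support(1)[OF smooth_on_continuous[OF sm] n] by auto
  have "(\<integral>x. f x \<partial>lborel) \<noteq> 0"
  proof
    assume "(\<integral>x. f x \<partial>lborel) = 0"
    then have "AE x in lborel. f x = 0"
      using f0 int by (simp add: integral_nonneg_eq_0_iff_AE)
    then have "AE x in lborel. x \<notin> ball c r"
      by (rule eventually_mono) (use pos in blast)
    then have "ball c r \<in> null_sets lborel"
      by (subst AE_iff_null_sets) auto
    then show False
      using assms open_not_negligible[of "ball c r"]
      by (auto simp: negligible_iff_null_sets dest: null_sets_completionI)
  qed
  moreover have "(\<integral>x. f x \<partial>lborel) \<ge> 0" by (simp add: f0)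
  ultimately have I: "(\<integral>x. f x \<partial>lborel) > 0" by linarith
  have "mollifier c r (\<lambda>x. inverse (\<integral>x. f x \<partial>lborel) * f x)"
    unfolding mollifier_def using I f0 pos sm by (auto intro!: smooth_on_cmult)
  then show ?thesis by blast
qed

section \<open>Convolution and integration by parts\<close>

lemma partial_deriv_zero_off_closed:
  fixes f :: "real ^ 'n::finite \<Rightarrow> real"
  assumes "closed S" "\<And>x. x \<notin> S \<Longrightarrow> f x = 0" "x \<notin> S"
  shows "partial_deriv i f x = 0"
proof -
  have "((\<lambda>_. 0) has_derivative (\<lambda>_. 0)) (at x)" by simp
  then have "(f has_derivative (\<lambda>_. 0)) (at x)"
    by (rule has_derivative_transform_within_open[where s="- S"]) (use assms in auto)
  then show ?thesis by (simp add: partial_deriv_eqI)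
qed

lemma pds_zero_off_closed:
  fixes f :: "real ^ 'n::finite \<Rightarrow> real"
  assumes "closed S" "\<And>x. x \<notin> S \<Longrightarrow> f x = 0"
  shows "x \<notin> S \<Longrightarrow> pds is f x = 0"
  by (induction "is" arbitrary: x) (auto intro: assms(2) partial_deriv_zero_off_closed[OF assms(1)])

text \<open>
  The difference quotients have integral zero, because Lebesgue measure is invariant under
  translations; they converge dominatedly to the derivative.
\<close>

lemma integral_partial_deriv_eq_0:
  fixes h :: "real ^ 'n::finite \<Rightarrow> real"
  assumes h: "C_on 1 UNIV h" and R: "\<And>x. h x \<noteq> 0 \<Longrightarrow> norm x \<le> R"
  shows "(\<integral>x. partial_deriv i h x \<partial>lborel) = 0"
proof -
  have d: "h differentiable (at x)" for x using h by simp
  have c: "continuous_on UNIV (partial_deriv i h)" using h by simp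
  have ch: "continuous_on UNIV h" using h by (rule C_on_imp_continuous)
  have Rd: "partial_deriv i h x \<noteq> 0 \<Longrightarrow> norm x \<le> R" for x
    using partial_deriv_zero_off_closed[of "cball 0 R" h x i] R by fastforce
  from continuous_bounded_support(2)[OF c Rd] obtain B where B: "B \<ge> 0" "\<And>x. \<bar>partial_deriv i h x\<bar> \<le> B" by blast
  define t where "t n = inverse (real (Suc n))" for n
  have t: "0 < t n" "t n \<le> 1" for n by (auto simp: t_def inverse_le_1_iff)
  have t0: "t \<longlonglongrightarrow> 0" unfolding t_def by (rule LIMSEQ_inverse_real_of_nat)
  define q where "q n x = (h (x + t n *\<^sub>R axis i 1) - h x) / t n" for n x
  have [measurable]: "h \<in> borel_measurable borel" "partial_deriv i h \<in> borel_measurable borel"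
    using c ch by (auto intro: borel_measurable_continuous_onI)
  have ih: "integrable lborel h" by (rule continuous_bounded_support[OF ch R])
  have q0: "(\<integral>x. q n x \<partial>lborel) = 0" for n
    unfolding q_def using ih
    by (simp add: lborel_integral_translate Bochner_Integration.integral_diff)
  have "(\<lambda>n. \<integral>x. q n x \<partial>lborel) \<longlonglongrightarrow> (\<integral>x. partial_deriv i h x \<partial>lborel)"
  proof (rule integral_dominated_convergence)
    show "partial_deriv i h \<in> borel_measurable lborel" "\<And>n. q n \<in> borel_measurable lborel"
      unfolding q_def by auto
    show "integrable lborel (\<lambda>x. B * indicator (cball 0 (R + 1)) x :: real)"
      by (intro integrable_mult_right integrable_real_indicator emeasure_compact_finite) auto
    show "AE x in lborel. (\<lambda>n. q n x) \<longlonglongrightarrow> partial_deriv i h x"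
    proof (rule AE_I2)
      fix x
      have "((\<lambda>s. h (x + s *\<^sub>R axis i 1)) has_real_derivative partial_deriv i h (x + 0 *\<^sub>R axis i 1)) (at 0)"
        by (intro differentiable_line d)
      then have "((\<lambda>s. (h (x + s *\<^sub>R axis i 1) - h x) / s) \<longlongrightarrow> partial_deriv i h x) (at 0)"
        by (simp add: DERIV_def)
      moreover have "filterlim t (at 0) sequentially"
        using t0 t(1) by (auto simp: filterlim_at less_imp_neq[symmetric] intro!: always_eventually)
      ultimately show "(\<lambda>n. q n x) \<longlonglongrightarrow> partial_deriv i h x"
        unfolding q_def by (rule filterlim_compose)
    qed
    show "AE x in lborel. norm (q n x) \<le> B * indicator (cball 0 (R + 1)) x" for n
    proof (rule AE_I2)
      fix x
      have "\<exists>s. 0 < s \<and> s < t n \<and> h (x + t n *\<^sub>R axis i 1) - h (x + 0 *\<^sub>R axis i 1) = (t n - 0) * partial_deriv i h (x + s *\<^sub>R axis i 1)"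
        by (rule MVT2[OF t(1) differentiable_line[OF d]])
      then obtain s where s: "0 < s" "s < t n" "q n x = partial_deriv i h (x + s *\<^sub>R axis i 1)"
        using t(1)[of n] by (auto simp: q_def)
      show "norm (q n x) \<le> B * indicator (cball 0 (R + 1)) x"
      proof (cases "q n x = 0")
        case True
        then show ?thesis using B by simp
      next
        case False
        then have "norm (x + s *\<^sub>R axis i 1) \<le> R" using s Rd by auto
        moreover have "norm (s *\<^sub>R axis i 1 :: real ^ 'n) \<le> 1" using s t(2)[of n] by simp
        ultimately have "norm x \<le> R + 1"
          using norm_triangle_ineq4[of "x + s *\<^sub>R axis i 1" "s *\<^sub>R axis i 1"] by simp
        then show ?thesis using B(2) s by simp
      qed
    qed
  qed
  then show ?thesis unfolding q0 by (simp add: LIMSEQ_const_iff)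
qed

lemma integration_by_parts_partial_deriv:
  fixes f g :: "real ^ 'n::finite \<Rightarrow> real"
  assumes f: "C_on 1 UNIV f" and g: "C_on 1 UNIV g" and R: "\<And>x. g x \<noteq> 0 \<Longrightarrow> norm x \<le> R"
  shows "(\<integral>x. f x * partial_deriv i g x \<partial>lborel) = - (\<integral>x. partial_deriv i f x * g x \<partial>lborel)"
proof -
  have d: "f differentiable (at x)" "g differentiable (at x)" for x using f g by auto
  have c: "continuous_on UNIV f" "continuous_on UNIV g" "continuous_on UNIV (partial_deriv i f)" "continuous_on UNIV (partial_deriv i g)"
    using C_on_imp_continuous[OF f] C_on_imp_continuous[OF g] f g by auto
  have Rd: "partial_deriv i g x \<noteq> 0 \<Longrightarrow> norm x \<le> R" for x
    using partial_deriv_zero_off_closed[of "cball 0 R" g x i] R by fastforce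
  have "(\<integral>x. partial_deriv i (\<lambda>x. f x * g x) x \<partial>lborel) = 0"
    by (rule integral_partial_deriv_eq_0[OF C_on_mult[OF f g], of R]) (use R in auto)
  moreover have "integrable lborel (\<lambda>x. f x * partial_deriv i g x)" "integrable lborel (\<lambda>x. partial_deriv i f x * g x)"
    by (rule continuous_bounded_support(1)[of _ R]; use R Rd c in \<open>auto intro!: continuous_intros\<close>)+
  ultimately show ?thesis by (simp add: partial_deriv_mult d)
qed

text \<open>
  The factor \<open>g\<close> has just as many derivatives as are moved, so that a smooth \<open>f\<close> can be paired with the
  \<open>C\<^sup>m\<close> fields that define the variation.
\<close>

lemma integration_by_parts_pds:
  fixes f g :: "real ^ 'n::finite \<Rightarrow> real"
  assumes f: "smooth_on UNIV f" and g: "C_on (length is) UNIV g" and R: "\<And>x. g x \<noteq> 0 \<Longrightarrow> norm x \<le> R"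
  shows "(\<integral>x. f x * pds is g x \<partial>lborel) = (-1) ^ length is * (\<integral>x. pds is f x * g x \<partial>lborel)"
  using f g
proof (induction "is" arbitrary: f)
  case (Cons i "is")
  have "C_on (Suc 0) UNIV (pds is g)" using Cons.prems(2) by (rule C_on_pds) simp
  moreover have "pds is g x \<noteq> 0 \<Longrightarrow> norm x \<le> R" for x
    using pds_zero_off_closed[of "cball 0 R" g x "is"] R by fastforce
  ultimately have "(\<integral>x. f x * partial_deriv i (pds is g) x \<partial>lborel) = - (\<integral>x. partial_deriv i f x * pds is g x \<partial>lborel)"
    using Cons.prems(1) by (intro integration_by_parts_partial_deriv) (auto simp: smooth_on_def simp del: C_on.simps)
  also have "(\<integral>x. partial_deriv i f x * pds is g x \<partial>lborel) = (-1) ^ length is * (\<integral>x. pds is (partial_deriv i f) x * g x \<partial>lborel)"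
    using Cons.prems by (intro Cons.IH smooth_on_partial_deriv) (auto intro: C_on_Suc_D simp del: C_on.simps)
  finally show ?case using Cons.prems by (simp add: partial_deriv_pds_commute)
qed simp

definition convol :: "(real ^ 'n::finite \<Rightarrow> real) \<Rightarrow> (real ^ 'n \<Rightarrow> real) \<Rightarrow> real ^ 'n \<Rightarrow> real" where
  "convol \<rho> f x = (\<integral>y. \<rho> (x - y) * f y \<partial>lborel)"

lemma integrable_bounded_mult:
  fixes f g :: "'a \<Rightarrow> real"
  assumes "integrable M f" "g \<in> borel_measurable M" "\<And>x. \<bar>g x\<bar> \<le> B"
  shows "integrable M (\<lambda>x. g x * f x)"
proof -
  have [measurable]: "f \<in> borel_measurable M" "g \<in> borel_measurable M" using assms by auto
  show ?thesis
  proof (rule Bochner_Integration.integrable_bound[of _ "\<lambda>x. B * f x"])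
    show "integrable M (\<lambda>x. B * f x)" using assms by simp
    show "AE x in M. norm (g x * f x) \<le> norm (B * f x)"
    proof (rule AE_I2)
      fix x
      have "\<bar>g x\<bar> \<le> \<bar>B\<bar>" using assms(3)[of x] by linarith
      then show "norm (g x * f x) \<le> norm (B * f x)" by (simp add: abs_mult mult_right_mono)
    qed
  qed measurable
qed

text \<open>
  The derivatives are uniformly continuous, so the first-order expansion has an error that is uniform
  in the base point.  This is what permits differentiation under the integral of a convolution.
\<close>

lemma uniform_differentiability:
  fixes \<rho> :: "real ^ 'n::finite \<Rightarrow> real"
  assumes \<rho>: "smooth_on UNIV \<rho>" and R: "\<And>x. \<rho> x \<noteq> 0 \<Longrightarrow> norm x \<le> R" and e: "e > 0"
  shows "\<exists>d>0. \<forall>z h. norm h < d \<longrightarrow> \<bar>\<rho> (z + h) - \<rho> z - (\<Sum>i\<in>UNIV. h $ i * partial_deriv i \<rho> z)\<bar> \<le> e * norm h"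
proof -
  have Rd: "partial_deriv i \<rho> x \<noteq> 0 \<Longrightarrow> norm x \<le> R" for i x
    using partial_deriv_zero_off_closed[of "cball 0 R" \<rho> x i] R by fastforce
  \<comment> \<open>Each of the \<open>CARD('n)\<close> terms of the expansion may contribute \<open>e' * norm h\<close>.\<close>
  define e' where "e' = e / real CARD('n)"
  have e': "e' > 0" using e by (simp add: e'_def)
  have "uniformly_continuous_on UNIV (partial_deriv i \<rho>)" for i
    by (rule continuous_bounded_support(3)[OF smooth_on_continuous[OF smooth_on_partial_deriv[OF \<rho>]] Rd])
  then have "\<exists>d>0. \<forall>x y. dist y x < d \<longrightarrow> dist (partial_deriv i \<rho> y) (partial_deriv i \<rho> x) < e'" for i
    using e' unfolding uniformly_continuous_on_def by (metis UNIV_I)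
  then obtain d where d: "\<And>i. d i > 0" "\<And>i x y. dist y x < d i \<Longrightarrow> dist (partial_deriv i \<rho> y) (partial_deriv i \<rho> x) < e'"
    by metis
  define D where "D = Min (range d)"
  have D: "D > 0" "\<And>i. D \<le> d i" using d by (auto simp: D_def)
  have "\<bar>\<rho> (z + h) - \<rho> z - (\<Sum>i\<in>UNIV. h $ i * partial_deriv i \<rho> z)\<bar> \<le> e * norm h" if h: "norm h < D" for z h
  proof -
    define S where "S = cball z (norm h)"
    define f' where "f' x h = (\<Sum>i\<in>UNIV. h $ i * partial_deriv i \<rho> x)" for x h
    have "norm (\<rho> (z + h) - \<rho> z - f' z ((z + h) - z)) \<le> norm ((z + h) - z) * e"
    proof (rule differentiable_bound_linearization)
      show "z + t *\<^sub>R (z + h - z) \<in> S" if "t \<in> {0..1}" for t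
        using that by (auto simp: S_def dist_norm mult_left_le_one_le)
      show "z \<in> S" by (simp add: S_def)
      show "(\<rho> has_derivative f' x) (at x within S)" if "x \<in> S" for x
        using has_derivative_partial_derivs[OF smooth_on_differentiable[OF \<rho>], of x]
        unfolding f'_def[abs_def] by (rule has_derivative_at_withinI)
      show "onorm (f' x - f' z) \<le> e" if "x \<in> S" for x
      proof (rule onorm_le)
        fix v :: "real ^ 'n"
        have "norm ((f' x - f' z) v) = \<bar>\<Sum>i\<in>UNIV. v $ i * (partial_deriv i \<rho> x - partial_deriv i \<rho> z)\<bar>"
          by (simp add: f'_def sum_subtractf algebra_simps)
        also have "\<dots> \<le> (\<Sum>i\<in>UNIV. \<bar>v $ i * (partial_deriv i \<rho> x - partial_deriv i \<rho> z)\<bar>)" by (rule sum_abs)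
        also have "\<dots> \<le> (\<Sum>i\<in>(UNIV :: 'n set). norm v * e')"
        proof (rule sum_mono)
          fix i
          have "dist x z < d i" using that h D(2)[of i] by (simp add: S_def dist_commute)
          from d(2)[OF this] show "\<bar>v $ i * (partial_deriv i \<rho> x - partial_deriv i \<rho> z)\<bar> \<le> norm v * e'"
            unfolding abs_mult by (intro mult_mono component_le_norm_cart) (auto simp: dist_real_def)
        qed
        also have "\<dots> = e * norm v" by (simp add: e'_def)
        finally show "norm ((f' x - f' z) v) \<le> e * norm v" .
      qed
    qed
    then show ?thesis by (simp add: f'_def mult.commute)
  qed
  with D(1) show ?thesis by blast
qed

lemma convol_has_derivative:
  fixes \<rho> f :: "real ^ 'n::finite \<Rightarrow> real"
  assumes \<rho>: "smooth_on UNIV \<rho>" and R: "\<And>x. \<rho> x \<noteq> 0 \<Longrightarrow> norm x \<le> R" and f: "integrable lborel f"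
  shows "(convol \<rho> f has_derivative (\<lambda>h. \<Sum>i\<in>UNIV. h $ i * convol (partial_deriv i \<rho>) f x)) (at x)"
proof -
  have Rd: "partial_deriv i \<rho> x \<noteq> 0 \<Longrightarrow> norm x \<le> R" for i x
    using partial_deriv_zero_off_closed[of "cball 0 R" \<rho> x i] R by fastforce
  have [measurable]: "f \<in> borel_measurable borel" using f by auto
  have int: "integrable lborel (\<lambda>y. g (x - y) * f y)"
    if g: "smooth_on UNIV g" "\<And>x. g x \<noteq> 0 \<Longrightarrow> norm x \<le> R" for g x
  proof -
    from continuous_bounded_support(2)[OF smooth_on_continuous[OF g(1)] g(2)]
    obtain B where "\<And>x. \<bar>g x\<bar> \<le> B" by blast
    moreover have [measurable]: "g \<in> borel_measurable borel" using g(1) by measurable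
    ultimately show ?thesis by (intro integrable_bounded_mult[OF f]) auto
  qed
  have i1: "integrable lborel (\<lambda>y. \<rho> (x - y) * f y)" for x by (rule int[OF \<rho> R])
  have i2: "integrable lborel (\<lambda>y. partial_deriv i \<rho> (x - y) * f y)" for x i
    by (rule int[OF smooth_on_partial_deriv[OF \<rho>] Rd])
  let ?L = "\<lambda>h. \<Sum>i\<in>UNIV. h $ i * convol (partial_deriv i \<rho>) f x"
  show ?thesis unfolding has_derivative_at_alt
  proof (intro conjI allI impI)
    show "bounded_linear ?L"
      by (intro bounded_linear_sum bounded_linear_mult_const bounded_linear_vec_nth)
    fix e :: real assume e: "e > 0"
    \<comment> \<open>The summand 1 keeps \<open>N\<close> positive for \<open>f = 0\<close>.\<close>
    define N where "N = (\<integral>y. \<bar>f y\<bar> \<partial>lborel) + 1"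
    have "(\<integral>y. \<bar>f y\<bar> \<partial>lborel) \<ge> 0" by simp
    then have N: "N > 0" unfolding N_def by linarith
    from uniform_differentiability[OF \<rho> R, of "e / N"] e N
    obtain d where d: "d > 0" "\<And>z h. norm h < d \<Longrightarrow> \<bar>\<rho> (z + h) - \<rho> z - (\<Sum>i\<in>UNIV. h $ i * partial_deriv i \<rho> z)\<bar> \<le> e / N * norm h"
      by auto
    have "norm (convol \<rho> f x' - convol \<rho> f x - ?L (x' - x)) \<le> e * norm (x' - x)" if x': "norm (x' - x) < d" for x'
    proof -
      define h where "h = x' - x"
      have hd: "norm h < d" using x' by (simp add: h_def)
      let ?k = "\<lambda>y. \<rho> (x - y + h) - \<rho> (x - y) - (\<Sum>i\<in>UNIV. h $ i * partial_deriv i \<rho> (x - y))"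
      have x'eq: "x' - y = x - y + h" for y by (simp add: h_def)
      have eq: "convol \<rho> f x' - convol \<rho> f x - ?L h = (\<integral>y. ?k y * f y \<partial>lborel)"
        using i1[of x'] i1[of x] i2[of _ x] unfolding convol_def x'eq
        by (simp add: left_diff_distrib sum_distrib_right Bochner_Integration.integral_sum mult.assoc)
      have "\<bar>convol \<rho> f x' - convol \<rho> f x - ?L h\<bar> \<le> (\<integral>y. \<bar>?k y * f y\<bar> \<partial>lborel)"
        unfolding eq by (rule integral_abs_bound)
      also have "\<dots> \<le> (\<integral>y. (e / N * norm h) * \<bar>f y\<bar> \<partial>lborel)"
      proof (rule integral_mono)
        have "integrable lborel (\<lambda>y. ?k y * f y)"
          using i1[of x'] i1[of x] i2[of _ x] unfolding x'eq
          by (simp add: left_diff_distrib sum_distrib_right mult.assoc)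
        then show "integrable lborel (\<lambda>y. \<bar>?k y * f y\<bar>)" by simp
        show "integrable lborel (\<lambda>y. (e / N * norm h) * \<bar>f y\<bar>)" using f by simp
        show "\<bar>?k y * f y\<bar> \<le> (e / N * norm h) * \<bar>f y\<bar>" for y
          unfolding abs_mult using d(2)[OF hd, of "x - y"] by (intro mult_right_mono) simp_all
      qed
      also have "\<dots> = (e / N * norm h) * (\<integral>y. \<bar>f y\<bar> \<partial>lborel)" by simp
      also have "\<dots> \<le> (e / N * norm h) * N"
        using e N by (intro mult_left_mono) (auto simp: N_def)
      also have "\<dots> = e * norm h" using N by simp
      finally show ?thesis by (simp add: h_def)
    qed
    then show "\<exists>d>0. \<forall>y. norm (y - x) < d \<longrightarrow> norm (convol \<rho> f y - convol \<rho> f x - ?L (y - x)) \<le> e * norm (y - x)"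
      using d(1) by blast
  qed
qed

lemma partial_deriv_convol:
  fixes \<rho> f :: "real ^ 'n::finite \<Rightarrow> real"
  assumes \<rho>: "smooth_on UNIV \<rho>" and R: "\<And>x. \<rho> x \<noteq> 0 \<Longrightarrow> norm x \<le> R" and f: "integrable lborel f"
  shows "convol \<rho> f differentiable (at x)"
    and "partial_deriv i (convol \<rho> f) = convol (partial_deriv i \<rho>) f"
proof -
  note D = convol_has_derivative[OF assms]
  show "convol \<rho> f differentiable (at x)" using D by (auto simp: differentiable_def)
  show "partial_deriv i (convol \<rho> f) = convol (partial_deriv i \<rho>) f"
    using partial_deriv_eqI[OF D, of i]
    by (simp add: fun_eq_iff axis_def if_distrib[of "\<lambda>x. x * _"] cong: if_cong)
qed

lemma pds_bounded_support:
  fixes f :: "real ^ 'n::finite \<Rightarrow> real"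
  assumes "\<And>x. f x \<noteq> 0 \<Longrightarrow> norm x \<le> R" "pds is f x \<noteq> 0"
  shows "norm x \<le> R"
  using pds_zero_off_closed[of "cball 0 R" f x "is"] assms by fastforce

lemma pds_convol:
  fixes \<rho> f :: "real ^ 'n::finite \<Rightarrow> real"
  assumes \<rho>: "smooth_on UNIV \<rho>" and R: "\<And>x. \<rho> x \<noteq> 0 \<Longrightarrow> norm x \<le> R" and f: "integrable lborel f"
  shows "pds is (convol \<rho> f) = convol (pds is \<rho>) f"
proof (induction "is")
  case (Cons i "is")
  then show ?case
    using partial_deriv_convol(2)[OF smooth_on_pds[OF \<rho>] pds_bounded_support[OF R] f] by simp
qed simp

lemma smooth_on_convol:
  fixes \<rho> f :: "real ^ 'n::finite \<Rightarrow> real"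
  assumes \<rho>: "smooth_on UNIV \<rho>" and R: "\<And>x. \<rho> x \<noteq> 0 \<Longrightarrow> norm x \<le> R" and f: "integrable lborel f"
  shows "smooth_on UNIV (convol \<rho> f)"
proof (rule smooth_onI_coinduct[where P="\<lambda>g. \<exists>\<rho>. smooth_on UNIV \<rho> \<and> (\<forall>x. \<rho> x \<noteq> 0 \<longrightarrow> norm x \<le> R) \<and> g = convol \<rho> f"])
  show "\<exists>\<rho>'. smooth_on UNIV \<rho>' \<and> (\<forall>x. \<rho>' x \<noteq> 0 \<longrightarrow> norm x \<le> R) \<and> convol \<rho> f = convol \<rho>' f"
    using \<rho> R by blast
  fix g :: "real ^ 'n \<Rightarrow> real" and i x
  assume "\<exists>\<rho>. smooth_on UNIV \<rho> \<and> (\<forall>x. \<rho> x \<noteq> 0 \<longrightarrow> norm x \<le> R) \<and> g = convol \<rho> f"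
  then obtain \<rho> where r: "smooth_on UNIV \<rho>" "\<And>x. \<rho> x \<noteq> 0 \<Longrightarrow> norm x \<le> R" "g = convol \<rho> f" by blast
  show "g differentiable (at x)" unfolding r(3) by (rule partial_deriv_convol(1)[OF r(1,2) f])
  show "\<exists>\<rho>. smooth_on UNIV \<rho> \<and> (\<forall>x. \<rho> x \<noteq> 0 \<longrightarrow> norm x \<le> R) \<and> partial_deriv i g = convol \<rho> f"
    using r partial_deriv_convol(2)[OF r(1,2) f] smooth_on_partial_deriv[OF r(1)] pds_bounded_support[of \<rho> R "[i]"]
    by (intro exI[of _ "partial_deriv i \<rho>"]) auto
qed

definition smooth_supported :: "(real ^ 'n::finite) set \<Rightarrow> (real ^ 'n \<Rightarrow> real) \<Rightarrow> bool" where
  "smooth_supported \<Omega> \<psi> \<longleftrightarrow> smooth_on UNIV \<psi> \<and> compact_support_in \<Omega> \<psi>"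

lemma compact_support_inI:
  assumes "compact K" "K \<subseteq> \<Omega>" "\<And>x. x \<notin> K \<Longrightarrow> f x = 0"
  shows "compact_support_in \<Omega> f"
proof -
  have "closure {x. f x \<noteq> 0} \<subseteq> K"
    using assms by (intro closure_minimal compact_imp_closed) auto
  moreover have "compact (K \<inter> closure {x. f x \<noteq> 0})"
    using assms(1) by (intro compact_Int_closed) auto
  ultimately show ?thesis
    using assms(2) by (auto simp: compact_support_in_def Int_absorb1)
qed

lemma compact_support_inE:
  assumes "compact_support_in \<Omega> f"
  obtains K where "compact K" "K \<subseteq> \<Omega>" "\<And>x. x \<notin> K \<Longrightarrow> f x = 0"
proof -
  have *: "f x = 0" if "x \<notin> closure {x. f x \<noteq> 0}" for x
    using that closure_subset[of "{x. f x \<noteq> 0}"] by auto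
  show thesis
    by (rule that[OF _ _ *]) (use assms in \<open>simp_all only: compact_support_in_def\<close>)
qed

lemma smooth_supported_support:
  "smooth_supported \<Omega> \<psi> \<Longrightarrow> \<exists>K. compact K \<and> K \<subseteq> \<Omega> \<and> (\<forall>x. x \<notin> K \<longrightarrow> \<psi> x = 0)"
  unfolding smooth_supported_def by (auto elim!: compact_support_inE)

lemma smooth_supported_outside: "smooth_supported \<Omega> \<psi> \<Longrightarrow> x \<notin> \<Omega> \<Longrightarrow> \<psi> x = 0"
  using smooth_supported_support[of \<Omega> \<psi>] by blast

lemma smooth_supportedI:
  "smooth_on UNIV \<psi> \<Longrightarrow> compact K \<Longrightarrow> K \<subseteq> \<Omega> \<Longrightarrow> (\<And>x. x \<notin> K \<Longrightarrow> \<psi> x = 0) \<Longrightarrow> smooth_supported \<Omega> \<psi>"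
  unfolding smooth_supported_def by (auto intro: compact_support_inI)

lemma smooth_supported_bounded:
  assumes "smooth_supported \<Omega> \<psi>"
  shows "\<exists>B\<ge>0. \<forall>x. \<bar>\<psi> x\<bar> \<le> B" and "\<psi> \<in> borel_measurable borel" and "\<exists>R. \<forall>x. \<psi> x \<noteq> 0 \<longrightarrow> norm x \<le> R"
proof -
  have s: "smooth_on UNIV \<psi>" using assms by (simp add: smooth_supported_def)
  obtain K where K: "compact K" "\<forall>x. x \<notin> K \<longrightarrow> \<psi> x = 0" using smooth_supported_support[OF assms] by blast
  obtain R where R: "\<And>x. x \<in> K \<Longrightarrow> norm x \<le> R"
    using compact_imp_bounded[OF K(1)] by (auto simp: bounded_iff)
  have R': "\<psi> x \<noteq> 0 \<Longrightarrow> norm x \<le> R" for x using R K(2) by blast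
  then show "\<exists>R. \<forall>x. \<psi> x \<noteq> 0 \<longrightarrow> norm x \<le> R" by blast
  show "\<exists>B\<ge>0. \<forall>x. \<bar>\<psi> x\<bar> \<le> B"
    by (rule continuous_bounded_support(2)[OF smooth_on_continuous[OF s] R'])
  show "\<psi> \<in> borel_measurable borel" using s by measurable
qed

lemma smooth_supported_pds:
  assumes "smooth_supported \<Omega> \<psi>"
  shows "smooth_supported \<Omega> (pds is \<psi>)"
proof -
  obtain K where K: "compact K" "K \<subseteq> \<Omega>" "\<forall>x. x \<notin> K \<longrightarrow> \<psi> x = 0" using smooth_supported_support[OF assms] by blast
  have "pds is \<psi> x = 0" if "x \<notin> K" for x
    using pds_zero_off_closed[of K \<psi> x "is"] compact_imp_closed[OF K(1)] K(3) that by blast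
  then show ?thesis
    using assms smooth_on_pds[of \<psi>] K(1,2) by (intro smooth_supportedI[of _ K]) (auto simp: smooth_supported_def)
qed

text \<open>
  The indicator function of a neighbourhood of \<open>K\<close> is mollified.
\<close>

lemma smooth_cutoff_exists:
  fixes K U :: "(real ^ 'n::finite) set"
  assumes K: "compact K" and U: "open U" "K \<subseteq> U"
  shows "\<exists>\<psi>. smooth_supported U \<psi> \<and> (\<forall>x. 0 \<le> \<psi> x \<and> \<psi> x \<le> 1) \<and> (\<forall>x\<in>K. \<psi> x = 1)"
proof -
  from compact_subset_open_imp_ball_epsilon_subset[OF K U]
  obtain e where e: "e > 0" "(\<Union>x\<in>K. ball x e) \<subseteq> U" .
  \<comment> \<open>Enlarging \<open>K\<close> by \<open>d\<close> and mollifying at scale \<open>d\<close> uses up only \<open>2 * d < e\<close>.\<close>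
  define d where "d = e / 3"
  have d: "d > 0" using e by (simp add: d_def)
  define Kd where "Kd r = {x + y | x y. x \<in> K \<and> y \<in> cball 0 r}" for r
  have Kd: "compact (Kd r)" for r unfolding Kd_def by (intro compact_sums K) auto
  obtain \<rho> where \<rho>: "mollifier (0 :: real ^ 'n) d \<rho>" using mollifier_exists[OF d] by blast
  note r = mollifierD[OF \<rho>]
  have [measurable]: "Kd r \<in> sets borel" for r using Kd[of r] by (simp add: borel_compact)
  have f: "integrable lborel (indicator (Kd d) :: _ \<Rightarrow> real)"
    using Kd[of d] by (intro integrable_real_indicator emeasure_compact_finite) auto
  define \<psi> where "\<psi> = convol \<rho> (indicator (Kd d))"
  have 1: "smooth_on UNIV \<psi>" unfolding \<psi>_def by (rule smooth_on_convol[OF r(1) r(4) f])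
  have m: "\<rho> (x - y) * indicator (Kd d) y \<le> \<rho> (x - y)" for x y
    using r(2)[of "x - y"] by (auto simp: indicator_def)
  have int: "integrable lborel (\<lambda>y. \<rho> (x - y) * indicator (Kd d) y)" for x
    using integrable_bounded_mult[OF r(9)[of x], of "indicator (Kd d)" 1]
    by (simp add: mult.commute indicator_def)
  have 2: "0 \<le> \<psi> x \<and> \<psi> x \<le> 1" for x
    unfolding \<psi>_def convol_def using r(2) m integral_mono[OF int r(9), of x x] r(8)[of x] by auto
  have "\<psi> x = 1" if "x \<in> K" for x
  proof -
    have "\<rho> (x - y) * indicator (Kd d) y = \<rho> (x - y)" for y
    proof (cases "\<rho> (x - y) = 0")
      case False
      then have "x - y \<in> cball 0 d" by (rule r(3))
      then have "y = x + (y - x)" "y - x \<in> cball 0 d" by (auto simp: norm_minus_commute)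
      then have "y \<in> Kd d" using that unfolding Kd_def by blast
      then show ?thesis by simp
    qed simp
    then show ?thesis by (simp only: \<psi>_def convol_def r(8))
  qed
  moreover have "compact_support_in U \<psi>"
  proof (rule compact_support_inI[OF Kd[of "2 * d"]])
    show "Kd (2 * d) \<subseteq> U"
    proof
      fix z assume "z \<in> Kd (2 * d)"
      then obtain x y where "z = x + y" "x \<in> K" "norm y \<le> 2 * d" by (auto simp: Kd_def)
      then have "z \<in> (\<Union>x\<in>K. ball x e)" using e(1) by (auto simp: d_def dist_norm intro!: bexI[of _ x])
      then show "z \<in> U" using e(2) by blast
    qed
    show "\<psi> x = 0" if x: "x \<notin> Kd (2 * d)" for x
    proof -
      have "\<rho> (x - y) * indicator (Kd d) y = 0" for y
      proof (rule ccontr)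
        assume "\<not> ?thesis"
        then have "\<rho> (x - y) \<noteq> 0" "y \<in> Kd d" by (auto simp: indicator_def)
        then obtain a b where ab: "y = a + b" "a \<in> K" "norm b \<le> d" "norm (x - y) \<le> d"
          using r(3)[of "x - y"] by (auto simp: Kd_def)
        then have "x = a + (b + (x - y))" "norm (b + (x - y)) \<le> 2 * d"
          using norm_triangle_ineq[of b "x - y"] by auto
        with x ab(2) show False unfolding Kd_def by auto
      qed
      then show ?thesis by (simp only: \<psi>_def convol_def) simp
    qed
  qed
  ultimately show ?thesis using 1 2 by (auto simp: smooth_supported_def)
qed

section \<open>Density of test functions and duality\<close>

lemma L2_set_measurable [measurable]:
  "(\<And>i. i \<in> I \<Longrightarrow> (\<lambda>x. f i x) \<in> borel_measurable M) \<Longrightarrow> (\<lambda>x. L2_set (\<lambda>i. f i x) I) \<in> borel_measurable M"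
  unfolding L2_set_def by measurable

lemma integrable_L2_set:
  fixes f :: "'i \<Rightarrow> 'a \<Rightarrow> real"
  assumes "\<And>i. i \<in> I \<Longrightarrow> integrable M (f i)"
  shows "integrable M (\<lambda>x. L2_set (\<lambda>i. f i x) I)"
proof (rule Bochner_Integration.integrable_bound)
  show "integrable M (\<lambda>x. \<Sum>i\<in>I. \<bar>f i x\<bar>)" using assms by simp
  show "AE x in M. norm (L2_set (\<lambda>i. f i x) I) \<le> norm (\<Sum>i\<in>I. \<bar>f i x\<bar>)"
    using L2_set_le_sum_abs by (intro AE_I2) (simp add: sum_nonneg)
qed (use assms in measurable)

lemma sum_mult_le_L2_set: "(\<Sum>i\<in>I. f i * g i) \<le> L2_set f I * L2_set g I"
proof -
  have "(\<Sum>i\<in>I. f i * g i) \<le> (\<Sum>i\<in>I. \<bar>f i\<bar> * \<bar>g i\<bar>)"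
    by (intro sum_mono) (simp add: abs_mult[symmetric])
  then show ?thesis using L2_set_mult_ineq[of f g I] by linarith
qed

lemma sum_self_mult_L2_set: "finite I \<Longrightarrow> (\<Sum>i\<in>I. f i * f i) = (L2_set f I)\<^sup>2"
  by (simp add: L2_set_def sum_nonneg power2_eq_square)

lemma L2_set_integral_le:
  fixes f :: "'i \<Rightarrow> 'a \<Rightarrow> real"
  assumes I: "finite I" and f: "\<And>i. i \<in> I \<Longrightarrow> integrable M (f i)"
  shows "L2_set (\<lambda>i. \<integral>x. f i x \<partial>M) I \<le> (\<integral>x. L2_set (\<lambda>i. f i x) I \<partial>M)"
proof -
  define v where "v i = (\<integral>x. f i x \<partial>M)" for i
  have "(L2_set v I)\<^sup>2 = (\<Sum>i\<in>I. v i * (\<integral>x. f i x \<partial>M))"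
    by (simp add: sum_self_mult_L2_set[OF I, symmetric] v_def)
  also have "\<dots> = (\<integral>x. (\<Sum>i\<in>I. v i * f i x) \<partial>M)"
    using f by (simp add: Bochner_Integration.integral_sum)
  also have "\<dots> \<le> (\<integral>x. L2_set v I * L2_set (\<lambda>i. f i x) I \<partial>M)"
    using f by (intro integral_mono sum_mult_le_L2_set) (auto intro!: integrable_L2_set)
  also have "\<dots> = L2_set v I * (\<integral>x. L2_set (\<lambda>i. f i x) I \<partial>M)" by simp
  finally have *: "L2_set v I * L2_set v I \<le> L2_set v I * (\<integral>x. L2_set (\<lambda>i. f i x) I \<partial>M)"
    by (simp add: power2_eq_square)
  show ?thesis
  proof (cases "L2_set v I = 0")
    case True
    then show ?thesis unfolding v_def by simp
  next
    case False
    then have "L2_set v I > 0" using L2_set_nonneg[of v I] by linarith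
    with * show ?thesis unfolding v_def by simp
  qed
qed

text \<open>
  Finite measures on \<open>\<Omega>\<close> are represented by measures on the whole space for which the complement
  of \<open>\<Omega>\<close> is null, so that they integrate total functions.
\<close>

locale finite_borel_on = finite_measure \<sigma> for \<sigma> :: "(real ^ 'n::finite) measure" +
  fixes \<Omega> :: "(real ^ 'n) set"
  assumes sets_eq [measurable_cong]: "sets \<sigma> = sets borel"
    and open_domain: "open \<Omega>"
    and null_outside: "emeasure \<sigma> (- \<Omega>) = 0"
begin

lemma space_eq [simp]: "space \<sigma> = UNIV"
  using sets_eq_imp_space_eq[OF sets_eq] by simp

lemma AE_in_domain: "AE x in \<sigma>. x \<in> \<Omega>"
proof (rule AE_I[OF _ null_outside])
  show "- \<Omega> \<in> sets \<sigma>" using open_domain by (simp add: sets_eq)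
qed auto

lemma bounded_integrable:
  fixes f :: "real ^ 'n \<Rightarrow> real"
  assumes "f \<in> borel_measurable borel" "\<And>x. \<bar>f x\<bar> \<le> B"
  shows "integrable \<sigma> f"
  using assms by (intro integrable_const_bound[where B=B]) auto

lemma smooth_supported_integrable:
  assumes "smooth_supported \<Omega>' \<psi>"
  shows "integrable \<sigma> \<psi>"
  using smooth_supported_bounded(1,2)[OF assms] bounded_integrable by blast

text \<open>
  By regularity of \<open>\<sigma>\<close> there are a compact \<open>K\<close> and an open \<open>V\<close> with \<open>K \<subseteq> A \<inter> \<Omega> \<subseteq> V\<close>
  that differ by less than \<open>e\<close> in measure; a cutoff that is 1 on \<open>K\<close> and 0 off \<open>V\<close> is close to the
  indicator function of \<open>A\<close>.
\<close>

lemma test_function_dense_indicator: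
  assumes A: "A \<in> sets borel" and e: "e > 0"
  shows "\<exists>\<psi>. smooth_supported \<Omega> \<psi> \<and> (\<integral>x. \<bar>indicator A x - \<psi> x\<bar> \<partial>\<sigma>) < e"
proof -
  define E where "E = A \<inter> \<Omega>"
  have E: "E \<in> sets borel" using A open_domain by (simp add: E_def)
  have fin: "emeasure \<sigma> (space \<sigma>) \<noteq> \<infinity>" by simp
  have "\<exists>K. K \<subseteq> E \<and> compact K \<and> measure \<sigma> K > measure \<sigma> E - e / 2"
  proof (cases "measure \<sigma> E - e / 2 < 0")
    case True
    then show ?thesis by (intro exI[of _ "{}"]) auto
  next
    case False
    have "ennreal (measure \<sigma> E - e / 2) < emeasure \<sigma> E"
      using e False by (simp add: emeasure_eq_measure ennreal_less_iff)
    also have "emeasure \<sigma> E = (SUP K \<in> {K. K \<subseteq> E \<and> compact K}. emeasure \<sigma> K)"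
      by (rule inner_regular[OF sets_eq fin E])
    finally show ?thesis
      using False by (auto simp: less_SUP_iff emeasure_eq_measure ennreal_less_iff)
  qed
  then obtain K where K: "K \<subseteq> E" "compact K" "measure \<sigma> K > measure \<sigma> E - e / 2" by blast
  have "emeasure \<sigma> E < ennreal (measure \<sigma> E + e / 2)"
    using e by (simp add: emeasure_eq_measure ennreal_less_iff)
  then have "(INF U \<in> {U. E \<subseteq> U \<and> open U}. emeasure \<sigma> U) < ennreal (measure \<sigma> E + e / 2)"
    by (subst outer_regular[OF sets_eq fin E, symmetric])
  then obtain U where U: "E \<subseteq> U" "open U" "measure \<sigma> U < measure \<sigma> E + e / 2"
    by (auto simp: INF_less_iff emeasure_eq_measure ennreal_less_iff)
  define V where "V = U \<inter> \<Omega>"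
  have V: "open V" "K \<subseteq> V" "V \<subseteq> \<Omega>" using U K(1) open_domain by (auto simp: V_def E_def)
  have "measure \<sigma> V \<le> measure \<sigma> U"
    using U(2) V(1) by (intro finite_measure_mono) (auto simp: V_def sets_eq)
  with U K have VK: "measure \<sigma> V - measure \<sigma> K < e" by linarith
  obtain \<psi> where p: "smooth_supported V \<psi>" "\<And>x. 0 \<le> \<psi> x \<and> \<psi> x \<le> 1" "\<And>x. x \<in> K \<Longrightarrow> \<psi> x = 1"
    using smooth_cutoff_exists[OF K(2) V(1,2)] by blast
  have s: "smooth_supported \<Omega> \<psi>"
    using p(1) V(3) by (auto simp: smooth_supported_def compact_support_in_def)
  have p0: "\<psi> x = 0" if "x \<notin> V" for x
    using smooth_supported_outside[OF p(1) that] .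
  have [measurable]: "\<psi> \<in> borel_measurable borel" "K \<in> sets borel" "V \<in> sets borel"
    using smooth_supported_bounded(2)[OF s] K V by (auto intro: borel_compact)
  have "(\<integral>x. \<bar>indicator A x - \<psi> x\<bar> \<partial>\<sigma>) \<le> (\<integral>x. indicator (V - K) x \<partial>\<sigma>)"
  proof (rule integral_mono_AE)
    show "integrable \<sigma> (\<lambda>x. \<bar>indicator A x - \<psi> x\<bar>)"
    proof (rule bounded_integrable[where B=2])
      show "\<bar>\<bar>indicator A x - \<psi> x\<bar>\<bar> \<le> 2" for x
        using p(2)[of x] by (auto simp: indicator_def)
    qed (use A in measurable)
    show "integrable \<sigma> (indicator (V - K) :: _ \<Rightarrow> real)"
      by (intro integrable_real_indicator) (auto simp: sets_eq less_top[symmetric])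
    show "AE x in \<sigma>. \<bar>indicator A x - \<psi> x\<bar> \<le> indicator (V - K) x"
      using AE_in_domain
    proof (rule eventually_mono)
      fix x assume x: "x \<in> \<Omega>"
      show "\<bar>indicator A x - \<psi> x\<bar> \<le> indicator (V - K) x"
      proof (cases "x \<in> K")
        case True
        then show ?thesis using p(3) K(1) by (auto simp: E_def)
      next
        case False
        show ?thesis
        proof (cases "x \<in> V")
          case True
          then show ?thesis using False p(2)[of x] by (auto simp: indicator_def)
        next
          case False
          then have "x \<notin> A" using x U(1) by (auto simp: E_def V_def)
          then show ?thesis using p0[OF False] by simp
        qed
      qed
    qed
  qed
  also have "\<dots> = measure \<sigma> V - measure \<sigma> K"
    using V(2) by (simp add: finite_measure_Diff sets_eq)
  finally show ?thesis using VK s by auto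
qed

lemma test_function_dense:
  assumes f: "integrable \<sigma> f" and e: "e > 0"
  shows "\<exists>\<psi>. smooth_supported \<Omega> \<psi> \<and> (\<integral>x. \<bar>f x - \<psi> x\<bar> \<partial>\<sigma>) < e"
  using f e
proof (induction f arbitrary: e rule: integrable_induct)
  case (base A c)
  define e' where "e' = e / (\<bar>c\<bar> + 1)"
  have "e' > 0" using base by (simp add: e'_def)
  then obtain \<psi> where p: "smooth_supported \<Omega> \<psi>" "(\<integral>x. \<bar>indicator A x - \<psi> x\<bar> \<partial>\<sigma>) < e'"
    using test_function_dense_indicator[of A] base by (auto simp: sets_eq)
  have "\<bar>indicator A x *\<^sub>R c - c * \<psi> x\<bar> = \<bar>c\<bar> * \<bar>indicator A x - \<psi> x\<bar>" for x
    by (simp add: abs_mult[symmetric] algebra_simps)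
  then have "(\<integral>x. \<bar>indicator A x *\<^sub>R c - c * \<psi> x\<bar> \<partial>\<sigma>) = \<bar>c\<bar> * (\<integral>x. \<bar>indicator A x - \<psi> x\<bar> \<partial>\<sigma>)"
    by simp
  also have "\<dots> \<le> \<bar>c\<bar> * e'" using p by (intro mult_left_mono) auto
  also have "\<dots> < (\<bar>c\<bar> + 1) * e'" using \<open>e' > 0\<close> by simp
  also have "\<dots> = e" by (simp add: e'_def)
  finally have "(\<integral>x. \<bar>indicator A x *\<^sub>R c - c * \<psi> x\<bar> \<partial>\<sigma>) < e" .
  moreover have "smooth_supported \<Omega> (\<lambda>x. c * \<psi> x)"
  proof -
    obtain K where "compact K" "K \<subseteq> \<Omega>" "\<forall>x. x \<notin> K \<longrightarrow> \<psi> x = 0" using smooth_supported_support[OF p(1)] by blast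
    then show ?thesis
      using p(1) by (intro smooth_supportedI[of _ K] smooth_on_cmult) (auto simp: smooth_supported_def)
  qed
  ultimately show ?case by blast
next
  case (add f g)
  then obtain \<psi> \<eta> where p: "smooth_supported \<Omega> \<psi>" "(\<integral>x. \<bar>f x - \<psi> x\<bar> \<partial>\<sigma>) < e / 2"
    and q: "smooth_supported \<Omega> \<eta>" "(\<integral>x. \<bar>g x - \<eta> x\<bar> \<partial>\<sigma>) < e / 2"
    using add.IH(1)[of "e / 2"] add.IH(2)[of "e / 2"] by auto
  note ip = smooth_supported_integrable[OF p(1)] and iq = smooth_supported_integrable[OF q(1)]
  have "(\<integral>x. \<bar>f x + g x - (\<psi> x + \<eta> x)\<bar> \<partial>\<sigma>) \<le> (\<integral>x. \<bar>f x - \<psi> x\<bar> + \<bar>g x - \<eta> x\<bar> \<partial>\<sigma>)"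
    using ip iq add.hyps by (intro integral_mono) auto
  also have "\<dots> < e" using p q ip iq add.hyps by simp
  finally have "(\<integral>x. \<bar>f x + g x - (\<psi> x + \<eta> x)\<bar> \<partial>\<sigma>) < e" .
  moreover have "smooth_supported \<Omega> (\<lambda>x. \<psi> x + \<eta> x)"
  proof -
    obtain K where K: "compact K" "K \<subseteq> \<Omega>" "\<forall>x. x \<notin> K \<longrightarrow> \<psi> x = 0" using smooth_supported_support[OF p(1)] by blast
    obtain L where L: "compact L" "L \<subseteq> \<Omega>" "\<forall>x. x \<notin> L \<longrightarrow> \<eta> x = 0" using smooth_supported_support[OF q(1)] by blast
    show ?thesis
      using p(1) q(1) K L
      by (intro smooth_supportedI[of _ "K \<union> L"] smooth_on_add) (auto simp: smooth_supported_def)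
  qed
  ultimately show ?case by blast
next
  case (lim f s)
  have "(\<lambda>i. \<integral>x. \<bar>f x - s i x\<bar> \<partial>\<sigma>) \<longlonglongrightarrow> (\<integral>x. 0 \<partial>\<sigma>)"
  proof (rule integral_dominated_convergence[where w="\<lambda>x. 3 * \<bar>f x\<bar>"])
    show "AE x in \<sigma>. (\<lambda>i. \<bar>f x - s i x\<bar>) \<longlonglongrightarrow> 0"
    proof (rule AE_I2)
      fix x assume "x \<in> space \<sigma>"
      then have "(\<lambda>i. \<bar>f x - s i x\<bar>) \<longlonglongrightarrow> \<bar>f x - f x\<bar>"
        by (intro tendsto_intros lim)
      then show "(\<lambda>i. \<bar>f x - s i x\<bar>) \<longlonglongrightarrow> 0" by simp
    qed
    show "AE x in \<sigma>. norm \<bar>f x - s i x\<bar> \<le> 3 * \<bar>f x\<bar>" for i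
    proof (rule AE_I2)
      fix x assume "x \<in> space \<sigma>"
      then have "norm (s i x) \<le> 2 * norm (f x)" by (rule lim)
      then show "norm \<bar>f x - s i x\<bar> \<le> 3 * \<bar>f x\<bar>" by simp
    qed
  qed (use lim in auto)
  then have "eventually (\<lambda>i. (\<integral>x. \<bar>f x - s i x\<bar> \<partial>\<sigma>) < e / 2) sequentially"
    using lim.prems by (intro order_tendstoD(2)) auto
  then obtain i where i: "(\<integral>x. \<bar>f x - s i x\<bar> \<partial>\<sigma>) < e / 2"
    by (auto simp: eventually_sequentially)
  obtain \<psi> where p: "smooth_supported \<Omega> \<psi>" "(\<integral>x. \<bar>s i x - \<psi> x\<bar> \<partial>\<sigma>) < e / 2"
    using lim.IH[of "e / 2" i] lim.prems by auto
  note ip = smooth_supported_integrable[OF p(1)]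
  have "(\<integral>x. \<bar>f x - \<psi> x\<bar> \<partial>\<sigma>) \<le> (\<integral>x. \<bar>f x - s i x\<bar> + \<bar>s i x - \<psi> x\<bar> \<partial>\<sigma>)"
    using ip lim.hyps by (intro integral_mono) auto
  also have "\<dots> < e" using i p ip lim.hyps by simp
  finally show ?case using p by blast
qed

lemma smooth_on_inverse_sqrt:
  fixes p :: "real ^ 'n \<Rightarrow> real"
  assumes p: "smooth_on UNIV p" "\<And>x. p x \<ge> 0"
  shows "smooth_on UNIV (\<lambda>x. 1 / sqrt (1 + p x))"
proof -
  \<comment> \<open>The \<open>j\<close>-th derivative of \<open>(1 + t) powr (- 1 / 2)\<close>.\<close>
  define H where "H j t = (\<Prod>l<j. - 1 / 2 - real l) * (1 + t) powr (- 1 / 2 - real j)" for j t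
  have "(H j has_real_derivative H (Suc j) (p x)) (at (p x))" for j x
    unfolding H_def using p(2)[of x]
    by (auto intro!: derivative_eq_intros)
  from smooth_on_compose[of H, OF this p(1), of 0]
  show ?thesis
    using p(2) by (simp add: H_def powr_half_sqrt[symmetric] powr_minus_divide add_nonneg_nonneg)
qed

text \<open>
  Duality: the \<open>L\<^sup>1\<close> norm of a vector field \<open>F\<close> is attained by pairing with \<open>F / \<bar>F\<bar>\<close>.  This unit
  field is approximated by \<open>l \<psi> / sqrt (1 + l\<^sup>2 \<bar>\<psi>\<bar>\<^sup>2)\<close>, where \<open>\<psi>\<close> is a test field close to \<open>F\<close> and
  \<open>l\<close> is large: the quotient stays smooth and in the unit ball.
\<close>

lemma dual_test_field:
  assumes I: "finite I" and F: "\<And>i. i \<in> I \<Longrightarrow> integrable \<sigma> (F i)" and e: "e > 0"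
  shows "\<exists>g. (\<forall>i\<in>I. smooth_supported \<Omega> (g i)) \<and> (\<forall>x. L2_set (\<lambda>i. g i x) I \<le> 1) \<and>
     (\<integral>x. L2_set (\<lambda>i. F i x) I \<partial>\<sigma>) - e < (\<Sum>i\<in>I. \<integral>x. g i x * F i x \<partial>\<sigma>)"
proof -
  define N where "N x = L2_set (\<lambda>i. F i x) I" for x
  have [measurable]: "i \<in> I \<Longrightarrow> F i \<in> borel_measurable \<sigma>" for i using F by auto
  have iN: "integrable \<sigma> N" unfolding N_def using F by (intro integrable_L2_set) auto
  have N0: "N x \<ge> 0" for x by (simp add: N_def)
  have [measurable]: "N \<in> borel_measurable \<sigma>" using iN by auto
  \<comment> \<open>\<open>A l\<close> is the pairing of \<open>F\<close> with \<open>l F / sqrt (1 + l\<^sup>2 \<bar>F\<bar>\<^sup>2)\<close>; it increases to the norm of \<open>F\<close> as \<open>l\<close> grows.\<close>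
  define A where "A l x = l * (N x)\<^sup>2 / sqrt (1 + l\<^sup>2 * (N x)\<^sup>2)" for l x
  have A_le: "\<bar>A l x\<bar> \<le> N x" if "l \<ge> 0" for l x
  proof -
    have "l * N x \<le> sqrt (1 + l\<^sup>2 * (N x)\<^sup>2)"
      by (rule real_le_rsqrt) (simp add: power_mult_distrib)
    then have "N x * (l * N x) \<le> N x * sqrt (1 + l\<^sup>2 * (N x)\<^sup>2)"
      by (intro mult_left_mono N0)
    moreover have "sqrt (1 + l\<^sup>2 * (N x)\<^sup>2) > 0" by (simp add: add_pos_nonneg)
    ultimately show ?thesis
      using that N0[of x] by (simp add: A_def power2_eq_square divide_le_eq mult.left_commute)
  qed
  have "(\<lambda>k. \<integral>x. A (real k) x \<partial>\<sigma>) \<longlonglongrightarrow> (\<integral>x. N x \<partial>\<sigma>)"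
  proof (rule integral_dominated_convergence[where w=N])
    show "AE x in \<sigma>. (\<lambda>k. A (real k) x) \<longlonglongrightarrow> N x"
    proof (rule AE_I2)
      fix x
      show "(\<lambda>k. A (real k) x) \<longlonglongrightarrow> N x"
      proof (cases "N x = 0")
        case True
        then show ?thesis by (simp add: A_def)
      next
        case False
        then have np: "N x > 0" using N0[of x] by linarith
        have "(\<lambda>k. (N x)\<^sup>2 / sqrt ((1 / real k)\<^sup>2 + (N x)\<^sup>2)) \<longlonglongrightarrow> (N x)\<^sup>2 / sqrt (0\<^sup>2 + (N x)\<^sup>2)"
          using np by (intro tendsto_intros lim_1_over_n) auto
        moreover have "eventually (\<lambda>k. (N x)\<^sup>2 / sqrt ((1 / real k)\<^sup>2 + (N x)\<^sup>2) = A (real k) x) sequentially"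
          using eventually_gt_at_top[of 0]
        proof (rule eventually_mono)
          fix k :: nat assume k: "0 < k"
          have "1 + (real k)\<^sup>2 * (N x)\<^sup>2 = (real k)\<^sup>2 * ((1 / real k)\<^sup>2 + (N x)\<^sup>2)"
            using k by (simp add: field_simps)
          then have "sqrt (1 + (real k)\<^sup>2 * (N x)\<^sup>2) = real k * sqrt ((1 / real k)\<^sup>2 + (N x)\<^sup>2)"
            by (simp add: real_sqrt_mult)
          then show "(N x)\<^sup>2 / sqrt ((1 / real k)\<^sup>2 + (N x)\<^sup>2) = A (real k) x"
            using k by (simp add: A_def)
        qed
        moreover have "(N x)\<^sup>2 / sqrt (0\<^sup>2 + (N x)\<^sup>2) = N x"
          using np by (simp add: power2_eq_square)
        ultimately show ?thesis using Lim_transform_eventually by fastforce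
      qed
    qed
    show "AE x in \<sigma>. norm (A (real k) x) \<le> N x" for k
      using A_le by (intro AE_I2) simp
    show "(\<lambda>x. A (real k) x) \<in> borel_measurable \<sigma>" for k unfolding A_def by measurable
  qed (use iN in auto)
  then have "eventually (\<lambda>k. (\<integral>x. A (real k) x \<partial>\<sigma>) > (\<integral>x. N x \<partial>\<sigma>) - e) sequentially"
    using e by (intro order_tendstoD(1)) auto
  then obtain l0 :: nat where l0: "(\<integral>x. A (real l0) x \<partial>\<sigma>) > (\<integral>x. N x \<partial>\<sigma>) - e"
    by (auto simp: eventually_sequentially)
  define l where "l = real l0"
  \<comment> \<open>With \<open>l\<close> fixed, convergence of \<open>\<psi>\<close> to \<open>F\<close> in \<open>L\<^sup>1\<close> suffices: the quotients are bounded by 1 and converge almost everywhere along a subsequence.\<close>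
  have "\<forall>k i. \<exists>\<psi>. i \<in> I \<longrightarrow> smooth_supported \<Omega> \<psi> \<and> (\<integral>x. \<bar>F i x - \<psi> x\<bar> \<partial>\<sigma>) < inverse (real (Suc k))"
    using test_function_dense[OF F] by (metis inverse_positive_iff_positive of_nat_0_less_iff zero_less_Suc)
  then obtain \<psi> where p: "\<And>k i. i \<in> I \<Longrightarrow> smooth_supported \<Omega> (\<psi> k i)"
    "\<And>k i. i \<in> I \<Longrightarrow> (\<integral>x. \<bar>F i x - \<psi> k i x\<bar> \<partial>\<sigma>) < inverse (real (Suc k))" by metis
  have ip: "i \<in> I \<Longrightarrow> integrable \<sigma> (\<psi> k i)" for i k using p smooth_supported_integrable by blast
  have [measurable]: "i \<in> I \<Longrightarrow> \<psi> k i \<in> borel_measurable \<sigma>" for i k using ip by auto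
  define U where "U k x = (\<Sum>i\<in>I. \<bar>F i x - \<psi> k i x\<bar>)" for k x
  have iU: "integrable \<sigma> (U k)" for k unfolding U_def using ip F by auto
  have "(\<lambda>k. \<integral>x. norm (U k x) \<partial>\<sigma>) \<longlonglongrightarrow> 0"
  proof (rule tendsto_sandwich[OF _ _ tendsto_const])
    have "(\<integral>x. norm (U k x) \<partial>\<sigma>) \<le> real (card I) * inverse (real (Suc k))" for k
    proof -
      have "(\<integral>x. norm (U k x) \<partial>\<sigma>) = (\<Sum>i\<in>I. \<integral>x. \<bar>F i x - \<psi> k i x\<bar> \<partial>\<sigma>)"
        unfolding U_def using ip F by (simp add: sum_nonneg Bochner_Integration.integral_sum)
      also have "\<dots> \<le> (\<Sum>i\<in>I. inverse (real (Suc k)))" using p by (intro sum_mono) (auto intro: less_imp_le)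
      finally show ?thesis by simp
    qed
    then show "\<forall>\<^sub>F k in sequentially. (\<integral>x. norm (U k x) \<partial>\<sigma>) \<le> real (card I) * inverse (real (Suc k))" by simp
    show "(\<lambda>k. real (card I) * inverse (real (Suc k))) \<longlonglongrightarrow> 0"
      by (rule tendsto_mult_right_zero[OF LIMSEQ_inverse_real_of_nat])
  qed simp
  then obtain r where r: "AE x in \<sigma>. (\<lambda>k. U (r k) x) \<longlonglongrightarrow> 0"
    using tendsto_L1_AE_subseq[of \<sigma> U] iU by blast
  define P where "P k x = (\<Sum>i\<in>I. (\<psi> (r k) i x)\<^sup>2)" for k x
  have P0: "P k x \<ge> 0" for k x by (simp add: P_def sum_nonneg)
  define g where "g k i x = l * \<psi> (r k) i x * (1 / sqrt (1 + l\<^sup>2 * P k x))" for k i x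
  have [measurable]: "i \<in> I \<Longrightarrow> g k i \<in> borel_measurable \<sigma>" for i k unfolding g_def P_def by measurable
  have gs: "smooth_supported \<Omega> (g k i)" if i: "i \<in> I" for k i
  proof -
    have s: "i \<in> I \<Longrightarrow> smooth_on UNIV (\<psi> (r k) i)" for i using p by (auto simp: smooth_supported_def)
    have "smooth_on UNIV (\<lambda>x. l\<^sup>2 * P k x)"
      unfolding P_def power2_eq_square using s by (intro smooth_on_cmult smooth_on_sum smooth_on_mult) auto
    then have "smooth_on UNIV (\<lambda>x. 1 / sqrt (1 + l\<^sup>2 * P k x))"
      by (rule smooth_on_inverse_sqrt) (simp add: P0)
    then have "smooth_on UNIV (g k i)"
      unfolding g_def[abs_def] by (rule smooth_on_mult[OF smooth_on_cmult[OF s[OF i]]])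
    moreover obtain K where "compact K" "K \<subseteq> \<Omega>" "\<forall>x. x \<notin> K \<longrightarrow> \<psi> (r k) i x = 0"
      using smooth_supported_support[OF p(1)[OF i, of "r k"]] by blast
    ultimately show ?thesis by (intro smooth_supportedI[of _ K]) (auto simp: g_def)
  qed

  have g1: "L2_set (\<lambda>i. g k i x) I \<le> 1" for k x
  proof -
    have pos: "1 + l\<^sup>2 * P k x > 0" using P0[of k x] by (simp add: add_pos_nonneg)
    have "(\<Sum>i\<in>I. (g k i x)\<^sup>2) = l\<^sup>2 * P k x / (1 + l\<^sup>2 * P k x)"
      using P0[of k x] unfolding g_def P_def
      by (simp add: power_mult_distrib power_divide sum_divide_distrib[symmetric] sum_distrib_left[symmetric] sum_nonneg)
    also have "\<dots> \<le> 1" using pos by (simp add: divide_le_eq_1)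
    finally show ?thesis by (simp add: L2_set_def)
  qed
  have "(\<lambda>k. \<integral>x. (\<Sum>i\<in>I. g k i x * F i x) \<partial>\<sigma>) \<longlonglongrightarrow> (\<integral>x. A l x \<partial>\<sigma>)"
  proof (rule integral_dominated_convergence[where w=N])
    show "AE x in \<sigma>. (\<lambda>k. \<Sum>i\<in>I. g k i x * F i x) \<longlonglongrightarrow> A l x"
      using r
    proof (rule eventually_mono)
      fix x assume U: "(\<lambda>k. U (r k) x) \<longlonglongrightarrow> 0"
      have c: "(\<lambda>k. \<psi> (r k) i x) \<longlonglongrightarrow> F i x" if i: "i \<in> I" for i
      proof -
        have "(\<lambda>k. \<psi> (r k) i x - F i x) \<longlonglongrightarrow> 0"
        proof (rule Lim_null_comparison[OF _ U])
          show "\<forall>\<^sub>F k in sequentially. norm (\<psi> (r k) i x - F i x) \<le> U (r k) x"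
          proof (rule always_eventually, rule allI)
            fix k
            have "\<bar>F i x - \<psi> (r k) i x\<bar> \<le> U (r k) x"
              unfolding U_def by (rule member_le_sum[OF i, of "\<lambda>i. \<bar>F i x - \<psi> (r k) i x\<bar>"]) (use I in auto)
            then show "norm (\<psi> (r k) i x - F i x) \<le> U (r k) x" by (simp add: abs_minus_commute)
          qed
        qed
        then show ?thesis by (simp add: LIM_zero_iff)
      qed
      have NP: "(\<Sum>i\<in>I. (F i x)\<^sup>2) = (N x)\<^sup>2" by (simp add: N_def L2_set_def sum_nonneg)
      have "(\<lambda>k. \<Sum>i\<in>I. g k i x * F i x) \<longlonglongrightarrow> (\<Sum>i\<in>I. l * F i x * (1 / sqrt (1 + l\<^sup>2 * (\<Sum>i\<in>I. (F i x)\<^sup>2))) * F i x)"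
        unfolding g_def P_def
      proof (intro tendsto_intros c)
        have "1 + l\<^sup>2 * (\<Sum>i\<in>I. (F i x)\<^sup>2) > 0" by (simp add: add_pos_nonneg sum_nonneg)
        then show "sqrt (1 + l\<^sup>2 * (\<Sum>i\<in>I. (F i x)\<^sup>2)) \<noteq> 0" by simp
      qed auto
      also have "(\<Sum>i\<in>I. l * F i x * (1 / sqrt (1 + l\<^sup>2 * (\<Sum>i\<in>I. (F i x)\<^sup>2))) * F i x)
         = (\<Sum>i\<in>I. (l / sqrt (1 + l\<^sup>2 * (N x)\<^sup>2)) * (F i x)\<^sup>2)"
        unfolding NP by (intro sum.cong) (auto simp: power2_eq_square)
      also have "\<dots> = A l x"
        unfolding sum_distrib_left[symmetric] NP by (simp add: A_def)
      finally show "(\<lambda>k. \<Sum>i\<in>I. g k i x * F i x) \<longlonglongrightarrow> A l x" .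
    qed
    show "AE x in \<sigma>. norm (\<Sum>i\<in>I. g k i x * F i x) \<le> N x" for k
    proof (rule AE_I2)
      fix x
      have "\<bar>\<Sum>i\<in>I. g k i x * F i x\<bar> \<le> (\<Sum>i\<in>I. \<bar>g k i x\<bar> * \<bar>F i x\<bar>)"
        by (rule order_trans[OF sum_abs]) (simp add: abs_mult)
      also have "\<dots> \<le> L2_set (\<lambda>i. g k i x) I * N x" unfolding N_def by (rule L2_set_mult_ineq)
      also have "\<dots> \<le> 1 * N x" by (intro mult_right_mono g1 N0)
      finally show "norm (\<Sum>i\<in>I. g k i x * F i x) \<le> N x" by simp
    qed
    show "A l \<in> borel_measurable \<sigma>" unfolding A_def[abs_def] by measurable
  qed (use iN in auto)
  then have "eventually (\<lambda>k. (\<integral>x. (\<Sum>i\<in>I. g k i x * F i x) \<partial>\<sigma>) > (\<integral>x. N x \<partial>\<sigma>) - e) sequentially"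
    using l0 unfolding l_def by (intro order_tendstoD(1)) auto
  then obtain k where k: "(\<integral>x. (\<Sum>i\<in>I. g k i x * F i x) \<partial>\<sigma>) > (\<integral>x. N x \<partial>\<sigma>) - e"
    by (auto simp: eventually_sequentially)
  have "integrable \<sigma> (\<lambda>x. g k i x * F i x)" if i: "i \<in> I" for i
  proof -
    obtain B where "\<And>x. \<bar>g k i x\<bar> \<le> B" using smooth_supported_bounded(1)[OF gs[OF i]] by blast
    then show ?thesis using i by (intro integrable_bounded_mult[OF F]) auto
  qed
  then have "(\<integral>x. (\<Sum>i\<in>I. g k i x * F i x) \<partial>\<sigma>) = (\<Sum>i\<in>I. \<integral>x. g k i x * F i x \<partial>\<sigma>)"
    by (simp add: Bochner_Integration.integral_sum)
  with k gs g1 show ?thesis unfolding N_def by (intro exI[of _ "g k"]) auto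
qed

text \<open>
  The fundamental lemma of the calculus of variations, as the duality for fields with one component.
\<close>

lemma AE_eq_0_of_test_functions:
  assumes f: "integrable \<sigma> f" and *: "\<And>\<psi>. smooth_supported \<Omega> \<psi> \<Longrightarrow> (\<integral>x. \<psi> x * f x \<partial>\<sigma>) = 0"
  shows "AE x in \<sigma>. f x = 0"
proof -
  have "(\<integral>x. \<bar>f x\<bar> \<partial>\<sigma>) \<le> 0 + e" if e: "e > 0" for e
  proof -
    obtain g where g: "smooth_supported \<Omega> (g ())" "(\<integral>x. L2_set (\<lambda>i. f x) {()} \<partial>\<sigma>) - e < (\<Sum>i\<in>{()}. \<integral>x. g i x * f x \<partial>\<sigma>)"
      using dual_test_field[of "{()}" "\<lambda>_. f" e] f e by auto
    have "L2_set (\<lambda>i. f x) {()} = \<bar>f x\<bar>" for x by simp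
    with g *[OF g(1)] show ?thesis by simp
  qed
  then have "(\<integral>x. \<bar>f x\<bar> \<partial>\<sigma>) \<le> 0" by (rule field_le_epsilon)
  moreover have "(\<integral>x. \<bar>f x\<bar> \<partial>\<sigma>) \<ge> 0" by simp
  ultimately have "(\<integral>x. \<bar>f x\<bar> \<partial>\<sigma>) = 0" by linarith
  then show ?thesis using f by (subst (asm) integral_nonneg_eq_0_iff_AE) auto
qed

end

lemma restricted_lebesgue:
  fixes \<Omega> :: "(real ^ 'n::finite) set"
  assumes \<Omega>: "open \<Omega>" "bounded \<Omega>"
  shows "finite_borel_on (density lborel (indicator \<Omega>)) \<Omega>"
proof -
  have b [measurable]: "\<Omega> \<in> sets borel" using \<Omega>(1) by simp
  have em: "emeasure (density lborel (indicator \<Omega>)) A = emeasure lborel (\<Omega> \<inter> A)" if "A \<in> sets borel" for A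
    using that b by (subst emeasure_density)
      (auto simp: nn_integral_indicator[symmetric] indicator_inter_arith simp del: nn_integral_indicator intro!: borel_measurable_indicator)
  have "emeasure (density lborel (indicator \<Omega>)) (space (density lborel (indicator \<Omega>))) \<noteq> \<infinity>"
    using em[of UNIV] emeasure_bounded_finite[OF \<Omega>(2)] by auto
  moreover have "emeasure (density lborel (indicator \<Omega>)) (- \<Omega>) = 0" by (subst em) auto
  ultimately show ?thesis
    using \<Omega> by (intro finite_borel_on.intro finite_measureI finite_borel_on_axioms.intro) auto
qed

lemma integral_restricted_lebesgue:
  fixes g :: "real ^ 'n::finite \<Rightarrow> real"
  assumes [measurable]: "\<Omega> \<in> sets borel" "g \<in> borel_measurable borel"
  shows "(\<integral>x. g x \<partial>density lborel (indicator \<Omega>)) = (\<integral>x. indicator \<Omega> x * g x \<partial>lborel)"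
    and "integrable (density lborel (indicator \<Omega>)) g \<longleftrightarrow> integrable lborel (\<lambda>x. indicator \<Omega> x * g x)"
proof -
  have d: "density lborel (indicator \<Omega>) = density lborel (\<lambda>x. ennreal (indicator \<Omega> x))"
    by (simp add: ennreal_indicator)
  show "(\<integral>x. g x \<partial>density lborel (indicator \<Omega>)) = (\<integral>x. indicator \<Omega> x * g x \<partial>lborel)"
    unfolding d by (subst integral_density) auto
  show "integrable (density lborel (indicator \<Omega>)) g \<longleftrightarrow> integrable lborel (\<lambda>x. indicator \<Omega> x * g x)"
    unfolding d by (subst integrable_density) auto
qed

section \<open>Mollification of integrable functions and measures\<close>

text \<open>The density of the measure \<open>\<rho> * (h \<sigma>)\<close>.\<close>

definition mconvol :: "(real ^ 'n::finite) measure \<Rightarrow> (real ^ 'n \<Rightarrow> real) \<Rightarrow> (real ^ 'n \<Rightarrow> real) \<Rightarrow> real ^ 'n \<Rightarrow> real" where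
  "mconvol \<sigma> \<rho> h x = (\<integral>y. \<rho> (x - y) * h y \<partial>\<sigma>)"

lemma convol_eq_mconvol: "convol \<rho> f = mconvol lborel \<rho> f"
  by (simp add: convol_def mconvol_def fun_eq_iff)

text \<open>
  Tonelli's theorem and the fact that the kernel has integral 1: convolution preserves the mass of a
  nonnegative density.
\<close>

lemma nn_integral_mconvol:
  fixes \<sigma> :: "(real ^ 'n::finite) measure"
  assumes \<rho>: "mollifier c r \<rho>" and "sigma_finite_measure \<sigma>" and sets_eq [measurable_cong]: "sets \<sigma> = sets borel"
    and [measurable]: "h \<in> borel_measurable borel"
  shows "(\<integral>\<^sup>+x. \<integral>\<^sup>+y. ennreal (\<rho> (x - y)) * h y \<partial>\<sigma> \<partial>lborel) = (\<integral>\<^sup>+y. h y \<partial>\<sigma>)"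
proof -
  interpret \<sigma>: sigma_finite_measure \<sigma> by fact
  interpret pair_sigma_finite lborel \<sigma> ..
  note r = mollifierD[OF \<rho>]
  have [measurable]: "\<rho> \<in> borel_measurable borel" by (rule r)
  have "(\<integral>\<^sup>+x. \<integral>\<^sup>+y. ennreal (\<rho> (x - y)) * h y \<partial>\<sigma> \<partial>lborel) = (\<integral>\<^sup>+y. \<integral>\<^sup>+x. ennreal (\<rho> (x - y)) * h y \<partial>lborel \<partial>\<sigma>)"
    by (rule Fubini'[symmetric]) measurable
  also have "\<dots> = (\<integral>\<^sup>+y. (\<integral>\<^sup>+x. ennreal (\<rho> (x - y)) \<partial>lborel) * h y \<partial>\<sigma>)"
    by (intro nn_integral_cong nn_integral_multc) measurable
  also have "(\<lambda>y. \<integral>\<^sup>+x. ennreal (\<rho> (x - y)) \<partial>lborel) = (\<lambda>y. 1)"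
    using nn_integral_eq_integral[OF r(11)] r(2) r(10) by (simp add: fun_eq_iff)
  finally show ?thesis by simp
qed

lemma mollifier_mult_integrable:
  fixes \<sigma> :: "(real ^ 'n::finite) measure"
  assumes \<rho>: "mollifier c r \<rho>" and sets_eq [measurable_cong]: "sets \<sigma> = sets borel" and h: "integrable \<sigma> h"
  shows "integrable \<sigma> (\<lambda>y. \<rho> (x - y) * h y)"
proof -
  note r = mollifierD[OF \<rho>]
  have [measurable]: "\<rho> \<in> borel_measurable borel" by (rule r)
  obtain B where "\<And>x. \<bar>\<rho> x\<bar> \<le> B"
    using continuous_bounded_support(2)[OF smooth_on_continuous[OF r(1)] r(4)] by blast
  then show ?thesis by (intro integrable_bounded_mult[OF h]) auto
qed

lemma mconvol_integrable:
  fixes \<sigma> :: "(real ^ 'n::finite) measure"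
  assumes \<rho>: "mollifier c r \<rho>" and \<sigma>: "sigma_finite_measure \<sigma>" and sets_eq [measurable_cong]: "sets \<sigma> = sets borel"
    and h: "integrable \<sigma> h"
  shows "integrable lborel (mconvol \<sigma> \<rho> h)"
    and "(\<integral>x. \<bar>mconvol \<sigma> \<rho> h x\<bar> \<partial>lborel) \<le> (\<integral>y. \<bar>h y\<bar> \<partial>\<sigma>)"
proof -
  interpret \<sigma>: sigma_finite_measure \<sigma> by fact
  note r = mollifierD[OF \<rho>]
  have [measurable]: "\<rho> \<in> borel_measurable borel" by (rule r)
  have [measurable]: "h \<in> borel_measurable borel" using h sets_eq measurable_cong_sets by blast
  have m [measurable]: "mconvol \<sigma> \<rho> h \<in> borel_measurable borel"
    unfolding mconvol_def[abs_def] by measurable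
  note i = mollifier_mult_integrable[OF \<rho> sets_eq h]
  have le: "ennreal \<bar>mconvol \<sigma> \<rho> h x\<bar> \<le> (\<integral>\<^sup>+y. ennreal (\<rho> (x - y)) * ennreal \<bar>h y\<bar> \<partial>\<sigma>)" for x
  proof -
    have "ennreal \<bar>mconvol \<sigma> \<rho> h x\<bar> \<le> (\<integral>\<^sup>+y. ennreal \<bar>\<rho> (x - y) * h y\<bar> \<partial>\<sigma>)"
      using integral_norm_bound_ennreal[OF i[of x]] by (simp add: mconvol_def)
    also have "\<dots> = (\<integral>\<^sup>+y. ennreal (\<rho> (x - y)) * ennreal \<bar>h y\<bar> \<partial>\<sigma>)"
      using r(2) by (intro nn_integral_cong) (simp add: abs_mult ennreal_mult)
    finally show ?thesis .
  qed
  have "(\<integral>\<^sup>+x. ennreal \<bar>mconvol \<sigma> \<rho> h x\<bar> \<partial>lborel) \<le> (\<integral>\<^sup>+x. \<integral>\<^sup>+y. ennreal (\<rho> (x - y)) * ennreal \<bar>h y\<bar> \<partial>\<sigma> \<partial>lborel)"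
    by (intro nn_integral_mono le)
  also have "\<dots> = (\<integral>\<^sup>+y. ennreal \<bar>h y\<bar> \<partial>\<sigma>)"
    by (rule nn_integral_mconvol[OF \<rho> \<sigma> sets_eq]) measurable
  also have "\<dots> = ennreal (\<integral>y. \<bar>h y\<bar> \<partial>\<sigma>)"
    using h by (intro nn_integral_eq_integral) auto
  finally have *: "(\<integral>\<^sup>+x. ennreal \<bar>mconvol \<sigma> \<rho> h x\<bar> \<partial>lborel) \<le> ennreal (\<integral>y. \<bar>h y\<bar> \<partial>\<sigma>)" .
  show int: "integrable lborel (mconvol \<sigma> \<rho> h)"
  proof (rule integrableI_bounded)
    show "(\<integral>\<^sup>+x. ennreal (norm (mconvol \<sigma> \<rho> h x)) \<partial>lborel) < \<infinity>"
      using * by (simp add: le_less_trans)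
  qed measurable
  have "ennreal (\<integral>x. \<bar>mconvol \<sigma> \<rho> h x\<bar> \<partial>lborel) \<le> ennreal (\<integral>y. \<bar>h y\<bar> \<partial>\<sigma>)"
    using * int by (subst nn_integral_eq_integral[symmetric]) auto
  then show "(\<integral>x. \<bar>mconvol \<sigma> \<rho> h x\<bar> \<partial>lborel) \<le> (\<integral>y. \<bar>h y\<bar> \<partial>\<sigma>)"
    by (simp add: ennreal_le_iff)
qed

lemmas convol_integrable = mconvol_integrable[OF _ sigma_finite_lborel sets_lborel, folded convol_eq_mconvol]

lemma finite_imp_sigma_finite: "finite_measure \<sigma> \<Longrightarrow> sigma_finite_measure \<sigma>"
  by (simp add: finite_measure.axioms(1))

text \<open>
  The density of test functions for a finite measure is applied to Lebesgue measure on a ball that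
  contains the support of \<open>f\<close> in its interior.
\<close>

lemma integrable_bounded_support_test_dense:
  fixes f :: "real ^ 'n::finite \<Rightarrow> real"
  assumes f: "integrable lborel f" and R: "\<And>x. f x \<noteq> 0 \<Longrightarrow> norm x \<le> R" and e: "e > 0"
  shows "\<exists>\<psi>. smooth_supported (ball 0 (R + 1)) \<psi> \<and> integrable lborel \<psi> \<and> (\<integral>x. \<bar>f x - \<psi> x\<bar> \<partial>lborel) < e"
proof -
  let ?B = "ball (0 :: real ^ 'n) (R + 1)"
  let ?\<sigma> = "density lborel (indicator ?B) :: (real ^ 'n) measure"
  interpret finite_borel_on ?\<sigma> ?B by (rule restricted_lebesgue) auto
  have [measurable]: "f \<in> borel_measurable borel" using f by auto
  have dens: "integrable ?\<sigma> g \<longleftrightarrow> integrable lborel g" "(\<integral>x. g x \<partial>?\<sigma>) = (\<integral>x. g x \<partial>lborel)"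
    if g: "g \<in> borel_measurable borel" and z: "\<And>x. x \<notin> ?B \<Longrightarrow> g x = 0" for g :: "real ^ 'n \<Rightarrow> real"
  proof -
    have eq: "(\<lambda>x. indicator ?B x * g x) = g"
      using z by (auto simp: fun_eq_iff indicator_def simp del: mem_ball)
    show "integrable ?\<sigma> g \<longleftrightarrow> integrable lborel g" "(\<integral>x. g x \<partial>?\<sigma>) = (\<integral>x. g x \<partial>lborel)"
      using integral_restricted_lebesgue[OF _ g, of ?B] by (simp_all add: eq)
  qed
  have f0: "f x = 0" if "x \<notin> ?B" for x using R[of x] that by auto
  have "integrable ?\<sigma> f" using f dens(1)[OF _ f0] by simp
  from test_function_dense[OF this e]
  obtain \<psi> where p: "smooth_supported ?B \<psi>" "(\<integral>x. \<bar>f x - \<psi> x\<bar> \<partial>?\<sigma>) < e" by blast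
  have p0: "\<psi> x = 0" if "x \<notin> ?B" for x
    by (rule smooth_supported_outside[OF p(1) that])
  have [measurable]: "\<psi> \<in> borel_measurable borel" by (rule smooth_supported_bounded(2)[OF p(1)])
  have "integrable lborel \<psi>" using smooth_supported_integrable[OF p(1)] dens(1)[OF _ p0] by simp
  moreover have "(\<integral>x. \<bar>f x - \<psi> x\<bar> \<partial>?\<sigma>) = (\<integral>x. \<bar>f x - \<psi> x\<bar> \<partial>lborel)"
    by (rule dens(2)) (use f0 p0 in auto)
  ultimately show ?thesis using p by auto
qed

lemma convol_diff:
  assumes \<rho>: "mollifier c r \<rho>" and f: "integrable lborel f" and g: "integrable lborel g"
  shows "convol \<rho> (\<lambda>x. f x - g x) x = convol \<rho> f x - convol \<rho> g x"
  unfolding convol_def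
  using mollifier_mult_integrable[OF \<rho> sets_lborel f] mollifier_mult_integrable[OF \<rho> sets_lborel g]
  by (simp add: right_diff_distrib)

text \<open>
  For a test function the convergence is uniform, with supports in a fixed ball; the general case
  follows by density, because convolution does not increase the \<open>L\<^sup>1\<close> norm.  The number
  \<open>norm (c k) + r k\<close> bounds the distance over which the kernel averages, also if it is centred off the
  origin.
\<close>

lemma convol_L1_convergence:
  fixes f :: "real ^ 'n::finite \<Rightarrow> real"
  assumes \<rho>: "\<And>k. mollifier (c k) (r k) (\<rho> k)" and lim: "(\<lambda>k. norm (c k) + r k) \<longlonglongrightarrow> 0"
    and f: "integrable lborel f" and R: "\<And>x. f x \<noteq> 0 \<Longrightarrow> norm x \<le> R"
  shows "(\<lambda>k. \<integral>x. \<bar>convol (\<rho> k) f x - f x\<bar> \<partial>lborel) \<longlonglongrightarrow> 0"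
proof (rule LIMSEQ_I)
  fix e :: real assume e: "0 < e"
  then obtain \<psi> where p: "smooth_supported (ball 0 (R + 1)) \<psi>" "integrable lborel \<psi>" "(\<integral>x. \<bar>f x - \<psi> x\<bar> \<partial>lborel) < e / 3"
    using integrable_bounded_support_test_dense[OF f R, of "e / 3"] by auto
  let ?d = "\<lambda>x. f x - \<psi> x"
  have id: "integrable lborel ?d" using f p(2) by simp
  have p0: "norm x \<le> R + 1" if "\<psi> x \<noteq> 0" for x
    using smooth_supported_outside[OF p(1), of x] that by force
  have sp: "smooth_on UNIV \<psi>" using p(1) by (simp add: smooth_supported_def)
  have uc: "uniformly_continuous_on UNIV \<psi>"
    by (rule continuous_bounded_support(3)[OF smooth_on_continuous[OF sp] p0])
  \<comment> \<open>It contains the supports of \<open>\<psi>\<close> and of its mollifications at scale at most 1.\<close>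
  let ?B = "cball (0 :: real ^ 'n) (R + 2)"
  define V where "V = measure lborel ?B"
  define e' where "e' = e / (3 * (V + 1))"
  have V: "V \<ge> 0" by (simp add: V_def)
  have e': "e' > 0" using e V by (simp add: e'_def)
  obtain d where d: "d > 0" "\<And>x y. dist y x < d \<Longrightarrow> dist (\<psi> y) (\<psi> x) < e'"
    using uc e' unfolding uniformly_continuous_on_def by (metis UNIV_I)
  have "eventually (\<lambda>k. norm (c k) + r k < min d 1) sequentially"
    using lim d(1) by (intro order_tendstoD(2)) auto
  then obtain k0 where k0: "\<And>k. k \<ge> k0 \<Longrightarrow> norm (c k) + r k < min d 1" by (auto simp: eventually_sequentially)
  have "(\<integral>x. \<bar>convol (\<rho> k) f x - f x\<bar> \<partial>lborel) < e" if k: "k \<ge> k0" for k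
  proof -
    note r = mollifierD[OF \<rho>[of k]]
    note cf = convol_integrable[OF \<rho>[of k] f] and cp = convol_integrable[OF \<rho>[of k] p(2)]
      and cd = convol_integrable[OF \<rho>[of k] id]
    have ptw: "\<bar>convol (\<rho> k) \<psi> x - \<psi> x\<bar> \<le> e' * indicator ?B x" for x
    proof -
      have "convol (\<rho> k) \<psi> x - \<psi> x = (\<integral>y. \<rho> k (x - y) * \<psi> y \<partial>lborel) - (\<integral>y. \<rho> k (x - y) * \<psi> x \<partial>lborel)"
        by (simp add: convol_def r(8))
      also have "\<dots> = (\<integral>y. \<rho> k (x - y) * (\<psi> y - \<psi> x) \<partial>lborel)"
        using mollifier_mult_integrable[OF \<rho>[of k] sets_lborel p(2), of x] r(9)[of x]
        by (simp add: right_diff_distrib)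
      finally have eq: "convol (\<rho> k) \<psi> x - \<psi> x = (\<integral>y. \<rho> k (x - y) * (\<psi> y - \<psi> x) \<partial>lborel)" .
      have b: "\<bar>\<rho> k (x - y) * (\<psi> y - \<psi> x)\<bar> \<le> \<rho> k (x - y) * (e' * indicator ?B x)" for y
      proof (cases "\<rho> k (x - y) = 0")
        case False
        then have n: "norm (x - y) < min d 1" using r(4)[of "x - y"] k0[OF k] by linarith
        then have "\<bar>\<psi> y - \<psi> x\<bar> \<le> e'"
          using d(2)[of y x] by (simp add: dist_norm norm_minus_commute)
        moreover have "\<psi> y - \<psi> x = 0" if "x \<notin> ?B"
        proof -
          have "norm x > R + 2" using that by simp
          then have "norm y > R + 1" using n norm_triangle_ineq[of y "x - y"] by simp
          with \<open>norm x > R + 2\<close> show ?thesis using p0[of x] p0[of y] by force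
        qed
        ultimately have "\<bar>\<psi> y - \<psi> x\<bar> \<le> e' * indicator ?B x"
          by (cases "x \<in> ?B") auto
        then show ?thesis using r(2)[of "x - y"] by (simp add: abs_mult mult_left_mono)
      qed simp
      have "\<bar>\<integral>y. \<rho> k (x - y) * (\<psi> y - \<psi> x) \<partial>lborel\<bar> \<le> (\<integral>y. \<rho> k (x - y) * (e' * indicator ?B x) \<partial>lborel)"
      proof (rule order_trans[OF integral_abs_bound])
        have "integrable lborel (\<lambda>y. \<rho> k (x - y) * (\<psi> y - \<psi> x))"
          using mollifier_mult_integrable[OF \<rho>[of k] sets_lborel p(2), of x] r(9)[of x]
          by (simp add: right_diff_distrib)
        then show "(\<integral>y. \<bar>\<rho> k (x - y) * (\<psi> y - \<psi> x)\<bar> \<partial>lborel) \<le> (\<integral>y. \<rho> k (x - y) * (e' * indicator ?B x) \<partial>lborel)"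
          using r(9)[of x] b by (intro integral_mono) auto
      qed
      also have "\<dots> = e' * indicator ?B x" by (simp add: r(8))
      finally show ?thesis unfolding eq .
    qed
    have iB: "integrable lborel (\<lambda>x. e' * indicator ?B x)"
      by (intro integrable_mult_right integrable_real_indicator emeasure_compact_finite) auto
    have "(\<integral>x. \<bar>convol (\<rho> k) \<psi> x - \<psi> x\<bar> \<partial>lborel) \<le> (\<integral>x. e' * indicator ?B x \<partial>lborel)"
      using cp p(2) iB ptw by (intro integral_mono) auto
    also have "\<dots> = e' * V" by (simp add: V_def)
    also have "\<dots> < e / 3" using e V by (simp add: e'_def field_simps)
    finally have A: "(\<integral>x. \<bar>convol (\<rho> k) \<psi> x - \<psi> x\<bar> \<partial>lborel) < e / 3" .
    have "(\<integral>x. \<bar>convol (\<rho> k) f x - f x\<bar> \<partial>lborel)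
       \<le> (\<integral>x. \<bar>convol (\<rho> k) ?d x\<bar> + \<bar>convol (\<rho> k) \<psi> x - \<psi> x\<bar> + \<bar>?d x\<bar> \<partial>lborel)"
    proof (rule integral_mono)
      show "\<bar>convol (\<rho> k) f x - f x\<bar> \<le> \<bar>convol (\<rho> k) ?d x\<bar> + \<bar>convol (\<rho> k) \<psi> x - \<psi> x\<bar> + \<bar>?d x\<bar>" for x
        unfolding convol_diff[OF \<rho> f p(2)] by linarith
    qed (use cf cp cd p(2) id f in auto)
    also have "\<dots> = (\<integral>x. \<bar>convol (\<rho> k) ?d x\<bar> \<partial>lborel) + (\<integral>x. \<bar>convol (\<rho> k) \<psi> x - \<psi> x\<bar> \<partial>lborel) + (\<integral>x. \<bar>?d x\<bar> \<partial>lborel)"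
      using cp(1) cd(1) p(2) id by simp
    also have "\<dots> < e" using A cd(2) p(3) by linarith
    finally show ?thesis .
  qed
  then show "\<exists>no. \<forall>n\<ge>no. norm ((\<integral>x. \<bar>convol (\<rho> n) f x - f x\<bar> \<partial>lborel) - 0) < e"
    by auto
qed

text \<open>
  Jensen's inequality for the probability density \<open>\<rho> (x - y)\<close> and the convex function \<open>t powr q\<close>.
\<close>

lemma mollifier_jensen_powr:
  fixes f :: "real ^ 'n::finite \<Rightarrow> real"
  assumes \<rho>: "mollifier c r \<rho>" and q: "q > 1"
    and f: "integrable lborel f" and fq: "integrable lborel (\<lambda>x. \<bar>f x\<bar> powr q)"
  shows "\<bar>convol \<rho> f x\<bar> powr q \<le> convol \<rho> (\<lambda>x. \<bar>f x\<bar> powr q) x"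
proof -
  note r = mollifierD[OF \<rho>]
  note i1 = mollifier_mult_integrable[OF \<rho> sets_lborel integrable_abs[OF f], of x]
    and i2 = mollifier_mult_integrable[OF \<rho> sets_lborel fq, of x]
  define b where "b = convol \<rho> (\<lambda>x. \<bar>f x\<bar>) x"
  have b0: "b \<ge> 0" unfolding b_def convol_def using r(2) by simp
  have "\<bar>convol \<rho> f x\<bar> \<le> (\<integral>y. \<bar>\<rho> (x - y) * f y\<bar> \<partial>lborel)" unfolding convol_def by (rule integral_abs_bound)
  also have "\<dots> = b" unfolding b_def convol_def using r(2) by (simp add: abs_mult)
  finally have 1: "\<bar>convol \<rho> f x\<bar> powr q \<le> b powr q" using q by (intro powr_mono2) auto
  \<comment> \<open>Young's inequality is the tangent line inequality of \<open>t \<mapsto> t powr q\<close> at \<open>b\<close>.\<close>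
  define p where "p = q / (q - 1)"
  have p: "p > 1" "1 / q + 1 / p = 1" using q by (auto simp: p_def field_simps)
  have Y: "q * (a * b powr (q - 1)) \<le> a powr q + (q - 1) * b powr q" if "a \<ge> 0" for a
  proof -
    have "a * b powr (q - 1) \<le> a powr q / q + (b powr (q - 1)) powr p / p"
      using q p that by (intro Youngs_inequality) auto
    also have "(b powr (q - 1)) powr p = b powr q" using q by (simp add: powr_powr p_def)
    finally have "q * (a * b powr (q - 1)) \<le> q * (a powr q / q + b powr q / p)"
      using q by (intro mult_left_mono) auto
    also have "\<dots> = a powr q + (q - 1) * b powr q" using q by (simp add: p_def field_simps)
    finally show ?thesis .
  qed
  have "(\<integral>y. (q * b powr (q - 1)) * (\<rho> (x - y) * \<bar>f y\<bar>) \<partial>lborel)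
     \<le> (\<integral>y. \<rho> (x - y) * \<bar>f y\<bar> powr q + ((q - 1) * b powr q) * \<rho> (x - y) \<partial>lborel)"
  proof (rule integral_mono)
    fix y
    have "\<rho> (x - y) * (q * (\<bar>f y\<bar> * b powr (q - 1))) \<le> \<rho> (x - y) * (\<bar>f y\<bar> powr q + (q - 1) * b powr q)"
      using r(2) by (intro mult_left_mono Y) auto
    then show "(q * b powr (q - 1)) * (\<rho> (x - y) * \<bar>f y\<bar>) \<le> \<rho> (x - y) * \<bar>f y\<bar> powr q + ((q - 1) * b powr q) * \<rho> (x - y)"
      by (simp add: algebra_simps)
  qed (use i1 i2 r(9) in auto)
  then have "q * b powr (q - 1) * b \<le> convol \<rho> (\<lambda>x. \<bar>f x\<bar> powr q) x + (q - 1) * b powr q"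
    using i1 i2 r(9)[of x] r(8)[of x] by (simp add: b_def convol_def)
  also have "q * b powr (q - 1) * b = q * b powr q"
    using b0 powr_mult_base[of b "q - 1"] by (simp add: mult.commute mult.left_commute)
  finally have "b powr q \<le> convol \<rho> (\<lambda>x. \<bar>f x\<bar> powr q) x" by (simp add: algebra_simps)
  with 1 show ?thesis by linarith
qed

text \<open>
  Almost everywhere convergence of functions whose \<open>L\<^sup>q\<close> norms do not exceed that of the limit is
  convergence in \<open>L\<^sup>q\<close>: by Scheffe's argument \<open>\<bar>f\<^sub>k\<bar>\<^sup>q\<close> converges to \<open>\<bar>f\<bar>\<^sup>q\<close> in \<open>L\<^sup>1\<close>, and \<open>\<bar>f\<^sub>k - f\<bar>\<^sup>q\<close>
  exceeds a multiple of \<open>\<bar>\<bar>f\<^sub>k\<bar>\<^sup>q - \<bar>f\<bar>\<^sup>q\<bar>\<close> by at most a multiple of \<open>\<bar>f\<bar>\<^sup>q\<close>, so that dominated convergence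
  applies to the excess.
\<close>

lemma Lq_convergence_of_AE:
  fixes f :: "'a \<Rightarrow> real" and fk :: "nat \<Rightarrow> 'a \<Rightarrow> real"
  assumes q: "q > 0" and m [measurable]: "f \<in> borel_measurable M" "\<And>k. fk k \<in> borel_measurable M"
    and p: "integrable M (\<lambda>x. \<bar>f x\<bar> powr q)" and pk: "\<And>k. integrable M (\<lambda>x. \<bar>fk k x\<bar> powr q)"
    and le: "\<And>k. (\<integral>x. \<bar>fk k x\<bar> powr q \<partial>M) \<le> (\<integral>x. \<bar>f x\<bar> powr q \<partial>M)"
    and ae: "AE x in M. (\<lambda>k. fk k x) \<longlonglongrightarrow> f x"
  shows "(\<lambda>k. \<integral>x. \<bar>fk k x - f x\<bar> powr q \<partial>M) \<longlonglongrightarrow> 0"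
proof -
  define P where "P x = \<bar>f x\<bar> powr q" for x
  define Pk where "Pk k x = \<bar>fk k x\<bar> powr q" for k x
  have [measurable]: "P \<in> borel_measurable M" "\<And>k. Pk k \<in> borel_measurable M"
    unfolding P_def[abs_def] Pk_def[abs_def] by measurable
  have iP: "integrable M P" "\<And>k. integrable M (Pk k)" using p pk by (simp_all add: P_def[abs_def] Pk_def[abs_def])
  have P0: "P x \<ge> 0" "Pk k x \<ge> 0" for x k by (auto simp: P_def Pk_def)
  have aeP: "AE x in M. (\<lambda>k. Pk k x) \<longlonglongrightarrow> P x"
    using ae by (rule eventually_mono) (use q in \<open>auto simp: P_def Pk_def intro!: tendsto_powr' tendsto_intros\<close>)
  have "(\<lambda>k. \<integral>x. max 0 (P x - Pk k x) \<partial>M) \<longlonglongrightarrow> (\<integral>x. 0 \<partial>M)"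
  proof (rule integral_dominated_convergence[where w=P])
    show "AE x in M. (\<lambda>k. max 0 (P x - Pk k x)) \<longlonglongrightarrow> 0"
      using aeP
    proof (rule eventually_mono)
      fix x assume "(\<lambda>k. Pk k x) \<longlonglongrightarrow> P x"
      then have "(\<lambda>k. max 0 (P x - Pk k x)) \<longlonglongrightarrow> max 0 (P x - P x)" by (intro tendsto_intros)
      then show "(\<lambda>k. max 0 (P x - Pk k x)) \<longlonglongrightarrow> 0" by simp
    qed
    show "AE x in M. norm (max 0 (P x - Pk k x)) \<le> P x" for k
      using P0 by (intro AE_I2) (auto simp: max_def)
  qed (use iP in measurable)
  then have l1: "(\<lambda>k. 2 * (\<integral>x. max 0 (P x - Pk k x) \<partial>M)) \<longlonglongrightarrow> 0"
    by (auto intro: tendsto_eq_intros)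
  have imax: "integrable M (\<lambda>x. max 0 (P x - Pk k x))" for k
    using iP by (intro integrable_max) auto
  have abs_le: "(\<integral>x. \<bar>Pk k x - P x\<bar> \<partial>M) \<le> 2 * (\<integral>x. max 0 (P x - Pk k x) \<partial>M)" for k
  proof -
    have "(\<integral>x. \<bar>Pk k x - P x\<bar> \<partial>M) = (\<integral>x. (Pk k x - P x) + 2 * max 0 (P x - Pk k x) \<partial>M)"
      by (intro Bochner_Integration.integral_cong) (simp_all add: max_def)
    also have "\<dots> = (\<integral>x. Pk k x \<partial>M) - (\<integral>x. P x \<partial>M) + 2 * (\<integral>x. max 0 (P x - Pk k x) \<partial>M)"
      using iP imax by simp
    finally show ?thesis using le[of k] by (simp add: P_def Pk_def)
  qed
  have l2: "(\<lambda>k. \<integral>x. \<bar>Pk k x - P x\<bar> \<partial>M) \<longlonglongrightarrow> 0"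
    by (rule real_tendsto_sandwich[OF _ _ tendsto_const l1]) (use abs_le in \<open>auto intro!: always_eventually\<close>)
  \<comment> \<open>From \<open>\<bar>a - b\<bar> \<le> 2 * max \<bar>a\<bar> \<bar>b\<bar>\<close>.\<close>
  define C where "C = (2::real) powr q"
  have C: "C > 0" by (simp add: C_def)
  have bound: "\<bar>fk k x - f x\<bar> powr q \<le> C * P x + C * \<bar>Pk k x - P x\<bar>" for k x
  proof -
    let ?m = "max \<bar>fk k x\<bar> \<bar>f x\<bar>"
    have "\<bar>fk k x - f x\<bar> powr q \<le> (2 * ?m) powr q" using q by (intro powr_mono2) auto
    also have "\<dots> = C * ?m powr q" by (simp add: powr_mult C_def)
    also have "?m powr q \<le> P x + \<bar>Pk k x - P x\<bar>" by (auto simp: P_def Pk_def max_def)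
    finally show ?thesis using C by (simp add: distrib_left)
  qed
  \<comment> \<open>The excess, which is dominated by \<open>C * P\<close>.\<close>
  define W where "W k x = max 0 (\<bar>fk k x - f x\<bar> powr q - C * \<bar>Pk k x - P x\<bar>)" for k x
  have [measurable]: "W k \<in> borel_measurable M" for k unfolding W_def[abs_def] by measurable
  have W: "0 \<le> W k x" "W k x \<le> C * P x" for k x
    using bound[where k=k and x=x] C P0(1)[of x] by (auto simp: W_def)
  have iW: "integrable M (W k)" for k
    by (rule Bochner_Integration.integrable_bound[of _ "\<lambda>x. C * P x"]) (use iP W C P0 in auto)
  have l3: "(\<lambda>k. \<integral>x. W k x \<partial>M) \<longlonglongrightarrow> (\<integral>x. 0 \<partial>M)"
  proof (rule integral_dominated_convergence[where w="\<lambda>x. C * P x"])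
    show "AE x in M. (\<lambda>k. W k x) \<longlonglongrightarrow> 0"
      using aeP ae
    proof eventually_elim
      case (elim x)
      have "(\<lambda>k. \<bar>fk k x - f x\<bar>) \<longlonglongrightarrow> \<bar>f x - f x\<bar>" by (intro tendsto_intros elim)
      from tendsto_powr'[OF this tendsto_const[of q]] q
      have "(\<lambda>k. \<bar>fk k x - f x\<bar> powr q) \<longlonglongrightarrow> \<bar>f x - f x\<bar> powr q" by simp
      then have "(\<lambda>k. W k x) \<longlonglongrightarrow> max 0 (\<bar>f x - f x\<bar> powr q - C * \<bar>P x - P x\<bar>)"
        unfolding W_def
        by (intro tendsto_max tendsto_const tendsto_diff tendsto_mult tendsto_rabs elim)
      then show ?case by simp
    qed
    show "AE x in M. norm (W k x) \<le> C * P x" for k using W by (intro AE_I2) simp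
  qed (use iP in auto)
  have l4: "(\<lambda>k. (\<integral>x. W k x \<partial>M) + C * (\<integral>x. \<bar>Pk k x - P x\<bar> \<partial>M)) \<longlonglongrightarrow> 0"
    using l3 tendsto_mult_right_zero[OF l2, of C] by (auto intro: tendsto_eq_intros)
  have "(\<integral>x. \<bar>fk k x - f x\<bar> powr q \<partial>M) \<le> (\<integral>x. W k x \<partial>M) + C * (\<integral>x. \<bar>Pk k x - P x\<bar> \<partial>M)" for k
  proof -
    have i: "integrable M (\<lambda>x. W k x + C * \<bar>Pk k x - P x\<bar>)" using iW iP by simp
    have "(\<integral>x. \<bar>fk k x - f x\<bar> powr q \<partial>M) \<le> (\<integral>x. W k x + C * \<bar>Pk k x - P x\<bar> \<partial>M)"
    proof (rule integral_mono)
      show "integrable M (\<lambda>x. \<bar>fk k x - f x\<bar> powr q)"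
        by (rule Bochner_Integration.integrable_bound[OF i])
           (use C in \<open>auto simp: W_def max_def intro!: AE_I2\<close>)
    qed (use i in \<open>auto simp: W_def max_def\<close>)
    then show ?thesis using iW iP by simp
  qed
  then show ?thesis
    by (intro real_tendsto_sandwich[OF _ _ tendsto_const l4]) (auto intro!: always_eventually)
qed

lemma tendsto_zero_by_subsequences:
  fixes a :: "nat \<Rightarrow> real"
  assumes a0: "\<And>k. a k \<ge> 0"
    and sub: "\<And>s :: nat \<Rightarrow> nat. strict_mono s \<Longrightarrow> \<exists>r :: nat \<Rightarrow> nat. (\<lambda>k. a (s (r k))) \<longlonglongrightarrow> 0"
  shows "a \<longlonglongrightarrow> 0"
proof (rule ccontr)
  assume "\<not> a \<longlonglongrightarrow> 0"
  then obtain e where e: "e > 0" "\<And>N. \<exists>n\<ge>N. \<not> \<bar>a n\<bar> < e"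
    unfolding LIMSEQ_iff by auto
  then have "\<exists>n>N. e \<le> a n" for N
    using e(2)[of "Suc N"] a0 by (auto simp: not_less) (metis Suc_le_lessD abs_of_nonneg)
  then have "infinite {n. e \<le> a n}" by (meson infinite_nat_iff_unbounded mem_Collect_eq)
  from infinite_enumerate[OF this]
  obtain s :: "nat \<Rightarrow> nat" where s: "strict_mono s" "\<And>n. e \<le> a (s n)" by auto
  from sub[OF s(1)] obtain r :: "nat \<Rightarrow> nat" where "(\<lambda>k. a (s (r k))) \<longlonglongrightarrow> 0" by blast
  from order_tendstoD(2)[OF this e(1)] show False
    using s(2) by (auto simp: eventually_sequentially not_less[symmetric])
qed

text \<open>
  The function is in \<open>L\<^sup>q\<close> on \<open>A\<close> only, but a mollification which at points of \<open>A\<close> samples no values off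
  \<open>A\<close> cannot tell \<open>f\<close> from its restriction to \<open>A\<close>.  Jensen's inequality bounds its \<open>L\<^sup>q\<close> norm by that of the
  restriction, and the convergence in \<open>L\<^sup>1\<close> gives almost everywhere convergence along subsequences.
\<close>

lemma convol_Lq_convergence:
  fixes f :: "real ^ 'n::finite \<Rightarrow> real"
  assumes \<rho>: "\<And>k. mollifier (c k) (r k) (\<rho> k)" and lim: "(\<lambda>k. norm (c k) + r k) \<longlonglongrightarrow> 0"
    and f: "integrable lborel f" and R: "\<And>x. f x \<noteq> 0 \<Longrightarrow> norm x \<le> R"
    and q: "q > 1" and A [measurable]: "A \<in> sets borel"
    and fq: "integrable lborel (\<lambda>x. indicator A x * \<bar>f x\<bar> powr q)"
    and stay: "\<And>k x y. x \<in> A \<Longrightarrow> \<rho> k (x - y) \<noteq> 0 \<Longrightarrow> f y \<noteq> 0 \<Longrightarrow> y \<in> A"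
  shows "(\<lambda>k. \<integral>x. indicator A x * \<bar>convol (\<rho> k) f x - f x\<bar> powr q \<partial>lborel) \<longlonglongrightarrow> 0"
    and "\<And>k. integrable lborel (\<lambda>x. indicator A x * \<bar>convol (\<rho> k) f x - f x\<bar> powr q)"
proof -
  have [measurable]: "f \<in> borel_measurable borel" using f by auto
  define g where "g x = indicator A x * f x" for x
  define h where "h k x = indicator A x * convol (\<rho> k) f x" for k x
  have ig: "integrable lborel g"
    unfolding g_def using integrable_mult_indicator[OF _ f, of A] by simp
  have gq: "\<bar>g x\<bar> powr q = indicator A x * \<bar>f x\<bar> powr q" for x
    by (auto simp: g_def indicator_def)
  have igq: "integrable lborel (\<lambda>x. \<bar>g x\<bar> powr q)" unfolding gq by (rule fq)
  have ic: "integrable lborel (convol (\<rho> k) f)" for k by (rule convol_integrable[OF \<rho> f])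
  have [measurable]: "convol (\<rho> k) f \<in> borel_measurable borel" for k using ic[of k] by auto
  have hg: "h k x = indicator A x * convol (\<rho> k) g x" for k x
  proof (cases "x \<in> A")
    case True
    have "\<rho> k (x - y) * f y = \<rho> k (x - y) * g y" for y
      using stay[OF True, of k y] by (auto simp: g_def indicator_def)
    then show ?thesis by (simp only: h_def convol_def)
  qed (simp add: h_def)
  have hq: "\<bar>h k x\<bar> powr q \<le> convol (\<rho> k) (\<lambda>x. \<bar>g x\<bar> powr q) x" for k x
  proof -
    have "\<bar>h k x\<bar> powr q \<le> \<bar>convol (\<rho> k) g x\<bar> powr q"
      unfolding hg using q by (intro powr_mono2) (auto simp: indicator_def)
    also have "\<dots> \<le> convol (\<rho> k) (\<lambda>x. \<bar>g x\<bar> powr q) x"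
      by (rule mollifier_jensen_powr[OF \<rho> q ig igq])
    finally show ?thesis .
  qed
  note icq = convol_integrable[OF \<rho> igq]
  have mh [measurable]: "h k \<in> borel_measurable lborel" for k unfolding h_def[abs_def] by measurable
  have ihq: "integrable lborel (\<lambda>x. \<bar>h k x\<bar> powr q)" for k
    by (rule Bochner_Integration.integrable_bound[OF icq(1)[of k]])
       (use hq[of k] in \<open>auto intro!: AE_I2 order_trans[OF _ abs_ge_self]\<close>)
  have le: "(\<integral>x. \<bar>h k x\<bar> powr q \<partial>lborel) \<le> (\<integral>x. \<bar>g x\<bar> powr q \<partial>lborel)" for k
  proof -
    have "(\<integral>x. \<bar>h k x\<bar> powr q \<partial>lborel) \<le> (\<integral>x. \<bar>convol (\<rho> k) (\<lambda>x. \<bar>g x\<bar> powr q) x\<bar> \<partial>lborel)"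
      using ihq icq(1) hq by (intro integral_mono) (auto intro: order_trans[OF _ abs_ge_self])
    also have "\<dots> \<le> (\<integral>x. \<bar>g x\<bar> powr q \<partial>lborel)" using icq(2)[of k] by simp
    finally show ?thesis .
  qed
  have eq: "indicator A x * \<bar>convol (\<rho> k) f x - f x\<bar> powr q = \<bar>h k x - g x\<bar> powr q" for k x
    by (auto simp: h_def g_def indicator_def)
  have hg0: "(\<lambda>k. \<integral>x. norm (h k x - g x) \<partial>lborel) \<longlonglongrightarrow> 0"
  proof (rule real_tendsto_sandwich[OF _ _ tendsto_const convol_L1_convergence[OF \<rho> lim f R]])
    have "(\<integral>x. norm (h k x - g x) \<partial>lborel) \<le> (\<integral>x. \<bar>convol (\<rho> k) f x - f x\<bar> \<partial>lborel)" for k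
    proof (rule integral_mono)
      show "norm (h k x - g x) \<le> \<bar>convol (\<rho> k) f x - f x\<bar>" for x
        by (auto simp: h_def g_def indicator_def)
      have "integrable lborel (h k)"
        unfolding h_def[abs_def] using integrable_mult_indicator[OF _ ic[of k], of A] by simp
      then show "integrable lborel (\<lambda>x. norm (h k x - g x))" using ig by simp
    qed (use ic f in auto)
    then show "\<forall>\<^sub>F k in sequentially. (\<integral>x. norm (h k x - g x) \<partial>lborel) \<le> (\<integral>x. \<bar>convol (\<rho> k) f x - f x\<bar> \<partial>lborel)"
      by simp
  qed simp_all
  show "(\<lambda>k. \<integral>x. indicator A x * \<bar>convol (\<rho> k) f x - f x\<bar> powr q \<partial>lborel) \<longlonglongrightarrow> 0"
    unfolding eq
  proof (rule tendsto_zero_by_subsequences)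
    fix s :: "nat \<Rightarrow> nat" assume s: "strict_mono s"
    have ih: "integrable lborel (\<lambda>x. h (s k) x - g x)" for k
      unfolding h_def[abs_def] using integrable_mult_indicator[OF _ ic[of "s k"], of A] ig by simp
    have "(\<lambda>k. \<integral>x. norm (h (s k) x - g x) \<partial>lborel) \<longlonglongrightarrow> 0"
      using LIMSEQ_subseq_LIMSEQ[OF hg0 s] by (simp add: o_def)
    from tendsto_L1_AE_subseq[of lborel "\<lambda>k x. h (s k) x - g x", OF ih this]
    obtain r :: "nat \<Rightarrow> nat" where r: "AE x in lborel. (\<lambda>k. h (s (r k)) x - g x) \<longlonglongrightarrow> 0" by blast
    have "(\<lambda>k. \<integral>x. \<bar>h (s (r k)) x - g x\<bar> powr q \<partial>lborel) \<longlonglongrightarrow> 0"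
    proof (rule Lq_convergence_of_AE[OF _ _ _ igq ihq le])
      show "AE x in lborel. (\<lambda>k. h (s (r k)) x) \<longlonglongrightarrow> g x"
        using r by (simp add: LIM_zero_iff)
    qed (use q ig in auto)
    then show "\<exists>r. (\<lambda>k. \<integral>x. \<bar>h (s (r k)) x - g x\<bar> powr q \<partial>lborel) \<longlonglongrightarrow> 0" by blast
  qed simp
  show "integrable lborel (\<lambda>x. indicator A x * \<bar>convol (\<rho> k) f x - f x\<bar> powr q)" for k
    unfolding eq
  proof (rule Bochner_Integration.integrable_bound)
    show "integrable lborel (\<lambda>x. 2 powr q * (\<bar>h k x\<bar> powr q + \<bar>g x\<bar> powr q))" using ihq igq by simp
    have "\<bar>h k x - g x\<bar> powr q \<le> 2 powr q * (\<bar>h k x\<bar> powr q + \<bar>g x\<bar> powr q)" for x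
    proof -
      have "\<bar>h k x - g x\<bar> powr q \<le> (2 * max \<bar>h k x\<bar> \<bar>g x\<bar>) powr q" using q by (intro powr_mono2) auto
      also have "\<dots> = 2 powr q * max \<bar>h k x\<bar> \<bar>g x\<bar> powr q" by (simp add: powr_mult)
      also have "\<dots> \<le> 2 powr q * (\<bar>h k x\<bar> powr q + \<bar>g x\<bar> powr q)" by (intro mult_left_mono) (auto simp: max_def)
      finally show ?thesis .
    qed
    then show "AE x in lborel. norm (\<bar>h k x - g x\<bar> powr q) \<le> norm (2 powr q * (\<bar>h k x\<bar> powr q + \<bar>g x\<bar> powr q))"
      by (intro AE_I2) simp
  qed (use ig in measurable)
qed

section \<open>Kernels and a partition of unity adapted to the boundaries\<close>

lemma C1_Lipschitz_on_cball:
  fixes \<gamma> :: "real ^ 'n::finite \<Rightarrow> real"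
  assumes \<gamma>: "C_on 1 UNIV \<gamma>"
  shows "\<exists>L\<ge>0. \<forall>x\<in>cball 0 R. \<forall>y\<in>cball 0 R. \<bar>\<gamma> x - \<gamma> y\<bar> \<le> L * norm (x - y)"
proof -
  have "\<exists>B\<ge>0. \<forall>x\<in>cball 0 R. \<bar>partial_deriv i \<gamma> x\<bar> \<le> B" for i
  proof -
    have "compact (partial_deriv i \<gamma> ` cball 0 R)"
      using \<gamma> by (intro compact_continuous_image) (auto intro: continuous_on_subset)
    then obtain B where B: "\<And>x. x \<in> cball 0 R \<Longrightarrow> \<bar>partial_deriv i \<gamma> x\<bar> \<le> B"
      using compact_imp_bounded[of "partial_deriv i \<gamma> ` cball 0 R"] unfolding bounded_iff by force
    then show ?thesis by (intro exI[of _ "max 0 B"]) (auto simp: le_max_iff_disj)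
  qed
  then obtain B where B: "\<And>i. B i \<ge> 0" "\<And>i x. x \<in> cball 0 R \<Longrightarrow> \<bar>partial_deriv i \<gamma> x\<bar> \<le> B i" by metis
  define L where "L = (\<Sum>i\<in>UNIV. B i)"
  have "norm (\<gamma> x - \<gamma> y) \<le> L * norm (x - y)" if "x \<in> cball 0 R" "y \<in> cball 0 R" for x y
  proof (rule differentiable_bound[where S="cball 0 R" and f'="\<lambda>x h. \<Sum>i\<in>UNIV. h $ i * partial_deriv i \<gamma> x"])
    fix x :: "real ^ 'n" assume x: "x \<in> cball 0 R"
    show "(\<gamma> has_derivative (\<lambda>h. \<Sum>i\<in>UNIV. h $ i * partial_deriv i \<gamma> x)) (at x within cball 0 R)"
      using \<gamma> by (intro has_derivative_at_withinI[OF has_derivative_partial_derivs]) simp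
    show "onorm (\<lambda>h. \<Sum>i\<in>UNIV. h $ i * partial_deriv i \<gamma> x) \<le> L"
    proof (rule onorm_le)
      fix h :: "real ^ 'n"
      have "norm (\<Sum>i\<in>UNIV. h $ i * partial_deriv i \<gamma> x) \<le> (\<Sum>i\<in>UNIV. norm h * B i)"
        using B(2)[OF x] B(1) by (intro sum_norm_le) (auto simp: abs_mult intro!: mult_mono component_le_norm_cart)
      then show "norm (\<Sum>i\<in>UNIV. h $ i * partial_deriv i \<gamma> x) \<le> L * norm h"
        unfolding L_def sum_distrib_right by (simp only: mult.commute)
    qed
  qed (use that in auto)
  moreover have "L \<ge> 0" by (simp add: L_def B sum_nonneg)
  ultimately show ?thesis by auto
qed

text \<open>
  The height above a \<open>C\<^sup>1\<close> graph increases along all directions of a narrow cone about \<open>e\<close>,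
  because the graph is Lipschitz.
\<close>

lemma height_increases_in_cone:
  fixes \<gamma> :: "real ^ 'n::finite \<Rightarrow> real" and x e :: "real ^ 'n"
  assumes \<gamma>: "C_on 1 UNIV \<gamma>" and e: "norm e = 1"
  shows "\<exists>\<delta>>0. \<forall>y\<in>ball x r. \<forall>t w. 0 < t \<and> norm w \<le> \<delta> \<and> y + t *\<^sub>R (e + w) \<in> ball x r \<longrightarrow>
     y \<bullet> e - \<gamma> (y - (y \<bullet> e) *\<^sub>R e) < (y + t *\<^sub>R (e + w)) \<bullet> e - \<gamma> ((y + t *\<^sub>R (e + w)) - ((y + t *\<^sub>R (e + w)) \<bullet> e) *\<^sub>R e)"
proof -
  define P where "P y = y - (y \<bullet> e) *\<^sub>R e" for y
  have P2: "norm (P y) \<le> 2 * norm y" for y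
    using norm_triangle_ineq4[of y "(y \<bullet> e) *\<^sub>R e"] Cauchy_Schwarz_ineq2[of y e] e by (simp add: P_def)
  have ee: "e \<bullet> e = 1" using e by (simp add: dot_square_norm)
  \<comment> \<open>The projection \<open>P\<close> maps the ball about \<open>x\<close> into the ball of radius \<open>R\<close> about the origin.\<close>
  define R where "R = 2 * (norm x + r)"
  obtain L where L: "L \<ge> 0" "\<And>x y. norm x \<le> R \<Longrightarrow> norm y \<le> R \<Longrightarrow> \<bar>\<gamma> x - \<gamma> y\<bar> \<le> L * norm (x - y)"
    using C1_Lipschitz_on_cball[OF \<gamma>, of R] by auto
  \<comment> \<open>A step of length \<open>t\<close> raises the point by at least \<open>t * (1 - \<delta>)\<close> and the graph by at most \<open>t * (2 * L * \<delta>)\<close>.\<close>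
  define \<delta> where "\<delta> = 1 / (2 * L + 2)"
  have \<delta>: "\<delta> > 0" "2 * L * \<delta> + \<delta> < 1" using L(1) by (auto simp: \<delta>_def field_simps)
  have "y \<bullet> e - \<gamma> (P y) < z \<bullet> e - \<gamma> (P z)"
    if y: "y \<in> ball x r" and z: "z \<in> ball x r" and t: "0 < t" and w: "norm w \<le> \<delta>" and zy: "z = y + t *\<^sub>R (e + w)" for y z t w
  proof -
    have "norm v \<le> norm x + r" if "v \<in> ball x r" for v
      using that norm_triangle_ineq4[of x "x - v"] by (simp add: dist_norm)
    then have R: "norm (P v) \<le> R" if "v \<in> ball x r" for v
      using P2[of v] that unfolding R_def by (meson mult_left_mono order_trans zero_le_numeral)
    have "P z - P y = t *\<^sub>R P w" by (simp add: zy P_def inner_add_left ee algebra_simps)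
    then have "norm (P z - P y) \<le> t * (2 * \<delta>)" using P2[of w] w t by simp
    then have "\<bar>\<gamma> (P z) - \<gamma> (P y)\<bar> \<le> L * (t * (2 * \<delta>))"
      using L(2)[OF R[OF z] R[OF y]] L(1) by (meson mult_left_mono order_trans)
    moreover have "z \<bullet> e = y \<bullet> e + t * (1 + w \<bullet> e)" by (simp add: zy inner_add_left ee algebra_simps)
    moreover have "\<bar>w \<bullet> e\<bar> \<le> \<delta>" using Cauchy_Schwarz_ineq2[of w e] e w by simp
    then have "t * (1 + w \<bullet> e) \<ge> t * (1 - \<delta>)" using t by (intro mult_left_mono) auto
    moreover have "t * (2 * L * \<delta> + \<delta>) < t * 1" using \<delta>(2) t by (intro mult_strict_left_mono) auto
    ultimately show ?thesis by (simp add: algebra_simps abs_le_iff)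
  qed
  with \<delta>(1) show ?thesis unfolding P_def by blast
qed

text \<open>
  Near \<open>x\<close>, small steps in the directions of the cone \<open>e + w\<close> leave neither \<open>\<Omega>\<close> nor the complement of
  \<open>D\<close>.  At the boundary of \<open>\<Omega>\<close> such an \<open>e\<close> points into \<open>\<Omega>\<close>, at the boundary of \<open>D\<close> it points out of
  \<open>D\<close>; elsewhere it can be 0.
\<close>

definition pushes_inward :: "(real ^ 'n::finite) set \<Rightarrow> (real ^ 'n) set \<Rightarrow> real ^ 'n \<Rightarrow> real \<Rightarrow> real ^ 'n \<Rightarrow> real \<Rightarrow> bool" where
  "pushes_inward \<Omega> D x r e \<delta> \<longleftrightarrow> 0 < r \<and> 0 < \<delta> \<and>
     (\<forall>y t w. y \<in> ball x r \<and> 0 < t \<and> t < r \<and> norm w \<le> \<delta> \<longrightarrow>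
        (y \<in> \<Omega> \<longrightarrow> y + t *\<^sub>R (e + w) \<in> \<Omega>) \<and> (y \<in> \<Omega> - D \<longrightarrow> y + t *\<^sub>R (e + w) \<notin> D))"

lemma pushed_point_in_ball:
  fixes x y e w :: "'a::real_normed_vector"
  assumes "y \<in> ball x (s / (2 + \<delta>))" "0 < t" "t < s / (2 + \<delta>)" "norm e \<le> 1" "norm w \<le> \<delta>" "\<delta> > 0"
  shows "y + t *\<^sub>R (e + w) \<in> ball x s" "y \<in> ball x s"
proof -
  let ?r = "s / (2 + \<delta>)"
  have "norm (e + w) \<le> 1 + \<delta>" using norm_triangle_ineq[of e w] assms by linarith
  then have "t * norm (e + w) \<le> ?r * (1 + \<delta>)"
    using assms by (intro mult_mono) auto
  then have "norm (t *\<^sub>R (e + w)) \<le> ?r * (1 + \<delta>)" using assms(2) by simp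
  moreover have "dist x y < ?r" using assms by simp
  moreover have "dist x (y + t *\<^sub>R (e + w)) \<le> dist x y + norm (t *\<^sub>R (e + w))"
    using dist_triangle[of x "y + t *\<^sub>R (e + w)" y] by (simp add: dist_norm)
  ultimately have "dist x (y + t *\<^sub>R (e + w)) < ?r + ?r * (1 + \<delta>)" by linarith
  also have "\<dots> = s / (2 + \<delta>) * (2 + \<delta>)"
    unfolding distrib_left by simp
  also have "\<dots> = s" using assms(6) by simp
  finally show "y + t *\<^sub>R (e + w) \<in> ball x s" by simp
  have "s > 0" using assms(2,3,6) by (smt (verit) divide_nonpos_pos)
  then have "?r \<le> s" using assms(6) by (simp add: field_simps)
  then show "y \<in> ball x s" using assms(1) by auto
qed

text \<open>
  The two boundaries are disjoint, so each point has a neighbourhood meeting at most one of them.  At the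
  boundary of \<open>\<Omega>\<close> a step along the cone increases the height above the graph and hence stays in
  \<open>\<Omega>\<close>; at the boundary of \<open>D\<close> the reversed cone decreases the height above the graph and hence stays
  outside of \<open>D\<close>.  Elsewhere every direction is admissible.
\<close>

lemma pushes_inward_exists:
  fixes \<Omega> D :: "(real ^ 'n::finite) set"
  assumes \<Omega>: "open \<Omega>" "C1_boundary \<Omega>" and D: "open D" "closure D \<subseteq> \<Omega>" "C1_boundary D" and x: "x \<in> closure \<Omega>"
  shows "\<exists>r e \<delta>. pushes_inward \<Omega> D x r e \<delta>"
proof -
  have DO: "D \<subseteq> \<Omega>" using D closure_subset by blast
  consider "x \<in> frontier \<Omega>" | "x \<in> frontier D" | "x \<in> D" | "x \<in> \<Omega>" "x \<notin> closure D"
    using x \<Omega>(1) D(1) by (auto simp: frontier_def interior_open)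
  then show ?thesis
  proof cases
    case 1
    then have "x \<notin> closure D" using D \<Omega>(1) by (auto simp: frontier_def interior_open)
    then obtain s0 where s0: "s0 > 0" "ball x s0 \<inter> closure D = {}"
      by (metis closed_closure openE open_Compl Compl_iff disjoint_eq_subset_Compl)
    obtain r0 e \<gamma> where g: "r0 > 0" "norm e = 1" "C_on 1 UNIV \<gamma>"
        "\<Omega> \<inter> ball x r0 = {y \<in> ball x r0. \<gamma> (y - (y \<bullet> e) *\<^sub>R e) < y \<bullet> e}"
      using \<Omega>(2) 1 unfolding C1_boundary_def by blast
    define s where "s = min r0 s0"
    obtain \<delta> where d: "\<delta> > 0" "\<And>y t w. y \<in> ball x s \<Longrightarrow> 0 < t \<Longrightarrow> norm w \<le> \<delta> \<Longrightarrow> y + t *\<^sub>R (e + w) \<in> ball x s \<Longrightarrow>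
     y \<bullet> e - \<gamma> (y - (y \<bullet> e) *\<^sub>R e) < (y + t *\<^sub>R (e + w)) \<bullet> e - \<gamma> ((y + t *\<^sub>R (e + w)) - ((y + t *\<^sub>R (e + w)) \<bullet> e) *\<^sub>R e)"
      using height_increases_in_cone[OF g(3,2), of x s] by blast
    have "pushes_inward \<Omega> D x (s / (2 + \<delta>)) e \<delta>"
      unfolding pushes_inward_def
    proof (intro conjI allI impI; (elim conjE)?)
      show "0 < s / (2 + \<delta>)" using s0 g d by (simp add: s_def)
      show "0 < \<delta>" by fact
      fix y t and w :: "real ^ 'n" assume a: "y \<in> ball x (s / (2 + \<delta>))" "0 < t" "t < s / (2 + \<delta>)" "norm w \<le> \<delta>"
      note b = pushed_point_in_ball[OF a(1-3) eq_refl[OF g(2)] a(4) d(1)]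
      define z where "z = y + t *\<^sub>R (e + w)"
      have zb: "z \<in> ball x s" "y \<in> ball x s" using b by (auto simp: z_def)
      have lt: "y \<bullet> e - \<gamma> (y - (y \<bullet> e) *\<^sub>R e) < z \<bullet> e - \<gamma> (z - (z \<bullet> e) *\<^sub>R e)"
        unfolding z_def using d(2)[OF zb(2) a(2,4)] zb(1) by (simp add: z_def)
      have iff: "v \<in> \<Omega> \<longleftrightarrow> \<gamma> (v - (v \<bullet> e) *\<^sub>R e) < v \<bullet> e" if v: "v \<in> ball x s" for v
      proof -
        have "v \<in> ball x r0" using v by (simp add: s_def)
        moreover have "v \<in> \<Omega> \<inter> ball x r0 \<longleftrightarrow> v \<in> {y \<in> ball x r0. \<gamma> (y - (y \<bullet> e) *\<^sub>R e) < y \<bullet> e}"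
          by (simp only: g(4))
        ultimately show ?thesis by simp
      qed
      show "y + t *\<^sub>R (e + w) \<in> \<Omega>" if "y \<in> \<Omega>"
        using that lt iff[OF zb(1)] iff[OF zb(2)] unfolding z_def by linarith
      show "y + t *\<^sub>R (e + w) \<notin> D"
        using zb(1) s0(2) closure_subset[of D] unfolding z_def s_def by auto
    qed
    then show ?thesis by blast
  next
    case 2
    then have "x \<in> \<Omega>" using D by (auto simp: frontier_def)
    then obtain s0 where s0: "s0 > 0" "ball x s0 \<subseteq> \<Omega>" using \<Omega>(1) openE by blast
    obtain r0 e \<gamma> where g: "r0 > 0" "norm e = 1" "C_on 1 UNIV \<gamma>"
        "D \<inter> ball x r0 = {y \<in> ball x r0. \<gamma> (y - (y \<bullet> e) *\<^sub>R e) < y \<bullet> e}"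
      using D(3) 2 unfolding C1_boundary_def by blast
    define s where "s = min r0 s0"
    obtain \<delta> where d: "\<delta> > 0" "\<And>y t w. y \<in> ball x s \<Longrightarrow> 0 < t \<Longrightarrow> norm w \<le> \<delta> \<Longrightarrow> y + t *\<^sub>R (e + w) \<in> ball x s \<Longrightarrow>
     y \<bullet> e - \<gamma> (y - (y \<bullet> e) *\<^sub>R e) < (y + t *\<^sub>R (e + w)) \<bullet> e - \<gamma> ((y + t *\<^sub>R (e + w)) - ((y + t *\<^sub>R (e + w)) \<bullet> e) *\<^sub>R e)"
      using height_increases_in_cone[OF g(3,2), of x s] by blast
    have "pushes_inward \<Omega> D x (s / (2 + \<delta>)) (- e) \<delta>"
      unfolding pushes_inward_def
    proof (intro conjI allI impI; (elim conjE)?)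
      show "0 < s / (2 + \<delta>)" using s0 g d by (simp add: s_def)
      show "0 < \<delta>" by fact
      fix y t and w :: "real ^ 'n" assume a: "y \<in> ball x (s / (2 + \<delta>))" "0 < t" "t < s / (2 + \<delta>)" "norm w \<le> \<delta>"
      have "norm (- e) \<le> 1" using g(2) by simp
      note b = pushed_point_in_ball[OF a(1-3) this a(4) d(1)]
      define z where "z = y + t *\<^sub>R (- e + w)"
      have zb: "z \<in> ball x s" "y \<in> ball x s" using b by (auto simp: z_def)
      \<comment> \<open>The step is reversed: it leads from \<open>z\<close> to \<open>y\<close> in a direction of the cone about \<open>e\<close>.\<close>
      have yz: "y = z + t *\<^sub>R (e + - w)" by (simp add: z_def algebra_simps)
      have "norm (- w) \<le> \<delta>" using a by simp
      then have lt: "z \<bullet> e - \<gamma> (z - (z \<bullet> e) *\<^sub>R e) < y \<bullet> e - \<gamma> (y - (y \<bullet> e) *\<^sub>R e)"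
        using d(2)[OF zb(1) a(2), of "- w", folded yz] zb by simp
      have iff: "v \<in> D \<longleftrightarrow> \<gamma> (v - (v \<bullet> e) *\<^sub>R e) < v \<bullet> e" if v: "v \<in> ball x s" for v
      proof -
        have "v \<in> ball x r0" using v by (simp add: s_def)
        moreover have "v \<in> D \<inter> ball x r0 \<longleftrightarrow> v \<in> {y \<in> ball x r0. \<gamma> (y - (y \<bullet> e) *\<^sub>R e) < y \<bullet> e}"
          by (simp only: g(4))
        ultimately show ?thesis by simp
      qed
      show "y + t *\<^sub>R (- e + w) \<in> \<Omega>"
        using zb(1) s0(2) unfolding z_def s_def by auto
      show "y + t *\<^sub>R (- e + w) \<notin> D" if "y \<in> \<Omega> - D"
        using that lt iff[OF zb(1)] iff[OF zb(2)] unfolding z_def by auto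
    qed
    then show ?thesis by blast
  next
    case 3
    then obtain s where s: "s > 0" "ball x s \<subseteq> D" using D(1) openE by blast
    have "pushes_inward \<Omega> D x (s / (2 + 1)) 0 1"
      unfolding pushes_inward_def
    proof (intro conjI allI impI; (elim conjE)?)
      fix y t and w :: "real ^ 'n" assume a: "y \<in> ball x (s / (2 + 1))" "0 < t" "t < s / (2 + 1)" "norm w \<le> 1"
      note b = pushed_point_in_ball[OF a(1-3) _ a(4), of 0]
      show "y + t *\<^sub>R (0 + w) \<in> \<Omega>" using b s DO by auto
      show "y + t *\<^sub>R (0 + w) \<notin> D" if "y \<in> \<Omega> - D" using that b(2) s by auto
    qed (use s in auto)
    then show ?thesis by blast
  next
    case 4
    then have "open (\<Omega> - closure D)" "x \<in> \<Omega> - closure D" using \<Omega>(1) by auto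
    then obtain s where s: "s > 0" "ball x s \<subseteq> \<Omega> - closure D" using openE by blast
    have "pushes_inward \<Omega> D x (s / (2 + 1)) 0 1"
      unfolding pushes_inward_def
    proof (intro conjI allI impI; (elim conjE)?)
      fix y t and w :: "real ^ 'n" assume a: "y \<in> ball x (s / (2 + 1))" "0 < t" "t < s / (2 + 1)" "norm w \<le> 1"
      note b = pushed_point_in_ball[OF a(1-3) _ a(4), of 0]
      show "y + t *\<^sub>R (0 + w) \<in> \<Omega>" using b s by auto
      show "y + t *\<^sub>R (0 + w) \<notin> D" using b s closure_subset[of D] by auto
    qed (use s in auto)
    then show ?thesis by blast
  qed
qed

text \<open>
  The telescoping identity for \<open>\<zeta> j = \<eta> j * (\<Prod>i. 1 - \<eta> i)\<close>, where \<open>i\<close> runs over the indices added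
  before \<open>j\<close>.  The functions sum to 1 wherever some \<open>\<eta> j\<close> equals 1.
\<close>

lemma smooth_partition_from_cutoffs:
  fixes \<eta> :: "'j \<Rightarrow> real ^ 'n::finite \<Rightarrow> real"
  assumes J: "finite J" and \<eta>: "\<And>j. j \<in> J \<Longrightarrow> smooth_on UNIV (\<eta> j)" "\<And>j x. j \<in> J \<Longrightarrow> 0 \<le> \<eta> j x \<and> \<eta> j x \<le> 1"
  shows "\<exists>\<zeta>. (\<forall>j\<in>J. smooth_on UNIV (\<zeta> j) \<and> (\<forall>x. 0 \<le> \<zeta> j x \<and> (\<eta> j x = 0 \<longrightarrow> \<zeta> j x = 0))) \<and>
     (\<forall>x. (\<Sum>j\<in>J. \<zeta> j x) + (\<Prod>j\<in>J. 1 - \<eta> j x) = 1)"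
  using assms
proof (induction J rule: finite_induct)
  case (insert i J)
  then obtain \<zeta> where z: "\<And>j. j \<in> J \<Longrightarrow> smooth_on UNIV (\<zeta> j)" "\<And>j x. j \<in> J \<Longrightarrow> 0 \<le> \<zeta> j x"
    "\<And>j x. j \<in> J \<Longrightarrow> \<eta> j x = 0 \<Longrightarrow> \<zeta> j x = 0" "\<And>x. (\<Sum>j\<in>J. \<zeta> j x) + (\<Prod>j\<in>J. 1 - \<eta> j x) = 1"
    by (metis insertCI)
  define \<zeta>' where "\<zeta>' = \<zeta>(i := \<lambda>x. \<eta> i x * (\<Prod>j\<in>J. 1 - \<eta> j x))"
  have J: "\<zeta>' j = \<zeta> j" if "j \<in> J" for j using that insert.hyps by (auto simp: \<zeta>'_def)
  have i: "\<zeta>' i = (\<lambda>x. \<eta> i x * (\<Prod>j\<in>J. 1 - \<eta> j x))" by (simp add: \<zeta>'_def)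
  have si: "smooth_on UNIV (\<zeta>' i)"
    unfolding i using insert.prems
    by (intro smooth_on_mult smooth_on_prod smooth_on_diff smooth_on_const) auto
  have 1: "(\<Sum>j\<in>insert i J. \<zeta>' j x) + (\<Prod>j\<in>insert i J. 1 - \<eta> j x) = 1" for x
  proof -
    have "(\<Sum>j\<in>J. \<zeta>' j x) = (\<Sum>j\<in>J. \<zeta> j x)" by (intro sum.cong) (auto simp: J)
    then show ?thesis using insert.hyps z(4)[of x] by (simp add: i algebra_simps)
  qed
  have ni: "0 \<le> \<zeta>' i x" for x
    unfolding i using insert.prems by (intro mult_nonneg_nonneg prod_nonneg) auto
  show ?case
    by (intro exI[of _ \<zeta>']) (use si ni 1 z J in \<open>auto simp: i\<close>)
qed auto

text \<open>
  Cutoffs \<open>\<zeta> j\<close> and kernels \<open>\<rho> j k\<close> such that the mollification of \<open>\<zeta> j * u\<close> at a point of \<open>\<Omega>\<close> samples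
  only points of \<open>\<Omega>\<close>, and at a point of \<open>\<Omega> - D\<close> only points of \<open>\<Omega> - D\<close>: near a boundary point the
  support of the kernel is shifted off the origin, so that points in the cone of admissible directions are
  sampled.
\<close>

lemma adapted_kernels_exist:
  fixes \<Omega> D :: "(real ^ 'n::finite) set"
  assumes \<Omega>: "open \<Omega>" "bounded \<Omega>" "C1_boundary \<Omega>" and D: "open D" "closure D \<subseteq> \<Omega>" "C1_boundary D"
  shows "\<exists>(J :: (real ^ 'n) set) U \<zeta> c r \<rho>. finite J \<and>
    (\<forall>j\<in>J. smooth_supported (U j) (\<zeta> j) \<and> (\<forall>y. 0 \<le> \<zeta> j y)) \<and>
    (\<forall>y\<in>\<Omega>. (\<Sum>j\<in>J. \<zeta> j y) = 1) \<and>
    (\<forall>j\<in>J. (\<forall>k. mollifier (c j k) (r j k) (\<rho> j k)) \<and> (\<lambda>k. norm (c j k) + r j k) \<longlonglongrightarrow> 0 \<and>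
      (\<forall>k x y. x \<in> \<Omega> \<and> x - y \<in> cball (c j k) (r j k) \<and> y \<in> U j \<longrightarrow> y \<in> \<Omega> \<and> (x \<notin> D \<longrightarrow> y \<notin> D)))"
proof -
  obtain r e \<delta> where p: "\<And>x. x \<in> closure \<Omega> \<Longrightarrow> pushes_inward \<Omega> D x (r x) (e x) (\<delta> x)"
    using pushes_inward_exists[OF \<Omega>(1,3) D] by metis
  have r0: "r x > 0" "\<delta> x > 0" if "x \<in> closure \<Omega>" for x
    using p[OF that] by (auto simp: pushes_inward_def)
  have "compact (closure \<Omega>)" using \<Omega>(2) by (simp add: compact_closure)
  then obtain J where J: "finite J" "J \<subseteq> closure \<Omega>" "closure \<Omega> \<subseteq> (\<Union>x\<in>J. ball x (r x / 4))"
    by (rule compactE_image[of "closure \<Omega>" "closure \<Omega>" "\<lambda>x. ball x (r x / 4)"]) (use r0 in auto)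
  have "\<exists>\<psi>. smooth_supported (ball x (r x / 2)) \<psi> \<and> (\<forall>y. 0 \<le> \<psi> y \<and> \<psi> y \<le> 1) \<and> (\<forall>y\<in>cball x (r x / 4). \<psi> y = 1)" if "x \<in> J" for x
    using r0[of x] J(2) that by (intro smooth_cutoff_exists) auto
  then obtain \<eta> where h: "\<And>x. x \<in> J \<Longrightarrow> smooth_supported (ball x (r x / 2)) (\<eta> x)"
    "\<And>x y. x \<in> J \<Longrightarrow> 0 \<le> \<eta> x y \<and> \<eta> x y \<le> 1" "\<And>x y. x \<in> J \<Longrightarrow> y \<in> cball x (r x / 4) \<Longrightarrow> \<eta> x y = 1"
    by metis
  have "\<exists>\<zeta>. (\<forall>j\<in>J. smooth_on UNIV (\<zeta> j) \<and> (\<forall>x. 0 \<le> \<zeta> j x \<and> (\<eta> j x = 0 \<longrightarrow> \<zeta> j x = 0))) \<and>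
     (\<forall>x. (\<Sum>j\<in>J. \<zeta> j x) + (\<Prod>j\<in>J. 1 - \<eta> j x) = 1)"
    by (rule smooth_partition_from_cutoffs[OF J(1)]) (use h(1,2) in \<open>auto simp: smooth_supported_def\<close>)
  then obtain \<zeta> where zz: "\<forall>j\<in>J. smooth_on UNIV (\<zeta> j) \<and> (\<forall>x. 0 \<le> \<zeta> j x \<and> (\<eta> j x = 0 \<longrightarrow> \<zeta> j x = 0))"
     "\<forall>x. (\<Sum>j\<in>J. \<zeta> j x) + (\<Prod>j\<in>J. 1 - \<eta> j x) = 1" by blast
  have z: "\<And>j. j \<in> J \<Longrightarrow> smooth_on UNIV (\<zeta> j)" "\<And>j y. j \<in> J \<Longrightarrow> 0 \<le> \<zeta> j y"
    "\<And>j y. j \<in> J \<Longrightarrow> \<eta> j y = 0 \<Longrightarrow> \<zeta> j y = 0" "\<And>y. (\<Sum>j\<in>J. \<zeta> j y) + (\<Prod>j\<in>J. 1 - \<eta> j y) = 1"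
    using zz by auto
  have zs: "smooth_supported (ball j (r j / 2)) (\<zeta> j)" if j: "j \<in> J" for j
  proof -
    obtain K where "compact K" "K \<subseteq> ball j (r j / 2)" "\<forall>y. y \<notin> K \<longrightarrow> \<eta> j y = 0"
      using smooth_supported_support[OF h(1)[OF j]] by blast
    then show ?thesis
      using z(1)[OF j] z(3)[OF j] by (intro smooth_supportedI[of _ K]) auto
  qed
  have z1: "(\<Sum>j\<in>J. \<zeta> j y) = 1" if "y \<in> \<Omega>" for y
  proof -
    have "y \<in> closure \<Omega>" using that closure_subset by blast
    then obtain j where "j \<in> J" "y \<in> ball j (r j / 4)" using J(3) by blast
    then have "\<exists>j\<in>J. 1 - \<eta> j y = 0" using h(3)[of j y] by force
    then have "(\<Prod>j\<in>J. 1 - \<eta> j y) = 0" using J(1) by (simp add: prod_zero_iff)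
    with z(4)[of y] show ?thesis by simp
  qed
  define N where "N j = norm (e j) + \<delta> j" for j
  \<comment> \<open>A step of at most \<open>\<tau> j * N j\<close> from the support of the cutoff stays in \<open>ball j (r j)\<close>.\<close>
  define \<tau> where "\<tau> j = r j / (2 * (N j + 1))" for j
  define t where "t j k = \<tau> j * inverse (real (Suc k))" for j k
  have N0: "N j > 0" if "j \<in> J" for j using r0[of j] J(2) that by (auto simp: N_def add_nonneg_pos)
  have \<tau>: "\<tau> j > 0" "\<tau> j < r j" "\<tau> j * N j < r j / 2" if "j \<in> J" for j
    using N0[OF that] r0(1)[of j] J(2) that by (auto simp: \<tau>_def field_simps add_pos_pos)
  have t: "t j k > 0" "t j k < r j" "t j k * N j < r j / 2" if "j \<in> J" for j k
  proof -
    show "t j k > 0" using \<tau>[OF that] by (simp add: t_def)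
    have "inverse (real (Suc k)) \<le> 1" by (simp add: inverse_le_1_iff)
    then have le: "t j k \<le> \<tau> j" unfolding t_def using \<tau>(1)[OF that] by (simp add: mult_left_le)
    then show "t j k < r j" using \<tau>(2)[OF that] by simp
    have "t j k * N j \<le> \<tau> j * N j" using le N0[OF that] by simp
    then show "t j k * N j < r j / 2" using \<tau>(3)[OF that] by linarith
  qed
  \<comment> \<open>The minus sign makes the convolution at \<open>x\<close> sample points near \<open>x + t j k *\<^sub>R e j\<close>.\<close>
  define c where "c j k = - (t j k *\<^sub>R e j)" for j k
  define s where "s j k = t j k * \<delta> j" for j k
  have "\<exists>\<rho>. mollifier (c j k) (s j k) \<rho>" if "j \<in> J" for j k
    using t[OF that] r0[of j] J(2) that by (intro mollifier_exists) (auto simp: s_def)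
  then obtain \<rho> where \<rho>: "\<And>j k. j \<in> J \<Longrightarrow> mollifier (c j k) (s j k) (\<rho> j k)" by metis
  have cs: "norm (c j k) + s j k = \<tau> j * N j * inverse (real (Suc k))" if "j \<in> J" for j k
    using t(1)[OF that, of k] by (simp add: c_def s_def N_def t_def abs_mult \<tau>(1)[OF that] less_imp_le algebra_simps)
  have lim: "(\<lambda>k. norm (c j k) + s j k) \<longlonglongrightarrow> 0" if "j \<in> J" for j
    unfolding cs[OF that] by (rule tendsto_mult_right_zero[OF LIMSEQ_inverse_real_of_nat])
  have push: "y \<in> \<Omega> \<and> (x \<notin> D \<longrightarrow> y \<notin> D)"
    if j: "j \<in> J" and x: "x \<in> \<Omega>" and xy: "x - y \<in> cball (c j k) (s j k)" and y: "y \<in> ball j (r j / 2)" for j k x y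
  proof -
    define w where "w = (1 / t j k) *\<^sub>R (y - x) - e j"
    have tp: "t j k > 0" by (rule t[OF j])
    have yw: "y = x + t j k *\<^sub>R (e j + w)" using tp by (simp add: w_def)
    have "x - y - c j k = - (t j k *\<^sub>R w)" by (simp add: yw c_def algebra_simps)
    then have "t j k * norm w \<le> t j k * \<delta> j"
      using xy tp by (simp add: dist_norm norm_minus_commute s_def)
    then have w: "norm w \<le> \<delta> j" using tp by simp
    have "norm (x - y) \<le> norm (c j k) + s j k" using xy by (rule cball_norm_bound)
    also have "\<dots> = t j k * N j" using cs[OF j] by (simp add: t_def)
    also have "\<dots> < r j / 2" by (rule t[OF j])
    finally have "x \<in> ball j (r j)"
      using y dist_triangle[of j x y] by (simp add: dist_norm norm_minus_commute)
    with p[of j] j J(2) x w t[OF j, of k] yw show ?thesis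
      unfolding pushes_inward_def by blast
  qed
  show ?thesis
    by (rule exI[of _ J], rule exI[of _ "\<lambda>j. ball j (r j / 2)"], rule exI[of _ \<zeta>], rule exI[of _ c], rule exI[of _ s], rule exI[of _ \<rho>])
       (use J(1) zs z(2) z1 \<rho> lim push in blast)
qed

section \<open>Total variation and area of a vector measure with density\<close>

lemma finite_measure_sum_exists:
  fixes M :: "'j \<Rightarrow> 'a::topological_space measure"
  assumes J: "finite J" and M: "\<And>j. j \<in> J \<Longrightarrow> finite_measure (M j)" "\<And>j. j \<in> J \<Longrightarrow> sets (M j) = sets borel"
  shows "\<exists>\<sigma>. finite_measure \<sigma> \<and> sets \<sigma> = sets borel \<and> (\<forall>A\<in>sets borel. emeasure \<sigma> A = (\<Sum>j\<in>J. emeasure (M j) A))"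
proof -
  define \<sigma> where "\<sigma> = measure_of UNIV (sets borel) (\<lambda>A. \<Sum>j\<in>J. emeasure (M j) A)"
  have s: "sets \<sigma> = sets borel"
    unfolding \<sigma>_def using sets.sigma_sets_eq[of "borel :: 'a measure"] by simp
  have em: "emeasure \<sigma> A = (\<Sum>j\<in>J. emeasure (M j) A)" if "A \<in> sets borel" for A
    unfolding \<sigma>_def
  proof (rule emeasure_measure_of_sigma)
    show "sigma_algebra UNIV (sets borel)" using sets.sigma_algebra_axioms[of borel] by simp
    show "positive (sets borel) (\<lambda>A. \<Sum>j\<in>J. emeasure (M j) A)" by (simp add: positive_def)
    show "countably_additive (sets borel) (\<lambda>A. \<Sum>j\<in>J. emeasure (M j) A)"
    proof (rule countably_additiveI)
      fix A :: "nat \<Rightarrow> 'a set" assume A: "range A \<subseteq> sets borel" "disjoint_family A"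
      have "(\<Sum>i. \<Sum>j\<in>J. emeasure (M j) (A i)) = (\<Sum>j\<in>J. \<Sum>i. emeasure (M j) (A i))"
        by (rule suminf_sum) simp
      also have "\<dots> = (\<Sum>j\<in>J. emeasure (M j) (\<Union>i. A i))"
        using A M by (intro sum.cong refl suminf_emeasure) auto
      finally show "(\<Sum>i. \<Sum>j\<in>J. emeasure (M j) (A i)) = (\<Sum>j\<in>J. emeasure (M j) (\<Union>i. A i))" .
    qed
  qed (use that in auto)
  have "space \<sigma> = UNIV" using sets_eq_imp_space_eq[OF s] by simp
  then have "emeasure \<sigma> (space \<sigma>) = (\<Sum>j\<in>J. emeasure (M j) UNIV)" using em[of UNIV] by simp
  also have "\<dots> < \<infinity>"
  proof -
    have "emeasure (M j) UNIV < \<infinity>" if "j \<in> J" for j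
    proof -
      interpret finite_measure "M j" using M that by auto
      show ?thesis by (simp add: less_top[symmetric])
    qed
    then show ?thesis using J by (simp add: less_top[symmetric])
  qed
  finally have "finite_measure \<sigma>" by (intro finite_measureI) auto
  with s em show ?thesis by blast
qed

text \<open>
  The sum of finitely many measures dominates each of them, so all have Radon--Nikodym densities with
  respect to it.
\<close>

lemma common_dominating_measure:
  fixes M :: "'j \<Rightarrow> (real ^ 'n::finite) measure"
  assumes J: "finite J" and M: "\<And>j. j \<in> J \<Longrightarrow> finite_measure (M j)" "\<And>j. j \<in> J \<Longrightarrow> sets (M j) = sets borel"
    and \<Omega>: "open \<Omega>" "\<And>j. j \<in> J \<Longrightarrow> emeasure (M j) (- \<Omega>) = 0"
  shows "\<exists>\<sigma> p. finite_borel_on \<sigma> \<Omega> \<and> (\<forall>j\<in>J. p j \<in> borel_measurable borel \<and> (\<forall>x. 0 \<le> p j x) \<and>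
     integrable \<sigma> (p j) \<and> M j = density \<sigma> (\<lambda>x. ennreal (p j x)))"
proof -
  obtain \<sigma> where \<sigma>: "finite_measure \<sigma>" "sets \<sigma> = sets borel" "\<And>A. A \<in> sets borel \<Longrightarrow> emeasure \<sigma> A = (\<Sum>j\<in>J. emeasure (M j) A)"
    using finite_measure_sum_exists[of J M, OF J M] by blast
  have fb: "finite_borel_on \<sigma> \<Omega>"
    using \<sigma> \<Omega> by (intro finite_borel_on.intro finite_borel_on_axioms.intro) auto
  interpret finite_borel_on \<sigma> \<Omega> by (rule fb)
  have "\<exists>p. p \<in> borel_measurable borel \<and> (\<forall>x. 0 \<le> p x) \<and> integrable \<sigma> p \<and> M j = density \<sigma> (\<lambda>x. ennreal (p x))" if j: "j \<in> J" for j
  proof -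
    interpret Mj: finite_measure "M j" by (rule M[OF j])
    have seq: "sets (M j) = sets \<sigma>" using M(2)[OF j] \<sigma>(2) by simp
    have ac: "absolutely_continuous \<sigma> (M j)"
      unfolding absolutely_continuous_def
    proof
      fix A assume "A \<in> null_sets \<sigma>"
      then have A: "A \<in> sets borel" "emeasure \<sigma> A = 0" using \<sigma>(2) by auto
      then have "emeasure (M j) A = 0" using \<sigma>(3)[OF A(1)] j J by auto
      with A show "A \<in> null_sets (M j)" using M(2)[OF j] by auto
    qed
    from real_RN_deriv[OF M(1)[OF j] ac seq] obtain p where p: "p \<in> borel_measurable \<sigma>"
      "AE x in \<sigma>. RN_deriv \<sigma> (M j) x = ennreal (p x)" "\<And>x. 0 \<le> p x" by metis
    have [measurable]: "p \<in> borel_measurable borel" using p(1) \<sigma>(2) measurable_cong_sets by blast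
    have "M j = density \<sigma> (RN_deriv \<sigma> (M j))" using density_RN_deriv[OF ac seq] by simp
    also have "\<dots> = density \<sigma> (\<lambda>x. ennreal (p x))" using p by (intro density_cong) auto
    finally have d: "M j = density \<sigma> (\<lambda>x. ennreal (p x))" .
    have "(\<integral>\<^sup>+x. ennreal (p x) \<partial>\<sigma>) = emeasure (M j) (space \<sigma>)"
      by (subst d, subst emeasure_density) (auto intro!: nn_integral_cong)
    also have "\<dots> < \<infinity>" by (simp add: less_top[symmetric])
    finally have "integrable \<sigma> p" using p by (intro integrableI_nonneg) auto
    with d p show ?thesis by (intro exI[of _ p]) auto
  qed
  then obtain p where "\<And>j. j \<in> J \<Longrightarrow> p j \<in> borel_measurable borel \<and> (\<forall>x. 0 \<le> p j x) \<and> integrable \<sigma> (p j) \<and> M j = density \<sigma> (\<lambda>x. ennreal (p j x))"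
    by metis
  with fb show ?thesis by blast
qed

lemma measurable_map_count_space:
  fixes g :: "'i \<Rightarrow> 'a \<Rightarrow> 'b::countable"
  assumes "\<And>i. i \<in> set is \<Longrightarrow> g i \<in> M \<rightarrow>\<^sub>M count_space UNIV"
  shows "(\<lambda>x. map (\<lambda>i. g i x) is) \<in> M \<rightarrow>\<^sub>M count_space UNIV"
  using assms
proof (induction "is")
  case (Cons i "is")
  have "(\<lambda>x. a # map (\<lambda>i. g i x) is) \<in> M \<rightarrow>\<^sub>M count_space UNIV" for a
    using measurable_compose[OF Cons.IH, of "(#) a"] Cons.prems by simp
  from measurable_compose_countable[where f="\<lambda>a x. a # map (\<lambda>i. g i x) is", OF this, of "g i"]
  show ?case using Cons.prems by simp
qed simp

text \<open>
  A partition never yields more than the integral of the norm, by the triangle inequality.  Conversely,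
  \<open>\<Omega>\<close> is divided into countably many cells on each of which all components of \<open>h\<close> vary by at most
  \<open>d\<close>; on such a cell the norm of the integral of \<open>h\<close> and the integral of the norm of \<open>h\<close> almost agree.
\<close>

lemma total_variation_density:
  fixes \<sigma> :: "(real ^ 'n::finite) measure" and s :: "'i \<Rightarrow> (real ^ 'n) set \<Rightarrow> real"
  assumes "finite_borel_on \<sigma> \<Omega>" and I: "finite I" and h: "\<And>i. i \<in> I \<Longrightarrow> integrable \<sigma> (h i)"
    and s: "\<And>i B. i \<in> I \<Longrightarrow> B \<in> sets borel \<Longrightarrow> B \<subseteq> \<Omega> \<Longrightarrow> s i B = (\<integral>x. indicator B x * h i x \<partial>\<sigma>)"
  shows "total_variation I s \<Omega> = (\<integral>x. L2_set (\<lambda>i. h i x) I \<partial>\<sigma>)"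
proof -
  interpret finite_borel_on \<sigma> \<Omega> by fact
  define H where "H x = L2_set (\<lambda>i. h i x) I" for x
  have iH: "integrable \<sigma> H" unfolding H_def using h by (rule integrable_L2_set)
  have H0: "H x \<ge> 0" for x by (simp add: H_def)
  have [measurable]: "H \<in> borel_measurable \<sigma>" using iH by auto
  have mh [measurable]: "i \<in> I \<Longrightarrow> h i \<in> borel_measurable \<sigma>" for i using h by auto
  define \<tau> where "\<tau> = density \<sigma> (\<lambda>x. ennreal (H x))"
  have st: "sets \<tau> = sets borel" by (simp add: \<tau>_def sets_eq)
  have iind: "integrable \<sigma> (\<lambda>x. indicator B x * f x)" if "integrable \<sigma> f" "B \<in> sets borel" for B and f :: "real ^ 'n \<Rightarrow> real"
    using integrable_mult_indicator[OF _ that(1), of B] that(2) by (simp add: sets_eq)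
  have \<tau>: "emeasure \<tau> B = ennreal (\<integral>x. indicator B x * H x \<partial>\<sigma>)" if B: "B \<in> sets borel" for B
  proof -
    have "emeasure \<tau> B = (\<integral>\<^sup>+x. ennreal (indicator B x * H x) \<partial>\<sigma>)"
      unfolding \<tau>_def using B by (subst emeasure_density) (auto simp: sets_eq indicator_def intro!: nn_integral_cong)
    then show ?thesis using iind[OF iH B] H0 by (simp add: nn_integral_eq_integral)
  qed
  have \<Omega>b: "\<Omega> \<in> sets borel" using open_domain by simp
  have "(\<integral>x. indicator \<Omega> x * H x \<partial>\<sigma>) = (\<integral>x. H x \<partial>\<sigma>)"
  proof (rule integral_cong_AE)
    show "AE x in \<sigma>. indicator \<Omega> x * H x = H x" using AE_in_domain by (rule eventually_mono) simp
    show "(\<lambda>x. indicator \<Omega> x * H x) \<in> borel_measurable \<sigma>" using iind[OF iH \<Omega>b] by auto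
  qed auto
  then have \<tau>\<Omega>: "emeasure \<tau> \<Omega> = ennreal (\<integral>x. H x \<partial>\<sigma>)" using \<tau>[OF \<Omega>b] by simp
  let ?part = "{E :: nat \<Rightarrow> (real ^ 'n) set. range E \<subseteq> sets borel \<and> disjoint_family E \<and> (\<Union>j. E j) = \<Omega>}"
  let ?V = "SUP E \<in> ?part. \<Sum>j. ennreal (L2_set (\<lambda>i. s i (E j)) I)"
  have le: "?V \<le> ennreal (\<integral>x. H x \<partial>\<sigma>)"
  proof (rule SUP_least)
    fix E assume "E \<in> ?part"
    then have E: "range E \<subseteq> sets borel" "disjoint_family E" "(\<Union>j. E j) = \<Omega>" by auto
    have "L2_set (\<lambda>i. s i (E j)) I \<le> (\<integral>x. indicator (E j) x * H x \<partial>\<sigma>)" for j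
    proof -
      have Ej: "E j \<in> sets borel" "E j \<subseteq> \<Omega>" using E by auto
      have "L2_set (\<lambda>i. s i (E j)) I = L2_set (\<lambda>i. \<integral>x. indicator (E j) x * h i x \<partial>\<sigma>) I"
        using s Ej by (intro L2_set_cong) auto
      also have "\<dots> \<le> (\<integral>x. L2_set (\<lambda>i. indicator (E j) x * h i x) I \<partial>\<sigma>)"
        using h Ej iind by (intro L2_set_integral_le I) auto
      also have "\<dots> = (\<integral>x. indicator (E j) x * H x \<partial>\<sigma>)"
        by (simp add: H_def L2_set_right_distrib)
      finally show ?thesis .
    qed
    then have "(\<Sum>j. ennreal (L2_set (\<lambda>i. s i (E j)) I)) \<le> (\<Sum>j. emeasure \<tau> (E j))"
      using E by (intro suminf_le) (auto simp: \<tau> intro!: ennreal_leI)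
    also have "\<dots> = emeasure \<tau> \<Omega>"
      using E st by (subst suminf_emeasure) auto
    finally show "(\<Sum>j. ennreal (L2_set (\<lambda>i. s i (E j)) I)) \<le> ennreal (\<integral>x. H x \<partial>\<sigma>)"
      by (simp add: \<tau>\<Omega>)
  qed
  have ge: "ennreal (\<integral>x. H x \<partial>\<sigma>) \<le> ?V + ennreal e" if e: "e > 0" for e
  proof -
    define S where "S = measure \<sigma> \<Omega>"
    \<comment> \<open>Comparing norm and integral on a cell costs twice \<open>d * card I\<close> times the measure of the cell.\<close>
    define d where "d = e / (2 * (real (card I) + 1) * (S + 1))"
    have S0: "S \<ge> 0" by (simp add: S_def)
    have d: "d > 0" using e S0 by (simp add: d_def)
    define D where "D = d * real (card I)"
    have D: "D \<ge> 0" using d by (simp add: D_def)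
    have DS: "2 * D * S \<le> e"
    proof -
      have "2 * D * S \<le> 2 * (d * (real (card I) + 1)) * (S + 1)"
        unfolding D_def using d S0 by (intro mult_mono) auto
      also have "\<dots> = e"
      proof -
        have "2 * (e / (2 * c * T) * c) * T = e" if "c > 0" "T > 0" for c T :: real
          using that by simp
        from this[of "real (card I) + 1" "S + 1"] show ?thesis
          using S0 unfolding d_def by simp
      qed
      finally show ?thesis .
    qed
    obtain xs where xs: "set xs = I" using finite_list[OF I] by blast
    \<comment> \<open>The cells are the level sets of \<open>c\<close>, which has countably many values.\<close>
    define c where "c x = map (\<lambda>i. \<lfloor>h i x / d\<rfloor>) xs" for x
    have cm: "c \<in> \<sigma> \<rightarrow>\<^sub>M count_space UNIV"
      unfolding c_def[abs_def]
    proof (rule measurable_map_count_space)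
      fix i assume "i \<in> set xs"
      then have [measurable]: "h i \<in> borel_measurable \<sigma>" using xs by simp
      show "(\<lambda>x. \<lfloor>h i x / d\<rfloor>) \<in> \<sigma> \<rightarrow>\<^sub>M count_space UNIV" by measurable
    qed
    define E where "E j = {x \<in> \<Omega>. to_nat (c x) = j}" for j
    have "(\<lambda>x. to_nat (c x)) \<in> \<sigma> \<rightarrow>\<^sub>M count_space UNIV"
      using measurable_compose[OF cm, of to_nat] by simp
    then have "(\<lambda>x. to_nat (c x)) -` {j} \<inter> space \<sigma> \<in> sets \<sigma>" for j
      by (rule measurable_sets) simp
    moreover have "E j = ((\<lambda>x. to_nat (c x)) -` {j} \<inter> space \<sigma>) \<inter> \<Omega>" for j
      by (auto simp: E_def)
    ultimately have Eb: "E j \<in> sets borel" for j using \<Omega>b sets_eq by auto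
    have Ep: "E \<in> ?part" using Eb by (auto simp: E_def disjoint_family_on_def)
    have key: "(\<integral>x. indicator (E j) x * H x \<partial>\<sigma>) \<le> L2_set (\<lambda>i. s i (E j)) I + 2 * D * measure \<sigma> (E j)" for j
    proof (cases "E j = {}")
      case True
      then show ?thesis using D by simp
    next
      case False
      then obtain z where z: "z \<in> E j" by blast
      define v where "v i = h i z" for i
      have Ej: "E j \<subseteq> \<Omega>" by (auto simp: E_def)
      have m: "measure \<sigma> (E j) \<ge> 0" by simp
      have close: "\<bar>h i x - v i\<bar> \<le> d" if "x \<in> E j" "i \<in> I" for x i
      proof -
        have "c x = c z" using that z by (auto simp: E_def)
        then have fl: "\<lfloor>h i x / d\<rfloor> = \<lfloor>h i z / d\<rfloor>" using that xs by (auto simp: c_def)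
        have "h i x / d < of_int \<lfloor>h i x / d\<rfloor> + 1" "of_int \<lfloor>h i x / d\<rfloor> \<le> h i x / d"
          "h i z / d < of_int \<lfloor>h i z / d\<rfloor> + 1" "of_int \<lfloor>h i z / d\<rfloor> \<le> h i z / d"
          by linarith+
        with fl have "\<bar>h i x / d - h i z / d\<bar> \<le> 1" by linarith
        then show ?thesis using d by (simp add: v_def diff_divide_distrib[symmetric] abs_divide)
      qed
      have L2close: "L2_set (\<lambda>i. h i x - v i) I \<le> D" if "x \<in> E j" for x
      proof -
        have "L2_set (\<lambda>i. h i x - v i) I \<le> (\<Sum>i\<in>I. \<bar>h i x - v i\<bar>)" by (rule L2_set_le_sum_abs)
        also have "\<dots> \<le> (\<Sum>i\<in>I. d)" using close that by (intro sum_mono) auto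
        finally show ?thesis by (simp add: D_def mult.commute)
      qed
      have iE: "integrable \<sigma> (indicator (E j) :: _ \<Rightarrow> real)"
        using Eb[of j] by (intro integrable_real_indicator) (auto simp: sets_eq less_top[symmetric])
      have "(\<integral>x. indicator (E j) x * H x \<partial>\<sigma>) \<le> (\<integral>x. (L2_set v I + D) * indicator (E j) x \<partial>\<sigma>)"
      proof (rule integral_mono[OF iind[OF iH Eb]])
        show "indicator (E j) x * H x \<le> (L2_set v I + D) * indicator (E j) x" for x
        proof (cases "x \<in> E j")
          case True
          have "H x = L2_set (\<lambda>i. v i + (h i x - v i)) I" by (simp add: H_def)
          also have "\<dots> \<le> L2_set v I + L2_set (\<lambda>i. h i x - v i) I" by (rule L2_set_triangle_ineq)
          finally show ?thesis using L2close[OF True] True by simp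
        qed simp
      qed (use iE in simp)
      also have "\<dots> = L2_set v I * measure \<sigma> (E j) + D * measure \<sigma> (E j)"
        using iE by (simp add: distrib_right)
      also have "L2_set v I * measure \<sigma> (E j) \<le> L2_set (\<lambda>i. s i (E j)) I + D * measure \<sigma> (E j)"
      proof -
        have si: "measure \<sigma> (E j) * v i = s i (E j) + (\<integral>x. indicator (E j) x * (v i - h i x) \<partial>\<sigma>)" if i: "i \<in> I" for i
        proof -
          have "(\<integral>x. indicator (E j) x * (v i - h i x) \<partial>\<sigma>) = (\<integral>x. indicator (E j) x * v i - indicator (E j) x * h i x \<partial>\<sigma>)"
            by (simp add: right_diff_distrib)
          also have "\<dots> = measure \<sigma> (E j) * v i - s i (E j)"
            using iE iind[OF h[OF i] Eb] s[OF i Eb Ej] by simp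
          finally show ?thesis by simp
        qed
        have "L2_set v I * measure \<sigma> (E j) = L2_set (\<lambda>i. measure \<sigma> (E j) * v i) I"
          using L2_set_right_distrib[OF m, of v I] by (simp add: mult.commute)
        also have "\<dots> = L2_set (\<lambda>i. s i (E j) + (\<integral>x. indicator (E j) x * (v i - h i x) \<partial>\<sigma>)) I"
          using si by (intro L2_set_cong) auto
        also have "\<dots> \<le> L2_set (\<lambda>i. s i (E j)) I + L2_set (\<lambda>i. \<integral>x. indicator (E j) x * (v i - h i x) \<partial>\<sigma>) I"
          by (rule L2_set_triangle_ineq)
        also have "L2_set (\<lambda>i. \<integral>x. indicator (E j) x * (v i - h i x) \<partial>\<sigma>) I
            \<le> (\<integral>x. L2_set (\<lambda>i. indicator (E j) x * (v i - h i x)) I \<partial>\<sigma>)"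
          using h Eb by (intro L2_set_integral_le I iind) auto
        also have "\<dots> \<le> (\<integral>x. D * indicator (E j) x \<partial>\<sigma>)"
        proof (rule integral_mono)
          show "integrable \<sigma> (\<lambda>x. L2_set (\<lambda>i. indicator (E j) x * (v i - h i x)) I)"
            using h Eb by (intro integrable_L2_set iind) auto
          show "L2_set (\<lambda>i. indicator (E j) x * (v i - h i x)) I \<le> D * indicator (E j) x" for x
          proof (cases "x \<in> E j")
            case True
            have "L2_set (\<lambda>i. v i - h i x) I = L2_set (\<lambda>i. h i x - v i) I"
              by (simp add: L2_set_def power2_commute)
            then show ?thesis using True L2close[OF True] by simp
          qed (simp add: L2_set_0')
        qed (use iE in simp)
        finally show ?thesis by simp
      qed
      finally show ?thesis by simp
    qed
    have "ennreal (\<integral>x. H x \<partial>\<sigma>) = (\<Sum>j. emeasure \<tau> (E j))"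
      using Ep st \<tau>\<Omega> by (subst suminf_emeasure) auto
    also have "\<dots> \<le> (\<Sum>j. ennreal (L2_set (\<lambda>i. s i (E j)) I) + ennreal (2 * D) * emeasure \<sigma> (E j))"
    proof (intro suminf_le summableI allI)
      fix j
      have "emeasure \<tau> (E j) \<le> ennreal (L2_set (\<lambda>i. s i (E j)) I + 2 * D * measure \<sigma> (E j))"
        unfolding \<tau>[OF Eb] by (intro ennreal_leI key)
      also have "\<dots> = ennreal (L2_set (\<lambda>i. s i (E j)) I) + ennreal (2 * D) * emeasure \<sigma> (E j)"
        using D by (simp add: ennreal_plus ennreal_mult emeasure_eq_measure)
      finally show "emeasure \<tau> (E j) \<le> ennreal (L2_set (\<lambda>i. s i (E j)) I) + ennreal (2 * D) * emeasure \<sigma> (E j)" .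
    qed
    also have "\<dots> = (\<Sum>j. ennreal (L2_set (\<lambda>i. s i (E j)) I)) + ennreal (2 * D) * emeasure \<sigma> \<Omega>"
    proof -
      have "(\<Sum>j. emeasure \<sigma> (E j)) = emeasure \<sigma> \<Omega>"
        using Ep sets_eq by (subst suminf_emeasure) auto
      then show ?thesis by (simp add: suminf_add[symmetric])
    qed
    also have "\<dots> \<le> ?V + ennreal e"
    proof (rule add_mono)
      show "(\<Sum>j. ennreal (L2_set (\<lambda>i. s i (E j)) I)) \<le> ?V" by (rule SUP_upper[OF Ep])
      show "ennreal (2 * D) * emeasure \<sigma> \<Omega> \<le> ennreal e"
        using D DS S0 by (simp add: emeasure_eq_measure ennreal_mult[symmetric] S_def ennreal_leI)
    qed
    finally show ?thesis .
  qed
  have "ennreal (\<integral>x. H x \<partial>\<sigma>) \<le> ?V"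
    by (rule ennreal_le_epsilon) (rule ge)
  with le have V: "?V = ennreal (\<integral>x. H x \<partial>\<sigma>)" by (rule antisym)
  have "(\<integral>x. H x \<partial>\<sigma>) \<ge> 0" using H0 by simp
  then show ?thesis unfolding total_variation_def V unfolding H_def by (rule enn2real_ennreal)
qed

section \<open>The gradient measure of a function of bounded variation of higher order\<close>

lemma lebesgue_set_integral_eq_lborel:
  fixes h k :: "real ^ 'n::finite \<Rightarrow> real"
  assumes k [measurable]: "k \<in> borel_measurable borel" and A [measurable]: "A \<in> sets borel"
    and ae: "AE x in lborel. x \<in> A \<longrightarrow> h x = k x"
  shows "(LINT x:A|lebesgue. h x) = (\<integral>x. indicator A x * k x \<partial>lborel)"
    and "set_integrable lebesgue A h \<longleftrightarrow> integrable lborel (\<lambda>x. indicator A x * k x)"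
proof -
  have m: "(\<lambda>x. indicator A x * k x) \<in> borel_measurable lborel" by measurable
  have ae': "AE x in lebesgue. indicator A x * k x = indicator A x *\<^sub>R h x"
    using AE_completion[OF ae] by (rule eventually_mono) (auto simp: indicator_def)
  have m1: "(\<lambda>x. indicator A x * k x) \<in> borel_measurable lebesgue" using measurable_completion[OF m] .
  have m2: "(\<lambda>x. indicator A x *\<^sub>R h x) \<in> borel_measurable lebesgue"
    by (rule borel_measurable_AE[OF m1 ae'])
  show "(LINT x:A|lebesgue. h x) = (\<integral>x. indicator A x * k x \<partial>lborel)"
    unfolding set_lebesgue_integral_def
    using integral_cong_AE[OF m1 m2 ae'] integral_completion[OF m] by simp
  show "set_integrable lebesgue A h \<longleftrightarrow> integrable lborel (\<lambda>x. indicator A x * k x)"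
    unfolding set_integrable_def
    using integrable_cong_AE[OF m1 m2 ae'] integrable_completion[OF m] by simp
qed

lemma lebesgue_set_integral_mult:
  fixes h k g :: "real ^ 'n::finite \<Rightarrow> real"
  assumes \<Omega>: "\<Omega> \<in> sets borel" and k: "k \<in> borel_measurable borel" "\<forall>x. x \<notin> \<Omega> \<longrightarrow> k x = 0"
    and ae: "AE x in lborel. x \<in> \<Omega> \<longrightarrow> h x = k x" and g: "g \<in> borel_measurable borel"
  shows "(LINT x:\<Omega>|lebesgue. h x * g x) = (\<integral>x. k x * g x \<partial>lborel)"
proof -
  have "AE x in lborel. x \<in> \<Omega> \<longrightarrow> h x * g x = k x * g x" using ae by (rule eventually_mono) auto
  then have "(LINT x:\<Omega>|lebesgue. h x * g x) = (\<integral>x. indicator \<Omega> x * (k x * g x) \<partial>lborel)"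
    using k(1) g by (intro lebesgue_set_integral_eq_lborel(1) \<Omega>) auto
  also have "\<dots> = (\<integral>x. k x * g x \<partial>lborel)"
    using k(2) by (intro Bochner_Integration.integral_cong) (auto simp: indicator_def)
  finally show ?thesis .
qed

lemma borel_representative:
  fixes a :: "real ^ 'n::finite \<Rightarrow> real"
  assumes a: "set_integrable lebesgue \<Omega> a" and \<Omega>: "\<Omega> \<in> sets borel"
  shows "\<exists>b. b \<in> borel_measurable borel \<and> integrable lborel b \<and> (\<forall>x. x \<notin> \<Omega> \<longrightarrow> b x = 0) \<and>
    (AE x in lborel. x \<in> \<Omega> \<longrightarrow> a x = b x)"
proof -
  have "(\<lambda>x. indicator \<Omega> x *\<^sub>R a x) \<in> borel_measurable lebesgue"
    using a unfolding set_integrable_def by auto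
  from completion_ex_borel_measurable_real[OF this]
  obtain g where g: "g \<in> borel_measurable lborel" "AE x in lborel. indicator \<Omega> x *\<^sub>R a x = g x" by blast
  define b where "b x = indicator \<Omega> x * g x" for x
  have b: "b \<in> borel_measurable borel" unfolding b_def[abs_def] using g(1) \<Omega> by measurable
  have ae: "AE x in lborel. x \<in> \<Omega> \<longrightarrow> a x = b x"
    using g(2) by (rule eventually_mono) (auto simp: b_def indicator_def)
  have "integrable lborel (\<lambda>x. indicator \<Omega> x * b x)"
    using lebesgue_set_integral_eq_lborel(2)[OF b \<Omega> ae] a by simp
  also have "(\<lambda>x. indicator \<Omega> x * b x) = b" by (simp add: b_def fun_eq_iff indicator_def)
  finally have ib: "integrable lborel b" .
  show ?thesis by (intro exI[of _ b] conjI b ib ae) (simp add: b_def)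
qed

lemma signed_measure_additive:
  assumes "finite_signed_measure \<Omega> s" and \<Omega>: "\<Omega> \<in> sets borel"
    and A: "A \<in> sets borel" "A \<subseteq> \<Omega>" and B: "B \<in> sets borel" "B \<subseteq> \<Omega>" and "A \<inter> B = {}"
  shows "s (A \<union> B) = s A + s B"
proof -
  obtain P N where PN: "finite_measure P" "finite_measure N" "sets P = sets (restrict_space borel \<Omega>)"
    "sets N = sets (restrict_space borel \<Omega>)" "\<And>B. B \<in> sets (restrict_space borel \<Omega>) \<Longrightarrow> s B = measure P B - measure N B"
    using assms(1) unfolding finite_signed_measure_def signed_decomp_def by blast
  have r: "C \<in> sets (restrict_space borel \<Omega>) \<longleftrightarrow> C \<in> sets borel \<and> C \<subseteq> \<Omega>" for C
    using \<Omega> by (auto simp: sets_restrict_space_iff)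
  interpret P: finite_measure P by fact
  interpret N: finite_measure N by fact
  have "measure P (A \<union> B) = measure P A + measure P B"
    using A B assms(7) PN(3) r by (intro P.finite_measure_Union) auto
  moreover have "measure N (A \<union> B) = measure N A + measure N B"
    using A B assms(7) PN(4) r by (intro N.finite_measure_Union) auto
  ultimately show ?thesis using A B PN(5) r by simp
qed

text \<open>
  The measure \<open>\<sigma>\<close> dominates Lebesgue measure on \<open>\<Omega>\<close>, whose density is \<open>f None\<close>, and the components of
  the gradient of \<open>u\<close>, whose densities are \<open>f (Some \<nu>)\<close>.  Since \<open>sqrt (1 + \<bar>v\<bar>\<^sup>2)\<close> is the norm of \<open>(1, v)\<close>,
  adjoining Lebesgue measure to the gradient as one more component turns the area into a total variation;
  area and variation can then be treated as the mass of \<open>f \<sigma>\<close> over different sets of components.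
\<close>

locale gradient_density = finite_borel_on \<sigma> \<Omega> for \<sigma> :: "(real ^ 'n::finite) measure" and \<Omega> +
  fixes m :: nat and u :: "real ^ 'n \<Rightarrow> real" and f :: "('n \<Rightarrow> nat) option \<Rightarrow> real ^ 'n \<Rightarrow> real"
  assumes density_measurable: "i \<in> insert None (Some ` midx m) \<Longrightarrow> f i \<in> borel_measurable borel"
    and density_integrable: "i \<in> insert None (Some ` midx m) \<Longrightarrow> integrable \<sigma> (f i)"
    and lebesgue_density_nonneg: "0 \<le> f None x"
    and lebesgue_density: "density \<sigma> (\<lambda>x. ennreal (f None x)) = density lborel (indicator \<Omega>)"
    and grad_measure_density: "\<nu> \<in> midx m \<Longrightarrow> B \<in> sets borel \<Longrightarrow> B \<subseteq> \<Omega> \<Longrightarrow>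
      grad_measure \<Omega> u \<nu> B = (\<integral>x. indicator B x * f (Some \<nu>) x \<partial>\<sigma>)"
    and grad_test_density: "\<nu> \<in> midx m \<Longrightarrow> smooth_supported \<Omega> \<psi> \<Longrightarrow>
      (LINT x:\<Omega>|lebesgue. u x * multi_deriv \<nu> \<psi> x) = (-1) ^ m * (\<integral>x. \<psi> x * f (Some \<nu>) x \<partial>\<sigma>)"
begin

lemma domain_borel [measurable]: "\<Omega> \<in> sets borel"
  using open_domain by simp

lemma measurable_f0 [measurable]: "f None \<in> borel_measurable borel"
  by (rule density_measurable) simp

lemma lebesgue_integral_density:
  fixes g :: "real ^ 'n \<Rightarrow> real"
  assumes [measurable]: "g \<in> borel_measurable borel"
  shows "(\<integral>x. f None x * g x \<partial>\<sigma>) = (\<integral>x. indicator \<Omega> x * g x \<partial>lborel)"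
    and "integrable \<sigma> (\<lambda>x. f None x * g x) \<longleftrightarrow> integrable lborel (\<lambda>x. indicator \<Omega> x * g x)"
proof -
  have "(\<integral>x. f None x * g x \<partial>\<sigma>) = (\<integral>x. g x \<partial>density \<sigma> (\<lambda>x. ennreal (f None x)))"
    using lebesgue_density_nonneg by (subst integral_density) auto
  also have "\<dots> = (\<integral>x. indicator \<Omega> x * g x \<partial>lborel)"
    unfolding lebesgue_density by (rule integral_restricted_lebesgue) measurable
  finally show "(\<integral>x. f None x * g x \<partial>\<sigma>) = (\<integral>x. indicator \<Omega> x * g x \<partial>lborel)" .
  have "integrable \<sigma> (\<lambda>x. f None x * g x) \<longleftrightarrow> integrable (density \<sigma> (\<lambda>x. ennreal (f None x))) g"
    using lebesgue_density_nonneg by (subst integrable_density) auto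
  also have "\<dots> \<longleftrightarrow> integrable lborel (\<lambda>x. indicator \<Omega> x * g x)"
    unfolding lebesgue_density by (rule integral_restricted_lebesgue) measurable
  finally show "integrable \<sigma> (\<lambda>x. f None x * g x) \<longleftrightarrow> integrable lborel (\<lambda>x. indicator \<Omega> x * g x)" .
qed

text \<open>
  This separates the two parts of a Lebesgue decomposition: on a null set carrying the singular part the
  component \<open>f None\<close> vanishes, so that there the area element is the variation.
\<close>

lemma lebesgue_density_zero_on_null:
  assumes "Z \<in> null_sets lborel"
  shows "AE x in \<sigma>. x \<in> Z \<longrightarrow> f None x = 0"
proof -
  have Z [measurable]: "Z \<in> sets borel" using assms by auto
  have iz: "integrable \<sigma> (\<lambda>x. f None x * indicator Z x)"
    using integrable_mult_indicator[of Z \<sigma> "f None"] density_integrable[of None] Z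
    by (simp add: sets_eq mult.commute)
  have ae: "AE x in lborel. indicator \<Omega> x * indicator Z x = (0::real)"
    using AE_not_in[OF assms] by (rule eventually_mono) auto
  have "(\<integral>x. f None x * indicator Z x \<partial>\<sigma>) = (\<integral>x. indicator \<Omega> x * indicator Z x \<partial>lborel)"
    by (rule lebesgue_integral_density) measurable
  also have "\<dots> = 0" by (rule integral_eq_zero_AE[OF ae])
  finally have "AE x in \<sigma>. f None x * indicator Z x = 0"
    using iz lebesgue_density_nonneg by (subst (asm) integral_nonneg_eq_0_iff_AE) auto
  then show ?thesis by (rule eventually_mono) auto
qed

lemma integrable_indicator_mult:
  fixes g :: "real ^ 'n \<Rightarrow> real"
  assumes "integrable \<sigma> g" "B \<in> sets borel"
  shows "integrable \<sigma> (\<lambda>x. indicator B x * g x)"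
  using integrable_mult_indicator[OF _ assms(1), of B] assms(2) by (simp add: sets_eq)

text \<open>
  Let \<open>Z\<close> be a null set carrying the singular part.  Off \<open>Z\<close> the gradient has a density \<open>b\<close> with respect
  to Lebesgue measure, \<open>f (Some \<nu>) = f None * b \<nu>\<close>, and the norm of \<open>f\<close> is \<open>f None * sqrt (1 + \<bar>b\<bar>\<^sup>2)\<close>.
  On \<open>Z\<close> the component \<open>f None\<close> vanishes and the norm of \<open>f\<close> is that of the singular part.
\<close>

lemma area_of_decomposition:
  assumes dec: "lebesgue_decomp (midx m) \<Omega> (grad_measure \<Omega> u) a s"
  shows "(LINT x:\<Omega>|lebesgue. sqrt (1 + (L2_set (\<lambda>\<nu>. a \<nu> x) (midx m))\<^sup>2)) + total_variation (midx m) s \<Omega>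
    = (\<integral>x. L2_set (\<lambda>i. f i x) (insert None (Some ` midx m)) \<partial>\<sigma>)"
proof -
  let ?I = "midx m :: ('n \<Rightarrow> nat) set"
  have I: "finite ?I" by (rule finite_midx)
  have ai: "\<And>\<nu>. \<nu> \<in> ?I \<Longrightarrow> set_integrable lebesgue \<Omega> (a \<nu>)"
    and sfin: "\<And>\<nu>. \<nu> \<in> ?I \<Longrightarrow> finite_signed_measure \<Omega> (s \<nu>)"
    and ex: "\<And>\<nu>. \<nu> \<in> ?I \<Longrightarrow> \<exists>Z\<in>null_sets lborel. \<forall>B\<in>sets (restrict_space borel \<Omega>). B \<inter> Z = {} \<longrightarrow> s \<nu> B = 0"
    and deq: "\<And>\<nu> B. \<nu> \<in> ?I \<Longrightarrow> B \<in> sets (restrict_space borel \<Omega>) \<Longrightarrow> grad_measure \<Omega> u \<nu> B = (LINT x:B|lebesgue. a \<nu> x) + s \<nu> B"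
    using dec unfolding lebesgue_decomp_def by auto
  have r: "C \<in> sets (restrict_space borel \<Omega>) \<longleftrightarrow> C \<in> sets borel \<and> C \<subseteq> \<Omega>" for C
    by (auto simp: sets_restrict_space_iff)
  have "\<forall>\<nu>\<in>?I. \<exists>Z. Z \<in> null_sets lborel \<and> (\<forall>B. B \<in> sets borel \<and> B \<subseteq> \<Omega> \<and> B \<inter> Z = {} \<longrightarrow> s \<nu> B = 0)"
  proof
    fix \<nu> assume "\<nu> \<in> ?I"
    from ex[OF this] obtain Z where "Z \<in> null_sets lborel" "\<And>B. B \<in> sets (restrict_space borel \<Omega>) \<Longrightarrow> B \<inter> Z = {} \<Longrightarrow> s \<nu> B = 0" by auto
    then show "\<exists>Z. Z \<in> null_sets lborel \<and> (\<forall>B. B \<in> sets borel \<and> B \<subseteq> \<Omega> \<and> B \<inter> Z = {} \<longrightarrow> s \<nu> B = 0)"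
      using r by (intro exI[of _ Z]) auto
  qed
  from bchoice[OF this] obtain Zn where
    ZZ: "\<forall>\<nu>\<in>?I. Zn \<nu> \<in> null_sets lborel \<and> (\<forall>B. B \<in> sets borel \<and> B \<subseteq> \<Omega> \<and> B \<inter> Zn \<nu> = {} \<longrightarrow> s \<nu> B = 0)" ..
  have Zn: "Zn \<nu> \<in> null_sets lborel" "B \<in> sets borel \<Longrightarrow> B \<subseteq> \<Omega> \<Longrightarrow> B \<inter> Zn \<nu> = {} \<Longrightarrow> s \<nu> B = 0"
    if "\<nu> \<in> ?I" for \<nu> B
    using bspec[OF ZZ that] by simp_all
  define Z where "Z = (\<Union>\<nu>\<in>?I. Zn \<nu>)"
  have Z: "Z \<in> null_sets lborel" unfolding Z_def using I Zn by (intro null_sets.finite_UN) auto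
  then have Zb [measurable]: "Z \<in> sets borel" by auto
  have Zs: "s \<nu> B = 0" if "\<nu> \<in> ?I" "B \<in> sets borel" "B \<subseteq> \<Omega>" "B \<inter> Z = {}" for \<nu> B
  proof (rule Zn(2)[OF that(1-3)])
    have "Zn \<nu> \<subseteq> Z" using that(1) by (auto simp: Z_def)
    then show "B \<inter> Zn \<nu> = {}" using that(4) by blast
  qed
  have "\<forall>\<nu>\<in>?I. \<exists>b. b \<in> borel_measurable borel \<and> integrable lborel b \<and> (\<forall>x. x \<notin> \<Omega> \<longrightarrow> b x = 0) \<and>
    (AE x in lborel. x \<in> \<Omega> \<longrightarrow> a \<nu> x = b x)"
    by (intro ballI borel_representative[OF ai domain_borel])
  from bchoice[OF this] obtain b where bb: "\<forall>\<nu>\<in>?I. b \<nu> \<in> borel_measurable borel \<and> integrable lborel (b \<nu>) \<and>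
    (\<forall>x. x \<notin> \<Omega> \<longrightarrow> b \<nu> x = 0) \<and> (AE x in lborel. x \<in> \<Omega> \<longrightarrow> a \<nu> x = b \<nu> x)" ..
  have b: "b \<nu> \<in> borel_measurable borel" "integrable lborel (b \<nu>)" "x \<notin> \<Omega> \<Longrightarrow> b \<nu> x = 0"
    "AE x in lborel. x \<in> \<Omega> \<longrightarrow> a \<nu> x = b \<nu> x" if "\<nu> \<in> ?I" for \<nu> x
    using bspec[OF bb that] by simp_all
  note [measurable] = b(1)
  have fm [measurable]: "f (Some \<nu>) \<in> borel_measurable borel" if "\<nu> \<in> ?I" for \<nu>
    using that by (intro density_measurable) auto
  have fi: "integrable \<sigma> (f (Some \<nu>))" if "\<nu> \<in> ?I" for \<nu>
    using that by (intro density_integrable) auto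
  have ib: "integrable \<sigma> (\<lambda>x. f None x * b \<nu> x)" if "\<nu> \<in> ?I" for \<nu>
  proof -
    have "(\<lambda>x. indicator \<Omega> x * b \<nu> x) = b \<nu>" using b(3)[OF that] by (auto simp: fun_eq_iff indicator_def)
    then show ?thesis using lebesgue_integral_density(2)[OF b(1)[OF that]] b(2)[OF that] by simp
  qed
  have ab: "(LINT x:B|lebesgue. a \<nu> x) = (\<integral>x. f None x * (indicator B x * b \<nu> x) \<partial>\<sigma>)"
    if nu: "\<nu> \<in> ?I" and B [measurable]: "B \<in> sets borel" and BO: "B \<subseteq> \<Omega>" for \<nu> B
  proof -
    have "AE x in lborel. x \<in> B \<longrightarrow> a \<nu> x = b \<nu> x"
      using b(4)[OF nu] by (rule eventually_mono) (use BO in auto)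
    then have "(LINT x:B|lebesgue. a \<nu> x) = (\<integral>x. indicator B x * b \<nu> x \<partial>lborel)"
      using nu by (intro lebesgue_set_integral_eq_lborel) auto
    also have "\<dots> = (\<integral>x. indicator \<Omega> x * (indicator B x * b \<nu> x) \<partial>lborel)"
      using BO by (intro Bochner_Integration.integral_cong) (auto simp: indicator_def)
    also have "\<dots> = (\<integral>x. f None x * (indicator B x * b \<nu> x) \<partial>\<sigma>)"
      using nu by (intro lebesgue_integral_density[symmetric]) measurable
    finally show ?thesis .
  qed
  have off: "AE x in \<sigma>. x \<notin> Z \<longrightarrow> f (Some \<nu>) x = f None x * b \<nu> x" if nu: "\<nu> \<in> ?I" for \<nu>
  proof -
    let ?C = "\<Omega> - Z"
    have C: "?C \<in> sets borel" by measurable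
    have "AE x in \<sigma>. indicator ?C x * f (Some \<nu>) x = indicator ?C x * (f None x * b \<nu> x)"
    proof (rule density_unique_real)
      show "integrable \<sigma> (\<lambda>x. indicator ?C x * f (Some \<nu>) x)" by (rule integrable_indicator_mult[OF fi[OF nu] C])
      show "integrable \<sigma> (\<lambda>x. indicator ?C x * (f None x * b \<nu> x))" by (rule integrable_indicator_mult[OF ib[OF nu] C])
      fix A assume "A \<in> sets \<sigma>"
      then have A: "A \<inter> ?C \<in> sets borel" using C by (auto simp: sets_eq)
      have "(\<integral>x\<in>A. indicator ?C x * f (Some \<nu>) x \<partial>\<sigma>) = (\<integral>x. indicator (A \<inter> ?C) x * f (Some \<nu>) x \<partial>\<sigma>)"
        unfolding set_lebesgue_integral_def by (intro Bochner_Integration.integral_cong) (auto simp: indicator_def)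
      also have "\<dots> = grad_measure \<Omega> u \<nu> (A \<inter> ?C)" using A nu by (intro grad_measure_density[symmetric]) auto
      also have "\<dots> = (LINT x:A \<inter> ?C|lebesgue. a \<nu> x)"
      proof -
        have sub: "A \<inter> ?C \<subseteq> \<Omega>" "A \<inter> ?C \<inter> Z = {}" by auto
        then have "A \<inter> ?C \<in> sets (restrict_space borel \<Omega>)" using A r by blast
        from deq[OF nu this] Zs[OF nu A sub] show ?thesis by simp
      qed
      also have "\<dots> = (\<integral>x. f None x * (indicator (A \<inter> ?C) x * b \<nu> x) \<partial>\<sigma>)" using A by (intro ab nu) auto
      also have "\<dots> = (\<integral>x\<in>A. indicator ?C x * (f None x * b \<nu> x) \<partial>\<sigma>)"
        unfolding set_lebesgue_integral_def by (intro Bochner_Integration.integral_cong) (auto simp: indicator_def)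
      finally show "(\<integral>x\<in>A. indicator ?C x * f (Some \<nu>) x \<partial>\<sigma>) = (\<integral>x\<in>A. indicator ?C x * (f None x * b \<nu> x) \<partial>\<sigma>)" .
    qed
    with AE_in_domain show ?thesis by eventually_elim (auto simp: indicator_def)
  qed
  have on: "AE x in \<sigma>. x \<in> Z \<longrightarrow> f None x = 0" by (rule lebesgue_density_zero_on_null[OF Z])
  \<comment> \<open>The singular part lives on \<open>Z\<close>, and the absolutely continuous part does not charge it.\<close>
  have sing: "s \<nu> B = (\<integral>x. indicator B x * (indicator Z x * f (Some \<nu>) x) \<partial>\<sigma>)"
    if nu: "\<nu> \<in> ?I" and B: "B \<in> sets borel" "B \<subseteq> \<Omega>" for \<nu> B
  proof -
    have BZ: "B \<inter> Z \<in> sets borel" "B - Z \<in> sets borel" using B by auto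
    have "s \<nu> ((B \<inter> Z) \<union> (B - Z)) = s \<nu> (B \<inter> Z) + s \<nu> (B - Z)"
      using B BZ by (intro signed_measure_additive[OF sfin[OF nu] domain_borel]) auto
    also have "(B \<inter> Z) \<union> (B - Z) = B" by auto
    also have "s \<nu> (B - Z) = 0" using B BZ by (intro Zs nu) auto
    finally have "s \<nu> B = grad_measure \<Omega> u \<nu> (B \<inter> Z) - (LINT x:B \<inter> Z|lebesgue. a \<nu> x)"
    proof -
      assume e: "s \<nu> B = s \<nu> (B \<inter> Z) + 0"
      have "B \<inter> Z \<in> sets (restrict_space borel \<Omega>)" using BZ(1) B(2) r by blast
      from deq[OF nu this] e show ?thesis by simp
    qed
    also have "(LINT x:B \<inter> Z|lebesgue. a \<nu> x) = (\<integral>x. f None x * (indicator (B \<inter> Z) x * b \<nu> x) \<partial>\<sigma>)"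
      using BZ B by (intro ab nu) auto
    also have "\<dots> = 0"
      by (rule integral_eq_zero_AE) (use on in \<open>auto elim!: eventually_mono simp: indicator_def\<close>)
    also have "grad_measure \<Omega> u \<nu> (B \<inter> Z) = (\<integral>x. indicator (B \<inter> Z) x * f (Some \<nu>) x \<partial>\<sigma>)"
      using BZ B nu by (intro grad_measure_density) auto
    also have "\<dots> = (\<integral>x. indicator B x * (indicator Z x * f (Some \<nu>) x) \<partial>\<sigma>)"
      by (intro Bochner_Integration.integral_cong) (auto simp: indicator_def)
    finally show ?thesis by simp
  qed
  have iZ: "integrable \<sigma> (\<lambda>x. indicator Z x * f (Some \<nu>) x)" if "\<nu> \<in> ?I" for \<nu>
    by (rule integrable_indicator_mult[OF fi[OF that] Zb])
  have TV: "total_variation ?I s \<Omega> = (\<integral>x. L2_set (\<lambda>\<nu>. indicator Z x * f (Some \<nu>) x) ?I \<partial>\<sigma>)"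
    by (rule total_variation_density[OF finite_borel_on_axioms I iZ sing])
  let ?q = "\<lambda>x. sqrt (1 + (L2_set (\<lambda>\<nu>. b \<nu> x) ?I)\<^sup>2)"
  have qm [measurable]: "?q \<in> borel_measurable borel" by measurable
  have "AE x in lborel. \<forall>\<nu>\<in>?I. x \<in> \<Omega> \<longrightarrow> a \<nu> x = b \<nu> x"
    using b(4) I by (intro AE_finite_allI) auto
  then have "AE x in lborel. x \<in> \<Omega> \<longrightarrow> sqrt (1 + (L2_set (\<lambda>\<nu>. a \<nu> x) ?I)\<^sup>2) = ?q x"
    by (rule eventually_mono) (auto cong: L2_set_cong)
  then have "(LINT x:\<Omega>|lebesgue. sqrt (1 + (L2_set (\<lambda>\<nu>. a \<nu> x) ?I)\<^sup>2)) = (\<integral>x. indicator \<Omega> x * ?q x \<partial>lborel)"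
    by (intro lebesgue_set_integral_eq_lborel(1)) auto
  also have "\<dots> = (\<integral>x. f None x * ?q x \<partial>\<sigma>)" by (rule lebesgue_integral_density(1)[symmetric]) measurable
  finally have AC: "(LINT x:\<Omega>|lebesgue. sqrt (1 + (L2_set (\<lambda>\<nu>. a \<nu> x) ?I)\<^sup>2)) = (\<integral>x. f None x * ?q x \<partial>\<sigma>)" .
  have L2ins: "L2_set (\<lambda>i. f i x) (insert None (Some ` ?I)) = sqrt ((f None x)\<^sup>2 + (L2_set (\<lambda>\<nu>. f (Some \<nu>) x) ?I)\<^sup>2)" for x
    using I by (simp add: L2_set_def sum.reindex sum_nonneg)
  have iq: "integrable \<sigma> (\<lambda>x. f None x * ?q x)"
  proof (rule Bochner_Integration.integrable_bound)
    show "integrable \<sigma> (\<lambda>x. f None x + (\<Sum>\<nu>\<in>?I. \<bar>f None x * b \<nu> x\<bar>))"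
      using density_integrable[of None] ib by auto
    show "AE x in \<sigma>. norm (f None x * ?q x) \<le> norm (f None x + (\<Sum>\<nu>\<in>?I. \<bar>f None x * b \<nu> x\<bar>))"
    proof (rule AE_I2)
      fix x
      have "?q x \<le> 1 + L2_set (\<lambda>\<nu>. b \<nu> x) ?I"
        by (intro real_le_lsqrt) (auto simp: power2_sum add_nonneg_nonneg)
      also have "\<dots> \<le> 1 + (\<Sum>\<nu>\<in>?I. \<bar>b \<nu> x\<bar>)" by (intro add_left_mono L2_set_le_sum_abs)
      finally have "f None x * ?q x \<le> f None x * (1 + (\<Sum>\<nu>\<in>?I. \<bar>b \<nu> x\<bar>))"
        using lebesgue_density_nonneg by (intro mult_left_mono)
      also have "\<dots> = f None x + (\<Sum>\<nu>\<in>?I. \<bar>f None x * b \<nu> x\<bar>)"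
        using lebesgue_density_nonneg[of x] by (simp add: distrib_left sum_distrib_left abs_mult)
      finally show "norm (f None x * ?q x) \<le> norm (f None x + (\<Sum>\<nu>\<in>?I. \<bar>f None x * b \<nu> x\<bar>))"
        using lebesgue_density_nonneg[of x] by (simp add: sum_nonneg add_nonneg_nonneg)
    qed
  qed measurable
  have iZL: "integrable \<sigma> (\<lambda>x. L2_set (\<lambda>\<nu>. indicator Z x * f (Some \<nu>) x) ?I)"
    by (rule integrable_L2_set[OF iZ])
  have "(\<integral>x. f None x * ?q x \<partial>\<sigma>) + total_variation ?I s \<Omega>
      = (\<integral>x. f None x * ?q x + L2_set (\<lambda>\<nu>. indicator Z x * f (Some \<nu>) x) ?I \<partial>\<sigma>)"
    unfolding TV using iq iZL by simp
  also have "\<dots> = (\<integral>x. L2_set (\<lambda>i. f i x) (insert None (Some ` ?I)) \<partial>\<sigma>)"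
  proof (rule integral_cong_AE)
    show "(\<lambda>x. f None x * ?q x + L2_set (\<lambda>\<nu>. indicator Z x * f (Some \<nu>) x) ?I) \<in> borel_measurable \<sigma>"
      using iq iZL by auto
    show "(\<lambda>x. L2_set (\<lambda>i. f i x) (insert None (Some ` ?I))) \<in> borel_measurable \<sigma>"
      using density_integrable by (intro borel_measurable_integrable integrable_L2_set) auto
    have "AE x in \<sigma>. \<forall>\<nu>\<in>?I. x \<notin> Z \<longrightarrow> f (Some \<nu>) x = f None x * b \<nu> x"
      using off I by (intro AE_finite_allI) auto
    with on show "AE x in \<sigma>. f None x * ?q x + L2_set (\<lambda>\<nu>. indicator Z x * f (Some \<nu>) x) ?I
        = L2_set (\<lambda>i. f i x) (insert None (Some ` ?I))"
    proof eventually_elim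
      case (elim x)
      show ?case
      proof (cases "x \<in> Z")
        case True
        then show ?thesis using elim unfolding L2ins by simp
      next
        case False
        have "L2_set (\<lambda>\<nu>. f (Some \<nu>) x) ?I = L2_set (\<lambda>\<nu>. f None x * b \<nu> x) ?I"
          using elim False by (intro L2_set_cong) auto
        also have "\<dots> = f None x * L2_set (\<lambda>\<nu>. b \<nu> x) ?I"
          using lebesgue_density_nonneg[of x] by (simp add: L2_set_right_distrib)
        finally have "(f None x)\<^sup>2 + (L2_set (\<lambda>\<nu>. f (Some \<nu>) x) ?I)\<^sup>2 = (f None x)\<^sup>2 * (1 + (L2_set (\<lambda>\<nu>. b \<nu> x) ?I)\<^sup>2)"
          by (simp add: power_mult_distrib distrib_left)
        then show ?thesis
          unfolding L2ins using False lebesgue_density_nonneg[of x] by (simp add: real_sqrt_mult L2_set_0')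
      qed
    qed
  qed
  finally show ?thesis using AC by simp
qed

text \<open>
  The zero set of \<open>f None\<close> in \<open>\<Omega>\<close> is a null set, and off it the gradient is absolutely continuous.
\<close>

lemma decomposition_exists:
  "\<exists>a s. lebesgue_decomp (midx m) \<Omega> (grad_measure \<Omega> u) a s"
proof -
  define Z where "Z = {x \<in> \<Omega>. f None x = 0}"
  have Zb [measurable]: "Z \<in> sets borel" unfolding Z_def by measurable
  have Z: "Z \<in> null_sets lborel"
  proof (rule null_setsI)
    have "emeasure (density lborel (indicator \<Omega>)) Z = (\<integral>\<^sup>+x. indicator \<Omega> x * indicator Z x \<partial>lborel)"
      by (rule emeasure_density) (auto intro!: borel_measurable_indicator)
    also have "\<dots> = (\<integral>\<^sup>+x. indicator Z x \<partial>lborel)"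
      by (intro nn_integral_cong) (auto simp: indicator_def Z_def)
    finally have "emeasure lborel Z = emeasure (density \<sigma> (\<lambda>x. ennreal (f None x))) Z"
      by (simp add: lebesgue_density)
    also have "\<dots> = (\<integral>\<^sup>+x. ennreal (f None x) * indicator Z x \<partial>\<sigma>)"
      by (rule emeasure_density) (auto simp: sets_eq)
    also have "\<dots> = (\<integral>\<^sup>+x. 0 \<partial>\<sigma>)" by (intro nn_integral_cong) (auto simp: indicator_def Z_def)
    finally show "emeasure lborel Z = 0" by simp
  qed simp
  \<comment> \<open>On \<open>Z\<close> the quotient is 0 by convention.\<close>
  define a where "a \<nu> x = f (Some \<nu>) x / f None x" for \<nu> x
  define s where "s \<nu> B = (\<integral>x. indicator B x * (indicator Z x * f (Some \<nu>) x) \<partial>\<sigma>)" for \<nu> B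
  have "lebesgue_decomp (midx m) \<Omega> (grad_measure \<Omega> u) a s"
    unfolding lebesgue_decomp_def
  proof (intro ballI conjI)
    fix \<nu> :: "'n \<Rightarrow> nat" assume nu: "\<nu> \<in> midx m"
    have fm [measurable]: "f (Some \<nu>) \<in> borel_measurable borel" using nu by (intro density_measurable) auto
    have fi: "integrable \<sigma> (f (Some \<nu>))" using nu by (intro density_integrable) auto
    have am [measurable]: "a \<nu> \<in> borel_measurable borel" unfolding a_def[abs_def] by measurable
    have i1: "integrable \<sigma> (\<lambda>x. f None x * a \<nu> x)"
      by (rule Bochner_Integration.integrable_bound[OF fi]) (auto simp: a_def)
    have lq: "(LINT x:B|lebesgue. a \<nu> x) = (\<integral>x. f None x * (indicator B x * a \<nu> x) \<partial>\<sigma>)"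
      if [measurable]: "B \<in> sets borel" and BO: "B \<subseteq> \<Omega>" for B
    proof -
      have "(LINT x:B|lebesgue. a \<nu> x) = (\<integral>x. indicator B x * a \<nu> x \<partial>lborel)"
        by (intro lebesgue_set_integral_eq_lborel) auto
      also have "\<dots> = (\<integral>x. indicator \<Omega> x * (indicator B x * a \<nu> x) \<partial>lborel)"
        using BO by (intro Bochner_Integration.integral_cong) (auto simp: indicator_def)
      also have "\<dots> = (\<integral>x. f None x * (indicator B x * a \<nu> x) \<partial>\<sigma>)"
        by (intro lebesgue_integral_density[symmetric]) measurable
      finally show ?thesis .
    qed
    have "integrable lborel (\<lambda>x. indicator \<Omega> x * a \<nu> x)"
      using i1 lebesgue_integral_density(2)[OF am] by simp
    then show "set_integrable lebesgue \<Omega> (a \<nu>)"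
      using lebesgue_set_integral_eq_lborel(2)[OF am domain_borel, of "a \<nu>"] by simp
    have iZ: "integrable \<sigma> (\<lambda>x. indicator Z x * f (Some \<nu>) x)" by (rule integrable_indicator_mult[OF fi Zb])
    show "finite_signed_measure \<Omega> (s \<nu>)"
    proof -
      define M where "M g = restrict_space (density \<sigma> (\<lambda>x. ennreal (g x))) \<Omega>" for g :: "real ^ 'n \<Rightarrow> real"
      have r: "C \<in> sets (restrict_space borel \<Omega>) \<longleftrightarrow> C \<in> sets borel \<and> C \<subseteq> \<Omega>" for C
        by (auto simp: sets_restrict_space_iff)
      have M: "finite_measure (M g)" "sets (M g) = sets (restrict_space borel \<Omega>)"
        "\<And>B. B \<in> sets (restrict_space borel \<Omega>) \<Longrightarrow> measure (M g) B = (\<integral>x. indicator B x * g x \<partial>\<sigma>)"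
        if g: "integrable \<sigma> g" "\<And>x. 0 \<le> g x" for g
      proof -
        have gm [measurable]: "g \<in> borel_measurable \<sigma>" using g by auto
        show s: "sets (M g) = sets (restrict_space borel \<Omega>)"
          unfolding M_def by (rule sets_restrict_space_cong) (simp add: sets_eq)
        have em: "emeasure (M g) B = ennreal (\<integral>x. indicator B x * g x \<partial>\<sigma>)" if B: "B \<in> sets (restrict_space borel \<Omega>)" for B
        proof -
          have B': "B \<in> sets borel" "B \<subseteq> \<Omega>" using B r by auto
          have "emeasure (M g) B = emeasure (density \<sigma> (\<lambda>x. ennreal (g x))) B"
            unfolding M_def using B' by (intro emeasure_restrict_space) (auto simp: sets_eq)
          also have "\<dots> = (\<integral>\<^sup>+x. ennreal (indicator B x * g x) \<partial>\<sigma>)"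
            using B' by (subst emeasure_density) (auto simp: sets_eq indicator_def intro!: nn_integral_cong)
          also have "\<dots> = ennreal (\<integral>x. indicator B x * g x \<partial>\<sigma>)"
            using integrable_indicator_mult[OF g(1) B'(1)] g(2) by (intro nn_integral_eq_integral) auto
          finally show ?thesis .
        qed
        have "space (M g) = \<Omega>" unfolding M_def by (simp add: space_restrict_space)
        then have "emeasure (M g) (space (M g)) \<noteq> \<infinity>" using em[of \<Omega>] r by simp
        then show "finite_measure (M g)" by (rule finite_measureI)
        show "measure (M g) B = (\<integral>x. indicator B x * g x \<partial>\<sigma>)" if "B \<in> sets (restrict_space borel \<Omega>)" for B
          unfolding measure_def em[OF that] using g(2) by (intro enn2real_ennreal) simp
      qed
      define gp gn where "gp x = max 0 (indicator Z x * f (Some \<nu>) x)" and "gn x = max 0 (- (indicator Z x * f (Some \<nu>) x))" for x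
      have ig: "integrable \<sigma> gp" "integrable \<sigma> gn" unfolding gp_def gn_def using iZ by auto
      have g0: "0 \<le> gp x" "0 \<le> gn x" for x by (auto simp: gp_def gn_def)
      have "s \<nu> B = measure (M gp) B - measure (M gn) B" if B: "B \<in> sets (restrict_space borel \<Omega>)" for B
      proof -
        have Bb: "B \<in> sets borel" using B r by auto
        have "measure (M gp) B - measure (M gn) B = (\<integral>x. indicator B x * gp x - indicator B x * gn x \<partial>\<sigma>)"
          using M(3)[OF ig(1) g0(1) B] M(3)[OF ig(2) g0(2) B] integrable_indicator_mult[OF ig(1) Bb] integrable_indicator_mult[OF ig(2) Bb]
          by simp
        also have "\<dots> = s \<nu> B"
          unfolding s_def by (intro Bochner_Integration.integral_cong) (auto simp: gp_def gn_def max_def right_diff_distrib[symmetric])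
        finally show ?thesis by simp
      qed
      then show ?thesis
        unfolding finite_signed_measure_def signed_decomp_def
        using M[OF ig(1) g0(1)] M[OF ig(2) g0(2)] by blast
    qed
    show "\<exists>Z\<in>null_sets lborel. \<forall>B\<in>sets (restrict_space borel \<Omega>). B \<inter> Z = {} \<longrightarrow> s \<nu> B = 0"
    proof (intro bexI[OF _ Z] ballI impI)
      fix B assume "B \<inter> Z = {}"
      then have "indicator B x * (indicator Z x * f (Some \<nu>) x) = 0" for x by (auto simp: indicator_def)
      then show "s \<nu> B = 0" by (simp only: s_def) simp
    qed
    fix B assume "B \<in> sets (restrict_space borel \<Omega>)"
    then have B: "B \<in> sets borel" "B \<subseteq> \<Omega>" by (auto simp: sets_restrict_space_iff)
    have i2: "integrable \<sigma> (\<lambda>x. indicator B x * (indicator Z x * f (Some \<nu>) x))"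
      by (rule integrable_indicator_mult[OF iZ B(1)])
    have i3: "integrable \<sigma> (\<lambda>x. f None x * (indicator B x * a \<nu> x))"
      using integrable_indicator_mult[OF i1 B(1)] by (simp add: mult.left_commute)
    have "grad_measure \<Omega> u \<nu> B = (\<integral>x. indicator B x * f (Some \<nu>) x \<partial>\<sigma>)" by (rule grad_measure_density[OF nu B])
    also have "\<dots> = (\<integral>x. f None x * (indicator B x * a \<nu> x) + indicator B x * (indicator Z x * f (Some \<nu>) x) \<partial>\<sigma>)"
      using B by (intro Bochner_Integration.integral_cong) (auto simp: indicator_def Z_def a_def)
    also have "\<dots> = (LINT x:B|lebesgue. a \<nu> x) + s \<nu> B"
      unfolding lq[OF B] s_def using i2 i3 by simp
    finally show "grad_measure \<Omega> u \<nu> B = (LINT x:B|lebesgue. a \<nu> x) + s \<nu> B" .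
  qed
  then show ?thesis by blast
qed

lemma grad_area_eq: "grad_area m \<Omega> u = (\<integral>x. L2_set (\<lambda>i. f i x) (insert None (Some ` midx m)) \<partial>\<sigma>)"
proof -
  let ?P = "\<lambda>r. \<exists>a s. lebesgue_decomp (midx m) \<Omega> (grad_measure \<Omega> u) a s \<and>
     r = (LINT x:\<Omega>|lebesgue. sqrt (1 + (L2_set (\<lambda>i. a i x) (midx m))\<^sup>2)) + total_variation (midx m) s \<Omega>"
  have "\<exists>r. ?P r" using decomposition_exists by blast
  then have "?P (SOME r. ?P r)" by (rule someI_ex)
  then obtain a s where "lebesgue_decomp (midx m) \<Omega> (grad_measure \<Omega> u) a s"
    "(SOME r. ?P r) = (LINT x:\<Omega>|lebesgue. sqrt (1 + (L2_set (\<lambda>i. a i x) (midx m))\<^sup>2)) + total_variation (midx m) s \<Omega>" by blast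
  then show ?thesis
    unfolding grad_area_def area_measure_def using area_of_decomposition by simp
qed

end

text \<open>
  The measure \<open>\<sigma>\<close> is the sum of Lebesgue measure on \<open>\<Omega>\<close> and of the measures \<open>P\<close> and \<open>N\<close> in signed
  decompositions of all the components of the gradient.
\<close>

lemma gradient_density_exists:
  fixes u :: "real ^ 'n::finite \<Rightarrow> real"
  assumes \<Omega>: "open \<Omega>" "bounded \<Omega>" and u: "u \<in> BV_space m \<Omega>"
  shows "\<exists>\<sigma> f. gradient_density \<sigma> \<Omega> m u f"
proof -
  let ?I = "midx m :: ('n \<Rightarrow> nat) set"
  have \<Omega>b [measurable]: "\<Omega> \<in> sets borel" using \<Omega> by simp
  have r: "C \<in> sets (restrict_space borel \<Omega>) \<longleftrightarrow> C \<in> sets borel \<and> C \<subseteq> \<Omega>" for C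
    by (auto simp: sets_restrict_space_iff)
  have "is_deriv_measure \<Omega> \<nu> u (grad_measure \<Omega> u \<nu>)" if "\<nu> \<in> ?I" for \<nu>
    unfolding grad_measure_def
    by (rule someI_ex[of "is_deriv_measure \<Omega> \<nu> u"]) (use u that in \<open>simp add: BV_space_def\<close>)
  then have "\<forall>\<nu>\<in>?I. \<exists>p. signed_decomp \<Omega> (grad_measure \<Omega> u \<nu>) (fst p) (snd p) \<and>
      (\<forall>\<psi>. smooth_supported \<Omega> \<psi> \<longrightarrow> (LINT x:\<Omega>|lebesgue. u x * multi_deriv \<nu> \<psi> x) =
           (-1) ^ order_of \<nu> * ((LINT x|fst p. \<psi> x) - (LINT x|snd p. \<psi> x)))"
    unfolding is_deriv_measure_def smooth_supported_def split_paired_Ex fst_conv snd_conv by blast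
  from bchoice[OF this] obtain pn where pn: "\<forall>\<nu>\<in>?I. signed_decomp \<Omega> (grad_measure \<Omega> u \<nu>) (fst (pn \<nu>)) (snd (pn \<nu>)) \<and>
      (\<forall>\<psi>. smooth_supported \<Omega> \<psi> \<longrightarrow> (LINT x:\<Omega>|lebesgue. u x * multi_deriv \<nu> \<psi> x) =
           (-1) ^ order_of \<nu> * ((LINT x|fst (pn \<nu>). \<psi> x) - (LINT x|snd (pn \<nu>). \<psi> x)))" ..
  define P N where "P \<nu> = fst (pn \<nu>)" and "N \<nu> = snd (pn \<nu>)" for \<nu>
  have PN: "signed_decomp \<Omega> (grad_measure \<Omega> u \<nu>) (P \<nu>) (N \<nu>)"
    and test: "smooth_supported \<Omega> \<psi> \<Longrightarrow> (LINT x:\<Omega>|lebesgue. u x * multi_deriv \<nu> \<psi> x) =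
           (-1) ^ order_of \<nu> * ((LINT x|P \<nu>. \<psi> x) - (LINT x|N \<nu>. \<psi> x))" if "\<nu> \<in> ?I" for \<nu> \<psi>
    using bspec[OF pn that] by (simp_all add: P_def N_def)
  define R where "R \<nu> p = (if p then P \<nu> else N \<nu>)" for \<nu> p
  have R: "finite_measure (R \<nu> p)" "sets (R \<nu> p) = sets (restrict_space borel \<Omega>)" if "\<nu> \<in> ?I" for \<nu> p
    using PN[OF that] by (auto simp: R_def signed_decomp_def)
  have idm: "(\<lambda>x. x) \<in> R \<nu> p \<rightarrow>\<^sub>M borel" if "\<nu> \<in> ?I" for \<nu> p
    using measurable_cong_sets[OF R(2)[OF that, of p] refl] measurable_restrict_space1[of "\<lambda>x. x" borel borel \<Omega>] by auto
  have spR: "space (R \<nu> p) = \<Omega>" if "\<nu> \<in> ?I" for \<nu> p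
    using sets_eq_imp_space_eq[OF R(2)[OF that, of p]] by (simp add: space_restrict_space)
  define M where "M j = (case j of None \<Rightarrow> density lborel (indicator \<Omega>) | Some (\<nu>, p) \<Rightarrow> distr (R \<nu> p) borel (\<lambda>x. x))" for j
  define J where "J = insert None (Some ` (?I \<times> (UNIV :: bool set)))"
  have J: "finite J" by (simp add: J_def finite_midx)
  have M1: "finite_measure (M j)" and M2: "sets (M j) = sets borel" and M3: "emeasure (M j) (- \<Omega>) = 0" if j: "j \<in> J" for j
  proof -
    have "finite_measure (M j) \<and> sets (M j) = sets borel \<and> emeasure (M j) (- \<Omega>) = 0"
    proof (cases j)
      case None
      interpret L: finite_borel_on "density lborel (indicator \<Omega>)" \<Omega> by (rule restricted_lebesgue[OF \<Omega>])
      show ?thesis using None L.finite_measure_axioms L.null_outside by (simp add: M_def)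
    next
      case (Some k)
      then obtain \<nu> p where k: "j = Some (\<nu>, p)" "\<nu> \<in> ?I" using j by (auto simp: J_def)
      have "emeasure (distr (R \<nu> p) borel (\<lambda>x. x)) (- \<Omega>) = emeasure (R \<nu> p) {}"
        using idm[OF k(2)] spR[OF k(2), of p] by (subst emeasure_distr) auto
      then show ?thesis using k finite_measure.finite_measure_distr[OF R(1)[OF k(2)] idm[OF k(2)]] by (simp add: M_def)
    qed
    then show "finite_measure (M j)" "sets (M j) = sets borel" "emeasure (M j) (- \<Omega>) = 0" by auto
  qed
  obtain \<sigma> p where fb: "finite_borel_on \<sigma> \<Omega>" and p: "\<And>j. j \<in> J \<Longrightarrow> p j \<in> borel_measurable borel"
    "\<And>j x. j \<in> J \<Longrightarrow> 0 \<le> p j x" "\<And>j. j \<in> J \<Longrightarrow> integrable \<sigma> (p j)" "\<And>j. j \<in> J \<Longrightarrow> M j = density \<sigma> (\<lambda>x. ennreal (p j x))"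
    using common_dominating_measure[of J M \<Omega>, OF J M1 M2 \<Omega>(1) M3] by blast
  interpret finite_borel_on \<sigma> \<Omega> by (rule fb)
  define f where "f i x = (case i of None \<Rightarrow> p None x | Some \<nu> \<Rightarrow> p (Some (\<nu>, True)) x - p (Some (\<nu>, False)) x)" for i x
  have NJ: "None \<in> J" and SJ: "\<nu> \<in> ?I \<Longrightarrow> Some (\<nu>, q) \<in> J" for \<nu> q by (auto simp: J_def)
  have fN: "f None = p None" and fS: "f (Some \<nu>) = (\<lambda>x. p (Some (\<nu>, True)) x - p (Some (\<nu>, False)) x)" for \<nu>
    by (auto simp: f_def)
  have int: "(\<integral>x. g x \<partial>R \<nu> q) = (\<integral>x. p (Some (\<nu>, q)) x * g x \<partial>\<sigma>)"
    if nu: "\<nu> \<in> ?I" and [measurable]: "g \<in> borel_measurable borel" for \<nu> q and g :: "real ^ 'n \<Rightarrow> real"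
  proof -
    note [measurable] = p(1)[OF SJ[OF nu]]
    have "(\<integral>x. g x \<partial>R \<nu> q) = (\<integral>x. g x \<partial>M (Some (\<nu>, q)))"
      by (simp add: M_def integral_distr[OF idm[OF nu]])
    also have "\<dots> = (\<integral>x. p (Some (\<nu>, q)) x * g x \<partial>\<sigma>)"
      unfolding p(4)[OF SJ[OF nu]] using p(2)[OF SJ[OF nu]] by (subst integral_density) auto
    finally show ?thesis .
  qed
  have bi: "integrable \<sigma> (\<lambda>x. p (Some (\<nu>, q)) x * g x)"
    if nu: "\<nu> \<in> ?I" and g: "g \<in> borel_measurable borel" "\<And>x. \<bar>g x\<bar> \<le> B" for \<nu> q B and g :: "real ^ 'n \<Rightarrow> real"
  proof -
    have "g \<in> borel_measurable \<sigma>" using g(1) measurable_cong_sets[OF sets_eq refl] by auto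
    from integrable_bounded_mult[OF p(3)[OF SJ[OF nu, of q]] this g(2)] show ?thesis by (simp add: mult.commute)
  qed
  have "gradient_density \<sigma> \<Omega> m u f"
  proof (intro gradient_density.intro fb gradient_density_axioms.intro)
    fix i assume i: "i \<in> insert None (Some ` ?I)"
    show "f i \<in> borel_measurable borel"
      using i p(1)[OF NJ] p(1)[OF SJ] by (cases i) (auto simp: fN fS)
    show "integrable \<sigma> (f i)"
      using i p(3)[OF NJ] p(3)[OF SJ] by (cases i) (auto simp: fN fS)
  next
    show "0 \<le> f None x" for x using p(2)[OF NJ] by (simp add: fN)
    show "density \<sigma> (\<lambda>x. ennreal (f None x)) = density lborel (indicator \<Omega>)"
      using p(4)[OF NJ] by (simp add: fN M_def)
  next
    fix \<nu> B assume nu: "\<nu> \<in> ?I" and B: "B \<in> sets borel" "B \<subseteq> \<Omega>"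
    have Bm: "indicator B \<in> borel_measurable borel" "\<And>x. \<bar>indicator B x :: real\<bar> \<le> 1" using B by (auto simp: indicator_def)
    have "measure (R \<nu> q) B = (\<integral>x. p (Some (\<nu>, q)) x * indicator B x \<partial>\<sigma>)" for q
    proof -
      interpret R: finite_measure "R \<nu> q" by (rule R(1)[OF nu])
      have "B \<in> sets (R \<nu> q)" using R(2)[OF nu] B r by auto
      then have "measure (R \<nu> q) B = (\<integral>x. indicator B x \<partial>R \<nu> q)" using R.emeasure_finite by simp
      also have "\<dots> = (\<integral>x. p (Some (\<nu>, q)) x * indicator B x \<partial>\<sigma>)" by (rule int[OF nu Bm(1)])
      finally show ?thesis .
    qed
    note mq = this
    have "grad_measure \<Omega> u \<nu> B = measure (R \<nu> True) B - measure (R \<nu> False) B"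
      using PN[OF nu] B r by (simp add: signed_decomp_def R_def)
    also have "\<dots> = (\<integral>x. p (Some (\<nu>, True)) x * indicator B x - p (Some (\<nu>, False)) x * indicator B x \<partial>\<sigma>)"
      unfolding mq using bi[OF nu Bm] by simp
    also have "\<dots> = (\<integral>x. indicator B x * f (Some \<nu>) x \<partial>\<sigma>)"
      by (simp add: fS algebra_simps)
    finally show "grad_measure \<Omega> u \<nu> B = (\<integral>x. indicator B x * f (Some \<nu>) x \<partial>\<sigma>)" .
  next
    fix \<nu> \<psi> assume nu: "\<nu> \<in> ?I" and \<psi>: "smooth_supported \<Omega> \<psi>"
    obtain B where B: "\<And>x. \<bar>\<psi> x\<bar> \<le> B" using smooth_supported_bounded(1)[OF \<psi>] by blast
    have \<psi>m: "\<psi> \<in> borel_measurable borel" by (rule smooth_supported_bounded(2)[OF \<psi>])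
    have "(LINT x|P \<nu>. \<psi> x) - (LINT x|N \<nu>. \<psi> x) = (\<integral>x. \<psi> x \<partial>R \<nu> True) - (\<integral>x. \<psi> x \<partial>R \<nu> False)"
      by (simp add: R_def)
    also have "\<dots> = (\<integral>x. p (Some (\<nu>, True)) x * \<psi> x - p (Some (\<nu>, False)) x * \<psi> x \<partial>\<sigma>)"
      unfolding int[OF nu \<psi>m] using bi[OF nu \<psi>m B] by simp
    also have "\<dots> = (\<integral>x. \<psi> x * f (Some \<nu>) x \<partial>\<sigma>)"
      by (simp add: fS algebra_simps)
    finally show "(LINT x:\<Omega>|lebesgue. u x * multi_deriv \<nu> \<psi> x) = (-1) ^ m * (\<integral>x. \<psi> x * f (Some \<nu>) x \<partial>\<sigma>)"
      using test[OF nu \<psi>] nu by (simp add: midx_def)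
  qed
  then show ?thesis by blast
qed

section \<open>The approximating functions and their derivatives\<close>

lemma tendsto_0_of_le:
  fixes a b :: "nat \<Rightarrow> real"
  assumes "b \<longlonglongrightarrow> 0" "\<And>k. a k \<le> b k" "\<And>k. 0 \<le> a k"
  shows "a \<longlonglongrightarrow> 0"
  using assms by (intro real_tendsto_sandwich[OF _ _ tendsto_const assms(1)]) auto

text \<open>
  The functions \<open>w\<close> and \<open>v \<nu>\<close> are Borel representatives of \<open>u\<close> and its weak derivatives of order less than
  \<open>m\<close>, extended by zero; \<open>\<zeta>\<close> is a partition of unity on \<open>\<Omega>\<close>, and the kernels \<open>\<rho> j k\<close> are adapted to
  \<open>\<Omega>\<close> and \<open>D\<close>.
\<close>

locale mollified_pieces = gradient_density \<sigma> \<Omega> m u f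
  for \<sigma> :: "(real ^ 'n::finite) measure" and \<Omega> m u f +
  fixes D :: "(real ^ 'n) set" and w :: "real ^ 'n \<Rightarrow> real" and v :: "('n \<Rightarrow> nat) \<Rightarrow> real ^ 'n \<Rightarrow> real"
    and J :: "'j set" and U :: "'j \<Rightarrow> (real ^ 'n) set" and \<zeta> :: "'j \<Rightarrow> real ^ 'n \<Rightarrow> real"
    and c :: "'j \<Rightarrow> nat \<Rightarrow> real ^ 'n" and r :: "'j \<Rightarrow> nat \<Rightarrow> real" and \<rho> :: "'j \<Rightarrow> nat \<Rightarrow> real ^ 'n \<Rightarrow> real"
  assumes bounded_domain: "bounded \<Omega>"
    and order_pos: "0 < m"
    and w_integrable: "integrable lborel w"
    and w_outside: "x \<notin> \<Omega> \<Longrightarrow> w x = 0"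
    and w_AE: "AE x in lborel. x \<in> \<Omega> \<longrightarrow> u x = w x"
    and v_integrable: "order_of \<nu> < m \<Longrightarrow> integrable lborel (v \<nu>)"
    and v_outside: "order_of \<nu> < m \<Longrightarrow> x \<notin> \<Omega> \<Longrightarrow> v \<nu> x = 0"
    and v_test: "order_of \<nu> < m \<Longrightarrow> smooth_supported \<Omega> \<psi> \<Longrightarrow>
      (\<integral>x. w x * multi_deriv \<nu> \<psi> x \<partial>lborel) = (-1) ^ order_of \<nu> * (\<integral>x. \<psi> x * v \<nu> x \<partial>lborel)"
    and finite_J: "finite J"
    and cutoff: "j \<in> J \<Longrightarrow> smooth_supported (U j) (\<zeta> j)"
    and cutoff_nonneg: "j \<in> J \<Longrightarrow> 0 \<le> \<zeta> j x"
    and partition: "x \<in> \<Omega> \<Longrightarrow> (\<Sum>j\<in>J. \<zeta> j x) = 1"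
    and kernel: "j \<in> J \<Longrightarrow> mollifier (c j k) (r j k) (\<rho> j k)"
    and kernel_lim: "j \<in> J \<Longrightarrow> (\<lambda>k. norm (c j k) + r j k) \<longlonglongrightarrow> 0"
    and kernel_push: "j \<in> J \<Longrightarrow> x \<in> \<Omega> \<Longrightarrow> x - y \<in> cball (c j k) (r j k) \<Longrightarrow> y \<in> U j \<Longrightarrow> y \<in> \<Omega> \<and> (x \<notin> D \<longrightarrow> y \<notin> D)"
begin

definition approx :: "nat \<Rightarrow> real ^ 'n \<Rightarrow> real" where
  "approx k x = (\<Sum>j\<in>J. convol (\<rho> j k) (\<lambda>y. \<zeta> j y * w y) x)"

lemma cutoff_smooth: "j \<in> J \<Longrightarrow> smooth_on UNIV (\<zeta> j)"
  using cutoff by (auto simp: smooth_supported_def)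

lemma pds_cutoff: "j \<in> J \<Longrightarrow> smooth_supported (U j) (pds A (\<zeta> j))"
  by (rule smooth_supported_pds[OF cutoff])

lemma pds_cutoff_bounded: "j \<in> J \<Longrightarrow> \<exists>B\<ge>0. \<forall>x. \<bar>pds A (\<zeta> j) x\<bar> \<le> B"
  by (rule smooth_supported_bounded(1)[OF pds_cutoff])

lemma pds_cutoff_measurable: "j \<in> J \<Longrightarrow> pds A (\<zeta> j) \<in> borel_measurable borel"
  by (rule smooth_supported_bounded(2)[OF pds_cutoff])

lemma cutoff_zero_off_U:
  "j \<in> J \<Longrightarrow> \<zeta> j y \<noteq> 0 \<Longrightarrow> y \<in> U j"
  using smooth_supported_outside[OF cutoff] by blast

lemma cutoff_mult_integrable:
  fixes g :: "real ^ 'n \<Rightarrow> real"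
  assumes j: "j \<in> J" and g: "integrable lborel g"
  shows "integrable lborel (\<lambda>y. pds A (\<zeta> j) y * g y)"
proof -
  obtain B where B: "\<And>x. \<bar>pds A (\<zeta> j) x\<bar> \<le> B" using pds_cutoff_bounded[OF j] by blast
  have "pds A (\<zeta> j) \<in> borel_measurable lborel" using pds_cutoff_measurable[OF j] by simp
  from integrable_bounded_mult[OF g this B] show ?thesis .
qed

lemma cutoff_mult_integrable_measure:
  fixes g :: "real ^ 'n \<Rightarrow> real"
  assumes j: "j \<in> J" and g: "integrable \<sigma> g"
  shows "integrable \<sigma> (\<lambda>y. \<zeta> j y * g y)"
proof -
  obtain B where B: "\<And>x. \<bar>\<zeta> j x\<bar> \<le> B" using pds_cutoff_bounded[OF j, of "[]"] by auto
  have "\<zeta> j \<in> borel_measurable \<sigma>" using pds_cutoff_measurable[OF j, of "[]"] measurable_cong_sets[OF sets_eq refl] by auto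
  from integrable_bounded_mult[OF g this B] show ?thesis .
qed

lemma cutoff_support_bounded: "j \<in> J \<Longrightarrow> \<exists>R. \<forall>x. pds A (\<zeta> j) x \<noteq> 0 \<longrightarrow> norm x \<le> R"
  by (rule smooth_supported_bounded(3)[OF pds_cutoff])

lemma approx_smooth: "smooth_on UNIV (approx k)"
proof -
  have "smooth_on UNIV (convol (\<rho> j k) (\<lambda>y. \<zeta> j y * w y))" if "j \<in> J" for j
    using cutoff_mult_integrable[OF that w_integrable, of "[]"] mollifierD(1,4)[OF kernel[OF that, of k]]
    by (intro smooth_on_convol) auto
  then show ?thesis unfolding approx_def[abs_def] by (intro smooth_on_sum)
qed

lemma piece_converges:
  assumes j: "j \<in> J" and g: "integrable lborel g"
  shows "(\<lambda>k. \<integral>x. \<bar>convol (\<rho> j k) (\<lambda>y. pds A (\<zeta> j) y * g y) x - pds A (\<zeta> j) x * g x\<bar> \<partial>lborel) \<longlonglongrightarrow> 0"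
    and "integrable lborel (convol (\<rho> j k) (\<lambda>y. pds A (\<zeta> j) y * g y))"
proof -
  note i = cutoff_mult_integrable[OF j g, of A]
  obtain R where R: "\<And>x. pds A (\<zeta> j) x \<noteq> 0 \<Longrightarrow> norm x \<le> R" using cutoff_support_bounded[OF j] by blast
  show "(\<lambda>k. \<integral>x. \<bar>convol (\<rho> j k) (\<lambda>y. pds A (\<zeta> j) y * g y) x - pds A (\<zeta> j) x * g x\<bar> \<partial>lborel) \<longlonglongrightarrow> 0"
    by (rule convol_L1_convergence[OF kernel[OF j] kernel_lim[OF j] i, of R]) (use R in auto)
  show "integrable lborel (convol (\<rho> j k) (\<lambda>y. pds A (\<zeta> j) y * g y))"
    by (rule convol_integrable(1)[OF kernel[OF j] i])
qed

lemma pieces_converge: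
  assumes g: "integrable lborel g"
  shows "(\<lambda>k. \<integral>x. \<bar>(\<Sum>j\<in>J. convol (\<rho> j k) (\<lambda>y. pds A (\<zeta> j) y * g y) x) - (\<Sum>j\<in>J. pds A (\<zeta> j) x) * g x\<bar> \<partial>lborel) \<longlonglongrightarrow> 0"
    and "integrable lborel (\<lambda>x. \<Sum>j\<in>J. convol (\<rho> j k) (\<lambda>y. pds A (\<zeta> j) y * g y) x)"
proof -
  let ?c = "\<lambda>j k. convol (\<rho> j k) (\<lambda>y. pds A (\<zeta> j) y * g y)" and ?l = "\<lambda>j x. pds A (\<zeta> j) x * g x"
  show "integrable lborel (\<lambda>x. \<Sum>j\<in>J. ?c j k x)"
    using piece_converges(2)[OF _ g] by (intro Bochner_Integration.integrable_sum) auto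
  have lim: "(\<lambda>k. \<Sum>j\<in>J. \<integral>x. \<bar>?c j k x - ?l j x\<bar> \<partial>lborel) \<longlonglongrightarrow> (\<Sum>j\<in>J. 0)"
    by (intro tendsto_sum piece_converges(1)[OF _ g])
  have "(\<integral>x. \<bar>(\<Sum>j\<in>J. ?c j k x) - (\<Sum>j\<in>J. pds A (\<zeta> j) x) * g x\<bar> \<partial>lborel) \<le> (\<Sum>j\<in>J. \<integral>x. \<bar>?c j k x - ?l j x\<bar> \<partial>lborel)" for k
  proof -
    have ii: "integrable lborel (\<lambda>x. \<bar>?c j k x - ?l j x\<bar>)" if "j \<in> J" for j
      using piece_converges(2)[OF that g] cutoff_mult_integrable[OF that g] by auto
    have "(\<integral>x. \<bar>(\<Sum>j\<in>J. ?c j k x) - (\<Sum>j\<in>J. pds A (\<zeta> j) x) * g x\<bar> \<partial>lborel) \<le> (\<integral>x. (\<Sum>j\<in>J. \<bar>?c j k x - ?l j x\<bar>) \<partial>lborel)"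
    proof (rule integral_mono)
      have "integrable lborel (\<lambda>x. (\<Sum>j\<in>J. ?c j k x) - (\<Sum>j\<in>J. ?l j x))"
        using piece_converges(2)[OF _ g] cutoff_mult_integrable[OF _ g]
        by (intro Bochner_Integration.integrable_diff Bochner_Integration.integrable_sum) auto
      then show "integrable lborel (\<lambda>x. \<bar>(\<Sum>j\<in>J. ?c j k x) - (\<Sum>j\<in>J. pds A (\<zeta> j) x) * g x\<bar>)"
        by (simp add: sum_distrib_right)
      show "integrable lborel (\<lambda>x. \<Sum>j\<in>J. \<bar>?c j k x - ?l j x\<bar>)"
        using ii by (intro Bochner_Integration.integrable_sum) auto
      show "\<bar>(\<Sum>j\<in>J. ?c j k x) - (\<Sum>j\<in>J. pds A (\<zeta> j) x) * g x\<bar> \<le> (\<Sum>j\<in>J. \<bar>?c j k x - ?l j x\<bar>)" for x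
        unfolding sum_distrib_right sum_subtractf[symmetric] by (rule sum_abs)
    qed
    also have "\<dots> = (\<Sum>j\<in>J. \<integral>x. \<bar>?c j k x - ?l j x\<bar> \<partial>lborel)"
      by (intro Bochner_Integration.integral_sum ii)
    finally show ?thesis .
  qed
  then show "(\<lambda>k. \<integral>x. \<bar>(\<Sum>j\<in>J. ?c j k x) - (\<Sum>j\<in>J. pds A (\<zeta> j) x) * g x\<bar> \<partial>lborel) \<longlonglongrightarrow> 0"
    by (rule tendsto_0_of_le[OF lim[unfolded sum.neutral_const]]) simp
qed

lemma sum_pds_cutoff:
  assumes x: "x \<in> \<Omega>"
  shows "(\<Sum>j\<in>J. pds A (\<zeta> j) x) = (if A = [] then 1 else 0)"
proof (cases A)
  case Nil
  then show ?thesis using partition[OF x] by simp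
next
  case (Cons i B)
  have sm: "smooth_on UNIV (\<lambda>x. \<Sum>j\<in>J. \<zeta> j x)" by (intro smooth_on_sum cutoff_smooth)
  have "(\<Sum>j\<in>J. pds A (\<zeta> j) x) = pds A (\<lambda>x. \<Sum>j\<in>J. \<zeta> j x) x"
    by (simp add: pds_sum cutoff_smooth)
  \<comment> \<open>Subtracting 1 gives a function that vanishes on the open set \<open>\<Omega>\<close>, together with its derivatives.\<close>
  also have "\<dots> = pds A (\<lambda>x. (\<Sum>j\<in>J. \<zeta> j x) + (- 1)) x"
  proof -
    have "pds A (\<lambda>x. -1 :: real) = (\<lambda>x. 0)"
    proof -
      have "pds C (\<lambda>x. -1 :: real) = (\<lambda>x. 0)" if "C \<noteq> []" for C
        using that by (cases C rule: rev_cases) (auto simp: pds_append partial_deriv_const pds_zero)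
      then show ?thesis using Cons by blast
    qed
    then show ?thesis by (subst pds_add[OF sm smooth_on_const]) simp
  qed
  also have "\<dots> = 0"
  proof (rule pds_zero_off_closed[of "- \<Omega>"])
    show "closed (- \<Omega>)" using open_domain by (rule closed_Compl)
    show "(\<Sum>j\<in>J. \<zeta> j y) + (- 1) = 0" if "y \<notin> - \<Omega>" for y using partition[of y] that by simp
  qed (use x in simp)
  finally show ?thesis using Cons by simp
qed

text \<open>
  Hence pieces in which a cutoff is differentiated cancel in the limit, while the others add up to the
  function itself.
\<close>

lemma sum_pds_cutoff_mult:
  assumes "\<And>x. x \<notin> \<Omega> \<Longrightarrow> g x = 0"
  shows "(\<Sum>j\<in>J. pds A (\<zeta> j) x) * g x = (if A = [] then g x else 0)"
  using sum_pds_cutoff[of x A] assms[of x] by (cases "x \<in> \<Omega>") auto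

text \<open>
  The shifted kernels enter here: for \<open>x\<close> in \<open>\<Omega>\<close>, also close to the boundary, the convolution at \<open>x\<close> is
  a pairing with a function that is compactly supported in \<open>\<Omega>\<close>.
\<close>

lemma test_function_at:
  assumes j: "j \<in> J" and x: "x \<in> \<Omega>"
  shows "smooth_supported \<Omega> (\<lambda>y. pds A (\<zeta> j) y * \<rho> j k (x - y))"
proof -
  obtain K where K: "compact K" "K \<subseteq> U j" "\<forall>x. x \<notin> K \<longrightarrow> pds A (\<zeta> j) x = 0"
    using smooth_supported_support[OF pds_cutoff[OF j]] by blast
  let ?S = "(\<lambda>y. x - y) -` cball (c j k) (r j k)"
  have "closed ?S" by (intro closed_vimage) (auto intro!: continuous_intros)
  then have "compact (K \<inter> ?S)" using K(1) by (rule compact_Int_closed[rotated])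
  moreover have "K \<inter> ?S \<subseteq> \<Omega>" using kernel_push[OF j x] K(2) by auto
  moreover have "pds A (\<zeta> j) y * \<rho> j k (x - y) = 0" if "y \<notin> K \<inter> ?S" for y
    using that K(3) mollifierD(3)[OF kernel[OF j, of k], of "x - y"] by auto
  ultimately have "compact_support_in \<Omega> (\<lambda>y. pds A (\<zeta> j) y * \<rho> j k (x - y))" by (rule compact_support_inI)
  then show ?thesis
    unfolding smooth_supported_def
    using smooth_on_pds[OF cutoff_smooth[OF j]] smooth_on_reflect[OF mollifierD(1)[OF kernel[OF j]]]
    by (auto intro!: smooth_on_mult)
qed

lemma w_mult_integrable:
  assumes "smooth_supported \<Omega>' \<psi>"
  shows "integrable lborel (\<lambda>y. w y * \<psi> y)"
proof -
  obtain B where B: "\<And>x. \<bar>\<psi> x\<bar> \<le> B" using smooth_supported_bounded(1)[OF assms] by blast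
  have "\<psi> \<in> borel_measurable lborel" using smooth_supported_bounded(2)[OF assms] by simp
  from integrable_bounded_mult[OF w_integrable this B] show ?thesis by (simp add: mult.commute)
qed

text \<open>
  The terms of the product rule in which a cutoff is differentiated.  If \<open>is\<close> has length at most \<open>m\<close>, they
  only involve derivatives of \<open>u\<close> of order less than \<open>m\<close>, which are functions.
\<close>

definition commutator :: "nat \<Rightarrow> 'n list \<Rightarrow> real ^ 'n \<Rightarrow> real" where
  "commutator k is x = (\<Sum>(A, B)\<leftarrow>leibniz_pairs is. \<Sum>j\<in>J. convol (\<rho> j k) (\<lambda>y. pds A (\<zeta> j) y * v (count_list B) y) x)"

lemma leibniz_order:
  assumes "(A, B) \<in> set (leibniz_pairs is)" "length is \<le> m"
  shows "order_of (count_list B) < m" "A \<noteq> []" "length A + length B = length is"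
proof -
  note l = leibniz_pairs_length[OF assms(1)]
  then have "length A > 0" by simp
  with l assms(2) have "length B < m" by linarith
  with l show "order_of (count_list B) < m" "A \<noteq> []" "length A + length B = length is"
    by (simp_all add: order_of_count_list)
qed

lemma L1_sum_list_tendsto_0:
  fixes G :: "'a \<Rightarrow> nat \<Rightarrow> real ^ 'n \<Rightarrow> real"
  assumes "\<And>a k. a \<in> set L \<Longrightarrow> integrable lborel (G a k)"
    and "\<And>a. a \<in> set L \<Longrightarrow> (\<lambda>k. \<integral>x. \<bar>G a k x\<bar> \<partial>lborel) \<longlonglongrightarrow> 0"
  shows "(\<forall>k. integrable lborel (\<lambda>x. \<Sum>a\<leftarrow>L. G a k x)) \<and> (\<lambda>k. \<integral>x. \<bar>\<Sum>a\<leftarrow>L. G a k x\<bar> \<partial>lborel) \<longlonglongrightarrow> 0"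
  using assms
proof (induction L)
  case (Cons a L)
  then have i: "integrable lborel (G a k)" "integrable lborel (\<lambda>x. \<Sum>a\<leftarrow>L. G a k x)" for k by auto
  have "(\<integral>x. \<bar>G a k x + (\<Sum>a\<leftarrow>L. G a k x)\<bar> \<partial>lborel) \<le> (\<integral>x. \<bar>G a k x\<bar> \<partial>lborel) + (\<integral>x. \<bar>\<Sum>a\<leftarrow>L. G a k x\<bar> \<partial>lborel)" for k
  proof -
    have "(\<integral>x. \<bar>G a k x + (\<Sum>a\<leftarrow>L. G a k x)\<bar> \<partial>lborel) \<le> (\<integral>x. \<bar>G a k x\<bar> + \<bar>\<Sum>a\<leftarrow>L. G a k x\<bar> \<partial>lborel)"
      using i[of k] by (intro integral_mono) auto
    then show ?thesis using i[of k] by simp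
  qed
  moreover have "(\<lambda>k. (\<integral>x. \<bar>G a k x\<bar> \<partial>lborel) + (\<integral>x. \<bar>\<Sum>a\<leftarrow>L. G a k x\<bar> \<partial>lborel)) \<longlonglongrightarrow> 0 + 0"
    using Cons by (intro tendsto_add) auto
  then have lim: "(\<lambda>k. (\<integral>x. \<bar>G a k x\<bar> \<partial>lborel) + (\<integral>x. \<bar>\<Sum>a\<leftarrow>L. G a k x\<bar> \<partial>lborel)) \<longlonglongrightarrow> 0" by simp
  ultimately have "(\<lambda>k. \<integral>x. \<bar>G a k x + (\<Sum>a\<leftarrow>L. G a k x)\<bar> \<partial>lborel) \<longlonglongrightarrow> 0"
    by (intro tendsto_0_of_le[OF lim]) simp_all
  with i show ?case by simp
qed simp

text \<open>
  Each term tends in \<open>L\<^sup>1\<close> to the sum over \<open>j\<close> of a derivative of \<open>\<zeta> j\<close>, times a lower derivative of \<open>u\<close>.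
  This sum is zero because the cutoffs sum to 1.
\<close>

lemma commutator_tendsto_0:
  assumes "length is \<le> m"
  shows "integrable lborel (commutator k is)" and "(\<lambda>k. \<integral>x. \<bar>commutator k is x\<bar> \<partial>lborel) \<longlonglongrightarrow> 0"
proof -
  have "(\<forall>k. integrable lborel (\<lambda>x. \<Sum>AB\<leftarrow>leibniz_pairs is. case AB of (A, B) \<Rightarrow> \<Sum>j\<in>J. convol (\<rho> j k) (\<lambda>y. pds A (\<zeta> j) y * v (count_list B) y) x))
    \<and> (\<lambda>k. \<integral>x. \<bar>\<Sum>AB\<leftarrow>leibniz_pairs is. case AB of (A, B) \<Rightarrow> \<Sum>j\<in>J. convol (\<rho> j k) (\<lambda>y. pds A (\<zeta> j) y * v (count_list B) y) x\<bar> \<partial>lborel) \<longlonglongrightarrow> 0"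
  proof (rule L1_sum_list_tendsto_0[of "leibniz_pairs is" "\<lambda>AB k x. case AB of (A, B) \<Rightarrow> \<Sum>j\<in>J. convol (\<rho> j k) (\<lambda>y. pds A (\<zeta> j) y * v (count_list B) y) x"])
    fix AB assume AB: "AB \<in> set (leibniz_pairs is)"
    obtain A B where ABe: "AB = (A, B)" by fastforce
    note o = leibniz_order[OF AB[unfolded ABe] assms]
    note vi = v_integrable[OF o(1)]
    have sv: "(\<Sum>j\<in>J. pds A (\<zeta> j) x) * v (count_list B) x = (if A = [] then v (count_list B) x else 0)" for x
      by (rule sum_pds_cutoff_mult) (rule v_outside[OF o(1)])
    show "integrable lborel (\<lambda>x. case AB of (A, B) \<Rightarrow> \<Sum>j\<in>J. convol (\<rho> j k) (\<lambda>y. pds A (\<zeta> j) y * v (count_list B) y) x)" for k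
      unfolding ABe using pieces_converge(2)[OF vi] by simp
    show "(\<lambda>k. \<integral>x. \<bar>case AB of (A, B) \<Rightarrow> \<Sum>j\<in>J. convol (\<rho> j k) (\<lambda>y. pds A (\<zeta> j) y * v (count_list B) y) x\<bar> \<partial>lborel) \<longlonglongrightarrow> 0"
      using pieces_converge(1)[OF vi, where A=A] o(2)
      unfolding ABe sv by simp
  qed
  then show "integrable lborel (commutator k is)" and "(\<lambda>k. \<integral>x. \<bar>commutator k is x\<bar> \<partial>lborel) \<longlonglongrightarrow> 0"
    by (simp_all add: commutator_def[abs_def])
qed

text \<open>
  The derivatives of the convolution fall on the kernel.  The product of the cutoff with the differentiated
  kernel is \<open>pds is\<close> of a test function, plus terms with derivatives of the cutoff.  In the latter fewer than
  \<open>m\<close> derivatives have to be transferred to \<open>u\<close>, which gives its weak derivatives; the former is kept as a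
  pairing with \<open>w\<close>, since for length \<open>m\<close> the derivatives of \<open>u\<close> are measures.
\<close>

lemma pds_piece:
  assumes j: "j \<in> J" and x: "x \<in> \<Omega>" and len: "length is \<le> m"
  shows "pds is (convol (\<rho> j k) (\<lambda>y. \<zeta> j y * w y)) x =
    (-1) ^ length is * (\<integral>y. w y * pds is (\<lambda>y. \<zeta> j y * \<rho> j k (x - y)) y \<partial>lborel) +
    (\<Sum>(A, B)\<leftarrow>leibniz_pairs is. convol (\<rho> j k) (\<lambda>y. pds A (\<zeta> j) y * v (count_list B) y) x)"
proof -
  note K = mollifierD[OF kernel[OF j, of k]]
  define \<psi> where "\<psi> y = \<rho> j k (x - y)" for y
  have s\<psi>: "smooth_on UNIV \<psi>" unfolding \<psi>_def[abs_def] by (rule smooth_on_reflect[OF K(1)])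
  have iw: "integrable lborel (\<lambda>y. \<zeta> j y * w y)" using cutoff_mult_integrable[OF j w_integrable, of "[]"] by simp
  have s1: "smooth_supported \<Omega> (\<lambda>y. pds A (\<zeta> j) y * \<psi> y)" for A
    unfolding \<psi>_def by (rule test_function_at[OF j x])
  let ?T = "\<lambda>AB y. case AB of (A, B) \<Rightarrow> (-1) ^ length A * pds B (\<lambda>y. pds A (\<zeta> j) y * \<psi> y) y"
  let ?C = "\<lambda>AB. case AB of (A, B) \<Rightarrow> convol (\<rho> j k) (\<lambda>y. pds A (\<zeta> j) y * v (count_list B) y) x"
  have i1: "integrable lborel (\<lambda>y. w y * pds is (\<lambda>y. \<zeta> j y * \<psi> y) y)"
    using w_mult_integrable[OF smooth_supported_pds[OF s1[of "[]"]], of "is"] by simp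
  have T: "integrable lborel (\<lambda>y. w y * ?T AB y) \<and> (-1) ^ length is * (\<integral>y. w y * ?T AB y \<partial>lborel) = ?C AB"
    if AB: "AB \<in> set (leibniz_pairs is)" for AB
  proof -
    obtain A B where ABe: "AB = (A, B)" by fastforce
    note o = leibniz_order[OF AB[unfolded ABe] len]
    have "integrable lborel (\<lambda>y. w y * pds B (\<lambda>y. pds A (\<zeta> j) y * \<psi> y) y)"
      by (rule w_mult_integrable[OF smooth_supported_pds[OF s1]])
    then have i: "integrable lborel (\<lambda>y. (-1) ^ length A * (w y * pds B (\<lambda>y. pds A (\<zeta> j) y * \<psi> y) y))" by simp
    have "(\<integral>y. w y * pds B (\<lambda>y. pds A (\<zeta> j) y * \<psi> y) y \<partial>lborel)
        = (\<integral>y. w y * multi_deriv (count_list B) (\<lambda>y. pds A (\<zeta> j) y * \<psi> y) y \<partial>lborel)"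
      using s1[of A] by (simp add: multi_deriv_count_list smooth_supported_def)
    also have "\<dots> = (-1) ^ length B * (\<integral>y. (pds A (\<zeta> j) y * \<psi> y) * v (count_list B) y \<partial>lborel)"
      using v_test[OF o(1) s1[of A]] by (simp add: order_of_count_list)
    also have "(\<integral>y. (pds A (\<zeta> j) y * \<psi> y) * v (count_list B) y \<partial>lborel) = convol (\<rho> j k) (\<lambda>y. pds A (\<zeta> j) y * v (count_list B) y) x"
      unfolding convol_def \<psi>_def by (intro Bochner_Integration.integral_cong) auto
    finally have e: "(\<integral>y. w y * pds B (\<lambda>y. pds A (\<zeta> j) y * \<psi> y) y \<partial>lborel) = (-1) ^ length B * ?C AB"
      by (simp add: ABe)
    have "(-1) ^ length is * ((-1) ^ length A * (-1) ^ length B) = (1 :: real)"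
    proof -
      have "(-1) ^ length A * (-1) ^ length B = ((-1) ^ length is :: real)" by (simp add: o(3)[symmetric] power_add)
      then show ?thesis by (simp only: power_mult_distrib[symmetric]) simp
    qed
    then have sign: "(-1) ^ length is * ((-1) ^ length A * ((-1) ^ length B * z)) = z" for z :: real
      by (simp only: mult.assoc[symmetric] mult_1_left)
    have "(\<integral>y. (-1) ^ length A * (w y * pds B (\<lambda>y. pds A (\<zeta> j) y * \<psi> y) y) \<partial>lborel) = (-1) ^ length A * ((-1) ^ length B * ?C AB)"
      unfolding e[symmetric] by simp
    with i sign[of "?C AB"] show ?thesis by (simp add: ABe mult.left_commute)
  qed
  have sumT: "integrable lborel (\<lambda>y. w y * (\<Sum>AB\<leftarrow>L. ?T AB y)) \<and>
      (-1) ^ length is * (\<integral>y. w y * (\<Sum>AB\<leftarrow>L. ?T AB y) \<partial>lborel) = (\<Sum>AB\<leftarrow>L. ?C AB)" if "set L \<subseteq> set (leibniz_pairs is)" for L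
    using that
  proof (induction L)
    case (Cons AB L)
    then have IH: "integrable lborel (\<lambda>y. w y * (\<Sum>AB\<leftarrow>L. ?T AB y))"
      "(-1) ^ length is * (\<integral>y. w y * (\<Sum>AB\<leftarrow>L. ?T AB y) \<partial>lborel) = (\<Sum>AB\<leftarrow>L. ?C AB)" by auto
    have "AB \<in> set (leibniz_pairs is)" using Cons.prems by simp
    note T1 = T[OF this]
    have eq: "(\<lambda>y. w y * (\<Sum>AB\<leftarrow>AB # L. ?T AB y)) = (\<lambda>y. w y * ?T AB y + w y * (\<Sum>AB\<leftarrow>L. ?T AB y))"
      by (simp add: distrib_left)
    have "integrable lborel (\<lambda>y. w y * ?T AB y + w y * (\<Sum>AB\<leftarrow>L. ?T AB y))"
      using T1 IH(1) by (intro Bochner_Integration.integrable_add) blast+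
    moreover have "(\<integral>y. w y * ?T AB y + w y * (\<Sum>AB\<leftarrow>L. ?T AB y) \<partial>lborel) = (\<integral>y. w y * ?T AB y \<partial>lborel) + (\<integral>y. w y * (\<Sum>AB\<leftarrow>L. ?T AB y) \<partial>lborel)"
      using T1 IH(1) by (intro Bochner_Integration.integral_add) blast+
    ultimately show ?case unfolding eq using T1 IH(2) by (simp add: distrib_left)
  qed simp
  have LI: "\<zeta> j y * pds is \<psi> y = pds is (\<lambda>y. \<zeta> j y * \<psi> y) y + (\<Sum>AB\<leftarrow>leibniz_pairs is. ?T AB y)" for y
    using fun_cong[OF leibniz_inverse[OF s\<psi> cutoff_smooth[OF j], of "is"], of y] by simp
  have "pds is (convol (\<rho> j k) (\<lambda>y. \<zeta> j y * w y)) x = (\<integral>y. pds is (\<rho> j k) (x - y) * (\<zeta> j y * w y) \<partial>lborel)"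
    by (simp add: pds_convol[OF K(1) K(4) iw] convol_def)
  also have "\<dots> = (\<integral>y. (-1) ^ length is * (w y * (\<zeta> j y * pds is \<psi> y)) \<partial>lborel)"
  proof (rule Bochner_Integration.integral_cong)
    fix y
    have "pds is \<psi> y = (-1) ^ length is * pds is (\<rho> j k) (x - y)"
      unfolding \<psi>_def[abs_def] by (simp add: pds_reflect[OF K(1)])
    then have "(-1) ^ length is * pds is \<psi> y = pds is (\<rho> j k) (x - y)"
      by (simp add: power_mult_distrib[symmetric] mult.assoc[symmetric])
    then show "pds is (\<rho> j k) (x - y) * (\<zeta> j y * w y) = (-1) ^ length is * (w y * (\<zeta> j y * pds is \<psi> y))"
      by (metis (no_types) mult.commute mult.left_commute)
  qed simp
  also have "\<dots> = (-1) ^ length is * (\<integral>y. w y * pds is (\<lambda>y. \<zeta> j y * \<psi> y) y + w y * (\<Sum>AB\<leftarrow>leibniz_pairs is. ?T AB y) \<partial>lborel)"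
    by (simp only: LI distrib_left[of "w _"] integral_mult_right_zero)
  also have "\<dots> = (-1) ^ length is * (\<integral>y. w y * pds is (\<lambda>y. \<zeta> j y * \<psi> y) y \<partial>lborel) + (\<Sum>AB\<leftarrow>leibniz_pairs is. ?C AB)"
    using i1 sumT[OF order_refl] by (simp add: Bochner_Integration.integral_add distrib_left)
  finally show ?thesis unfolding \<psi>_def .
qed

lemma pds_approx:
  assumes x: "x \<in> \<Omega>" and len: "length is \<le> m"
  shows "pds is (approx k) x =
    (\<Sum>j\<in>J. (-1) ^ length is * (\<integral>y. w y * pds is (\<lambda>y. \<zeta> j y * \<rho> j k (x - y)) y \<partial>lborel)) + commutator k is x"
proof -
  have sm: "smooth_on UNIV (convol (\<rho> j k) (\<lambda>y. \<zeta> j y * w y))" if "j \<in> J" for j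
    using cutoff_mult_integrable[OF that w_integrable, of "[]"] mollifierD(1,4)[OF kernel[OF that, of k]]
    by (intro smooth_on_convol) auto
  have "pds is (approx k) x = (\<Sum>j\<in>J. pds is (convol (\<rho> j k) (\<lambda>y. \<zeta> j y * w y)) x)"
    unfolding approx_def[abs_def] by (simp add: pds_sum sm)
  also have "\<dots> = (\<Sum>j\<in>J. (-1) ^ length is * (\<integral>y. w y * pds is (\<lambda>y. \<zeta> j y * \<rho> j k (x - y)) y \<partial>lborel))
    + (\<Sum>j\<in>J. \<Sum>(A, B)\<leftarrow>leibniz_pairs is. convol (\<rho> j k) (\<lambda>y. pds A (\<zeta> j) y * v (count_list B) y) x)"
    by (simp add: pds_piece[OF _ x len] sum.distrib)
  also have "(\<Sum>j\<in>J. \<Sum>(A, B)\<leftarrow>leibniz_pairs is. convol (\<rho> j k) (\<lambda>y. pds A (\<zeta> j) y * v (count_list B) y) x) = commutator k is x"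
  proof -
    have "(\<Sum>j\<in>J. \<Sum>a\<leftarrow>L. F a j) = (\<Sum>a\<leftarrow>L. \<Sum>j\<in>J. F a j)" for L and F :: "'n list \<times> 'n list \<Rightarrow> 'j \<Rightarrow> real"
      by (induction L) (auto simp: sum.distrib)
    then show ?thesis unfolding commutator_def by (simp add: split_def)
  qed
  finally show ?thesis .
qed

lemma lower_deriv_approx:
  assumes x: "x \<in> \<Omega>" and \<nu>: "order_of \<nu> < m"
  shows "multi_deriv \<nu> (approx k) x = (\<Sum>j\<in>J. convol (\<rho> j k) (\<lambda>y. \<zeta> j y * v \<nu> y) x) + commutator k (midx_list \<nu>) x"
proof -
  have "(-1) ^ order_of \<nu> * (\<integral>y. w y * multi_deriv \<nu> (\<lambda>y. \<zeta> j y * \<rho> j k (x - y)) y \<partial>lborel) = convol (\<rho> j k) (\<lambda>y. \<zeta> j y * v \<nu> y) x"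
    if j: "j \<in> J" for j
  proof -
    have "smooth_supported \<Omega> (\<lambda>y. \<zeta> j y * \<rho> j k (x - y))" using test_function_at[OF j x, of "[]"] by simp
    from v_test[OF \<nu> this]
    have "(-1) ^ order_of \<nu> * (\<integral>y. w y * multi_deriv \<nu> (\<lambda>y. \<zeta> j y * \<rho> j k (x - y)) y \<partial>lborel)
        = (\<integral>y. \<zeta> j y * \<rho> j k (x - y) * v \<nu> y \<partial>lborel)"
      by (simp add: power_mult_distrib[symmetric] mult.assoc[symmetric])
    also have "\<dots> = convol (\<rho> j k) (\<lambda>y. \<zeta> j y * v \<nu> y) x"
      unfolding convol_def by (intro Bochner_Integration.integral_cong) auto
    finally show ?thesis .
  qed
  then show ?thesis
    using pds_approx[OF x, of "midx_list \<nu>" k] \<nu> by (simp add: multi_deriv_pds length_midx_list)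
qed

lemma lower_deriv_converges:
  assumes \<nu>: "order_of \<nu> < m"
  shows "(\<lambda>k. \<integral>x. indicator \<Omega> x * \<bar>multi_deriv \<nu> (approx k) x - v \<nu> x\<bar> \<partial>lborel) \<longlonglongrightarrow> 0"
    and "integrable lborel (\<lambda>x. indicator \<Omega> x * \<bar>multi_deriv \<nu> (approx k) x - v \<nu> x\<bar>)"
proof -
  let ?S = "\<lambda>k x. (\<Sum>j\<in>J. convol (\<rho> j k) (\<lambda>y. \<zeta> j y * v \<nu> y) x)" and ?R = "\<lambda>k. commutator k (midx_list \<nu>)"
  have len: "length (midx_list \<nu>) \<le> m" using \<nu> by (simp add: length_midx_list)
  note vi = v_integrable[OF \<nu>]
  have sv: "(\<Sum>j\<in>J. pds [] (\<zeta> j) x) * v \<nu> x = v \<nu> x" for x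
    using sum_pds_cutoff_mult[of "v \<nu>" "[]" x] v_outside[OF \<nu>] by simp
  have S: "(\<lambda>k. \<integral>x. \<bar>?S k x - v \<nu> x\<bar> \<partial>lborel) \<longlonglongrightarrow> 0" "integrable lborel (?S k)" for k
    using pieces_converge[OF vi, where A="[]"] unfolding sv by simp_all
  note R = commutator_tendsto_0[OF len]
  have le: "indicator \<Omega> x * \<bar>multi_deriv \<nu> (approx k) x - v \<nu> x\<bar> \<le> \<bar>?S k x - v \<nu> x\<bar> + \<bar>?R k x\<bar>" for k x
    using lower_deriv_approx[OF _ \<nu>, of x k] by (auto simp: indicator_def)
  have ib: "integrable lborel (\<lambda>x. \<bar>?S k x - v \<nu> x\<bar> + \<bar>?R k x\<bar>)" for k
    using S(2) R(1) vi by auto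
  have [measurable]: "multi_deriv \<nu> (approx k) \<in> borel_measurable borel" for k
    using smooth_on_pds[OF approx_smooth] by (simp add: multi_deriv_pds smooth_on_borel)
  have [measurable]: "v \<nu> \<in> borel_measurable borel" using vi by auto
  show i: "integrable lborel (\<lambda>x. indicator \<Omega> x * \<bar>multi_deriv \<nu> (approx k) x - v \<nu> x\<bar>)" for k
    by (rule Bochner_Integration.integrable_bound[OF ib[of k]]) (use le[of _ k] in auto)
  have "(\<integral>x. indicator \<Omega> x * \<bar>multi_deriv \<nu> (approx k) x - v \<nu> x\<bar> \<partial>lborel) \<le> (\<integral>x. \<bar>?S k x - v \<nu> x\<bar> \<partial>lborel) + (\<integral>x. \<bar>?R k x\<bar> \<partial>lborel)" for k
  proof -
    have "(\<integral>x. indicator \<Omega> x * \<bar>multi_deriv \<nu> (approx k) x - v \<nu> x\<bar> \<partial>lborel) \<le> (\<integral>x. \<bar>?S k x - v \<nu> x\<bar> + \<bar>?R k x\<bar> \<partial>lborel)"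
      by (intro integral_mono i ib le)
    then show ?thesis using S(2) R(1) vi by simp
  qed
  moreover have "(\<lambda>k. (\<integral>x. \<bar>?S k x - v \<nu> x\<bar> \<partial>lborel) + (\<integral>x. \<bar>?R k x\<bar> \<partial>lborel)) \<longlonglongrightarrow> 0 + 0"
    by (intro tendsto_add S(1) R(2))
  then have lim: "(\<lambda>k. (\<integral>x. \<bar>?S k x - v \<nu> x\<bar> \<partial>lborel) + (\<integral>x. \<bar>?R k x\<bar> \<partial>lborel)) \<longlonglongrightarrow> 0" by simp
  ultimately show "(\<lambda>k. \<integral>x. indicator \<Omega> x * \<bar>multi_deriv \<nu> (approx k) x - v \<nu> x\<bar> \<partial>lborel) \<longlonglongrightarrow> 0"
    by (intro tendsto_0_of_le[OF lim]) simp_all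
qed

lemma approx_converges_L1:
  "(\<lambda>k. \<integral>x. indicator \<Omega> x * \<bar>approx k x - w x\<bar> \<partial>lborel) \<longlonglongrightarrow> 0"
  "integrable lborel (\<lambda>x. indicator \<Omega> x * \<bar>approx k x - w x\<bar>)"
proof -
  have sw: "(\<Sum>j\<in>J. pds [] (\<zeta> j) x) * w x = w x" for x
    using sum_pds_cutoff_mult[of w "[]" x] w_outside by simp
  have S: "(\<lambda>k. \<integral>x. \<bar>approx k x - w x\<bar> \<partial>lborel) \<longlonglongrightarrow> 0" and i: "integrable lborel (approx k)" for k
    using pieces_converge[OF w_integrable, where A="[]"] unfolding sw approx_def[abs_def] by simp_all
  have ii: "integrable lborel (\<lambda>x. \<bar>approx k x - w x\<bar>)" for k using i w_integrable by simp
  show i2: "integrable lborel (\<lambda>x. indicator \<Omega> x * \<bar>approx k x - w x\<bar>)" for k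
    using integrable_mult_indicator[OF _ ii[of k], of \<Omega>] by simp
  have "(\<integral>x. indicator \<Omega> x * \<bar>approx k x - w x\<bar> \<partial>lborel) \<le> (\<integral>x. \<bar>approx k x - w x\<bar> \<partial>lborel)" for k
    by (intro integral_mono i2 ii) (auto simp: indicator_def)
  then show "(\<lambda>k. \<integral>x. indicator \<Omega> x * \<bar>approx k x - w x\<bar> \<partial>lborel) \<longlonglongrightarrow> 0"
    by (intro tendsto_0_of_le[OF S]) simp_all
qed

lemma w_measurable [measurable]: "w \<in> borel_measurable borel"
  using w_integrable by auto

lemma lebesgue_test_integral:
  assumes "smooth_supported \<Omega> \<psi>"
  shows "(LINT x:\<Omega>|lebesgue. u x * multi_deriv \<nu> \<psi> x) = (\<integral>x. w x * multi_deriv \<nu> \<psi> x \<partial>lborel)"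
  using smooth_supported_bounded(2)[OF smooth_supported_pds[OF assms]] w_outside
  by (intro lebesgue_set_integral_mult w_AE) (auto simp: multi_deriv_pds)

lemma top_deriv_approx:
  assumes x: "x \<in> \<Omega>" and \<nu>: "\<nu> \<in> midx m"
  shows "multi_deriv \<nu> (approx k) x = (\<Sum>j\<in>J. mconvol \<sigma> (\<rho> j k) (\<lambda>y. \<zeta> j y * f (Some \<nu>) y) x) + commutator k (midx_list \<nu>) x"
proof -
  have om: "order_of \<nu> = m" using \<nu> by (simp add: midx_def)
  have "(-1) ^ m * (\<integral>y. w y * multi_deriv \<nu> (\<lambda>y. \<zeta> j y * \<rho> j k (x - y)) y \<partial>lborel) = mconvol \<sigma> (\<rho> j k) (\<lambda>y. \<zeta> j y * f (Some \<nu>) y) x"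
    if j: "j \<in> J" for j
  proof -
    let ?\<psi> = "\<lambda>y. \<zeta> j y * \<rho> j k (x - y)"
    have s: "smooth_supported \<Omega> ?\<psi>" using test_function_at[OF j x, of "[]"] by simp
    have "(\<integral>y. w y * multi_deriv \<nu> ?\<psi> y \<partial>lborel) = (-1) ^ m * (\<integral>y. ?\<psi> y * f (Some \<nu>) y \<partial>\<sigma>)"
      using grad_test_density[OF \<nu> s] by (simp add: lebesgue_test_integral[OF s])
    then have "(-1) ^ m * (\<integral>y. w y * multi_deriv \<nu> ?\<psi> y \<partial>lborel) = (\<integral>y. ?\<psi> y * f (Some \<nu>) y \<partial>\<sigma>)"
      by (simp add: power_mult_distrib[symmetric] mult.assoc[symmetric])
    also have "\<dots> = mconvol \<sigma> (\<rho> j k) (\<lambda>y. \<zeta> j y * f (Some \<nu>) y) x"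
      unfolding mconvol_def by (intro Bochner_Integration.integral_cong) auto
    finally show ?thesis .
  qed
  then show ?thesis
    using pds_approx[OF x, of "midx_list \<nu>" k] by (simp add: multi_deriv_pds length_midx_list om)
qed

end

section \<open>Convergence of variation, area and norms\<close>

lemma L2_set_sum_le: "L2_set (\<lambda>i. \<Sum>j\<in>J. a j i) I \<le> (\<Sum>j\<in>J. L2_set (a j) I)"
proof (induction J rule: infinite_finite_induct)
  case (insert j J)
  have "L2_set (\<lambda>i. a j i + (\<Sum>j\<in>J. a j i)) I \<le> L2_set (a j) I + L2_set (\<lambda>i. \<Sum>j\<in>J. a j i) I"
    by (rule L2_set_triangle_ineq)
  with insert show ?case by simp
qed (simp_all add: L2_set_0')

lemma abs_sum_powr_le:
  fixes a :: "'j \<Rightarrow> real"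
  assumes J: "finite J" and q: "q > 0"
  shows "\<bar>\<Sum>j\<in>J. a j\<bar> powr q \<le> real (card J) powr q * (\<Sum>j\<in>J. \<bar>a j\<bar> powr q)"
proof (cases "J = {}")
  case False
  define M where "M = Max ((\<lambda>j. \<bar>a j\<bar>) ` J)"
  have "M \<in> (\<lambda>j. \<bar>a j\<bar>) ` J" unfolding M_def using J False by (intro Max_in) auto
  then obtain i where i: "i \<in> J" "M = \<bar>a i\<bar>" by blast
  have M: "\<bar>a j\<bar> \<le> M" if "j \<in> J" for j unfolding M_def using J that by (intro Max_ge) auto
  have "\<bar>\<Sum>j\<in>J. a j\<bar> \<le> (\<Sum>j\<in>J. \<bar>a j\<bar>)" by (rule sum_abs)
  also have "\<dots> \<le> (\<Sum>j\<in>J. M)" by (intro sum_mono M)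
  finally have "\<bar>\<Sum>j\<in>J. a j\<bar> \<le> real (card J) * \<bar>a i\<bar>" using i by simp
  then have "\<bar>\<Sum>j\<in>J. a j\<bar> powr q \<le> (real (card J) * \<bar>a i\<bar>) powr q" using q by (intro powr_mono2) auto
  also have "\<dots> = real (card J) powr q * \<bar>a i\<bar> powr q" by (simp add: powr_mult)
  also have "\<bar>a i\<bar> powr q \<le> (\<Sum>j\<in>J. \<bar>a j\<bar> powr q)"
    using J i(1) by (intro member_le_sum[of i J "\<lambda>j. \<bar>a j\<bar> powr q"]) auto
  finally show ?thesis by (simp add: mult_left_mono)
qed simp

context mollified_pieces
begin

text \<open>
  The component \<open>None\<close>, constantly 1, corresponds to Lebesgue measure: with it the norm of \<open>grad_comp\<close> is
  the integrand of the area, without it that of the variation.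
\<close>

definition grad_comp :: "nat \<Rightarrow> ('n \<Rightarrow> nat) option \<Rightarrow> real ^ 'n \<Rightarrow> real" where
  "grad_comp k i x = (case i of None \<Rightarrow> 1 | Some \<nu> \<Rightarrow> multi_deriv \<nu> (approx k) x)"

text \<open>
  What remains of \<open>grad_comp\<close> in \<open>\<Omega>\<close> after subtracting the mollification of the vector measure \<open>f \<sigma>\<close>.
\<close>

definition grad_err :: "nat \<Rightarrow> ('n \<Rightarrow> nat) option \<Rightarrow> real ^ 'n \<Rightarrow> real" where
  "grad_err k i x = (case i of None \<Rightarrow> indicator \<Omega> x - (\<Sum>j\<in>J. convol (\<rho> j k) (\<lambda>y. \<zeta> j y * indicator \<Omega> y) x)
     | Some \<nu> \<Rightarrow> commutator k (midx_list \<nu>) x)"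

abbreviation all_comps :: "('n \<Rightarrow> nat) option set" where
  "all_comps \<equiv> insert None (Some ` midx m)"

lemma finite_all_comps: "finite all_comps"
  by (simp add: finite_midx)

lemma grad_comp_measurable [measurable]: "grad_comp k i \<in> borel_measurable borel"
proof (cases i)
  case (Some \<nu>)
  then have "grad_comp k i = pds (midx_list \<nu>) (approx k)" by (simp add: grad_comp_def fun_eq_iff multi_deriv_pds)
  then show ?thesis using smooth_on_borel[OF smooth_on_pds[OF approx_smooth]] by simp
qed (simp add: grad_comp_def[abs_def])

lemma grad_comp_eq:
  assumes x: "x \<in> \<Omega>" and i: "i \<in> all_comps"
  shows "grad_comp k i x = (\<Sum>j\<in>J. mconvol \<sigma> (\<rho> j k) (\<lambda>y. \<zeta> j y * f i y) x) + grad_err k i x"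
proof (cases i)
  case None
  have "mconvol \<sigma> (\<rho> j k) (\<lambda>y. \<zeta> j y * f None y) x = convol (\<rho> j k) (\<lambda>y. \<zeta> j y * indicator \<Omega> y) x" if j: "j \<in> J" for j
  proof -
    have [measurable]: "\<zeta> j \<in> borel_measurable borel" using pds_cutoff_measurable[OF j, of "[]"] by simp
    have [measurable]: "\<rho> j k \<in> borel_measurable borel" by (rule mollifierD(7)[OF kernel[OF j]])
    have "mconvol \<sigma> (\<rho> j k) (\<lambda>y. \<zeta> j y * f None y) x = (\<integral>y. f None y * (\<rho> j k (x - y) * \<zeta> j y) \<partial>\<sigma>)"
      unfolding mconvol_def by (intro Bochner_Integration.integral_cong) auto
    also have "\<dots> = (\<integral>y. indicator \<Omega> y * (\<rho> j k (x - y) * \<zeta> j y) \<partial>lborel)"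
      by (rule lebesgue_integral_density(1)) measurable
    also have "\<dots> = convol (\<rho> j k) (\<lambda>y. \<zeta> j y * indicator \<Omega> y) x"
      unfolding convol_def by (intro Bochner_Integration.integral_cong) auto
    finally show ?thesis .
  qed
  then show ?thesis using None x by (simp add: grad_comp_def grad_err_def)
next
  case (Some \<nu>)
  then have "\<nu> \<in> midx m" using i by auto
  from top_deriv_approx[OF x this] show ?thesis using Some by (simp add: grad_comp_def grad_err_def)
qed

lemma grad_err_tendsto_0:
  assumes i: "i \<in> all_comps"
  shows "integrable lborel (grad_err k i)" and "(\<lambda>k. \<integral>x. \<bar>grad_err k i x\<bar> \<partial>lborel) \<longlonglongrightarrow> 0"
proof -
  have "(\<forall>k. integrable lborel (grad_err k i)) \<and> (\<lambda>k. \<integral>x. \<bar>grad_err k i x\<bar> \<partial>lborel) \<longlonglongrightarrow> 0"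
  proof (cases i)
    case None
    have iO: "integrable lborel (indicator \<Omega> :: _ \<Rightarrow> real)"
      using bounded_domain by (intro integrable_real_indicator emeasure_bounded_finite) auto
    have s: "(\<Sum>j\<in>J. pds [] (\<zeta> j) x) * indicator \<Omega> x = indicator \<Omega> x" for x
      using sum_pds_cutoff_mult[of "indicator \<Omega>" "[]" x] by simp
    note P = pieces_converge[OF iO, where A="[]", unfolded s, simplified]
    have "integrable lborel (grad_err k i)" for k
      using P(2)[of k] iO None by (simp add: grad_err_def[abs_def])
    moreover have "(\<lambda>k. \<integral>x. \<bar>grad_err k i x\<bar> \<partial>lborel) \<longlonglongrightarrow> 0"
      using P(1) None by (simp add: grad_err_def abs_minus_commute)
    ultimately show ?thesis by blast
  next
    case (Some \<nu>)
    then have "length (midx_list \<nu>) \<le> m" using i by (auto simp: length_midx_list midx_def)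
    from commutator_tendsto_0[OF this] show ?thesis using Some by (simp add: grad_err_def[abs_def])
  qed
  then show "integrable lborel (grad_err k i)" and "(\<lambda>k. \<integral>x. \<bar>grad_err k i x\<bar> \<partial>lborel) \<longlonglongrightarrow> 0" by auto
qed

text \<open>
  Mollifying the vector measure \<open>f \<sigma>\<close> piecewise does not increase its total mass: this is the triangle
  inequality, followed by Tonelli's theorem and the fact that the cutoffs add up to 1.
\<close>

lemma grad_comp_mass_le:
  assumes I: "I \<subseteq> all_comps"
  shows "integrable lborel (\<lambda>x. indicator \<Omega> x * L2_set (\<lambda>i. grad_comp k i x) I)"
    and "(\<integral>x. indicator \<Omega> x * L2_set (\<lambda>i. grad_comp k i x) I \<partial>lborel)
      \<le> (\<integral>x. L2_set (\<lambda>i. f i x) I \<partial>\<sigma>) + (\<Sum>i\<in>I. \<integral>x. \<bar>grad_err k i x\<bar> \<partial>lborel)"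
proof -
  have fI: "finite I" using I finite_all_comps by (rule finite_subset)
  have fi: "integrable \<sigma> (f i)" if "i \<in> I" for i using density_integrable I that by blast
  define H where "H x = L2_set (\<lambda>i. f i x) I" for x
  have iH: "integrable \<sigma> H" unfolding H_def by (rule integrable_L2_set[OF fi])
  have H0: "H x \<ge> 0" for x by (simp add: H_def)
  let ?M = "\<lambda>j. mconvol \<sigma> (\<rho> j k) (\<lambda>y. \<zeta> j y * H y)"
  have sf: "sigma_finite_measure \<sigma>" by (rule finite_imp_sigma_finite[OF finite_measure_axioms])
  have iM: "integrable lborel (?M j)" "(\<integral>x. \<bar>?M j x\<bar> \<partial>lborel) \<le> (\<integral>y. \<bar>\<zeta> j y * H y\<bar> \<partial>\<sigma>)" if j: "j \<in> J" for j
    using mconvol_integrable[OF kernel[OF j] sf sets_eq cutoff_mult_integrable_measure[OF j iH]] by auto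
  have ie: "integrable lborel (grad_err k i)" if "i \<in> I" for i using grad_err_tendsto_0(1) I that by blast
  have le: "indicator \<Omega> x * L2_set (\<lambda>i. grad_comp k i x) I \<le> (\<Sum>j\<in>J. \<bar>?M j x\<bar>) + (\<Sum>i\<in>I. \<bar>grad_err k i x\<bar>)" for x
  proof (cases "x \<in> \<Omega>")
    case True
    have "L2_set (\<lambda>i. grad_comp k i x) I
        = L2_set (\<lambda>i. (\<Sum>j\<in>J. mconvol \<sigma> (\<rho> j k) (\<lambda>y. \<zeta> j y * f i y) x) + grad_err k i x) I"
      using grad_comp_eq[OF True] I by (intro L2_set_cong) auto
    also have "\<dots> \<le> L2_set (\<lambda>i. \<Sum>j\<in>J. mconvol \<sigma> (\<rho> j k) (\<lambda>y. \<zeta> j y * f i y) x) I + L2_set (\<lambda>i. grad_err k i x) I"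
      by (rule L2_set_triangle_ineq)
    also have "L2_set (\<lambda>i. \<Sum>j\<in>J. mconvol \<sigma> (\<rho> j k) (\<lambda>y. \<zeta> j y * f i y) x) I
        \<le> (\<Sum>j\<in>J. L2_set (\<lambda>i. mconvol \<sigma> (\<rho> j k) (\<lambda>y. \<zeta> j y * f i y) x) I)"
      by (rule L2_set_sum_le)
    also have "\<dots> \<le> (\<Sum>j\<in>J. \<bar>?M j x\<bar>)"
    proof (rule sum_mono)
      fix j assume j: "j \<in> J"
      have "L2_set (\<lambda>i. mconvol \<sigma> (\<rho> j k) (\<lambda>y. \<zeta> j y * f i y) x) I \<le> (\<integral>y. L2_set (\<lambda>i. \<rho> j k (x - y) * (\<zeta> j y * f i y)) I \<partial>\<sigma>)"
        unfolding mconvol_def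
        by (intro L2_set_integral_le fI mollifier_mult_integrable[OF kernel[OF j] sets_eq] cutoff_mult_integrable_measure[OF j] fi)
      also have "\<dots> = ?M j x"
        unfolding mconvol_def
      proof (rule Bochner_Integration.integral_cong)
        fix y
        have "0 \<le> \<rho> j k (x - y) * \<zeta> j y" using mollifierD(2)[OF kernel[OF j]] cutoff_nonneg[OF j] by simp
        from L2_set_right_distrib[OF this, of "\<lambda>i. f i y" I]
        show "L2_set (\<lambda>i. \<rho> j k (x - y) * (\<zeta> j y * f i y)) I = \<rho> j k (x - y) * (\<zeta> j y * H y)"
          by (simp add: H_def mult.assoc)
      qed simp
      finally show "L2_set (\<lambda>i. mconvol \<sigma> (\<rho> j k) (\<lambda>y. \<zeta> j y * f i y) x) I \<le> \<bar>?M j x\<bar>" by linarith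
    qed
    also have "L2_set (\<lambda>i. grad_err k i x) I \<le> (\<Sum>i\<in>I. \<bar>grad_err k i x\<bar>)" by (rule L2_set_le_sum_abs)
    finally show ?thesis using True by simp
  qed (simp add: sum_nonneg add_nonneg_nonneg)
  have ib: "integrable lborel (\<lambda>x. (\<Sum>j\<in>J. \<bar>?M j x\<bar>) + (\<Sum>i\<in>I. \<bar>grad_err k i x\<bar>))"
    using iM(1) ie by (intro Bochner_Integration.integrable_add Bochner_Integration.integrable_sum integrable_abs) auto
  show i: "integrable lborel (\<lambda>x. indicator \<Omega> x * L2_set (\<lambda>i. grad_comp k i x) I)"
  proof (rule Bochner_Integration.integrable_bound[OF ib])
    show "AE x in lborel. norm (indicator \<Omega> x * L2_set (\<lambda>i. grad_comp k i x) I) \<le> norm ((\<Sum>j\<in>J. \<bar>?M j x\<bar>) + (\<Sum>i\<in>I. \<bar>grad_err k i x\<bar>))"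
      using order_trans[OF le abs_ge_self] by (intro AE_I2) simp
  qed measurable
  have "(\<integral>x. indicator \<Omega> x * L2_set (\<lambda>i. grad_comp k i x) I \<partial>lborel) \<le> (\<integral>x. (\<Sum>j\<in>J. \<bar>?M j x\<bar>) + (\<Sum>i\<in>I. \<bar>grad_err k i x\<bar>) \<partial>lborel)"
    by (rule integral_mono[OF i ib le])
  also have "\<dots> = (\<Sum>j\<in>J. \<integral>x. \<bar>?M j x\<bar> \<partial>lborel) + (\<Sum>i\<in>I. \<integral>x. \<bar>grad_err k i x\<bar> \<partial>lborel)"
    using iM(1) ie by (simp add: Bochner_Integration.integral_sum)
  also have "(\<Sum>j\<in>J. \<integral>x. \<bar>?M j x\<bar> \<partial>lborel) \<le> (\<Sum>j\<in>J. \<integral>y. \<zeta> j y * H y \<partial>\<sigma>)"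
  proof (rule sum_mono)
    fix j assume j: "j \<in> J"
    have "\<bar>\<zeta> j y * H y\<bar> = \<zeta> j y * H y" for y using cutoff_nonneg[OF j] H0 by simp
    with iM(2)[OF j] show "(\<integral>x. \<bar>?M j x\<bar> \<partial>lborel) \<le> (\<integral>y. \<zeta> j y * H y \<partial>\<sigma>)" by simp
  qed
  also have "\<dots> = (\<integral>y. (\<Sum>j\<in>J. \<zeta> j y) * H y \<partial>\<sigma>)"
    using cutoff_mult_integrable_measure[OF _ iH] by (simp add: Bochner_Integration.integral_sum sum_distrib_right)
  also have "\<dots> = (\<integral>y. H y \<partial>\<sigma>)"
  proof (rule integral_cong_AE)
    have "integrable \<sigma> (\<lambda>y. \<Sum>j\<in>J. \<zeta> j y * H y)"
      using cutoff_mult_integrable_measure[OF _ iH] by (intro Bochner_Integration.integrable_sum) auto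
    then show "(\<lambda>y. (\<Sum>j\<in>J. \<zeta> j y) * H y) \<in> borel_measurable \<sigma>" by (auto simp: sum_distrib_right)
    show "AE y in \<sigma>. (\<Sum>j\<in>J. \<zeta> j y) * H y = H y"
      using AE_in_domain by (rule eventually_mono) (simp add: partition)
  qed (use iH in auto)
  finally show "(\<integral>x. indicator \<Omega> x * L2_set (\<lambda>i. grad_comp k i x) I \<partial>lborel)
      \<le> (\<integral>x. L2_set (\<lambda>i. f i x) I \<partial>\<sigma>) + (\<Sum>i\<in>I. \<integral>x. \<bar>grad_err k i x\<bar> \<partial>lborel)"
    by (simp add: H_def)
qed

lemma C_test_properties:
  assumes "C_on m UNIV g" "compact_support_in \<Omega> g"
  shows "\<exists>R. \<forall>x. g x \<noteq> 0 \<longrightarrow> norm x \<le> R" "g x \<noteq> 0 \<Longrightarrow> x \<in> \<Omega>" "length is \<le> m \<Longrightarrow> x \<notin> \<Omega> \<Longrightarrow> pds is g x = 0"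
    "length is \<le> m \<Longrightarrow> \<exists>B\<ge>0. \<forall>x. \<bar>pds is g x\<bar> \<le> B" "length is \<le> m \<Longrightarrow> pds is g \<in> borel_measurable borel"
proof -
  obtain K where K: "compact K" "K \<subseteq> \<Omega>" "\<And>x. x \<notin> K \<Longrightarrow> g x = 0"
    using assms(2) compact_support_inE by blast
  obtain R where R: "\<And>x. x \<in> K \<Longrightarrow> norm x \<le> R"
    using compact_imp_bounded[OF K(1)] by (auto simp: bounded_iff)
  have gK: "x \<in> K" if "g x \<noteq> 0" for x using K(3) that by metis
  have gR: "norm x \<le> R" if "g x \<noteq> 0" for x by (rule R[OF gK[OF that]])
  then show "\<exists>R. \<forall>x. g x \<noteq> 0 \<longrightarrow> norm x \<le> R" by metis
  show "g x \<noteq> 0 \<Longrightarrow> x \<in> \<Omega>" using gK[of x] K(2) by auto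
  have "x \<notin> K \<Longrightarrow> pds is g x = 0"
    by (rule pds_zero_off_closed[OF compact_imp_closed[OF K(1)] K(3)])
  then show "length is \<le> m \<Longrightarrow> x \<notin> \<Omega> \<Longrightarrow> pds is g x = 0"
    using K(2) by blast
  assume "length is \<le> m"
  then have c: "continuous_on UNIV (pds is g)" using C_on_pds[OF assms(1), of "is" 0] by simp
  show "\<exists>B\<ge>0. \<forall>x. \<bar>pds is g x\<bar> \<le> B"
  proof (rule continuous_bounded_support(2)[OF c, of R])
    fix y assume "pds is g y \<noteq> 0"
    then show "norm y \<le> R" by (rule pds_bounded_support[rotated]) (rule gR)
  qed
  show "pds is g \<in> borel_measurable borel" using c by (rule borel_measurable_continuous_onI)
qed

text \<open>
  The pairing of a component of \<open>f \<sigma>\<close> with a \<open>C\<^sup>m\<close> function, expressed through \<open>u\<close>: the measures of the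
  gradient are only known to represent the pairing with smooth functions.
\<close>

definition test_value :: "('n \<Rightarrow> nat) option \<Rightarrow> (real ^ 'n \<Rightarrow> real) \<Rightarrow> real" where
  "test_value i g = (case i of None \<Rightarrow> \<integral>x. indicator \<Omega> x * g x \<partial>lborel
     | Some \<nu> \<Rightarrow> (-1) ^ m * (\<integral>x. w x * multi_deriv \<nu> g x \<partial>lborel))"

text \<open>
  All derivatives are moved to \<open>g\<close>; what is left to pass to the limit is the \<open>L\<^sup>1\<close> convergence of the
  approximations.
\<close>

lemma grad_comp_test_tendsto:
  assumes i: "i \<in> all_comps" and g: "C_on m UNIV g" "compact_support_in \<Omega> g"
  shows "(\<lambda>k. \<integral>x. indicator \<Omega> x * (g x * grad_comp k i x) \<partial>lborel) \<longlonglongrightarrow> test_value i g"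
proof (cases i)
  case None
  then show ?thesis by (simp add: grad_comp_def test_value_def)
next
  case (Some \<nu>)
  let ?is = "midx_list \<nu>"
  have len: "length ?is = m" using i Some by (auto simp: length_midx_list midx_def)
  note t = C_test_properties[OF g]
  obtain R where R: "\<And>x. g x \<noteq> 0 \<Longrightarrow> norm x \<le> R" using t(1) by blast
  obtain B where B: "B \<ge> 0" "\<And>x. \<bar>pds ?is g x\<bar> \<le> B" using t(4)[of ?is] len by auto
  have pz: "pds ?is g x = 0" if "x \<notin> \<Omega>" for x using t(3)[of ?is x] len that by simp
  have pm [measurable]: "pds ?is g \<in> borel_measurable borel" using t(5)[of ?is] len by simp
  have eq: "(\<integral>x. indicator \<Omega> x * (g x * grad_comp k i x) \<partial>lborel) = (-1) ^ m * (\<integral>x. approx k x * pds ?is g x \<partial>lborel)" for k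
  proof -
    have "(\<integral>x. indicator \<Omega> x * (g x * grad_comp k i x) \<partial>lborel) = (\<integral>x. pds ?is (approx k) x * g x \<partial>lborel)"
      using t(2) Some by (intro Bochner_Integration.integral_cong) (auto simp: grad_comp_def multi_deriv_pds indicator_def)
    moreover have "(\<integral>x. approx k x * pds ?is g x \<partial>lborel) = (-1) ^ m * (\<integral>x. pds ?is (approx k) x * g x \<partial>lborel)"
      using integration_by_parts_pds[OF approx_smooth, of ?is g R k] g(1) R len by simp
    ultimately show ?thesis by (simp add: power_mult_distrib[symmetric] mult.assoc[symmetric])
  qed
  have "(\<lambda>k. \<integral>x. approx k x * pds ?is g x \<partial>lborel) \<longlonglongrightarrow> (\<integral>x. w x * pds ?is g x \<partial>lborel)"
  proof -
    have iw: "integrable lborel (\<lambda>x. w x * pds ?is g x)"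
      using integrable_bounded_mult[OF w_integrable _ B(2)] by (simp add: mult.commute)
    have ia: "integrable lborel (\<lambda>x. approx k x * pds ?is g x)" for k
    proof -
      have c: "continuous_on UNIV (\<lambda>x. approx k x * pds ?is g x)"
        using smooth_on_continuous[OF approx_smooth] C_on_pds[OF g(1), of ?is 0] len by (intro continuous_intros) auto
      show ?thesis
        by (rule continuous_bounded_support(1)[OF c, of R]) (use pds_bounded_support[of g R, OF R] in auto)
    qed
    have "(\<lambda>k. (\<integral>x. approx k x * pds ?is g x \<partial>lborel) - (\<integral>x. w x * pds ?is g x \<partial>lborel)) \<longlonglongrightarrow> 0"
    proof (rule Lim_null_comparison)
      have "\<bar>(\<integral>x. approx k x * pds ?is g x \<partial>lborel) - (\<integral>x. w x * pds ?is g x \<partial>lborel)\<bar> \<le> B * (\<integral>x. indicator \<Omega> x * \<bar>approx k x - w x\<bar> \<partial>lborel)" for k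
      proof -
        have eq: "(\<integral>x. approx k x * pds ?is g x \<partial>lborel) - (\<integral>x. w x * pds ?is g x \<partial>lborel) = (\<integral>x. (approx k x - w x) * pds ?is g x \<partial>lborel)"
          using ia iw by (simp add: left_diff_distrib)
        have "\<bar>\<integral>x. (approx k x - w x) * pds ?is g x \<partial>lborel\<bar> \<le> (\<integral>x. \<bar>(approx k x - w x) * pds ?is g x\<bar> \<partial>lborel)"
          by (rule integral_abs_bound)
        also have "\<dots> \<le> (\<integral>x. B * (indicator \<Omega> x * \<bar>approx k x - w x\<bar>) \<partial>lborel)"
        proof (rule integral_mono)
          show "integrable lborel (\<lambda>x. \<bar>(approx k x - w x) * pds ?is g x\<bar>)"
            using Bochner_Integration.integrable_diff[OF ia[of k] iw] by (simp add: left_diff_distrib)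
          show "integrable lborel (\<lambda>x. B * (indicator \<Omega> x * \<bar>approx k x - w x\<bar>))"
            using approx_converges_L1(2)[of k] by simp
          show "\<bar>(approx k x - w x) * pds ?is g x\<bar> \<le> B * (indicator \<Omega> x * \<bar>approx k x - w x\<bar>)" for x
          proof (cases "x \<in> \<Omega>")
            case True
            then show ?thesis using B(2)[of x] by (simp add: abs_mult mult.commute[of _ "\<bar>pds _ _ _\<bar>"] mult_right_mono)
          qed (use pz in simp)
        qed
        also have "\<dots> = B * (\<integral>x. indicator \<Omega> x * \<bar>approx k x - w x\<bar> \<partial>lborel)" by simp
        finally show ?thesis unfolding eq .
      qed
      then show "\<forall>\<^sub>F k in sequentially. norm ((\<integral>x. approx k x * pds ?is g x \<partial>lborel) - (\<integral>x. w x * pds ?is g x \<partial>lborel))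
          \<le> B * (\<integral>x. indicator \<Omega> x * \<bar>approx k x - w x\<bar> \<partial>lborel)" by simp
      show "(\<lambda>k. B * (\<integral>x. indicator \<Omega> x * \<bar>approx k x - w x\<bar> \<partial>lborel)) \<longlonglongrightarrow> 0"
        by (rule tendsto_mult_right_zero[OF approx_converges_L1(1)])
    qed
    then show ?thesis by (simp add: LIM_zero_iff)
  qed
  then have "(\<lambda>k. (-1) ^ m * (\<integral>x. approx k x * pds ?is g x \<partial>lborel)) \<longlonglongrightarrow> (-1) ^ m * (\<integral>x. w x * pds ?is g x \<partial>lborel)"
    by (intro tendsto_mult tendsto_const)
  then show ?thesis unfolding eq using Some by (simp add: test_value_def multi_deriv_pds)
qed

lemma test_sum_bound:
  assumes I: "I \<subseteq> all_comps" and g: "\<And>i. i \<in> I \<Longrightarrow> C_on m UNIV (g i)" "\<And>i. i \<in> I \<Longrightarrow> compact_support_in \<Omega> (g i)"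
    and g1: "\<And>x. L2_set (\<lambda>i. g i x) I \<le> 1"
  shows "\<bar>\<Sum>i\<in>I. \<integral>x. indicator \<Omega> x * (g i x * grad_comp k i x) \<partial>lborel\<bar>
    \<le> (\<integral>x. indicator \<Omega> x * L2_set (\<lambda>i. grad_comp k i x) I \<partial>lborel)"
proof -
  have fI: "finite I" using I finite_all_comps by (rule finite_subset)
  note iG = grad_comp_mass_le(1)[OF I, of k]
  have le: "\<bar>g i x * grad_comp k i x\<bar> \<le> L2_set (\<lambda>i. grad_comp k i x) I" if i: "i \<in> I" for i x
  proof -
    have "\<bar>g i x\<bar> * \<bar>grad_comp k i x\<bar> \<le> (\<Sum>i\<in>I. \<bar>g i x\<bar> * \<bar>grad_comp k i x\<bar>)"
      using fI i by (intro member_le_sum[of i I "\<lambda>i. \<bar>g i x\<bar> * \<bar>grad_comp k i x\<bar>"]) auto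
    also have "\<dots> \<le> L2_set (\<lambda>i. g i x) I * L2_set (\<lambda>i. grad_comp k i x) I" by (rule L2_set_mult_ineq)
    also have "\<dots> \<le> 1 * L2_set (\<lambda>i. grad_comp k i x) I" by (intro mult_right_mono g1) simp
    finally show ?thesis by (simp add: abs_mult)
  qed
  have gm: "g i \<in> borel_measurable borel" if "i \<in> I" for i
    using C_on_imp_continuous[OF g(1)[OF that]] by (rule borel_measurable_continuous_onI)
  have ii: "integrable lborel (\<lambda>x. indicator \<Omega> x * (g i x * grad_comp k i x))" if i: "i \<in> I" for i
  proof (rule Bochner_Integration.integrable_bound[OF iG])
    note [measurable] = gm[OF i]
    show "(\<lambda>x. indicator \<Omega> x * (g i x * grad_comp k i x)) \<in> borel_measurable lborel" by measurable
    show "AE x in lborel. norm (indicator \<Omega> x * (g i x * grad_comp k i x)) \<le> norm (indicator \<Omega> x * L2_set (\<lambda>i. grad_comp k i x) I)"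
      using le[OF i] by (intro AE_I2) (auto simp: indicator_def)
  qed
  have "(\<Sum>i\<in>I. \<integral>x. indicator \<Omega> x * (g i x * grad_comp k i x) \<partial>lborel) = (\<integral>x. (\<Sum>i\<in>I. indicator \<Omega> x * (g i x * grad_comp k i x)) \<partial>lborel)"
    by (rule Bochner_Integration.integral_sum[symmetric]) (rule ii)
  also have "\<bar>\<integral>x. (\<Sum>i\<in>I. indicator \<Omega> x * (g i x * grad_comp k i x)) \<partial>lborel\<bar> \<le> (\<integral>x. \<bar>\<Sum>i\<in>I. indicator \<Omega> x * (g i x * grad_comp k i x)\<bar> \<partial>lborel)"
    by (rule integral_abs_bound)
  also have "\<dots> \<le> (\<integral>x. indicator \<Omega> x * L2_set (\<lambda>i. grad_comp k i x) I \<partial>lborel)"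
  proof (rule integral_mono[OF _ iG])
    show "integrable lborel (\<lambda>x. \<bar>\<Sum>i\<in>I. indicator \<Omega> x * (g i x * grad_comp k i x)\<bar>)"
      using ii by (intro integrable_abs Bochner_Integration.integrable_sum) auto
    show "\<bar>\<Sum>i\<in>I. indicator \<Omega> x * (g i x * grad_comp k i x)\<bar> \<le> indicator \<Omega> x * L2_set (\<lambda>i. grad_comp k i x) I" for x
    proof (cases "x \<in> \<Omega>")
      case True
      have "\<bar>\<Sum>i\<in>I. g i x * grad_comp k i x\<bar> \<le> (\<Sum>i\<in>I. \<bar>g i x\<bar> * \<bar>grad_comp k i x\<bar>)"
        by (rule order_trans[OF sum_abs]) (simp add: abs_mult)
      also have "\<dots> \<le> L2_set (\<lambda>i. g i x) I * L2_set (\<lambda>i. grad_comp k i x) I" by (rule L2_set_mult_ineq)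
      also have "\<dots> \<le> 1 * L2_set (\<lambda>i. grad_comp k i x) I" by (intro mult_right_mono g1) simp
      finally show ?thesis using True by simp
    qed simp
  qed
  finally show ?thesis .
qed

lemma grad_err_sum_tendsto_0:
  assumes I: "I \<subseteq> all_comps"
  shows "(\<lambda>k. \<Sum>i\<in>I. \<integral>x. \<bar>grad_err k i x\<bar> \<partial>lborel) \<longlonglongrightarrow> 0"
proof -
  have "(\<lambda>k. \<Sum>i\<in>I. \<integral>x. \<bar>grad_err k i x\<bar> \<partial>lborel) \<longlonglongrightarrow> (\<Sum>i\<in>I. 0)"
    using I by (intro tendsto_sum grad_err_tendsto_0(2)) auto
  then show ?thesis by simp
qed

text \<open>
  For \<open>C\<^sup>m\<close> fields the bound is obtained as the limit of the bounds for the approximations, whose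
  derivatives are functions and can be integrated against any continuous field.
\<close>

lemma test_value_le_mass:
  assumes I: "I \<subseteq> all_comps" and g: "\<And>i. i \<in> I \<Longrightarrow> C_on m UNIV (g i)" "\<And>i. i \<in> I \<Longrightarrow> compact_support_in \<Omega> (g i)"
    and g1: "\<And>x. L2_set (\<lambda>i. g i x) I \<le> 1"
  shows "\<bar>\<Sum>i\<in>I. test_value i (g i)\<bar> \<le> (\<integral>x. L2_set (\<lambda>i. f i x) I \<partial>\<sigma>)"
proof (rule LIMSEQ_le)
  show "(\<lambda>k. \<bar>\<Sum>i\<in>I. \<integral>x. indicator \<Omega> x * (g i x * grad_comp k i x) \<partial>lborel\<bar>) \<longlonglongrightarrow> \<bar>\<Sum>i\<in>I. test_value i (g i)\<bar>"
    using I g by (intro tendsto_rabs tendsto_sum grad_comp_test_tendsto) auto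
  have "(\<lambda>k. (\<integral>x. L2_set (\<lambda>i. f i x) I \<partial>\<sigma>) + (\<Sum>i\<in>I. \<integral>x. \<bar>grad_err k i x\<bar> \<partial>lborel)) \<longlonglongrightarrow> (\<integral>x. L2_set (\<lambda>i. f i x) I \<partial>\<sigma>) + 0"
    by (intro tendsto_add tendsto_const grad_err_sum_tendsto_0 I)
  then show "(\<lambda>k. (\<integral>x. L2_set (\<lambda>i. f i x) I \<partial>\<sigma>) + (\<Sum>i\<in>I. \<integral>x. \<bar>grad_err k i x\<bar> \<partial>lborel)) \<longlonglongrightarrow> (\<integral>x. L2_set (\<lambda>i. f i x) I \<partial>\<sigma>)" by simp
  show "\<exists>N. \<forall>k\<ge>N. \<bar>\<Sum>i\<in>I. \<integral>x. indicator \<Omega> x * (g i x * grad_comp k i x) \<partial>lborel\<bar>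
      \<le> (\<integral>x. L2_set (\<lambda>i. f i x) I \<partial>\<sigma>) + (\<Sum>i\<in>I. \<integral>x. \<bar>grad_err k i x\<bar> \<partial>lborel)"
    using order_trans[OF test_sum_bound[OF I g g1] grad_comp_mass_le(2)[OF I]] by blast
qed

lemma test_value_smooth:
  assumes i: "i \<in> all_comps" and g: "smooth_supported \<Omega> g"
  shows "test_value i g = (\<integral>x. g x * f i x \<partial>\<sigma>)"
proof (cases i)
  case None
  have "g \<in> borel_measurable borel" by (rule smooth_supported_bounded(2)[OF g])
  from lebesgue_integral_density(1)[OF this] show ?thesis using None by (simp add: test_value_def mult.commute)
next
  case (Some \<nu>)
  then have "\<nu> \<in> midx m" using i by auto
  from grad_test_density[OF this g] show ?thesis
    using Some by (simp add: test_value_def lebesgue_test_integral[OF g] power_mult_distrib[symmetric] mult.assoc[symmetric])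
qed

lemma optimal_test_exists:
  assumes I: "I \<subseteq> all_comps" and e: "e > 0"
  shows "\<exists>g. (\<forall>i\<in>I. smooth_supported \<Omega> (g i)) \<and> (\<forall>x. L2_set (\<lambda>i. g i x) I \<le> 1) \<and>
    (\<integral>x. L2_set (\<lambda>i. f i x) I \<partial>\<sigma>) - e < (\<Sum>i\<in>I. test_value i (g i))"
proof -
  have fI: "finite I" using I finite_all_comps by (rule finite_subset)
  have fi: "integrable \<sigma> (f i)" if "i \<in> I" for i using density_integrable I that by blast
  obtain g where g: "\<And>i. i \<in> I \<Longrightarrow> smooth_supported \<Omega> (g i)" "\<And>x. L2_set (\<lambda>i. g i x) I \<le> 1"
    "(\<integral>x. L2_set (\<lambda>i. f i x) I \<partial>\<sigma>) - e < (\<Sum>i\<in>I. \<integral>x. g i x * f i x \<partial>\<sigma>)"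
    using dual_test_field[of I f e, OF fI fi e] by blast
  have "(\<Sum>i\<in>I. test_value i (g i)) = (\<Sum>i\<in>I. \<integral>x. g i x * f i x \<partial>\<sigma>)"
    using I g(1) by (intro sum.cong refl test_value_smooth) auto
  with g show ?thesis by (intro exI[of _ g]) auto
qed

text \<open>
  The upper bound is the mass estimate for mollified measures.  The lower bound is semicontinuity: the
  mass is at least the pairing with a fixed test field that is almost optimal for \<open>f \<sigma>\<close>, and this pairing
  converges.
\<close>

lemma mass_converges:
  assumes I: "I \<subseteq> all_comps"
  shows "(\<lambda>k. \<integral>x. indicator \<Omega> x * L2_set (\<lambda>i. grad_comp k i x) I \<partial>lborel) \<longlonglongrightarrow> (\<integral>x. L2_set (\<lambda>i. f i x) I \<partial>\<sigma>)"
proof (rule LIMSEQ_I)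
  let ?T = "\<integral>x. L2_set (\<lambda>i. f i x) I \<partial>\<sigma>" and ?a = "\<lambda>k. \<integral>x. indicator \<Omega> x * L2_set (\<lambda>i. grad_comp k i x) I \<partial>lborel"
  fix e :: real assume e: "0 < e"
  obtain g where g: "\<And>i. i \<in> I \<Longrightarrow> smooth_supported \<Omega> (g i)" "\<And>x. L2_set (\<lambda>i. g i x) I \<le> 1" "?T - e < (\<Sum>i\<in>I. test_value i (g i))"
    using optimal_test_exists[OF I e] by blast
  have gC: "\<And>i. i \<in> I \<Longrightarrow> C_on m UNIV (g i)" "\<And>i. i \<in> I \<Longrightarrow> compact_support_in \<Omega> (g i)"
    using g(1) by (auto simp: smooth_supported_def smooth_on_def)
  have "(\<lambda>k. \<Sum>i\<in>I. \<integral>x. indicator \<Omega> x * (g i x * grad_comp k i x) \<partial>lborel) \<longlonglongrightarrow> (\<Sum>i\<in>I. test_value i (g i))"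
    using I gC by (intro tendsto_sum grad_comp_test_tendsto) auto
  from order_tendstoD(1)[OF this g(3)]
  have "eventually (\<lambda>k. ?T - e < ?a k) sequentially"
  proof (rule eventually_mono)
    fix k assume "?T - e < (\<Sum>i\<in>I. \<integral>x. indicator \<Omega> x * (g i x * grad_comp k i x) \<partial>lborel)"
    with test_sum_bound[OF I gC g(2), of k] show "?T - e < ?a k" by linarith
  qed
  moreover have "eventually (\<lambda>k. ?a k < ?T + e) sequentially"
    using order_tendstoD(2)[OF grad_err_sum_tendsto_0[OF I] e]
  proof (rule eventually_mono)
    fix k assume "(\<Sum>i\<in>I. \<integral>x. \<bar>grad_err k i x\<bar> \<partial>lborel) < e"
    with grad_comp_mass_le(2)[OF I, of k] show "?a k < ?T + e" by linarith
  qed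
  ultimately have "eventually (\<lambda>k. norm (?a k - ?T) < e) sequentially"
    by eventually_elim (simp add: abs_less_iff)
  then show "\<exists>N. \<forall>k\<ge>N. norm (?a k - ?T) < e" by (simp add: eventually_sequentially)
qed

text \<open>
  The duality formula has \<open>C\<^sup>m\<close> fields, the dual test fields are smooth: the supremum is bounded by the
  mass of the gradient, and smooth fields come arbitrarily close to it.
\<close>

lemma grad_variation_eq: "grad_variation m \<Omega> u = (\<integral>x. L2_set (\<lambda>i. f i x) (Some ` midx m) \<partial>\<sigma>)"
proof -
  let ?I = "Some ` (midx m :: ('n \<Rightarrow> nat) set)"
  let ?T = "\<integral>x. L2_set (\<lambda>i. f i x) ?I \<partial>\<sigma>"
  have I: "?I \<subseteq> all_comps" by auto
  have L2: "L2_set h ?I = L2_set (\<lambda>\<nu>. h (Some \<nu>)) (midx m)" for h :: "('n \<Rightarrow> nat) option \<Rightarrow> real"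
    by (simp add: L2_set_def sum.reindex)
  have val: "(LINT x:\<Omega>|lebesgue. u x * (\<Sum>\<nu>\<in>midx m. multi_deriv \<nu> (g \<nu>) x)) = (-1) ^ m * (\<Sum>i\<in>?I. test_value i (g (the i)))"
    if g: "\<And>\<nu>. \<nu> \<in> midx m \<Longrightarrow> C_on m UNIV (g \<nu>)" "\<And>\<nu>. \<nu> \<in> midx m \<Longrightarrow> compact_support_in \<Omega> (g \<nu>)" for g
  proof -
    have i: "integrable lborel (\<lambda>x. w x * multi_deriv \<nu> (g \<nu>) x)" if nu: "\<nu> \<in> midx m" for \<nu>
    proof -
      have len: "length (midx_list \<nu>) \<le> m" using nu by (simp add: length_midx_list midx_def)
      obtain B where B: "\<And>x. \<bar>pds (midx_list \<nu>) (g \<nu>) x\<bar> \<le> B" using C_test_properties(4)[OF g[OF nu] len] by blast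
      have "pds (midx_list \<nu>) (g \<nu>) \<in> borel_measurable lborel" using C_test_properties(5)[OF g[OF nu] len] by simp
      from integrable_bounded_mult[OF w_integrable this B] show ?thesis by (simp add: multi_deriv_pds mult.commute)
    qed
    have "multi_deriv \<nu> (g \<nu>) \<in> borel_measurable borel" if nu: "\<nu> \<in> midx m" for \<nu>
      using C_test_properties(5)[OF g[OF nu], of "midx_list \<nu>"] nu by (simp add: multi_deriv_pds length_midx_list midx_def)
    then have "(LINT x:\<Omega>|lebesgue. u x * (\<Sum>\<nu>\<in>midx m. multi_deriv \<nu> (g \<nu>) x)) = (\<integral>x. w x * (\<Sum>\<nu>\<in>midx m. multi_deriv \<nu> (g \<nu>) x) \<partial>lborel)"
      using w_outside by (intro lebesgue_set_integral_mult w_AE borel_measurable_sum) auto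
    also have "\<dots> = (\<integral>x. (\<Sum>\<nu>\<in>midx m. w x * multi_deriv \<nu> (g \<nu>) x) \<partial>lborel)"
      by (simp add: sum_distrib_left)
    also have "\<dots> = (\<Sum>\<nu>\<in>midx m. \<integral>x. w x * multi_deriv \<nu> (g \<nu>) x \<partial>lborel)"
      by (rule Bochner_Integration.integral_sum) (rule i)
    also have "\<dots> = (-1) ^ m * (\<Sum>i\<in>?I. test_value i (g (the i)))"
      by (simp add: sum.reindex test_value_def sum_distrib_left mult.assoc[symmetric] power_mult_distrib[symmetric])
    finally show ?thesis .
  qed
  show ?thesis
    unfolding grad_variation_def
  proof (rule cSup_eq)
    fix z assume "z \<in> {LINT x:\<Omega>|lebesgue. u x * (\<Sum>\<nu>\<in>midx m. multi_deriv \<nu> (g \<nu>) x) | g.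
            (\<forall>\<nu>\<in>midx m. C_on m UNIV (g \<nu>) \<and> compact_support_in \<Omega> (g \<nu>)) \<and> (\<forall>x. L2_set (\<lambda>\<nu>. g \<nu> x) (midx m) \<le> 1)}"
    then obtain g where g: "z = (LINT x:\<Omega>|lebesgue. u x * (\<Sum>\<nu>\<in>midx m. multi_deriv \<nu> (g \<nu>) x))"
      "\<And>\<nu>. \<nu> \<in> midx m \<Longrightarrow> C_on m UNIV (g \<nu>)" "\<And>\<nu>. \<nu> \<in> midx m \<Longrightarrow> compact_support_in \<Omega> (g \<nu>)"
      "\<And>x. L2_set (\<lambda>\<nu>. g \<nu> x) (midx m) \<le> 1" by blast
    have "\<bar>\<Sum>i\<in>?I. test_value i (g (the i))\<bar> \<le> ?T"
      using g(2-4) by (intro test_value_le_mass[OF I]) (auto simp: L2)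
    moreover have "\<bar>z\<bar> = \<bar>\<Sum>i\<in>?I. test_value i (g (the i))\<bar>"
      using val[of g] g(2,3) by (simp add: g(1) abs_mult)
    ultimately show "z \<le> ?T" by linarith
  next
    fix y assume y: "\<And>z. z \<in> {LINT x:\<Omega>|lebesgue. u x * (\<Sum>\<nu>\<in>midx m. multi_deriv \<nu> (g \<nu>) x) | g.
            (\<forall>\<nu>\<in>midx m. C_on m UNIV (g \<nu>) \<and> compact_support_in \<Omega> (g \<nu>)) \<and> (\<forall>x. L2_set (\<lambda>\<nu>. g \<nu> x) (midx m) \<le> 1)} \<Longrightarrow> z \<le> y"
    show "?T \<le> y"
    proof (rule field_le_epsilon)
      fix e :: real assume "0 < e"
      then obtain g where g: "\<And>i. i \<in> ?I \<Longrightarrow> smooth_supported \<Omega> (g i)" "\<And>x. L2_set (\<lambda>i. g i x) ?I \<le> 1"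
        "?T - e < (\<Sum>i\<in>?I. test_value i (g i))"
        using optimal_test_exists[OF I, of e] by blast
      \<comment> \<open>The sign compensates the one from integrating by parts \<open>m\<close> times, which the duality formula omits.\<close>
      define g' where "g' \<nu> x = (-1) ^ m * g (Some \<nu>) x" for \<nu> x
      have sg: "smooth_on UNIV (g (Some \<nu>))" "compact_support_in \<Omega> (g (Some \<nu>))" if "\<nu> \<in> midx m" for \<nu>
        using g(1)[of "Some \<nu>"] that by (auto simp: smooth_supported_def)
      have g'C: "C_on m UNIV (g' \<nu>)" if "\<nu> \<in> midx m" for \<nu>
        using smooth_on_cmult[OF sg(1)[OF that], of "(-1) ^ m"] unfolding g'_def smooth_on_def by blast
      have g's: "compact_support_in \<Omega> (g' \<nu>)" if "\<nu> \<in> midx m" for \<nu>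
        using sg(2)[OF that] by (simp add: compact_support_in_def g'_def)
      have g'1: "L2_set (\<lambda>\<nu>. g' \<nu> x) (midx m) \<le> 1" for x
        using g(2)[of x] unfolding L2 by (simp add: L2_set_def g'_def power_mult_distrib power_mult[symmetric])
      have "test_value (Some \<nu>) (g' \<nu>) = (-1) ^ m * test_value (Some \<nu>) (g (Some \<nu>))" if "\<nu> \<in> midx m" for \<nu>
      proof -
        have "multi_deriv \<nu> (g' \<nu>) = (\<lambda>x. (-1) ^ m * multi_deriv \<nu> (g (Some \<nu>)) x)"
          unfolding g'_def multi_deriv_pds by (rule pds_cmult[OF sg(1)[OF that]])
        then have "(\<integral>x. w x * multi_deriv \<nu> (g' \<nu>) x \<partial>lborel) = (-1) ^ m * (\<integral>x. w x * multi_deriv \<nu> (g (Some \<nu>)) x \<partial>lborel)"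
          by (simp only: mult.left_commute[of "w _" "(-1) ^ m"] integral_mult_right_zero)
        then show ?thesis by (simp add: test_value_def)
      qed
      then have "(-1) ^ m * (\<Sum>i\<in>?I. test_value i (g' (the i))) = (\<Sum>i\<in>?I. test_value i (g i))"
        by (simp add: sum.reindex sum_distrib_left mult.assoc[symmetric] power_mult_distrib[symmetric])
      then have "(LINT x:\<Omega>|lebesgue. u x * (\<Sum>\<nu>\<in>midx m. multi_deriv \<nu> (g' \<nu>) x)) = (\<Sum>i\<in>?I. test_value i (g i))"
        using val[of g', OF g'C g's] by simp
      moreover have "(LINT x:\<Omega>|lebesgue. u x * (\<Sum>\<nu>\<in>midx m. multi_deriv \<nu> (g' \<nu>) x)) \<le> y"
        using g'C g's g'1 by (intro y) blast
      ultimately show "?T \<le> y + e" using g(3) by linarith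
    qed
  qed
qed

lemma Lq_converges:
  assumes q: "q > 1" and D [measurable]: "D \<in> sets borel"
    and wq: "integrable lborel (\<lambda>x. indicator (\<Omega> - D) x * \<bar>w x\<bar> powr q)"
  shows "(\<lambda>k. \<integral>x. indicator (\<Omega> - D) x * \<bar>approx k x - w x\<bar> powr q \<partial>lborel) \<longlonglongrightarrow> 0"
proof -
  let ?A = "\<Omega> - D"
  let ?g = "\<lambda>j x. \<zeta> j x * w x"
  let ?a = "\<lambda>j k x. convol (\<rho> j k) (?g j) x - ?g j x"
  have C: "(\<lambda>k. \<integral>x. indicator ?A x * \<bar>?a j k x\<bar> powr q \<partial>lborel) \<longlonglongrightarrow> 0 \<and>
     (\<forall>k. integrable lborel (\<lambda>x. indicator ?A x * \<bar>?a j k x\<bar> powr q))" if j: "j \<in> J" for j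
  proof -
    have ig: "integrable lborel (?g j)" using cutoff_mult_integrable[OF j w_integrable, of "[]"] by simp
    have [measurable]: "\<zeta> j \<in> borel_measurable borel" using pds_cutoff_measurable[OF j, of "[]"] by simp
    obtain R where R: "\<And>x. \<zeta> j x \<noteq> 0 \<Longrightarrow> norm x \<le> R" using cutoff_support_bounded[OF j, of "[]"] by auto
    have igq: "integrable lborel (\<lambda>x. indicator ?A x * \<bar>?g j x\<bar> powr q)"
    proof (rule Bochner_Integration.integrable_bound[OF wq])
      show "AE x in lborel. norm (indicator ?A x * \<bar>?g j x\<bar> powr q) \<le> norm (indicator ?A x * \<bar>w x\<bar> powr q)"
      proof (rule AE_I2)
        fix x
        show "norm (indicator ?A x * \<bar>?g j x\<bar> powr q) \<le> norm (indicator ?A x * \<bar>w x\<bar> powr q)"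
        proof (cases "x \<in> ?A")
          case True
          then have "(\<Sum>j\<in>J. \<zeta> j x) = 1" by (intro partition) auto
          moreover have "\<zeta> j x \<le> (\<Sum>j\<in>J. \<zeta> j x)"
            using j finite_J cutoff_nonneg by (intro member_le_sum) auto
          ultimately have "\<bar>\<zeta> j x\<bar> \<le> 1" using cutoff_nonneg[OF j, of x] by simp
          then have "\<bar>?g j x\<bar> \<le> \<bar>w x\<bar>" by (simp add: abs_mult mult_left_le_one_le)
          then have "\<bar>?g j x\<bar> powr q \<le> \<bar>w x\<bar> powr q" using q by (intro powr_mono2) auto
          then show ?thesis using True by simp
        qed simp
      qed
    qed measurable
    have stay: "y \<in> ?A" if "x \<in> ?A" "\<rho> j k (x - y) \<noteq> 0" "?g j y \<noteq> 0" for k x y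
      using kernel_push[OF j, of x y k] that mollifierD(3)[OF kernel[OF j] that(2)] cutoff_zero_off_U[OF j, of y] by auto
    have AB: "?A \<in> sets borel" by measurable
    have gR: "norm x \<le> R" if "?g j x \<noteq> 0" for x using that R by auto
    have "(\<lambda>k. \<integral>x. indicator ?A x * \<bar>?a j k x\<bar> powr q \<partial>lborel) \<longlonglongrightarrow> 0"
      by (rule convol_Lq_convergence(1)[where c="c j" and r="r j" and \<rho>="\<rho> j" and R=R, OF kernel[OF j] kernel_lim[OF j] ig _ q AB igq])
         (rule gR, assumption, rule stay, assumption+)
    moreover have "integrable lborel (\<lambda>x. indicator ?A x * \<bar>?a j k x\<bar> powr q)" for k
      by (rule convol_Lq_convergence(2)[where c="c j" and r="r j" and \<rho>="\<rho> j" and R=R, OF kernel[OF j] kernel_lim[OF j] ig _ q AB igq])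
         (rule gR, assumption, rule stay, assumption+)
    ultimately show ?thesis by blast
  qed
  have lim: "(\<lambda>k. real (card J) powr q * (\<Sum>j\<in>J. \<integral>x. indicator ?A x * \<bar>?a j k x\<bar> powr q \<partial>lborel)) \<longlonglongrightarrow> 0"
  proof -
    have "(\<lambda>k. \<Sum>j\<in>J. \<integral>x. indicator ?A x * \<bar>?a j k x\<bar> powr q \<partial>lborel) \<longlonglongrightarrow> (\<Sum>j\<in>J. 0)"
      using C by (intro tendsto_sum) auto
    then show ?thesis by (intro tendsto_mult_right_zero) simp
  qed
  show ?thesis
  proof (rule tendsto_0_of_le[OF lim])
    fix k
    have sw: "approx k x - w x = (\<Sum>j\<in>J. ?a j k x)" for x
    proof -
      have "(\<Sum>j\<in>J. ?g j x) = w x"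
        using sum_pds_cutoff_mult[of w "[]" x] w_outside by (simp add: sum_distrib_right)
      then show ?thesis by (simp add: approx_def sum_subtractf)
    qed
    have ib: "integrable lborel (\<lambda>x. real (card J) powr q * (\<Sum>j\<in>J. indicator ?A x * \<bar>?a j k x\<bar> powr q))"
      using C by (intro integrable_mult_right Bochner_Integration.integrable_sum) auto
    have le: "indicator ?A x * \<bar>approx k x - w x\<bar> powr q \<le> real (card J) powr q * (\<Sum>j\<in>J. indicator ?A x * \<bar>?a j k x\<bar> powr q)" for x
    proof (cases "x \<in> ?A")
      case True
      then show ?thesis using abs_sum_powr_le[OF finite_J, of q "\<lambda>j. ?a j k x"] q unfolding sw by simp
    qed simp
    have [measurable]: "approx k \<in> borel_measurable borel" by (rule smooth_on_borel[OF approx_smooth])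
    have "(\<integral>x. indicator ?A x * \<bar>approx k x - w x\<bar> powr q \<partial>lborel) \<le> (\<integral>x. real (card J) powr q * (\<Sum>j\<in>J. indicator ?A x * \<bar>?a j k x\<bar> powr q) \<partial>lborel)"
    proof (rule integral_mono[OF _ ib le])
      show "integrable lborel (\<lambda>x. indicator ?A x * \<bar>approx k x - w x\<bar> powr q)"
        by (rule Bochner_Integration.integrable_bound[OF ib]) (use order_trans[OF le abs_ge_self] in auto)
    qed
    also have "\<dots> = real (card J) powr q * (\<Sum>j\<in>J. \<integral>x. indicator ?A x * \<bar>?a j k x\<bar> powr q \<partial>lborel)"
      using C by (simp add: Bochner_Integration.integral_sum)
    finally show "(\<integral>x. indicator ?A x * \<bar>approx k x - w x\<bar> powr q \<partial>lborel) \<le> \<dots>" .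
  qed simp
qed

end

section \<open>The approximation theorem\<close>

text \<open>
  The Sobolev norm uses an unspecified choice of weak derivatives; uniqueness makes it computable from any
  of them.
\<close>

lemma weak_deriv_unique:
  fixes a b :: "real ^ 'n::finite \<Rightarrow> real"
  assumes \<Omega>: "open \<Omega>" "bounded \<Omega>" and a: "is_weak_deriv \<Omega> \<nu> h a" and b: "is_weak_deriv \<Omega> \<nu> h b"
  shows "AE x in lborel. x \<in> \<Omega> \<longrightarrow> a x = b x"
proof -
  have \<Omega>b [measurable]: "\<Omega> \<in> sets borel" using \<Omega> by simp
  let ?\<sigma> = "density lborel (indicator \<Omega>) :: (real ^ 'n) measure"
  interpret finite_borel_on ?\<sigma> \<Omega> by (rule restricted_lebesgue[OF \<Omega>])
  have si: "set_integrable lebesgue \<Omega> a" "set_integrable lebesgue \<Omega> b" using a b by (auto simp: is_weak_deriv_def)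
  obtain a' where a': "a' \<in> borel_measurable borel" "integrable lborel a'" "\<forall>x. x \<notin> \<Omega> \<longrightarrow> a' x = 0" "AE x in lborel. x \<in> \<Omega> \<longrightarrow> a x = a' x"
    using borel_representative[OF si(1) \<Omega>b] by auto
  obtain b' where b': "b' \<in> borel_measurable borel" "integrable lborel b'" "\<forall>x. x \<notin> \<Omega> \<longrightarrow> b' x = 0" "AE x in lborel. x \<in> \<Omega> \<longrightarrow> b x = b' x"
    using borel_representative[OF si(2) \<Omega>b] by auto
  note [measurable] = a'(1) b'(1)
  have ind: "(\<lambda>x. indicator \<Omega> x * (a' x - b' x)) = (\<lambda>x. a' x - b' x)"
    using a'(3) b'(3) by (auto simp: fun_eq_iff indicator_def)
  have "AE x in ?\<sigma>. a' x - b' x = 0"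
  proof (rule AE_eq_0_of_test_functions)
    show "integrable ?\<sigma> (\<lambda>x. a' x - b' x)"
      using integral_restricted_lebesgue(2)[of \<Omega> "\<lambda>x. a' x - b' x"] a'(2) b'(2) unfolding ind by simp
    fix \<psi> assume \<psi>: "smooth_supported \<Omega> \<psi>"
    have [measurable]: "\<psi> \<in> borel_measurable borel" by (rule smooth_supported_bounded(2)[OF \<psi>])
    obtain B where B: "\<And>x. \<bar>\<psi> x\<bar> \<le> B" using smooth_supported_bounded(1)[OF \<psi>] by blast
    have int: "integrable lborel (\<lambda>x. g x * \<psi> x)" if "integrable lborel g" for g
      using integrable_bounded_mult[OF that, of \<psi> B] B by (simp add: mult.commute)
    have rep: "(LINT x:\<Omega>|lebesgue. a x * \<psi> x) = (\<integral>x. a' x * \<psi> x \<partial>lborel)"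
      "(LINT x:\<Omega>|lebesgue. b x * \<psi> x) = (\<integral>x. b' x * \<psi> x \<partial>lborel)"
      by (intro lebesgue_set_integral_mult a' b' \<Omega>b; measurable)+
    have "(-1) ^ order_of \<nu> * (LINT x:\<Omega>|lebesgue. a x * \<psi> x) = (-1) ^ order_of \<nu> * (LINT x:\<Omega>|lebesgue. b x * \<psi> x)"
    proof -
      have t: "smooth_on UNIV \<psi> \<and> compact_support_in \<Omega> \<psi>" using \<psi> by (simp add: smooth_supported_def)
      show ?thesis
        using a[unfolded is_weak_deriv_def, THEN conjunct2, rule_format, OF t]
          b[unfolded is_weak_deriv_def, THEN conjunct2, rule_format, OF t] by simp
    qed
    then have "(\<integral>x. a' x * \<psi> x \<partial>lborel) = (\<integral>x. b' x * \<psi> x \<partial>lborel)"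
      by (simp add: rep)
    moreover have "(\<integral>x. \<psi> x * (a' x - b' x) \<partial>?\<sigma>) = (\<integral>x. indicator \<Omega> x * (\<psi> x * (a' x - b' x)) \<partial>lborel)"
      by (rule integral_restricted_lebesgue) measurable
    moreover have "\<dots> = (\<integral>x. a' x * \<psi> x - b' x * \<psi> x \<partial>lborel)"
      using a'(3) b'(3) by (intro Bochner_Integration.integral_cong) (auto simp: indicator_def algebra_simps)
    ultimately show "(\<integral>x. \<psi> x * (a' x - b' x) \<partial>?\<sigma>) = 0"
      using int[OF a'(2)] int[OF b'(2)] by simp
  qed
  then have "AE x in lborel. x \<in> \<Omega> \<longrightarrow> a' x = b' x"
    by (subst (asm) AE_density) (auto simp: indicator_def elim!: eventually_mono)
  with a'(4) b'(4) show ?thesis by eventually_elim auto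
qed

context mollified_pieces
begin

lemma multi_deriv_approx_measurable [measurable]: "multi_deriv \<nu> (approx k) \<in> borel_measurable borel"
  using smooth_on_borel[OF smooth_on_pds[OF approx_smooth]] by (simp add: multi_deriv_pds)

lemma approx_measurable [measurable]: "approx k \<in> borel_measurable borel"
  by (rule smooth_on_borel[OF approx_smooth])

lemma diff_weak_deriv:
  assumes \<nu>: "order_of \<nu> < m"
  shows "is_weak_deriv \<Omega> \<nu> (\<lambda>x. u x - approx k x) (\<lambda>x. v \<nu> x - multi_deriv \<nu> (approx k) x)"
proof -
  have vm [measurable]: "v \<nu> \<in> borel_measurable borel" using v_integrable[OF \<nu>] by auto
  let ?d = "\<lambda>x. v \<nu> x - multi_deriv \<nu> (approx k) x"
  have i: "integrable lborel (\<lambda>x. indicator \<Omega> x * ?d x)"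
    by (rule Bochner_Integration.integrable_bound[OF lower_deriv_converges(2)[OF \<nu>, of k]])
       (auto simp: indicator_def abs_minus_commute)
  have "set_integrable lebesgue \<Omega> ?d"
    using lebesgue_set_integral_eq_lborel(2)[of ?d \<Omega> ?d] i by simp
  moreover have "(LINT x:\<Omega>|lebesgue. (u x - approx k x) * multi_deriv \<nu> \<psi> x) = (-1) ^ order_of \<nu> * (LINT x:\<Omega>|lebesgue. ?d x * \<psi> x)"
    if \<psi>: "smooth_supported \<Omega> \<psi>" for \<psi>
  proof -
    have s\<psi>: "smooth_on UNIV \<psi>" using \<psi> by (simp add: smooth_supported_def)
    have [measurable]: "\<psi> \<in> borel_measurable borel" by (rule smooth_supported_bounded(2)[OF \<psi>])
    have d\<psi>: "smooth_supported \<Omega> (multi_deriv \<nu> \<psi>)" unfolding multi_deriv_pds by (rule smooth_supported_pds[OF \<psi>])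
    have [measurable]: "multi_deriv \<nu> \<psi> \<in> borel_measurable borel" by (rule smooth_supported_bounded(2)[OF d\<psi>])
    obtain R where R: "\<And>x. \<psi> x \<noteq> 0 \<Longrightarrow> norm x \<le> R" using smooth_supported_bounded(3)[OF \<psi>] by blast
    obtain R' where R': "\<And>x. multi_deriv \<nu> \<psi> x \<noteq> 0 \<Longrightarrow> norm x \<le> R'" using smooth_supported_bounded(3)[OF d\<psi>] by blast
    obtain B where B: "\<And>x. \<bar>\<psi> x\<bar> \<le> B" using smooth_supported_bounded(1)[OF \<psi>] by blast
    have i1: "integrable lborel (\<lambda>x. w x * multi_deriv \<nu> \<psi> x)" by (rule w_mult_integrable[OF d\<psi>])
    have i2: "integrable lborel (\<lambda>x. approx k x * multi_deriv \<nu> \<psi> x)"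
    proof (rule continuous_bounded_support(1)[where R=R'])
      show "continuous_on UNIV (\<lambda>x. approx k x * multi_deriv \<nu> \<psi> x)"
        using d\<psi> by (intro continuous_on_mult smooth_on_continuous approx_smooth) (simp add: smooth_supported_def)
    qed (use R' in auto)
    have i3: "integrable lborel (\<lambda>x. multi_deriv \<nu> (approx k) x * \<psi> x)"
    proof (rule continuous_bounded_support(1)[where R=R])
      show "continuous_on UNIV (\<lambda>x. multi_deriv \<nu> (approx k) x * \<psi> x)"
        unfolding multi_deriv_pds by (intro continuous_on_mult smooth_on_continuous smooth_on_pds approx_smooth s\<psi>)
    qed (use R in auto)
    have i4: "integrable lborel (\<lambda>x. \<psi> x * v \<nu> x)"
      using integrable_bounded_mult[OF v_integrable[OF \<nu>], of \<psi> B] B by simp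
    have "AE x in lborel. x \<in> \<Omega> \<longrightarrow> (u x - approx k x) * multi_deriv \<nu> \<psi> x = (w x - approx k x) * multi_deriv \<nu> \<psi> x"
      using w_AE by (rule eventually_mono) auto
    then have "(LINT x:\<Omega>|lebesgue. (u x - approx k x) * multi_deriv \<nu> \<psi> x) = (\<integral>x. indicator \<Omega> x * ((w x - approx k x) * multi_deriv \<nu> \<psi> x) \<partial>lborel)"
      by (intro lebesgue_set_integral_eq_lborel(1)) auto
    also have "\<dots> = (\<integral>x. w x * multi_deriv \<nu> \<psi> x - approx k x * multi_deriv \<nu> \<psi> x \<partial>lborel)"
      using smooth_supported_outside[OF d\<psi>] by (intro Bochner_Integration.integral_cong) (auto simp: indicator_def left_diff_distrib)
    also have "\<dots> = (\<integral>x. w x * multi_deriv \<nu> \<psi> x \<partial>lborel) - (\<integral>x. approx k x * multi_deriv \<nu> \<psi> x \<partial>lborel)"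
      by (rule Bochner_Integration.integral_diff[OF i1 i2])
    also have "(\<integral>x. approx k x * multi_deriv \<nu> \<psi> x \<partial>lborel) = (-1) ^ order_of \<nu> * (\<integral>x. multi_deriv \<nu> (approx k) x * \<psi> x \<partial>lborel)"
    proof -
      have C: "C_on (length (midx_list \<nu>)) UNIV \<psi>" using s\<psi> by (simp add: smooth_on_def)
      show ?thesis
        unfolding multi_deriv_pds length_midx_list[symmetric]
        by (rule integration_by_parts_pds[OF approx_smooth C]) (rule R)
    qed
    also have "(\<integral>x. w x * multi_deriv \<nu> \<psi> x \<partial>lborel) = (-1) ^ order_of \<nu> * (\<integral>x. \<psi> x * v \<nu> x \<partial>lborel)"
      by (rule v_test[OF \<nu> \<psi>])
    also have "(-1) ^ order_of \<nu> * (\<integral>x. \<psi> x * v \<nu> x \<partial>lborel) - (-1) ^ order_of \<nu> * (\<integral>x. multi_deriv \<nu> (approx k) x * \<psi> x \<partial>lborel)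
        = (-1) ^ order_of \<nu> * (\<integral>x. \<psi> x * v \<nu> x - multi_deriv \<nu> (approx k) x * \<psi> x \<partial>lborel)"
      unfolding right_diff_distrib[symmetric] Bochner_Integration.integral_diff[OF i4 i3] ..
    also have "(\<integral>x. \<psi> x * v \<nu> x - multi_deriv \<nu> (approx k) x * \<psi> x \<partial>lborel) = (\<integral>x. indicator \<Omega> x * (?d x * \<psi> x) \<partial>lborel)"
      using smooth_supported_outside[OF \<psi>] by (intro Bochner_Integration.integral_cong) (auto simp: indicator_def algebra_simps)
    also have "\<dots> = (LINT x:\<Omega>|lebesgue. ?d x * \<psi> x)"
      by (rule lebesgue_set_integral_eq_lborel(1)[symmetric]) auto
    finally show ?thesis .
  qed
  ultimately show ?thesis unfolding is_weak_deriv_def smooth_supported_def by blast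
qed

lemma W_norm_converges: "(\<lambda>k. W_norm (m - 1) \<Omega> (\<lambda>x. u x - approx k x)) \<longlonglongrightarrow> 0"
proof -
  have "(\<lambda>k. LINT x:\<Omega>|lebesgue. \<bar>weak_deriv \<Omega> \<nu> (\<lambda>x. u x - approx k x) x\<bar>) \<longlonglongrightarrow> 0" if "\<nu> \<in> midx_le (m - 1)" for \<nu>
  proof -
    have \<nu>: "order_of \<nu> < m" using that order_pos by (simp add: midx_le_def)
    have [measurable]: "v \<nu> \<in> borel_measurable borel" using v_integrable[OF \<nu>] by auto
    have "(LINT x:\<Omega>|lebesgue. \<bar>weak_deriv \<Omega> \<nu> (\<lambda>x. u x - approx k x) x\<bar>) = (\<integral>x. indicator \<Omega> x * \<bar>multi_deriv \<nu> (approx k) x - v \<nu> x\<bar> \<partial>lborel)" for k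
    proof (rule lebesgue_set_integral_eq_lborel(1))
      have "is_weak_deriv \<Omega> \<nu> (\<lambda>x. u x - approx k x) (weak_deriv \<Omega> \<nu> (\<lambda>x. u x - approx k x))"
        unfolding weak_deriv_def by (rule someI[of "is_weak_deriv \<Omega> \<nu> (\<lambda>x. u x - approx k x)", OF diff_weak_deriv[OF \<nu>]])
      from weak_deriv_unique[OF open_domain bounded_domain this diff_weak_deriv[OF \<nu>]]
      show "AE x in lborel. x \<in> \<Omega> \<longrightarrow> \<bar>weak_deriv \<Omega> \<nu> (\<lambda>x. u x - approx k x) x\<bar> = \<bar>multi_deriv \<nu> (approx k) x - v \<nu> x\<bar>"
        by (rule eventually_mono) auto
    qed auto
    with lower_deriv_converges(1)[OF \<nu>] show ?thesis by simp
  qed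
  then have "(\<lambda>k. \<Sum>\<nu>\<in>midx_le (m - 1). LINT x:\<Omega>|lebesgue. \<bar>weak_deriv \<Omega> \<nu> (\<lambda>x. u x - approx k x) x\<bar>) \<longlonglongrightarrow> (\<Sum>\<nu>\<in>(midx_le (m - 1) :: ('n \<Rightarrow> nat) set). 0)"
    by (intro tendsto_sum)
  then show ?thesis by (simp add: W_norm_def)
qed

lemma Lp_norm_converges:
  assumes q: "q > 1" and D [measurable]: "D \<in> sets borel" and uq: "u \<in> Lp_space q (\<Omega> - D)"
  shows "(\<lambda>k. Lp_norm q (\<Omega> - D) (\<lambda>x. u x - approx k x)) \<longlonglongrightarrow> 0"
proof -
  have A: "\<Omega> - D \<in> sets borel" by measurable
  have "AE x in lborel. x \<in> \<Omega> - D \<longrightarrow> \<bar>u x\<bar> powr q = \<bar>w x\<bar> powr q" using w_AE by (rule eventually_mono) auto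
  moreover have "set_integrable lebesgue (\<Omega> - D) (\<lambda>x. \<bar>u x\<bar> powr q)" using uq by (simp add: Lp_space_def)
  ultimately have wq: "integrable lborel (\<lambda>x. indicator (\<Omega> - D) x * \<bar>w x\<bar> powr q)"
    using lebesgue_set_integral_eq_lborel(2)[OF _ A, of "\<lambda>x. \<bar>w x\<bar> powr q" "\<lambda>x. \<bar>u x\<bar> powr q"] by simp
  have eq: "(LINT x:\<Omega> - D|lebesgue. \<bar>u x - approx k x\<bar> powr q) = (\<integral>x. indicator (\<Omega> - D) x * \<bar>approx k x - w x\<bar> powr q \<partial>lborel)" for k
  proof (rule lebesgue_set_integral_eq_lborel(1)[OF _ A])
    show "AE x in lborel. x \<in> \<Omega> - D \<longrightarrow> \<bar>u x - approx k x\<bar> powr q = \<bar>approx k x - w x\<bar> powr q"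
      using w_AE by (rule eventually_mono) (auto simp: abs_minus_commute)
  qed measurable
  have "(\<lambda>k. (\<integral>x. indicator (\<Omega> - D) x * \<bar>approx k x - w x\<bar> powr q \<partial>lborel) powr (1 / q)) \<longlonglongrightarrow> 0 powr (1 / q)"
    by (intro tendsto_powr' Lq_converges[OF q D wq] tendsto_const) (use q in \<open>auto intro!: always_eventually\<close>)
  then show ?thesis by (simp add: Lp_norm_def eq)
qed

lemma grad_norm_eq: "grad_norm m (approx k) x = L2_set (\<lambda>i. grad_comp k i x) (Some ` midx m)"
  by (simp add: grad_norm_def L2_set_def sum.reindex grad_comp_def)

lemma variation_converges:
  "(\<lambda>k. LINT x:\<Omega>|lebesgue. grad_norm m (approx k) x) \<longlonglongrightarrow> grad_variation m \<Omega> u"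
proof -
  have "(LINT x:\<Omega>|lebesgue. grad_norm m (approx k) x) = (\<integral>x. indicator \<Omega> x * L2_set (\<lambda>i. grad_comp k i x) (Some ` midx m) \<partial>lborel)" for k
    unfolding grad_norm_eq by (rule lebesgue_set_integral_eq_lborel(1)) auto
  then show ?thesis unfolding grad_variation_eq using mass_converges[of "Some ` midx m"] by auto
qed

lemma area_converges:
  "(\<lambda>k. LINT x:\<Omega>|lebesgue. sqrt (1 + (grad_norm m (approx k) x)\<^sup>2)) \<longlonglongrightarrow> grad_area m \<Omega> u"
proof -
  have L2: "sqrt (1 + (grad_norm m (approx k) x)\<^sup>2) = L2_set (\<lambda>i. grad_comp k i x) all_comps" for k x
    unfolding grad_norm_eq by (simp add: finite_midx) (simp add: grad_comp_def)
  have "(LINT x:\<Omega>|lebesgue. sqrt (1 + (grad_norm m (approx k) x)\<^sup>2)) = (\<integral>x. indicator \<Omega> x * L2_set (\<lambda>i. grad_comp k i x) all_comps \<partial>lborel)" for k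
    unfolding L2 by (rule lebesgue_set_integral_eq_lborel(1)) measurable
  then show ?thesis unfolding grad_area_eq using mass_converges[of all_comps] by simp
qed

lemma approx_smooth_up_to_boundary: "smooth_up_to_boundary \<Omega> (approx k)"
  unfolding smooth_up_to_boundary_def
proof (intro conjI allI)
  have "C_on j S g" if "C_on j UNIV g" for j S and g :: "real ^ 'n \<Rightarrow> real"
    using that by (induction j arbitrary: g) (auto intro: continuous_on_subset)
  then show "smooth_on \<Omega> (approx k)" using approx_smooth by (auto simp: smooth_on_def)
  show "continuous_on (closure \<Omega>) (approx k)" by (rule smooth_on_continuous[OF approx_smooth])
  show "\<exists>h. continuous_on (closure \<Omega>) h \<and> (\<forall>x\<in>\<Omega>. h x = multi_deriv \<nu> (approx k) x)" for \<nu>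
    by (intro exI[of _ "multi_deriv \<nu> (approx k)"])
       (simp add: multi_deriv_pds smooth_on_continuous[OF smooth_on_pds[OF approx_smooth]])
qed

end

theorem theorem1p3:
  fixes m :: nat and q :: real
    and \<Omega> D :: "(real ^ 'n::finite) set" and x0 :: "real ^ 'n"
    and u :: "real ^ 'n \<Rightarrow> real"
  assumes "0 < m" and "m < CARD('n)"
    and "real CARD('n) / (real CARD('n) - real m) < q"
    and "open \<Omega>" and "bounded \<Omega>" and "C1_boundary \<Omega>"
    and "open D" and "compact (closure D)" and "closure D \<subseteq> \<Omega>" and "C1_boundary D"
    and "x0 \<in> D" and "\<forall>x\<in>D. closed_segment x0 x \<subseteq> D"
    and "u \<in> BV_space m \<Omega>" and "u \<in> Lp_space q (\<Omega> - D)"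
  shows "\<exists>\<phi> :: nat \<Rightarrow> real ^ 'n \<Rightarrow> real.
    (\<forall>k. smooth_up_to_boundary \<Omega> (\<phi> k)) \<and>
    (\<lambda>k. W_norm (m - 1) \<Omega> (\<lambda>x. u x - \<phi> k x)
         + Lp_norm q (\<Omega> - D) (\<lambda>x. u x - \<phi> k x)
         + \<bar>grad_variation m \<Omega> u - (LINT x:\<Omega>|lebesgue. grad_norm m (\<phi> k) x)\<bar>
         + \<bar>grad_area m \<Omega> u - (LINT x:\<Omega>|lebesgue. sqrt (1 + (grad_norm m (\<phi> k) x)\<^sup>2))\<bar>)
      \<longlonglongrightarrow> 0"
proof -
  have \<Omega>b: "\<Omega> \<in> sets borel" and Db: "D \<in> sets borel" using assms by auto
  \<comment> \<open>Jensen's inequality is applied with this exponent.\<close>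
  have q: "q > 1"
  proof -
    have "1 \<le> real CARD('n) / (real CARD('n) - real m)" using assms(1,2) by (simp add: le_divide_eq)
    with assms(3) show ?thesis by linarith
  qed
  obtain \<sigma> f where gd: "gradient_density \<sigma> \<Omega> m u f"
    using gradient_density_exists[OF assms(4,5,13)] by blast
  have uW: "set_integrable lebesgue \<Omega> u" "\<And>\<nu>. \<nu> \<in> midx_le (m - 1) \<Longrightarrow> \<exists>v. is_weak_deriv \<Omega> \<nu> u v"
    using assms(13) by (auto simp: BV_space_def W_space_def)
  obtain w where w: "w \<in> borel_measurable borel" "integrable lborel w" "\<forall>x. x \<notin> \<Omega> \<longrightarrow> w x = 0" "AE x in lborel. x \<in> \<Omega> \<longrightarrow> u x = w x"
    using borel_representative[OF uW(1) \<Omega>b] by auto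
  have "\<exists>v. integrable lborel v \<and> (\<forall>x. x \<notin> \<Omega> \<longrightarrow> v x = 0) \<and>
      (\<forall>\<psi>. smooth_supported \<Omega> \<psi> \<longrightarrow> (\<integral>x. w x * multi_deriv \<nu> \<psi> x \<partial>lborel) = (-1) ^ order_of \<nu> * (\<integral>x. \<psi> x * v x \<partial>lborel))"
    if \<nu>: "order_of \<nu> < m" for \<nu>
  proof -
    have "\<nu> \<in> midx_le (m - 1)" using \<nu> by (simp add: midx_le_def)
    then obtain a where a: "is_weak_deriv \<Omega> \<nu> u a" using uW(2) by blast
    then have "set_integrable lebesgue \<Omega> a" by (simp add: is_weak_deriv_def)
    then obtain b where b: "b \<in> borel_measurable borel" "integrable lborel b" "\<forall>x. x \<notin> \<Omega> \<longrightarrow> b x = 0" "AE x in lborel. x \<in> \<Omega> \<longrightarrow> a x = b x"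
      using borel_representative[OF _ \<Omega>b] by auto
    have "(\<integral>x. w x * multi_deriv \<nu> \<psi> x \<partial>lborel) = (-1) ^ order_of \<nu> * (\<integral>x. \<psi> x * b x \<partial>lborel)"
      if \<psi>: "smooth_supported \<Omega> \<psi>" for \<psi>
    proof -
      have s: "smooth_on UNIV \<psi>" "smooth_on UNIV (multi_deriv \<nu> \<psi>)"
        using \<psi> smooth_on_pds by (auto simp: smooth_supported_def multi_deriv_pds)
      have [measurable]: "\<psi> \<in> borel_measurable borel" "multi_deriv \<nu> \<psi> \<in> borel_measurable borel"
        using s by (auto intro: smooth_on_borel)
      have 1: "(LINT x:\<Omega>|lebesgue. u x * multi_deriv \<nu> \<psi> x) = (\<integral>x. w x * multi_deriv \<nu> \<psi> x \<partial>lborel)"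
        by (intro lebesgue_set_integral_mult \<Omega>b w; measurable)
      have 2: "(LINT x:\<Omega>|lebesgue. a x * \<psi> x) = (\<integral>x. b x * \<psi> x \<partial>lborel)"
        by (intro lebesgue_set_integral_mult \<Omega>b b; measurable)
      show ?thesis
        using a \<psi> 1 2 by (simp add: is_weak_deriv_def smooth_supported_def mult.commute)
    qed
    with b show ?thesis by (intro exI[of _ b]) simp
  qed
  then have "\<forall>\<nu>. \<exists>v. order_of \<nu> < m \<longrightarrow> integrable lborel v \<and> (\<forall>x. x \<notin> \<Omega> \<longrightarrow> v x = 0) \<and>
      (\<forall>\<psi>. smooth_supported \<Omega> \<psi> \<longrightarrow> (\<integral>x. w x * multi_deriv \<nu> \<psi> x \<partial>lborel) = (-1) ^ order_of \<nu> * (\<integral>x. \<psi> x * v x \<partial>lborel))"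
    by auto
  from choice[OF this] obtain v where v: "\<forall>\<nu>. order_of \<nu> < m \<longrightarrow> integrable lborel (v \<nu>) \<and> (\<forall>x. x \<notin> \<Omega> \<longrightarrow> v \<nu> x = 0) \<and>
      (\<forall>\<psi>. smooth_supported \<Omega> \<psi> \<longrightarrow> (\<integral>x. w x * multi_deriv \<nu> \<psi> x \<partial>lborel) = (-1) ^ order_of \<nu> * (\<integral>x. \<psi> x * v \<nu> x \<partial>lborel))" ..
  obtain J :: "(real ^ 'n) set" and U \<zeta> c r \<rho> where J: "finite J"
    "\<forall>j\<in>J. smooth_supported (U j) (\<zeta> j) \<and> (\<forall>y. 0 \<le> \<zeta> j y)"
    "\<forall>y\<in>\<Omega>. (\<Sum>j\<in>J. \<zeta> j y) = 1"
    "\<forall>j\<in>J. (\<forall>k. mollifier (c j k) (r j k) (\<rho> j k)) \<and> (\<lambda>k. norm (c j k) + r j k) \<longlonglongrightarrow> 0 \<and>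
      (\<forall>k x y. x \<in> \<Omega> \<and> x - y \<in> cball (c j k) (r j k) \<and> y \<in> U j \<longrightarrow> y \<in> \<Omega> \<and> (x \<notin> D \<longrightarrow> y \<notin> D))"
    using adapted_kernels_exist[OF assms(4-7,9,10)] by blast
  interpret mollified_pieces \<sigma> \<Omega> m u f D w v J U \<zeta> c r \<rho>
    by (intro mollified_pieces.intro gd mollified_pieces_axioms.intro)
       (use assms(1,5) w v J in \<open>blast+\<close>)
  show ?thesis
  proof (intro exI[of _ approx] conjI allI)
    show "smooth_up_to_boundary \<Omega> (approx k)" for k by (rule approx_smooth_up_to_boundary)
    have "(\<lambda>k. W_norm (m - 1) \<Omega> (\<lambda>x. u x - approx k x) + Lp_norm q (\<Omega> - D) (\<lambda>x. u x - approx k x)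
         + \<bar>grad_variation m \<Omega> u - (LINT x:\<Omega>|lebesgue. grad_norm m (approx k) x)\<bar>
         + \<bar>grad_area m \<Omega> u - (LINT x:\<Omega>|lebesgue. sqrt (1 + (grad_norm m (approx k) x)\<^sup>2))\<bar>)
      \<longlonglongrightarrow> 0 + 0 + \<bar>grad_variation m \<Omega> u - grad_variation m \<Omega> u\<bar> + \<bar>grad_area m \<Omega> u - grad_area m \<Omega> u\<bar>"
      by (intro tendsto_add tendsto_rabs tendsto_diff tendsto_const W_norm_converges
          Lp_norm_converges[OF q Db assms(14)] variation_converges area_converges)
    then show "(\<lambda>k. W_norm (m - 1) \<Omega> (\<lambda>x. u x - approx k x) + Lp_norm q (\<Omega> - D) (\<lambda>x. u x - approx k x)
         + \<bar>grad_variation m \<Omega> u - (LINT x:\<Omega>|lebesgue. grad_norm m (approx k) x)\<bar>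
         + \<bar>grad_area m \<Omega> u - (LINT x:\<Omega>|lebesgue. sqrt (1 + (grad_norm m (approx k) x)\<^sup>2))\<bar>) \<longlonglongrightarrow> 0"
      by simp
  qed
qed

end
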